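(* The following three statements are equivalent: (i) The Set Cover Conjecture (SCC) is true. (ii) For every $\epsilon>0$, there are $\sigma,\delta>0$ such that Triangle Partition on an $n$-vertex graph cannot be solved in time $(2-\epsilon)^p\cdot n^{\mathcal{O}(1)}$, even if the input contains a $(\sigma,\delta)$-hub of size $p$. (iii) For every $\epsilon>0$, there are $\sigma,\delta>0$ such that Triangle Packing on an $n$-vertex graph cannot be solved in time $(2-\epsilon)^p\cdot n^{\mathcal{O}(1)}$, even if the input contains a $(\sigma,\delta)$-hub of size $p$.
   Context: For a graph $G$ and integers $\sigma,\delta$, a set $Q\subseteq V(G)$ is a $(\sigma,\delta)$-hub of $G$ if every connected component of $G-Q$ has at most $\sigma$ vertices and each such component is adjacent to at most $\delta$ vertices of $Q$. Triangle Partition: given a graph $G$, decide whether $V(G)$ can be partitioned into sets each inducing a triangle (each part is a triangle of $G$). Triangle Packing: given a graph $G$ (and an integer $t$), find a maximum-size collection of pairwise vertex-disjoint triangles of $G$ (decide whether there are at least $t$). $\le d$-Set Cover: given a finite universe $U$, a family $\mathcal{F}$ of subsets of $U$ each of size at most $d$ with $\bigcup\mathcal{F}=U$, and an integer $t$, decide whether at most $t$ sets of $\mathcal{F}$ have union $U$. SCC: for all $\epsilon>0$ there exists $d\ge1$ such that there is no algorithm solving every $\le d$-Set Cover instance $(U,\mathcal{F})$ in time $(2-\epsilon)^n\cdot n^{\mathcal{O}(1)}$, where $n=|U|$. *)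

theory Defs
  imports Complex_Main "HOL-Library.Disjoint_Sets"
begin

section \<open>Graphs, hubs and the three problems\<close>

definition simple_graph :: "'a set \<Rightarrow> 'a set set \<Rightarrow> bool" where
  "simple_graph V E \<longleftrightarrow> finite V \<and> (\<forall>e\<in>E. e \<subseteq> V \<and> card e = 2)"

definition components :: "'a set \<Rightarrow> 'a set set \<Rightarrow> 'a set set" where
  "components V E = V // {(u, v). u \<in> V \<and> v \<in> V \<and> (u, v) \<in> {(x, y). {x, y} \<in> E}\<^sup>*}"

definition is_hub :: "nat \<Rightarrow> nat \<Rightarrow> 'a set \<Rightarrow> 'a set set \<Rightarrow> 'a set \<Rightarrow> bool" where
  "is_hub \<sigma> \<delta> V E Q \<longleftrightarrow> Q \<subseteq> V \<and>
     (\<forall>C \<in> components (V - Q) {e \<in> E. e \<inter> Q = {}}.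
        card C \<le> \<sigma> \<and> card {q \<in> Q. \<exists>v\<in>C. {q, v} \<in> E} \<le> \<delta>)"

definition triangle :: "'a set \<Rightarrow> 'a set set \<Rightarrow> 'a set \<Rightarrow> bool" where
  "triangle V E T \<longleftrightarrow> T \<subseteq> V \<and> card T = 3 \<and> (\<forall>u\<in>T. \<forall>v\<in>T. u \<noteq> v \<longrightarrow> {u, v} \<in> E)"

definition has_triangle_partition :: "'a set \<Rightarrow> 'a set set \<Rightarrow> bool" where
  "has_triangle_partition V E \<longleftrightarrow> (\<exists>P. partition_on V P \<and> (\<forall>T\<in>P. triangle V E T))"

definition has_triangle_packing :: "'a set \<Rightarrow> 'a set set \<Rightarrow> nat \<Rightarrow> bool" where
  "has_triangle_packing V E t \<longleftrightarrow>
     (\<exists>P. finite P \<and> disjoint P \<and> (\<forall>T\<in>P. triangle V E T) \<and> t \<le> card P)"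

definition set_cover_instance :: "nat \<Rightarrow> 'a set \<Rightarrow> 'a set set \<Rightarrow> bool" where
  "set_cover_instance d U F \<longleftrightarrow>
     finite U \<and> F \<subseteq> Pow U \<and> (\<forall>S\<in>F. card S \<le> d) \<and> \<Union>F = U"

definition has_set_cover :: "'a set \<Rightarrow> 'a set set \<Rightarrow> nat \<Rightarrow> bool" where
  "has_set_cover U F t \<longleftrightarrow> (\<exists>C\<subseteq>F. finite C \<and> card C \<le> t \<and> \<Union>C = U)"


section \<open>Model of computation\<close>

text \<open>
  Algorithms are programs of the language I of N. D. Jones (\<^emph>\<open>Computability and Complexity from
  a Programming Perspective\<close>): while programs with one variable, which holds a binary tree, and
  with unit cost for each elementary tree operation (a tree is a pointer to an immutable cell, so
  forming or taking apart a pair moves only pointers).  Further variables are simulated with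
  constant overhead by tupling.

  The exponential running times considered here are not preserved under a quadratic slowdown, so
  the model has to be close to the random access machine.  It is: a RAM running for \<open>T\<close> steps with
  logarithmic cost (or with words of \<open>O(log T)\<close> bits) is simulated in time \<open>O(T * polylog T)\<close> by
  keeping the memory in a balanced tree, and conversely a program running for \<open>T\<close> steps is
  simulated by a RAM with addresses of \<open>O(log T)\<close> bits.  Factors \<open>polylog T\<close> are polynomial in
  the instance size whenever \<open>T\<close> is single exponential in it.
\<close>

datatype tree = Leaf | Node tree tree

datatype expr = Var | LeafE | NodeE expr expr | Left expr | Right expr

fun left_of :: "tree \<Rightarrow> tree" where
  "left_of Leaf = Leaf"
| "left_of (Node l r) = l"

fun right_of :: "tree \<Rightarrow> tree" where
  "right_of Leaf = Leaf"
| "right_of (Node l r) = r"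

fun eval_expr :: "expr \<Rightarrow> tree \<Rightarrow> tree" where
  "eval_expr Var s = s"
| "eval_expr LeafE s = Leaf"
| "eval_expr (NodeE a b) s = Node (eval_expr a s) (eval_expr b s)"
| "eval_expr (Left a) s = left_of (eval_expr a s)"
| "eval_expr (Right a) s = right_of (eval_expr a s)"

fun expr_cost :: "expr \<Rightarrow> nat" where
  "expr_cost Var = 1"
| "expr_cost LeafE = 1"
| "expr_cost (NodeE a b) = expr_cost a + expr_cost b + 1"
| "expr_cost (Left a) = expr_cost a + 1"
| "expr_cost (Right a) = expr_cost a + 1"

datatype prog = Assign expr | Seq prog prog | Cond expr prog prog | While expr prog

text \<open>\<open>exec P s s' k\<close>: started with the variable set to \<open>s\<close>, program \<open>P\<close> halts after exactly \<open>k\<close>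
  steps with the variable set to \<open>s'\<close>.  Tests succeed on trees other than \<open>Leaf\<close>.\<close>

inductive exec :: "prog \<Rightarrow> tree \<Rightarrow> tree \<Rightarrow> nat \<Rightarrow> bool" where
  Assign: "exec (Assign a) s (eval_expr a s) (expr_cost a + 1)"
| Seq: "exec P s s' k \<Longrightarrow> exec Q s' s'' l \<Longrightarrow> exec (Seq P Q) s s'' (k + l)"
| CondTrue: "eval_expr a s \<noteq> Leaf \<Longrightarrow> exec P s s' k \<Longrightarrow>
    exec (Cond a P Q) s s' (expr_cost a + 1 + k)"
| CondFalse: "eval_expr a s = Leaf \<Longrightarrow> exec Q s s' k \<Longrightarrow>
    exec (Cond a P Q) s s' (expr_cost a + 1 + k)"
| WhileFalse: "eval_expr a s = Leaf \<Longrightarrow> exec (While a P) s s (expr_cost a + 1)"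
| WhileTrue: "eval_expr a s \<noteq> Leaf \<Longrightarrow> exec P s s' k \<Longrightarrow> exec (While a P) s' s'' l \<Longrightarrow>
    exec (While a P) s s'' (expr_cost a + 1 + k + l)"

inductive_cases exec_AssignE: "exec (Assign a) s s' k"
inductive_cases exec_SeqE: "exec (Seq P Q) s s' k"
inductive_cases exec_CondE: "exec (Cond a P Q) s s' k"
inductive_cases exec_WhileE: "exec (While a P) s s' k"

lemma exec_deterministic:
  "exec P s s1 k1 \<Longrightarrow> exec P s s2 k2 \<Longrightarrow> s1 = s2 \<and> k1 = k2"
proof (induction arbitrary: s2 k2 rule: exec.induct)
  case (Assign a s)
  then show ?case by (auto elim: exec_AssignE)
next
  case (Seq P s s' k Q s'' l)
  from Seq.prems obtain r i j where
    "exec P s r i" "exec Q r s2 j" "k2 = i + j" by (rule exec_SeqE) simp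
  with Seq.IH show ?case by metis
next
  case (CondTrue a s P s' k Q)
  from CondTrue.prems CondTrue.hyps obtain i where
    "exec P s s2 i" "k2 = expr_cost a + 1 + i" by (auto elim: exec_CondE)
  with CondTrue.IH show ?case by metis
next
  case (CondFalse a s Q s' k P)
  from CondFalse.prems CondFalse.hyps obtain i where
    "exec Q s s2 i" "k2 = expr_cost a + 1 + i" by (auto elim: exec_CondE)
  with CondFalse.IH show ?case by metis
next
  case (WhileFalse a s P)
  from WhileFalse.prems WhileFalse.hyps show ?case by (auto elim: exec_WhileE)
next
  case (WhileTrue a s P s' k s'' l)
  from WhileTrue.prems obtain r i j where
    "exec P s r i" "exec (While a P) r s2 j" "k2 = expr_cost a + 1 + i + j"
    by (rule exec_WhileE) (use WhileTrue.hyps(1) in simp_all)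
  with WhileTrue.IH show ?case by metis
qed

definition decides_within :: "prog \<Rightarrow> tree \<Rightarrow> bool \<Rightarrow> real \<Rightarrow> bool" where
  "decides_within P x answer T \<longleftrightarrow>
     (\<exists>y k. exec P x y k \<and> real k \<le> T \<and> (y \<noteq> Leaf \<longleftrightarrow> answer))"


section \<open>Encoding of instances\<close>

text \<open>
  Numbers are written in unary.  Vertices and universe elements are numbers below \<open>n\<close>, so this
  costs only a factor polynomial in \<open>n\<close>; running times are measured in \<open>n\<close> and \<open>p\<close> and not in
  the length of the encoding, so a large threshold \<open>t\<close> gives no additional time.
\<close>

fun enc_nat :: "nat \<Rightarrow> tree" where
  "enc_nat 0 = Leaf"
| "enc_nat (Suc m) = Node Leaf (enc_nat m)"

fun enc_list :: "tree list \<Rightarrow> tree" where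
  "enc_list [] = Leaf"
| "enc_list (x # xs) = Node x (enc_list xs)"

text \<open>A finite set is presented as a list of its elements without repetition, in any order.
  An algorithm has to be correct on all presentations.\<close>

definition encodes_set :: "('a \<Rightarrow> tree \<Rightarrow> bool) \<Rightarrow> 'a set \<Rightarrow> tree \<Rightarrow> bool" where
  "encodes_set R A x \<longleftrightarrow>
     (\<exists>as xs. distinct as \<and> set as = A \<and> list_all2 R as xs \<and> x = enc_list xs)"

definition encodes_vertices :: "nat set \<Rightarrow> tree \<Rightarrow> bool" where
  "encodes_vertices = encodes_set (\<lambda>a x. x = enc_nat a)"

definition encodes_family :: "nat set set \<Rightarrow> tree \<Rightarrow> bool" where
  "encodes_family = encodes_set encodes_vertices"


section \<open>Solvability in time \<open>b\<^sup>p \<cdot> n\<^bsup>O(1)\<^esup>\<close>\<close>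

text \<open>\<open>n\<^bsup>O(1)\<^esup>\<close> is rendered as \<open>c * (n + 1) ^ c\<close> for a constant \<open>c\<close>, which differs from \<open>n ^ c\<close>
  only in allowing a positive constant time for \<open>n \<le> 1\<close>.\<close>

definition time_bound :: "real \<Rightarrow> nat \<Rightarrow> nat \<Rightarrow> nat \<Rightarrow> real" where
  "time_bound b p n c = b ^ p * (real c * (real n + 1) ^ c)"

definition set_cover_solvable :: "nat \<Rightarrow> real \<Rightarrow> bool" where
  "set_cover_solvable d b \<longleftrightarrow>
     (\<exists>P c. \<forall>n F t f.
        set_cover_instance d {..<n} F \<and> encodes_family F f \<longrightarrow>
        decides_within P (Node (enc_nat n) (Node f (enc_nat t)))
          (has_set_cover {..<n} F t) (time_bound b n n c))"

text \<open>The hub is part of the input of the two triangle problems.\<close>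

definition triangle_partition_solvable :: "nat \<Rightarrow> nat \<Rightarrow> real \<Rightarrow> bool" where
  "triangle_partition_solvable \<sigma> \<delta> b \<longleftrightarrow>
     (\<exists>P c. \<forall>n E Q e q.
        simple_graph {..<n} E \<and> is_hub \<sigma> \<delta> {..<n} E Q \<and>
        encodes_family E e \<and> encodes_vertices Q q \<longrightarrow>
        decides_within P (Node (enc_nat n) (Node e q))
          (has_triangle_partition {..<n} E) (time_bound b (card Q) n c))"

definition triangle_packing_solvable :: "nat \<Rightarrow> nat \<Rightarrow> real \<Rightarrow> bool" where
  "triangle_packing_solvable \<sigma> \<delta> b \<longleftrightarrow>
     (\<exists>P c. \<forall>n E Q t e q.
        simple_graph {..<n} E \<and> is_hub \<sigma> \<delta> {..<n} E Q \<and>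
        encodes_family E e \<and> encodes_vertices Q q \<longrightarrow>
        decides_within P (Node (enc_nat n) (Node e (Node q (enc_nat t))))
          (has_triangle_packing {..<n} E t) (time_bound b (card Q) n c))"

definition set_cover_conjecture :: bool where
  "set_cover_conjecture \<longleftrightarrow>
     (\<forall>\<epsilon>::real. \<epsilon> > 0 \<longrightarrow> (\<exists>d\<ge>1. \<not> set_cover_solvable d (2 - \<epsilon>)))"

end

theory Submission
  imports Defs
begin

text \<open>Assume that set cover can be solved faster than \<open>2\<^sup>n\<close>. To pack triangles in a graph with a hub
  of size \<open>p\<close>, guess which hub vertices each component of the rest of the graph uses: this is an
  exact cover problem on the hub in which every component may be used once. To enforce this without
  an extra element for every component, the components are distributed to \<open>O(p / k)\<close> buckets such
  that boundedly many used components fall into each; a bucket then acts as one large set with one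
  extra element, and Toeplitz hashing leaves only \<open>2\<^bsup>o(p)\<^esup>\<close> distributions to be tried. A perfect packing is a
  triangle partition. Conversely, to solve set cover by triangle partition, \<open>k\<close> sets of the cover
  are merged into one, so that the bound on their number costs only \<open>n / k\<close> extra elements and the
  cover may be taken to be disjoint; a disjoint cover is a triangle partition of the graph in which
  every set is replaced by a ring of triangles, and the universe is a hub of that graph.\<close>

section \<open>Programs with time bounds\<close>

text \<open>Running times \<open>(2 - \<epsilon>)^p\<close> leave no room for a constant factor in
  the exponent: a reduction may add \<open>\<eta> * p\<close> elements or guesses only with
  \<open>\<eta>\<close> arbitrarily small, whereas factors polynomial in \<open>n\<close> are free.
  Hence every overhead has the form \<open>p / k\<close>, with a constant \<open>k\<close> so large
  that the gap between two bases pays for it. The number of components is not bounded in terms of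
  \<open>p\<close>; only that of the used ones is, since each of them takes a hub vertex of its own.
  They are unknown, so their distribution to buckets has to be guessed: the hash seed has
  \<open>O(log n)\<close> bits, hence polynomially many values, and the shape of the tree is a word
  of \<open>O(p / k)\<close> symbols over an alphabet polynomial in \<open>k\<close>, hence there
  are \<open>2^(O(p * log k / k))\<close> words. A set cover bounds the number of sets, but it
  neither forbids overlaps nor counts triangles. Therefore the guess also fixes for each bucket how
  many hub vertices it covers and how many triangles it gains; if the former numbers add up to
  \<open>p\<close> and each bucket supplies one set, then the cover is disjoint on the hub.\<close>

definition runs :: "prog \<Rightarrow> tree \<Rightarrow> tree \<Rightarrow> nat \<Rightarrow> bool" where
  "runs P x y T \<longleftrightarrow> (\<exists>k\<le>T. exec P x y k)"

lemma runs_mono: "runs P x y T \<Longrightarrow> T \<le> T' \<Longrightarrow> runs P x y T'"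
  unfolding runs_def by (meson le_trans)

lemma runs_Assign: "eval_expr a s = y \<Longrightarrow> expr_cost a + 1 \<le> T \<Longrightarrow> runs (Assign a) s y T"
  unfolding runs_def using exec.Assign by blast

lemma runs_Seq: "runs P x y T \<Longrightarrow> runs Q y z U \<Longrightarrow> runs (Seq P Q) x z (T + U)"
  unfolding runs_def by (meson add_mono exec.Seq)

lemma runs_CondTrue:
  "eval_expr a s \<noteq> Leaf \<Longrightarrow> runs P s y T \<Longrightarrow> runs (Cond a P Q) s y (expr_cost a + 1 + T)"
  unfolding runs_def by (meson add_le_mono exec.CondTrue le_refl)

lemma runs_CondFalse:
  "eval_expr a s = Leaf \<Longrightarrow> runs Q s y T \<Longrightarrow> runs (Cond a P Q) s y (expr_cost a + 1 + T)"
  unfolding runs_def by (meson add_le_mono exec.CondFalse le_refl)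

lemma runs_WhileFalse:
  "eval_expr a s = Leaf \<Longrightarrow> runs (While a P) s s (expr_cost a + 1)"
  unfolding runs_def using exec.WhileFalse by blast

lemma runs_WhileTrue:
  "eval_expr a s \<noteq> Leaf \<Longrightarrow> runs P s s' T \<Longrightarrow> runs (While a P) s' s'' U \<Longrightarrow>
    runs (While a P) s s'' (expr_cost a + 1 + T + U)"
  unfolding runs_def by (meson add_le_mono exec.WhileTrue le_refl)

lemma runs_While:
  assumes "\<And>i. i < N \<Longrightarrow> eval_expr a (s i) \<noteq> Leaf"
    and "\<And>i. i < N \<Longrightarrow> runs P (s i) (s (Suc i)) T"
    and "eval_expr a (s N) = Leaf"
  shows "runs (While a P) (s 0) (s N) (N * (expr_cost a + 1 + T) + expr_cost a + 1)"
  using assms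
proof (induction N arbitrary: s)
  case 0
  then show ?case using runs_WhileFalse by simp
next
  case (Suc N)
  have "runs (While a P) (s (Suc 0)) (s (Suc N)) (N * (expr_cost a + 1 + T) + expr_cost a + 1)"
    using Suc.IH[of "\<lambda>i. s (Suc i)"] Suc.prems by simp
  with Suc.prems(1,2)[of 0] have "runs (While a P) (s 0) (s (Suc N))
      (expr_cost a + 1 + T + (N * (expr_cost a + 1 + T) + expr_cost a + 1))"
    by (intro runs_WhileTrue) auto
  then show ?case by (rule runs_mono) simp
qed

section \<open>Subprograms that work on one half of a pair\<close>

fun expr_on_left :: "expr \<Rightarrow> expr" where
  "expr_on_left Var = Left Var"
| "expr_on_left LeafE = LeafE"
| "expr_on_left (NodeE a b) = NodeE (expr_on_left a) (expr_on_left b)"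
| "expr_on_left (Left a) = Left (expr_on_left a)"
| "expr_on_left (Right a) = Right (expr_on_left a)"

text \<open>With a single variable there is no local storage. A value is saved by keeping it in the
  right half of a pair while another program works on the left half.\<close>

fun on_left :: "prog \<Rightarrow> prog" where
  "on_left (Assign a) = Assign (NodeE (expr_on_left a) (Right Var))"
| "on_left (Seq P Q) = Seq (on_left P) (on_left Q)"
| "on_left (Cond a P Q) = Cond (expr_on_left a) (on_left P) (on_left Q)"
| "on_left (While a P) = While (expr_on_left a) (on_left P)"

lemma eval_expr_on_left [simp]: "eval_expr (expr_on_left a) (Node s r) = eval_expr a s"
  by (induction a) auto

lemma expr_cost_pos: "0 < expr_cost a"
  by (induction a) auto

lemma cost_expr_on_left: "expr_cost (expr_on_left a) \<le> 2 * expr_cost a"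
  by (induction a) auto

text \<open>Reading the left half at most doubles the cost of an expression, and rebuilding the pair
  adds 3 to an assignment, so the factor 4 suffices for every construct.\<close>

lemma exec_on_left: "exec P s s' k \<Longrightarrow> runs (on_left P) (Node s r) (Node s' r) (4 * k)"
proof (induction rule: exec.induct)
  case (Assign a s)
  show ?case using cost_expr_on_left[of a] expr_cost_pos[of a]
    by (auto intro!: runs_Assign)
next
  case (Seq P s s' k Q s'' l)
  have "runs (on_left (Seq P Q)) (Node s r) (Node s'' r) (4 * k + 4 * l)"
    using runs_Seq[OF Seq.IH] by simp
  then show ?case by (rule runs_mono) simp
next
  case (CondTrue a s P s' k Q)
  have "runs (on_left (Cond a P Q)) (Node s r) (Node s' r) (expr_cost (expr_on_left a) + 1 + 4 * k)"
    using runs_CondTrue[OF _ CondTrue.IH] CondTrue.hyps(1) by simp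
  then show ?case by (rule runs_mono) (use cost_expr_on_left[of a] in simp)
next
  case (CondFalse a s Q s' k P)
  have "runs (on_left (Cond a P Q)) (Node s r) (Node s' r) (expr_cost (expr_on_left a) + 1 + 4 * k)"
    using runs_CondFalse[OF _ CondFalse.IH] CondFalse.hyps(1) by simp
  then show ?case by (rule runs_mono) (use cost_expr_on_left[of a] in simp)
next
  case (WhileFalse a s P)
  have "runs (on_left (While a P)) (Node s r) (Node s r) (expr_cost (expr_on_left a) + 1)"
    using runs_WhileFalse WhileFalse by simp
  then show ?case by (rule runs_mono) (use cost_expr_on_left[of a] in simp)
next
  case (WhileTrue a s P s' k s'' l)
  have "runs (on_left (While a P)) (Node s r) (Node s'' r)
      (expr_cost (expr_on_left a) + 1 + 4 * k + 4 * l)"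
    using runs_WhileTrue[OF _ WhileTrue.IH(1)] WhileTrue.IH(2) WhileTrue.hyps(1) by simp
  then show ?case by (rule runs_mono) (use cost_expr_on_left[of a] in simp)
qed

lemma runs_on_left:
  assumes "runs P s s' T"
  shows "runs (on_left P) (Node s r) (Node s' r) (4 * T)"
proof -
  obtain k where "k \<le> T" "exec P s s' k" using assms unfolding runs_def by blast
  then show ?thesis using exec_on_left runs_mono by (metis mult_le_mono2)
qed

text \<open>The input is duplicated; after the first run the halves are swapped, so that the second
  program finds the untouched copy on the left.\<close>

definition pair_prog :: "prog \<Rightarrow> prog \<Rightarrow> prog" where
  "pair_prog P Q = Seq (Assign (NodeE Var Var)) (Seq (on_left P)
     (Seq (Assign (NodeE (Right Var) (Left Var))) (Seq (on_left Q)
       (Assign (NodeE (Right Var) (Left Var))))))"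

lemma runs_pair_prog:
  assumes "runs P x y T" "runs Q x z U"
  shows "runs (pair_prog P Q) x (Node y z) (4 * T + 4 * U + 16)"
proof -
  have "runs (pair_prog P Q) x (Node y z) (4 + (4 * T + (6 + (4 * U + 6))))"
    unfolding pair_prog_def
    by (rule runs_Seq[OF runs_Assign runs_Seq[OF runs_on_left[OF assms(1), where r = x]
          runs_Seq[OF runs_Assign runs_Seq[OF runs_on_left[OF assms(2), where r = y] runs_Assign]]]])
      simp_all
  then show ?thesis by (rule runs_mono) simp
qed

text \<open>Here the condition is a program, which destroys its input; a copy on the right survives
  for the branch taken.\<close>

definition cond_prog :: "prog \<Rightarrow> prog \<Rightarrow> prog \<Rightarrow> prog" where
  "cond_prog C P Q = Seq (Assign (NodeE Var Var)) (Seq (on_left C)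
     (Cond (Left Var) (Seq (Assign (Right Var)) P) (Seq (Assign (Right Var)) Q)))"

lemma runs_cond_prog:
  assumes "runs C x c T" "c \<noteq> Leaf \<Longrightarrow> runs P x y U" "c = Leaf \<Longrightarrow> runs Q x y U"
  shows "runs (cond_prog C P Q) x y (4 * T + U + 10)"
proof -
  have r: "runs (Assign (Right Var)) (Node c x) x 3" by (rule runs_Assign) simp_all
  have c: "runs (Cond (Left Var) (Seq (Assign (Right Var)) P) (Seq (Assign (Right Var)) Q))
      (Node c x) y (expr_cost (Left Var) + 1 + (3 + U))"
  proof (cases "c = Leaf")
    case True
    show ?thesis by (rule runs_CondFalse[OF _ runs_Seq[OF r assms(3)]]) (simp_all add: True)
  next
    case False
    show ?thesis by (rule runs_CondTrue[OF _ runs_Seq[OF r assms(2)]]) (simp_all add: False)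
  qed
  have "runs (cond_prog C P Q) x y (4 + (4 * T + (expr_cost (Left Var) + 1 + (3 + U))))"
    unfolding cond_prog_def
    by (rule runs_Seq[OF runs_Assign runs_Seq[OF runs_on_left[OF assms(1), where r = x] c]]) simp_all
  then show ?thesis by (rule runs_mono) simp
qed

text \<open>The state is the rest of the list, an environment and the accumulator. The body sees
  environment, accumulator and current element, while the rest of the list and a second copy of the
  environment wait on the right.\<close>

definition fold_prog :: "prog \<Rightarrow> prog" where
  "fold_prog P = Seq (While (Left Var)
     (Seq (Assign (NodeE (NodeE (Left (Right Var)) (NodeE (Right (Right Var)) (Left (Left Var))))
                         (NodeE (Right (Left Var)) (Left (Right Var)))))
     (Seq (on_left P)
          (Assign (NodeE (Left (Right Var)) (NodeE (Right (Right Var)) (Left Var)))))))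
     (Assign (Right (Right Var)))"

text \<open>The time \<open>T\<close> is required only for accumulators that arise from prefixes of
  \<open>xs\<close>: the cost of the body depends on the size of the accumulator and has no bound
  over all accumulators.\<close>

lemma runs_fold_prog:
  assumes "\<And>ys y zs. xs = ys @ y # zs \<Longrightarrow>
    runs P (Node e (Node (h (foldl f a ys)) (h' y))) (h (f (foldl f a ys) y)) T"
  shows "runs (fold_prog P) (Node (enc_list (map h' xs)) (Node e (h a))) (h (foldl f a xs))
    (length xs * (4 * T + 40) + 10)"
proof -
  define s where "s i = Node (enc_list (map h' (drop i xs))) (Node e (h (foldl f a (take i xs))))" for i
  let ?a = "NodeE (NodeE (Left (Right Var)) (NodeE (Right (Right Var)) (Left (Left Var))))
                  (NodeE (Right (Left Var)) (Left (Right Var)))"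
  let ?b = "NodeE (Left (Right Var)) (NodeE (Right (Right Var)) (Left Var))"
  have body: "runs (Seq (Assign ?a) (Seq (on_left P) (Assign ?b))) (s i) (s (Suc i))
      (expr_cost ?a + 1 + (4 * T + (expr_cost ?b + 1)))" if i: "i < length xs" for i
  proof -
    have d: "drop i xs = xs ! i # drop (Suc i) xs" using i by (simp add: Cons_nth_drop_Suc)
    have x: "xs = take i xs @ xs ! i # drop (Suc i) xs" using i by (simp add: id_take_nth_drop)
    have t: "take (Suc i) xs = take i xs @ [xs ! i]" using i by (simp add: take_Suc_conv_app_nth)
    show ?thesis
      by (rule runs_Seq[OF runs_Assign runs_Seq[OF runs_on_left[OF assms[OF x],
            where r = "Node (enc_list (map h' (drop (Suc i) xs))) e"] runs_Assign]])
        (simp_all add: s_def d t)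
  qed
  have "runs (While (Left Var) (Seq (Assign ?a) (Seq (on_left P) (Assign ?b)))) (s 0) (s (length xs))
      (length xs * (expr_cost (Left Var) + 1 + (expr_cost ?a + 1 + (4 * T + (expr_cost ?b + 1))))
        + expr_cost (Left Var) + 1)"
  proof (rule runs_While)
    fix i assume "i < length xs"
    then show "eval_expr (Left Var) (s i) \<noteq> Leaf"
      by (simp add: s_def flip: Cons_nth_drop_Suc)
  qed (use body in \<open>auto simp: s_def\<close>)
  moreover have "runs (Assign (Right (Right Var))) (s (length xs)) (h (foldl f a xs))
      (expr_cost (Right (Right Var)) + 1)"
    by (rule runs_Assign) (simp_all add: s_def)
  ultimately have "runs (fold_prog P) (s 0) (h (foldl f a xs))
      (length xs * (expr_cost (Left Var) + 1 + (expr_cost ?a + 1 + (4 * T + (expr_cost ?b + 1))))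
        + expr_cost (Left Var) + 1 + (expr_cost (Right (Right Var)) + 1))"
    unfolding fold_prog_def by (rule runs_Seq)
  then have "runs (fold_prog P) (s 0) (h (foldl f a xs)) (length xs * (4 * T + 40) + 10)"
    by (rule runs_mono) (simp add: algebra_simps)
  then show ?thesis by (simp add: s_def)
qed

section \<open>Polynomial-time functions\<close>

text \<open>One constant serves as coefficient and exponent, as in \<open>time_bound\<close>, so
  that such bounds can be transferred to it directly.\<close>

definition poly_bounded :: "(nat \<Rightarrow> nat) \<Rightarrow> bool" where
  "poly_bounded f \<longleftrightarrow> (\<exists>c. \<forall>s. f s \<le> c * (s + 1) ^ c)"

lemma poly_boundedI: "(\<And>s. f s \<le> c * (s + 1) ^ c) \<Longrightarrow> poly_bounded f"
  unfolding poly_bounded_def by blast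

lemma monomial_mono: "c \<le> d \<Longrightarrow> s \<le> t \<Longrightarrow> c * (s + 1) ^ c \<le> d * (t + 1) ^ d" for s t :: nat
  by (intro mult_le_mono order_trans[OF power_mono power_increasing]) auto

lemma poly_bounded_le: "poly_bounded g \<Longrightarrow> (\<And>s. f s \<le> g s) \<Longrightarrow> poly_bounded f"
  unfolding poly_bounded_def by (meson le_trans)

lemma poly_bounded_const: "poly_bounded (\<lambda>_. k)"
  by (rule poly_boundedI[of _ k]) simp

lemma poly_bounded_id: "poly_bounded (\<lambda>s. s)"
  by (rule poly_boundedI[of _ 1]) simp

lemma poly_bounded_add:
  assumes "poly_bounded f" "poly_bounded g"
  shows "poly_bounded (\<lambda>s. f s + g s)"
proof -
  obtain c d where c: "\<And>s. f s \<le> c * (s + 1) ^ c" and d: "\<And>s. g s \<le> d * (s + 1) ^ d"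
    using assms unfolding poly_bounded_def by blast
  show ?thesis
  proof (rule poly_boundedI[of _ "c + d"])
    fix s
    have "f s + g s \<le> c * (s + 1) ^ (c + d) + d * (s + 1) ^ (c + d)"
      using c[of s] d[of s]
      by (intro add_mono order_trans[OF c] order_trans[OF d] mult_le_mono2 power_increasing) auto
    then show "f s + g s \<le> (c + d) * (s + 1) ^ (c + d)" by (simp add: algebra_simps)
  qed
qed

lemma poly_bounded_mult:
  assumes "poly_bounded f" "poly_bounded g"
  shows "poly_bounded (\<lambda>s. f s * g s)"
proof -
  obtain c d where c: "\<And>s. f s \<le> c * (s + 1) ^ c" and d: "\<And>s. g s \<le> d * (s + 1) ^ d"
    using assms unfolding poly_bounded_def by blast
  show ?thesis
  proof (rule poly_boundedI[of _ "c * d + c + d"])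
    fix s
    have "f s * g s \<le> (c * (s + 1) ^ c) * (d * (s + 1) ^ d)" by (intro mult_le_mono c d)
    also have "\<dots> = (c * d) * (s + 1) ^ (c + d)" by (simp add: power_add)
    also have "\<dots> \<le> (c * d + c + d) * (s + 1) ^ (c * d + c + d)"
      by (intro mult_le_mono power_increasing) auto
    finally show "f s * g s \<le> (c * d + c + d) * (s + 1) ^ (c * d + c + d)" .
  qed
qed

lemma poly_bounded_power: "poly_bounded f \<Longrightarrow> poly_bounded (\<lambda>s. f s ^ m)"
  by (induction m) (auto intro: poly_bounded_const poly_bounded_mult)

lemma poly_bounded_comp:
  assumes "poly_bounded f" "poly_bounded g"
  shows "poly_bounded (\<lambda>s. f (g s))"
proof -
  obtain c where c: "\<And>s. f s \<le> c * (s + 1) ^ c" using assms(1) unfolding poly_bounded_def by blast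
  have "poly_bounded (\<lambda>s. c * (g s + 1) ^ c)"
    by (intro poly_bounded_mult poly_bounded_power poly_bounded_add poly_bounded_const assms)
  then show ?thesis using c by (rule poly_bounded_le)
qed

lemmas poly_bounded_intros =
  poly_bounded_const poly_bounded_id poly_bounded_add poly_bounded_mult poly_bounded_power

section \<open>Data as trees, and functions computable in polynomial time\<close>

class tree_enc =
  fixes enc :: "'a \<Rightarrow> tree"

instantiation tree :: tree_enc
begin
definition enc_tree_def: "enc (x :: tree) = x"
instance ..
end

instantiation nat :: tree_enc
begin
definition enc_nat_def: "enc (x :: nat) = enc_nat x"
instance ..
end

instantiation bool :: tree_enc
begin
definition enc_bool_def: "enc b = (if b then Node Leaf Leaf else Leaf)"
instance ..
end

instantiation prod :: (tree_enc, tree_enc) tree_enc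
begin
definition enc_prod_def: "enc p = Node (enc (fst p)) (enc (snd p))"
instance ..
end

instantiation list :: (tree_enc) tree_enc
begin
definition enc_list_eq: "enc xs = enc_list (map enc xs)"
instance ..
end

definition esize :: "'a::tree_enc \<Rightarrow> nat" where
  "esize x = size (enc x)"

lemma enc_Pair [simp]: "enc (x, y) = Node (enc x) (enc y)"
  by (simp add: enc_prod_def)

lemma enc_Nil [simp]: "enc [] = Leaf" and enc_Cons [simp]: "enc (x # xs) = Node (enc x) (enc xs)"
  by (simp_all add: enc_list_eq)

lemma enc_nat_replicate: "enc n = enc (replicate n Leaf)"
  unfolding enc_nat_def enc_list_eq by (induction n) (auto simp: enc_tree_def)

lemma enc_eq_Leaf [simp]: "enc (xs :: 'a::tree_enc list) = Leaf \<longleftrightarrow> xs = []"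
  by (cases xs) auto

lemma enc_bool_eq_Leaf [simp]: "enc b = Leaf \<longleftrightarrow> \<not> b"
  by (simp add: enc_bool_def)

lemma enc_0 [simp]: "enc (0 :: nat) = Leaf" and enc_Suc [simp]: "enc (Suc n) = Node Leaf (enc n)"
  by (simp_all add: enc_nat_def)

lemma esize_prod [simp]: "esize p = esize (fst p) + esize (snd p) + 1"
  by (cases p) (simp add: esize_def)

lemma esize_Nil [simp]: "esize [] = 0" and esize_Cons [simp]: "esize (x # xs) = esize x + esize xs + 1"
  by (simp_all add: esize_def)

lemma esize_append [simp]: "esize (xs @ ys) = esize xs + esize ys"
  by (induction xs) auto

lemma esize_nat [simp]: "esize (n :: nat) = n"
  unfolding esize_def by (induction n) auto

lemma esize_bool: "esize (b :: bool) \<le> 1"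
  by (simp add: esize_def enc_bool_def)

lemma length_le_esize: "length xs \<le> esize xs"
  by (induction xs) auto

lemma esize_member: "x \<in> set xs \<Longrightarrow> esize x < esize xs"
  by (induction xs) auto

lemma esize_list_bound: "(\<And>x. x \<in> set xs \<Longrightarrow> esize x \<le> b) \<Longrightarrow> esize xs \<le> length xs * (b + 1)"
  by (induction xs) (simp_all, metis add_mono add.assoc add.left_commute)

text \<open>The bound on the output is not a consequence of the bound on the time: repeated
  assignment of \<open>NodeE Var Var\<close> builds a tree of exponential size in linear time,
  because pointers are shared. Without it \<open>ptime\<close> would not be closed under
  composition.\<close>

definition ptime :: "('a::tree_enc \<Rightarrow> 'b::tree_enc) \<Rightarrow> bool" where
  "ptime f \<longleftrightarrow> (\<exists>P c. \<forall>x. runs P (enc x) (enc (f x)) (c * (esize x + 1) ^ c) \<and>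
     esize (f x) \<le> c * (esize x + 1) ^ c)"

lemma ptimeI:
  assumes "poly_bounded p" "poly_bounded q" "\<And>x. runs P (enc x) (enc (f x)) (p (esize x))"
    "\<And>x. esize (f x) \<le> q (esize x)"
  shows "ptime f"
proof -
  obtain c where c: "\<And>s. p s + q s \<le> c * (s + 1) ^ c"
    using poly_bounded_add[OF assms(1,2)] unfolding poly_bounded_def by blast
  have p: "p s \<le> c * (s + 1) ^ c" and q: "q s \<le> c * (s + 1) ^ c" for s
    using c[of s] by linarith+
  show ?thesis unfolding ptime_def using runs_mono[OF assms(3) p] order_trans[OF assms(4) q] by blast
qed

lemma ptimeE:
  assumes "ptime f"
  obtains p P where "poly_bounded p" "mono p" "\<And>x. runs P (enc x) (enc (f x)) (p (esize x))"
    "\<And>x. esize (f x) \<le> p (esize x)"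
proof -
  obtain P c where c: "\<And>x. runs P (enc x) (enc (f x)) (c * (esize x + 1) ^ c)"
    "\<And>x. esize (f x) \<le> c * (esize x + 1) ^ c" using assms unfolding ptime_def by blast
  show ?thesis
    by (rule that[of "\<lambda>s. c * (s + 1) ^ c" P])
      (use c monomial_mono[of c c] in \<open>auto intro!: poly_boundedI monoI\<close>)
qed

lemma ptime_esize:
  assumes "ptime f"
  obtains p where "poly_bounded p" "mono p" "\<And>x. esize (f x) \<le> p (esize x)"
  using assms by (meson ptimeE)

lemma ptime_expr:
  assumes "\<And>x. eval_expr a (enc x) = enc (f x)" "poly_bounded q" "\<And>x. esize (f x) \<le> q (esize x)"
  shows "ptime f"
  by (rule ptimeI[OF poly_bounded_const assms(2) _ assms(3), where P = "Assign a"])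
    (use assms(1) runs_Assign in blast)

text \<open>A nonempty list is encoded like the pair of its head and tail, and a number like a list
  of leaves, so these changes of type cost nothing.\<close>

lemma ptime_same_enc:
  assumes "ptime f" "\<And>x. enc (f x) = enc (g x)"
  shows "ptime g"
  using assms unfolding ptime_def by (simp add: esize_def)

lemma ptime_id: "ptime (\<lambda>x. x)"
  by (rule ptime_expr[of Var, OF _ poly_bounded_id]) auto

lemma ptime_const: "ptime (\<lambda>x. c)"
proof -
  have "\<exists>a. \<forall>s. eval_expr a s = t" for t
  proof (induction t)
    case Leaf
    then show ?case by (rule exI[of _ LeafE]) simp
  next
    case (Node l r)
    then obtain a b where "\<forall>s. eval_expr a s = l" "\<forall>s. eval_expr b s = r" by blast
    then show ?case by (intro exI[of _ "NodeE a b"]) simp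
  qed
  then obtain a where "\<forall>s. eval_expr a s = enc c" by blast
  then show ?thesis by (intro ptime_expr[of a, OF _ poly_bounded_const]) auto
qed

lemma ptime_comp:
  assumes "ptime f" "ptime g"
  shows "ptime (\<lambda>x. f (g x))"
proof -
  obtain p P where p: "poly_bounded p" "mono p" "\<And>x. runs P (enc x) (enc (f x)) (p (esize x))"
    "\<And>x. esize (f x) \<le> p (esize x)" using assms(1) by (rule ptimeE) blast
  obtain q Q where q: "poly_bounded q" "mono q" "\<And>x. runs Q (enc x) (enc (g x)) (q (esize x))"
    "\<And>x. esize (g x) \<le> q (esize x)" using assms(2) by (rule ptimeE) blast
  have b: "poly_bounded (\<lambda>s. p (q s))" using p(1) q(1) by (rule poly_bounded_comp)
  have m: "p (esize (g x)) \<le> p (q (esize x))" for x using p(2) q(4) by (simp add: monoD)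
  show ?thesis
  proof (rule ptimeI[OF poly_bounded_add[OF q(1) b] b, of "Seq Q P"])
    show "runs (Seq Q P) (enc x) (enc (f (g x))) (q (esize x) + p (q (esize x)))" for x
      by (rule runs_Seq[OF q(3) runs_mono[OF p(3) m]])
    show "esize (f (g x)) \<le> p (q (esize x))" for x using p(4) m order_trans by blast
  qed
qed

lemma ptime_Pair:
  assumes "ptime f" "ptime g"
  shows "ptime (\<lambda>x. (f x, g x))"
proof -
  obtain p P where p: "poly_bounded p" "\<And>x. runs P (enc x) (enc (f x)) (p (esize x))"
    "\<And>x. esize (f x) \<le> p (esize x)" using assms(1) by (meson ptimeE)
  obtain q Q where q: "poly_bounded q" "\<And>x. runs Q (enc x) (enc (g x)) (q (esize x))"
    "\<And>x. esize (g x) \<le> q (esize x)" using assms(2) by (meson ptimeE)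
  show ?thesis
  proof (rule ptimeI)
    show "poly_bounded (\<lambda>s. 4 * p s + 4 * q s + 16)" "poly_bounded (\<lambda>s. p s + q s + 1)"
      by (intro poly_bounded_intros p q)+
    show "runs (pair_prog P Q) (enc x) (enc (f x, g x)) (4 * p (esize x) + 4 * q (esize x) + 16)" for x
      using runs_pair_prog[OF p(2) q(2)] by simp
    show "esize (f x, g x) \<le> p (esize x) + q (esize x) + 1" for x
      using p(3)[of x] q(3)[of x] by simp
  qed
qed

lemma ptime_comp2:
  "ptime (\<lambda>z. h (fst z) (snd z)) \<Longrightarrow> ptime f \<Longrightarrow> ptime g \<Longrightarrow> ptime (\<lambda>x. h (f x) (g x))"
  using ptime_comp[OF _ ptime_Pair, of "\<lambda>z. h (fst z) (snd z)" f g] by simp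

lemma ptime_comp3:
  "ptime (\<lambda>z. h (fst z) (fst (snd z)) (snd (snd z))) \<Longrightarrow> ptime f \<Longrightarrow> ptime g \<Longrightarrow> ptime k \<Longrightarrow>
    ptime (\<lambda>x. h (f x) (g x) (k x))"
  using ptime_comp[OF _ ptime_Pair[OF _ ptime_Pair],
      of "\<lambda>z. h (fst z) (fst (snd z)) (snd (snd z))" f g k] by simp

lemma ptime_fst: "ptime f \<Longrightarrow> ptime (\<lambda>x. fst (f x))"
  by (rule ptime_comp[of fst], rule ptime_expr[of "Left Var", OF _ poly_bounded_id])
    (auto simp: enc_prod_def)

lemma ptime_snd: "ptime f \<Longrightarrow> ptime (\<lambda>x. snd (f x))"
  by (rule ptime_comp[of snd], rule ptime_expr[of "Right Var", OF _ poly_bounded_id])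
    (auto simp: enc_prod_def)

lemma ptime_if:
  assumes "ptime c" "ptime f" "ptime g"
  shows "ptime (\<lambda>x. if c x then f x else g x)"
proof -
  obtain C c' where c: "poly_bounded c'" "\<And>x. runs C (enc x) (enc (c x)) (c' (esize x))"
    using assms(1) by (meson ptimeE)
  obtain p P where p: "poly_bounded p" "\<And>x. runs P (enc x) (enc (f x)) (p (esize x))"
    "\<And>x. esize (f x) \<le> p (esize x)" using assms(2) by (meson ptimeE)
  obtain q Q where q: "poly_bounded q" "\<And>x. runs Q (enc x) (enc (g x)) (q (esize x))"
    "\<And>x. esize (g x) \<le> q (esize x)" using assms(3) by (meson ptimeE)
  show ?thesis
  proof (rule ptimeI)
    show "poly_bounded (\<lambda>s. 4 * c' s + (p s + q s) + 10)" "poly_bounded (\<lambda>s. p s + q s)"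
      by (intro poly_bounded_intros c p q)+
    show "runs (cond_prog C P Q) (enc x) (enc (if c x then f x else g x))
        (4 * c' (esize x) + (p (esize x) + q (esize x)) + 10)" for x
      by (rule runs_cond_prog[OF c(2)]) (auto intro: runs_mono[OF p(2)] runs_mono[OF q(2)])
    show "esize (if c x then f x else g x) \<le> p (esize x) + q (esize x)" for x
      using p(3)[of x] q(3)[of x] by simp
  qed
qed

text \<open>Iterating a polynomial-time step can blow up the accumulator exponentially, so a
  polynomial bound \<open>b\<close> on all intermediate accumulators has to be supplied for each
  fold separately.\<close>

lemma ptime_foldl:
  fixes g :: "'a::tree_enc \<Rightarrow> 'b::tree_enc list" and f :: "'a \<Rightarrow> 'c::tree_enc \<Rightarrow> 'b \<Rightarrow> 'c"
  assumes "ptime g" "ptime a" "ptime (\<lambda>z. f (fst z) (fst (snd z)) (snd (snd z)))"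
    and "poly_bounded b" "\<And>x ys zs. g x = ys @ zs \<Longrightarrow> esize (foldl (f x) (a x) ys) \<le> b (esize x)"
  shows "ptime (\<lambda>x. foldl (f x) (a x) (g x))"
proof -
  obtain p P where p: "poly_bounded p" "mono p"
    "\<And>z. runs P (enc z) (enc (f (fst z) (fst (snd z)) (snd (snd z)))) (p (esize z))"
    using assms(3) by (rule ptimeE) blast
  have P: "runs P (Node (enc x) (Node (enc c) (enc y))) (enc (f x c y)) (p (esize (x, c, y)))" for x c y
    using p(3)[of "(x, c, y)"] by simp
  obtain q Q where q: "poly_bounded q" "mono q"
    "\<And>x. runs Q (enc x) (enc (g x, x, a x)) (q (esize x))"
    using ptime_Pair[OF assms(1) ptime_Pair[OF ptime_id assms(2)]] by (rule ptimeE) blast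
  obtain r where r: "poly_bounded r" "\<And>x. esize (g x) \<le> r (esize x)"
    using assms(1) by (rule ptime_esize) blast
  define T where "T s = p (s + b s + r s + 2)" for s
  have T: "poly_bounded T" unfolding T_def
    by (intro poly_bounded_comp[OF p(1)] poly_bounded_intros assms r)
  show ?thesis
  proof (rule ptimeI)
    show "poly_bounded (\<lambda>s. q s + (r s * (4 * T s + 40) + 10))"
      by (intro poly_bounded_intros q r T)
    show "poly_bounded b" by (rule assms(4))
    show "esize (foldl (f x) (a x) (g x)) \<le> b (esize x)" for x
      using assms(5)[of x "g x" "[]"] by simp
    fix x :: 'a
    let ?s = "esize x"
    have "runs P (Node (enc x) (Node (enc (foldl (f x) (a x) ys)) (enc y)))
        (enc (f x (foldl (f x) (a x) ys) y)) (T ?s)" if g: "g x = ys @ y # zs" for ys y zs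
    proof (rule runs_mono[OF P])
      have "esize y \<le> r ?s" using esize_member[of y "g x"] r(2)[of x] g by simp
      then show "p (esize (x, foldl (f x) (a x) ys, y)) \<le> T ?s"
        unfolding T_def using assms(5)[OF g] by (intro monoD[OF p(2)]) simp
    qed
    from runs_fold_prog[where h = enc and h' = enc, of "g x" P "enc x", OF this]
    have "runs (fold_prog P) (enc (g x, x, a x)) (enc (foldl (f x) (a x) (g x)))
        (length (g x) * (4 * T ?s + 40) + 10)"
      by (simp add: enc_list_eq)
    then have "runs (fold_prog P) (enc (g x, x, a x)) (enc (foldl (f x) (a x) (g x)))
        (r ?s * (4 * T ?s + 40) + 10)"
      using r(2)[of x] length_le_esize[of "g x"] by (elim runs_mono) (simp add: mult_le_mono1)
    then show "runs (Seq Q (fold_prog P)) (enc x) (enc (foldl (f x) (a x) (g x)))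
        (q ?s + (r ?s * (4 * T ?s + 40) + 10))"
      by (rule runs_Seq[OF q(3)])
  qed
qed

section \<open>Closure under operations on lists and on unary numbers\<close>

lemma ptime_Cons: "ptime f \<Longrightarrow> ptime g \<Longrightarrow> ptime (\<lambda>x. f x # g x)"
  by (rule ptime_same_enc[OF ptime_Pair]) auto

lemma ptime_tl: "ptime f \<Longrightarrow> ptime (\<lambda>x. tl (f x))"
proof (rule ptime_comp[of tl], rule ptime_expr[of "Right Var", OF _ poly_bounded_id])
  fix xs :: "'b list"
  show "eval_expr (Right Var) (enc xs) = enc (tl xs)" by (cases xs) auto
  show "esize (tl xs) \<le> esize xs" by (cases xs) auto
qed

lemma ptime_neq_Nil: "ptime f \<Longrightarrow> ptime (\<lambda>x. f x \<noteq> [])"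
proof (rule ptime_comp[of "\<lambda>xs. xs \<noteq> []"], rule ptimeI[OF poly_bounded_const poly_bounded_const])
  fix xs :: "'b list"
  have "runs (Cond Var (Assign (NodeE LeafE LeafE)) (Assign LeafE)) (enc xs) (enc (xs \<noteq> []))
      (expr_cost Var + 1 + 4)"
  proof (cases "xs = []")
    case True
    then show ?thesis by (intro runs_CondFalse runs_Assign) (auto simp: enc_bool_def)
  next
    case False
    then show ?thesis by (intro runs_CondTrue runs_Assign) (auto simp: enc_bool_def)
  qed
  then show "runs (Cond Var (Assign (NodeE LeafE LeafE)) (Assign LeafE)) (enc xs) (enc (xs \<noteq> []))
      (expr_cost Var + 1 + 4)" .
  show "esize (xs \<noteq> []) \<le> 1" by (rule esize_bool)
qed

lemma ptime_cong: "ptime f \<Longrightarrow> (\<And>x. f x = g x) \<Longrightarrow> ptime g"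
  using ext[of f g] by simp

lemma ptime_not: "ptime f \<Longrightarrow> ptime (\<lambda>x. \<not> f x)"
  by (rule ptime_cong[OF ptime_if[OF _ ptime_const ptime_const]]) auto

lemma ptime_conj: "ptime f \<Longrightarrow> ptime g \<Longrightarrow> ptime (\<lambda>x. f x \<and> g x)"
  by (rule ptime_cong[OF ptime_if[OF _ _ ptime_const, of f g False]]) auto

lemma ptime_disj: "ptime f \<Longrightarrow> ptime g \<Longrightarrow> ptime (\<lambda>x. f x \<or> g x)"
  using ptime_not[OF ptime_conj[OF ptime_not ptime_not], of f g] by simp

lemma ptime_eq_Nil: "ptime f \<Longrightarrow> ptime (\<lambda>x. f x = [])"
  using ptime_not[OF ptime_neq_Nil, of f] by simp

lemma foldl_Cons_rev: "foldl (\<lambda>c y. h y # c) a xs = rev (map h xs) @ a"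
  by (induction xs arbitrary: a) auto

lemma esize_rev [simp]: "esize (rev xs) = esize xs"
  by (induction xs) auto

lemma ptime_rev: "ptime f \<Longrightarrow> ptime (\<lambda>x. rev (f x))"
proof (rule ptime_comp[of rev])
  have "ptime (\<lambda>x. foldl (\<lambda>c y. y # c) [] (x :: 'b list))"
    by (rule ptime_foldl[OF ptime_id ptime_const _ poly_bounded_id])
      (auto intro!: ptime_Cons ptime_fst ptime_snd ptime_id simp: foldl_Cons_rev[of "\<lambda>y. y", simplified])
  then show "ptime (rev :: 'b list \<Rightarrow> _)" by (simp add: foldl_Cons_rev[of "\<lambda>y. y", simplified])
qed

lemma ptime_map:
  fixes g :: "'a::tree_enc \<Rightarrow> 'b::tree_enc list" and f :: "'a \<Rightarrow> 'b \<Rightarrow> 'c::tree_enc"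
  assumes "ptime g" "ptime (\<lambda>z. f (fst z) (snd z))"
  shows "ptime (\<lambda>x. map (f x) (g x))"
proof -
  obtain p where p: "poly_bounded p" "mono p"
      "\<And>z :: 'a \<times> 'b. esize (f (fst z) (snd z)) \<le> p (esize z)"
    using assms(2) by (rule ptime_esize) blast
  obtain r where r: "poly_bounded r" "\<And>x. esize (g x) \<le> r (esize x)"
    using assms(1) by (rule ptime_esize) blast
  have *: "ptime (\<lambda>x. foldl (\<lambda>c y. f x y # c) [] (g x))"
  proof (rule ptime_foldl[OF assms(1) ptime_const])
    show "ptime (\<lambda>z. f (fst z) (snd (snd z)) # fst (snd z))"
      by (intro ptime_Cons ptime_fst ptime_snd ptime_id ptime_comp2[OF assms(2)])
    show "poly_bounded (\<lambda>s. r s * (p (s + r s + 1) + 1))"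
      by (intro poly_bounded_intros r poly_bounded_comp[OF p(1)])
    fix x ys zs assume g: "g x = ys @ zs"
    have "esize (map (f x) ys) \<le> length (map (f x) ys) * (p (esize x + r (esize x) + 1) + 1)"
    proof (rule esize_list_bound)
      fix w assume "w \<in> set (map (f x) ys)"
      then obtain y where y: "y \<in> set (g x)" "w = f x y" using g by auto
      have "esize w \<le> p (esize (x, y))" using p(3)[of "(x, y)"] y by simp
      also have "\<dots> \<le> p (esize x + r (esize x) + 1)"
        using esize_member[OF y(1)] r(2)[of x] by (intro monoD[OF p(2)]) simp
      finally show "esize w \<le> p (esize x + r (esize x) + 1)" .
    qed
    also have "\<dots> \<le> r (esize x) * (p (esize x + r (esize x) + 1) + 1)"
      using g length_le_esize[of "g x"] r(2)[of x] by (intro mult_le_mono1) simp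
    finally show "esize (foldl (\<lambda>c y. f x y # c) [] ys) \<le> r (esize x) * (p (esize x + r (esize x) + 1) + 1)"
      by (simp add: foldl_Cons_rev)
  qed
  from ptime_rev[OF *] show ?thesis by (simp add: foldl_Cons_rev)
qed

lemma ptime_append:
  assumes "ptime f" "ptime g"
  shows "ptime (\<lambda>x. f x @ g x)"
proof (rule ptime_comp2[OF _ assms, where h = "(@)"])
  have "ptime (\<lambda>z. foldl (\<lambda>c y. y # c) (snd z) (rev (fst z)) :: 'b list)"
  proof (rule ptime_foldl[OF _ _ _ poly_bounded_id])
    fix z :: "'b list \<times> 'b list" and ys zs assume "rev (fst z) = ys @ zs"
    then have "esize ys \<le> esize (fst z)" by (metis esize_append esize_rev le_add1)
    then show "esize (foldl (\<lambda>c y. y # c) (snd z) ys) \<le> esize z"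
      by (simp add: foldl_Cons_rev[of "\<lambda>y. y", simplified])
  qed (intro ptime_rev ptime_Cons ptime_fst ptime_snd ptime_id)+
  then show "ptime (\<lambda>z. fst z @ snd z :: 'b list)"
    by (simp add: foldl_Cons_rev[of "\<lambda>y. y", simplified])
qed

lemma esize_concat: "esize (concat xss) \<le> esize xss"
  by (induction xss) auto

lemma ptime_concat:
  assumes "ptime f"
  shows "ptime (\<lambda>x. concat (f x))"
proof (rule ptime_comp[OF _ assms])
  have eq: "foldl (@) [] xss = concat xss" for xss :: "'b list list"
    by (induction xss rule: rev_induct) auto
  have "ptime (\<lambda>x. foldl (@) [] (x :: 'b list list))"
    by (rule ptime_foldl[OF ptime_id ptime_const _ poly_bounded_id])
      (auto simp: eq intro!: ptime_append ptime_fst ptime_snd ptime_id order_trans[OF esize_concat])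
  then show "ptime (concat :: 'b list list \<Rightarrow> _)" by (simp add: eq)
qed

lemma ptime_filter:
  assumes "ptime g" "ptime (\<lambda>z. f (fst z) (snd z))"
  shows "ptime (\<lambda>x. filter (f x) (g x))"
proof -
  have "ptime (\<lambda>x. concat (map (\<lambda>y. if f x y then [y] else []) (g x)))"
    by (intro ptime_concat ptime_map ptime_if assms ptime_Cons ptime_const ptime_snd ptime_id)
  moreover have "concat (map (\<lambda>y. if f x y then [y] else []) ys) = filter (f x) ys" for x ys
    by (induction ys) auto
  ultimately show ?thesis by simp
qed

lemma ptime_Bex:
  assumes "ptime g" "ptime (\<lambda>z. f (fst z) (snd z))"
  shows "ptime (\<lambda>x. \<exists>y\<in>set (g x). f x y)"
  using ptime_neq_Nil[OF ptime_filter[OF assms]] by (simp add: filter_empty_conv)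

lemma ptime_Ball:
  assumes "ptime g" "ptime (\<lambda>z. f (fst z) (snd z))"
  shows "ptime (\<lambda>x. \<forall>y\<in>set (g x). f x y)"
  using ptime_not[OF ptime_Bex[OF assms(1) ptime_not[OF assms(2)]]] by simp

lemma ptime_length: "ptime f \<Longrightarrow> ptime (\<lambda>x. length (f x))"
proof -
  assume "ptime f"
  then have "ptime (\<lambda>x. map (\<lambda>_. Leaf) (f x))" by (intro ptime_map ptime_const)
  then show ?thesis
    by (rule ptime_same_enc) (simp add: enc_nat_replicate map_replicate_const)
qed

lemma ptime_replicate_Leaf: "ptime f \<Longrightarrow> ptime (\<lambda>x. replicate (f x) Leaf)"
  by (erule ptime_same_enc) (simp add: enc_nat_replicate)

lemma foldl_replicate: "foldl (\<lambda>c _. f c) a (replicate n y) = (f ^^ n) a"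
  by (induction n arbitrary: a) (auto simp: funpow_swap1)

lemma ptime_funpow:
  fixes f :: "'a::tree_enc \<Rightarrow> 'b::tree_enc \<Rightarrow> 'b"
  assumes "ptime n" "ptime a" "ptime (\<lambda>z. f (fst z) (snd z))"
    and "poly_bounded b" "\<And>x i. i \<le> n x \<Longrightarrow> esize ((f x ^^ i) (a x)) \<le> b (esize x)"
  shows "ptime (\<lambda>x. (f x ^^ n x) (a x))"
proof -
  have "ptime (\<lambda>x. foldl (\<lambda>c _. f x c) (a x) (replicate (n x) Leaf))"
  proof (rule ptime_foldl[OF ptime_replicate_Leaf[OF assms(1)] assms(2) _ assms(4)])
    show "ptime (\<lambda>z :: _ \<times> _ \<times> tree. f (fst z) (fst (snd z)))"
      by (intro ptime_comp2[OF assms(3)] ptime_fst ptime_snd ptime_id)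
    fix x ys zs assume r: "replicate (n x) Leaf = ys @ zs"
    have "ys = replicate (length ys) Leaf"
      by (metis r append_eq_conv_conj take_replicate length_replicate)
    moreover have "length ys \<le> n x" using arg_cong[OF r, of length] by simp
    ultimately show "esize (foldl (\<lambda>c _. f x c) (a x) ys) \<le> b (esize x)"
      using assms(5)[of "length ys" x] foldl_replicate[of "f x" "a x" "length ys" Leaf] by simp
  qed
  then show ?thesis by (simp add: foldl_replicate)
qed

lemma ptime_add: "ptime f \<Longrightarrow> ptime g \<Longrightarrow> ptime (\<lambda>x. f x + g x :: nat)"
  using ptime_length[OF ptime_append[OF ptime_replicate_Leaf ptime_replicate_Leaf], of f g] by simp

lemma ptime_Suc: "ptime f \<Longrightarrow> ptime (\<lambda>x. Suc (f x))"
  using ptime_add[OF ptime_const, of f 1] by simp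

text \<open>The unary minuend is shortened by \<open>tl\<close> once for each unit of the
  subtrahend; \<open>tl [] = []\<close> gives the truncation at 0.\<close>

lemma ptime_diff:
  assumes "ptime f" "ptime g"
  shows "ptime (\<lambda>x. f x - g x :: nat)"
proof (rule ptime_comp2[OF _ assms, where h = "(-)"])
  have e: "(tl ^^ i) xs = drop i xs" for i and xs :: "tree list"
    by (induction i arbitrary: xs) (auto simp: drop_Suc tl_drop)
  have r: "esize (replicate n Leaf) = n" for n
    using esize_nat[of n] unfolding esize_def enc_nat_replicate by simp
  have "ptime (\<lambda>z. (tl ^^ snd z) (replicate (fst z) Leaf))"
    by (rule ptime_funpow[OF _ _ _ poly_bounded_id])
      (auto simp: e r intro!: ptime_snd ptime_fst ptime_id ptime_tl ptime_replicate_Leaf)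
  then have "ptime (\<lambda>z. length (replicate (fst z - snd z) Leaf))"
    by (intro ptime_length) (simp add: e)
  then show "ptime (\<lambda>z. fst z - snd z :: nat)" by simp
qed

lemma ptime_nat_le: "ptime f \<Longrightarrow> ptime g \<Longrightarrow> ptime (\<lambda>x. f x \<le> (g x :: nat))"
  using ptime_eq_Nil[OF ptime_replicate_Leaf[OF ptime_diff], of f g] by simp

lemma ptime_nat_less: "ptime f \<Longrightarrow> ptime g \<Longrightarrow> ptime (\<lambda>x. f x < (g x :: nat))"
  using ptime_not[OF ptime_nat_le, of g f] by (simp add: not_le)

lemma ptime_nat_eq: "ptime f \<Longrightarrow> ptime g \<Longrightarrow> ptime (\<lambda>x. f x = (g x :: nat))"
  using ptime_conj[OF ptime_nat_le ptime_nat_le, of f g g f] by (simp add: eq_iff)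

lemma ptime_upt:
  assumes "ptime f"
  shows "ptime (\<lambda>x. [0..<f x])"
proof (rule ptime_comp[OF _ assms, where f = "upt 0"])
  have e: "((\<lambda>c. c @ [length c]) ^^ i) [] = [0..<i]" for i
    by (induction i) auto
  have "ptime (\<lambda>n. ((\<lambda>c. c @ [length c]) ^^ n) [])"
  proof (rule ptime_funpow)
    show "poly_bounded (\<lambda>s. s * (s + 1))" by (intro poly_bounded_intros)
    fix n i :: nat assume "i \<le> n"
    then show "esize (((\<lambda>c. c @ [length c]) ^^ i) []) \<le> esize n * (esize n + 1)"
      unfolding e by (intro order_trans[OF esize_list_bound[of _ n]]) (auto intro: add_mono)
  qed (intro ptime_append ptime_Cons ptime_length ptime_snd ptime_id ptime_const)+
  then show "ptime (upt 0)" by (simp add: e)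
qed

lemma ptime_sum_list: "ptime f \<Longrightarrow> ptime (\<lambda>x. sum_list (f x) :: nat)"
proof -
  assume "ptime f"
  then have "ptime (\<lambda>x. length (concat (map (\<lambda>n. replicate n Leaf) (f x))))"
    by (intro ptime_length ptime_concat ptime_map ptime_replicate_Leaf ptime_snd ptime_id)
  then show ?thesis by (simp add: length_concat comp_def)
qed

lemma ptime_mult: "ptime f \<Longrightarrow> ptime g \<Longrightarrow> ptime (\<lambda>x. f x * g x :: nat)"
proof -
  assume f: "ptime f" and g: "ptime g"
  have "ptime (\<lambda>x. sum_list (map (\<lambda>_. g x) [0..<f x]))"
    by (intro ptime_sum_list ptime_map ptime_upt f ptime_comp[OF g] ptime_fst ptime_id)
  then show ?thesis by (simp add: sum_list_triv)
qed

lemma ptime_member_nat: "ptime f \<Longrightarrow> ptime g \<Longrightarrow> ptime (\<lambda>x. (f x :: nat) \<in> set (g x))"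
proof -
  assume f: "ptime f" and g: "ptime g"
  have "ptime (\<lambda>x. \<exists>y\<in>set (g x). y = f x)"
    by (intro ptime_Bex g ptime_nat_eq ptime_snd ptime_id ptime_comp[OF f] ptime_fst)
  then show ?thesis by simp
qed

lemma ptime_case_list:
  assumes "ptime g" "ptime a" "ptime (\<lambda>z. f (fst z) (fst (snd z)) (snd (snd z)))"
  shows "ptime (\<lambda>x. case g x of [] \<Rightarrow> a x | y # ys \<Rightarrow> f x y ys)"
proof -
  obtain c C where c: "poly_bounded c" "\<And>x. runs C (enc x) (enc (g x \<noteq> [])) (c (esize x))"
    using ptime_neq_Nil[OF assms(1)] by (rule ptimeE) blast
  obtain p P where p: "poly_bounded p" "\<And>x. runs P (enc x) (enc (a x)) (p (esize x))"
    "\<And>x. esize (a x) \<le> p (esize x)" using assms(2) by (rule ptimeE) blast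
  obtain q Q where q: "poly_bounded q" "\<And>x. runs Q (enc x) (enc (x, g x)) (q (esize x))"
    "\<And>x. esize (x, g x) \<le> q (esize x)"
    using ptime_Pair[OF ptime_id assms(1)] by (rule ptimeE) blast
  obtain r R where r: "poly_bounded r" "mono r"
    "\<And>z. runs R (enc z) (enc (f (fst z) (fst (snd z)) (snd (snd z)))) (r (esize z))"
    "\<And>z. esize (f (fst z) (fst (snd z)) (snd (snd z))) \<le> r (esize z)"
    using assms(3) by (rule ptimeE) blast
  show ?thesis
  proof (rule ptimeI)
    show "poly_bounded (\<lambda>s. 4 * c s + (p s + (q s + r (q s))) + 10)" "poly_bounded (\<lambda>s. p s + r (q s))"
      by (intro poly_bounded_intros c p q poly_bounded_comp[OF r(1)])+
    fix x
    have Cons: "runs (Seq Q R) (enc x) (enc (f x y ys)) (q (esize x) + r (q (esize x)))"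
      "esize (f x y ys) \<le> r (q (esize x))" if g: "g x = y # ys" for y ys
    proof -
      have m: "r (esize (x, y, ys)) \<le> r (q (esize x))"
        using q(3)[of x] g by (intro monoD[OF r(2)]) simp
      have "runs Q (enc x) (enc (x, y, ys)) (q (esize x))" using q(2)[of x] g by simp
      moreover have "runs R (enc (x, y, ys)) (enc (f x y ys)) (r (q (esize x)))"
        using runs_mono[OF r(3)[of "(x, y, ys)"] m] by simp
      ultimately show "runs (Seq Q R) (enc x) (enc (f x y ys)) (q (esize x) + r (q (esize x)))"
        by (rule runs_Seq)
      show "esize (f x y ys) \<le> r (q (esize x))" using r(4)[of "(x, y, ys)"] m by simp
    qed
    show "runs (cond_prog C (Seq Q R) P) (enc x) (enc (case g x of [] \<Rightarrow> a x | y # ys \<Rightarrow> f x y ys))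
        (4 * c (esize x) + (p (esize x) + (q (esize x) + r (q (esize x)))) + 10)"
      by (rule runs_cond_prog[OF c(2)])
        (auto split: list.split intro: runs_mono[OF Cons(1)] runs_mono[OF p(2)])
    show "esize (case g x of [] \<Rightarrow> a x | y # ys \<Rightarrow> f x y ys) \<le> p (esize x) + r (q (esize x))"
      using p(3)[of x] Cons(2) by (auto split: list.split intro: trans_le_add1 trans_le_add2)
  qed
qed

text \<open>The algorithms below are HOL functions built from these operations, so that their
  running time can be read off their definitions. Unusual forms, such as element access by
  \<open>drop\<close>, are due to this.\<close>

named_theorems ptime_intros

lemmas [ptime_intros] = ptime_id ptime_const ptime_Pair ptime_fst ptime_snd ptime_if ptime_Cons
  ptime_tl ptime_neq_Nil ptime_eq_Nil ptime_not ptime_conj ptime_disj ptime_rev ptime_map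
  ptime_append ptime_concat ptime_filter ptime_Bex ptime_Ball ptime_length ptime_add ptime_Suc
  ptime_diff ptime_nat_le ptime_nat_less ptime_nat_eq ptime_upt ptime_sum_list ptime_mult
  ptime_member_nat ptime_case_list

section \<open>Inputs and running times of the three problems\<close>

lemma encodes_vertices_iff:
  "encodes_vertices A x \<longleftrightarrow> (\<exists>as. distinct as \<and> set as = A \<and> x = enc as)"
proof -
  have "list_all2 (\<lambda>a x. x = enc_nat a) as xs \<longleftrightarrow> xs = map enc as" for as xs
    by (auto simp: list_all2_conv_all_nth list_eq_iff_nth_eq enc_nat_def)
  then show ?thesis by (auto simp: encodes_vertices_def encodes_set_def enc_list_eq)
qed

text \<open>Every presentation of a family is the encoding of a list of lists. This replaces the
  relational input format by functions on lists that are correct for any order of the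
  elements.\<close>

lemma encodes_family_iff:
  "encodes_family F x \<longleftrightarrow>
    (\<exists>xss. distinct (map set xss) \<and> (\<forall>xs\<in>set xss. distinct xs) \<and> set ` set xss = F \<and> x = enc xss)"
proof
  assume "encodes_family F x"
  then obtain as xs where as: "distinct as" "set as = F" "list_all2 encodes_vertices as xs" "x = enc_list xs"
    unfolding encodes_family_def encodes_set_def by blast
  from as(3) have "\<exists>yss. map set yss = as \<and> (\<forall>ys\<in>set yss. distinct ys) \<and> xs = map enc yss"
  proof (induction rule: list_all2_induct)
    case Nil
    then show ?case by simp
  next
    case (Cons a as x xs)
    then obtain ys yss where "map set yss = as" "\<forall>ys\<in>set yss. distinct ys" "xs = map enc yss"
      "distinct ys" "set ys = a" "x = enc ys" by (auto simp: encodes_vertices_iff)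
    then show ?case by (intro exI[of _ "ys # yss"]) auto
  qed
  then obtain yss where y: "map set yss = as" "\<forall>ys\<in>set yss. distinct ys" "xs = map enc yss" by blast
  then have "set ` set yss = F" using as(2) by (metis set_map)
  with y as show "\<exists>xss. distinct (map set xss) \<and> (\<forall>xs\<in>set xss. distinct xs) \<and> set ` set xss = F \<and> x = enc xss"
    by (auto simp: enc_list_eq)
next
  assume "\<exists>xss. distinct (map set xss) \<and> (\<forall>xs\<in>set xss. distinct xs) \<and> set ` set xss = F \<and> x = enc xss"
  then obtain xss where x: "distinct (map set xss)" "\<forall>xs\<in>set xss. distinct xs" "set ` set xss = F" "x = enc xss"
    by blast
  then have "list_all2 encodes_vertices (map set xss) (map enc xss)"
    by (auto simp: list_all2_conv_all_nth encodes_vertices_iff)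
  then show "encodes_family F x" using x unfolding encodes_family_def encodes_set_def
    by (intro exI[of _ "map set xss"] exI[of _ "map enc xss"]) (auto simp: enc_list_eq)
qed

text \<open>A set of at most \<open>d\<close> numbers below \<open>n\<close> becomes a list of
  length exactly \<open>d\<close> over \<open>{..n}\<close> by padding with \<open>n\<close>, and is
  recovered from it.\<close>

lemma card_bounded_subsets:
  assumes "\<And>S. S \<in> F \<Longrightarrow> S \<subseteq> {..<n} \<and> card S \<le> d"
  shows "card F \<le> (n + 1) ^ d"
proof -
  have "F \<subseteq> (\<lambda>xs. set xs \<inter> {..<n}) ` {xs. set xs \<subseteq> {..n} \<and> length xs = d}"
  proof
    fix S assume "S \<in> F"
    then have S: "S \<subseteq> {..<n}" "card S \<le> d" using assms by auto
    then have "finite S" by (meson finite_lessThan finite_subset)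
    then obtain as where as: "set as = S" "distinct as" using finite_distinct_list by blast
    then have l: "length as \<le> d" using S(2) distinct_card by fastforce
    show "S \<in> (\<lambda>xs. set xs \<inter> {..<n}) ` {xs. set xs \<subseteq> {..n} \<and> length xs = d}"
      by (rule image_eqI[of _ _ "as @ replicate (d - length as) n"]) (use S(1) as l in auto)
  qed
  moreover have "finite {xs. set xs \<subseteq> {..n} \<and> length xs = d}" by (rule finite_lists_length_eq) simp
  ultimately have "card F \<le> card {xs. set xs \<subseteq> {..n} \<and> length xs = d}"
    by (rule surj_card_le[rotated])
  then show ?thesis by (simp add: card_lists_length_eq)
qed

lemma esize_nat_list:
  assumes "set xs \<subseteq> {..<n}" "length xs \<le> d"
  shows "esize xs \<le> d * (n + 1)"
proof -
  have "esize xs \<le> length xs * (n + 1)"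
    by (rule esize_list_bound) (use assms(1) in auto)
  also have "\<dots> \<le> d * (n + 1)" using assms(2) by (rule mult_le_mono1)
  finally show ?thesis .
qed

text \<open>Time is measured in \<open>n\<close>, so the input itself must have length polynomial in
  \<open>n\<close>. For families this is due to the constant bound \<open>d\<close> on the sizes of
  the sets.\<close>

lemma esize_family:
  assumes "distinct (map set xss)" "\<forall>xs\<in>set xss. distinct xs"
    "\<And>xs. xs \<in> set xss \<Longrightarrow> set xs \<subseteq> {..<n} \<and> card (set xs) \<le> d"
  shows "esize xss \<le> (n + 1) ^ d * (d * (n + 1) + 1)"
proof -
  have "esize xss \<le> length xss * (d * (n + 1) + 1)"
    using assms(2,3) by (intro esize_list_bound esize_nat_list) (auto simp: distinct_card)
  moreover have "length xss \<le> (n + 1) ^ d"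
    using card_bounded_subsets[of "set (map set xss)" n d] assms(3) distinct_card[OF assms(1)] by auto
  ultimately show ?thesis by (meson le_trans mult_le_mono1)
qed

lemma esize_distinct_nat_list:
  assumes "distinct xs" "set xs \<subseteq> {..<n}"
  shows "esize xs \<le> n * (n + 1)"
proof (rule esize_nat_list[OF assms(2)])
  show "length xs \<le> n" using assms card_mono[of "{..<n}" "set xs"] by (simp add: distinct_card)
qed

lemma decides_within_iff_runs:
  "decides_within P x ans T \<longleftrightarrow> (\<exists>y K. runs P x y K \<and> real K \<le> T \<and> (y \<noteq> Leaf \<longleftrightarrow> ans))"
proof
  assume "decides_within P x ans T"
  then show "\<exists>y K. runs P x y K \<and> real K \<le> T \<and> (y \<noteq> Leaf \<longleftrightarrow> ans)"
    unfolding decides_within_def runs_def by (metis order_refl)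
next
  assume "\<exists>y K. runs P x y K \<and> real K \<le> T \<and> (y \<noteq> Leaf \<longleftrightarrow> ans)"
  then obtain y K k where "exec P x y k" "k \<le> K" "real K \<le> T" "y \<noteq> Leaf \<longleftrightarrow> ans"
    unfolding runs_def by blast
  then show "decides_within P x ans T"
    unfolding decides_within_def by (intro exI[of _ y] exI[of _ k]) auto
qed

lemma decides_withinE:
  assumes "decides_within P x ans T"
  obtains y K where "runs P x y K" "real K \<le> T" "y \<noteq> Leaf \<longleftrightarrow> ans"
  using assms unfolding decides_within_iff_runs by blast

lemma time_bound_poly_bounded:
  assumes "poly_bounded q" "0 \<le> b"
  shows "\<exists>c. \<forall>p n. b ^ p * real (q n) \<le> time_bound b p n c"
proof -
  obtain c where c: "\<And>s. q s \<le> c * (s + 1) ^ c" using assms(1) unfolding poly_bounded_def by blast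
  have "real (q n) \<le> real c * (real n + 1) ^ c" for n
    using of_nat_mono[OF c[of n], where 'a = real] by (simp add: add.commute)
  then show ?thesis unfolding time_bound_def using assms(2) by (intro exI[of _ c]) (simp add: mult_left_mono)
qed

lemma time_bound_mono:
  assumes "0 < b" "b \<le> b'"
  shows "time_bound b p n c \<le> time_bound b' p n c"
  unfolding time_bound_def using assms by (intro mult_right_mono power_mono) auto

lemma decides_within_mono: "decides_within P x ans T \<Longrightarrow> T \<le> T' \<Longrightarrow> decides_within P x ans T'"
  unfolding decides_within_def by (meson order_trans)

lemma set_cover_solvable_mono:
  "set_cover_solvable d b \<Longrightarrow> 0 < b \<Longrightarrow> b \<le> b' \<Longrightarrow> set_cover_solvable d b'"
  unfolding set_cover_solvable_def by (elim ex_forward all_forward imp_forward decides_within_mono)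
    (auto intro: time_bound_mono)

lemma triangle_partition_solvable_mono:
  "triangle_partition_solvable \<sigma> \<delta> b \<Longrightarrow> 0 < b \<Longrightarrow> b \<le> b' \<Longrightarrow> triangle_partition_solvable \<sigma> \<delta> b'"
  unfolding triangle_partition_solvable_def by (elim ex_forward all_forward imp_forward decides_within_mono)
    (auto intro: time_bound_mono)

lemma triangle_packing_solvable_mono:
  "triangle_packing_solvable \<sigma> \<delta> b \<Longrightarrow> 0 < b \<Longrightarrow> b \<le> b' \<Longrightarrow> triangle_packing_solvable \<sigma> \<delta> b'"
  unfolding triangle_packing_solvable_def by (elim ex_forward all_forward imp_forward decides_within_mono)
    (auto intro: time_bound_mono)

lemma exec_pos: "exec P s s' k \<Longrightarrow> 0 < k"
  by (induction rule: exec.induct) auto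

lemma decides_within_pos: "decides_within P x ans T \<Longrightarrow> 0 < T"
  unfolding decides_within_def using exec_pos by fastforce

text \<open>The base \<open>2 - \<epsilon>\<close> may be zero or negative for large
  \<open>\<epsilon>\<close>. Every run takes at least one step, so an instance whose time bound
  contains \<open>b\<close> to the first power forces \<open>b\<close> to be positive; only then is
  solvability monotone in \<open>b\<close>.\<close>

lemma set_cover_solvable_pos:
  assumes "set_cover_solvable d b" "1 \<le> d"
  shows "0 < b"
proof -
  obtain P c where P: "\<And>n F t f. set_cover_instance d {..<n} F \<Longrightarrow> encodes_family F f \<Longrightarrow>
        decides_within P (Node (enc_nat n) (Node f (enc_nat t)))
          (has_set_cover {..<n} F t) (time_bound b n n c)"
    using assms(1) unfolding set_cover_solvable_def by blast
  have "0 < time_bound b 1 1 c"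
    by (rule decides_within_pos[OF P[of 1 "{{0}}" "enc [[0 :: nat]]" 0]])
      (use assms(2) in \<open>auto simp: set_cover_instance_def encodes_family_iff intro!: exI[of _ "[[0]]"]\<close>)
  then show ?thesis by (simp add: time_bound_def zero_less_mult_iff mult_less_0_iff)
qed

lemma triangle_partition_solvable_pos:
  assumes "triangle_partition_solvable \<sigma> \<delta> b"
  shows "0 < b"
proof -
  obtain P c where P: "\<And>n E Q e q. simple_graph {..<n} E \<Longrightarrow> is_hub \<sigma> \<delta> {..<n} E Q \<Longrightarrow>
      encodes_family E e \<Longrightarrow> encodes_vertices Q q \<Longrightarrow> decides_within P (Node (enc_nat n) (Node e q))
          (has_triangle_partition {..<n} E) (time_bound b (card Q) n c)"
    using assms(1) unfolding triangle_partition_solvable_def by blast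
  have "0 < time_bound b (card {0::nat}) 1 c"
    by (rule decides_within_pos[OF P[of 1 "{}" "{0}" "enc ([] :: nat list list)" "enc [0 :: nat]"]])
      (auto simp: simple_graph_def is_hub_def components_def quotient_def encodes_family_iff
        encodes_vertices_iff intro!: exI[of _ "[0]"])
  then show ?thesis by (simp add: time_bound_def zero_less_mult_iff mult_less_0_iff)
qed

lemma triangle_packing_solvable_pos:
  assumes "triangle_packing_solvable \<sigma> \<delta> b"
  shows "0 < b"
proof -
  obtain P c where P: "\<And>n E Q t e q. simple_graph {..<n} E \<Longrightarrow> is_hub \<sigma> \<delta> {..<n} E Q \<Longrightarrow>
      encodes_family E e \<Longrightarrow> encodes_vertices Q q \<Longrightarrow>
      decides_within P (Node (enc_nat n) (Node e (Node q (enc_nat t))))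
          (has_triangle_packing {..<n} E t) (time_bound b (card Q) n c)"
    using assms(1) unfolding triangle_packing_solvable_def by blast
  have "0 < time_bound b (card {0::nat}) 1 c"
    by (rule decides_within_pos[OF P[of 1 "{}" "{0}" "enc ([] :: nat list list)" "enc [0 :: nat]" 0]])
      (auto simp: simple_graph_def is_hub_def components_def quotient_def encodes_family_iff
        encodes_vertices_iff intro!: exI[of _ "[0]"])
  then show ?thesis by (simp add: time_bound_def zero_less_mult_iff mult_less_0_iff)
qed

text \<open>The ceiling of \<open>n / k\<close> for positive \<open>k\<close>, in a form that is
  visibly computable in polynomial time.\<close>

definition ceil_div :: "nat \<Rightarrow> nat \<Rightarrow> nat" where
  "ceil_div n k = length (filter (\<lambda>i. i * k < n) [0..<n])"

lemma ptime_ceil_div [ptime_intros]: "ptime f \<Longrightarrow> ptime (\<lambda>x. ceil_div (f x) k)"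
proof -
  have "ptime (\<lambda>n. ceil_div n k)" unfolding ceil_div_def by (intro ptime_intros)
  then show "ptime f \<Longrightarrow> ptime (\<lambda>x. ceil_div (f x) k)" by (rule ptime_comp)
qed

lemma ceil_div_less_iff: "0 < k \<Longrightarrow> i < ceil_div n k \<longleftrightarrow> i * k < n"
proof -
  assume k: "0 < k"
  have *: "j < (n + k - 1) div k \<longleftrightarrow> j * k < n" for j
    using less_eq_div_iff_mult_less_eq[OF k, of "Suc j" "n + k - 1"] k by auto
  have "j < n" if "j * k < n" for j
    using that k by (cases k) auto
  then have "set (filter (\<lambda>i. i * k < n) [0..<n]) = {..<(n + k - 1) div k}"
    using * by auto
  then have "ceil_div n k = (n + k - 1) div k"
    unfolding ceil_div_def by (metis card_lessThan distinct_card distinct_filter distinct_upt)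
  then show ?thesis using * by simp
qed

lemma mult_ceil_div: "0 < k \<Longrightarrow> n \<le> k * ceil_div n k \<and> k * ceil_div n k < n + k"
proof -
  assume k: "0 < k"
  have "n \<le> ceil_div n k * k" using ceil_div_less_iff[OF k, of "ceil_div n k" n] by simp
  moreover have "ceil_div n k * k < n + k"
  proof (cases "ceil_div n k")
    case (Suc i)
    then show ?thesis using ceil_div_less_iff[OF k, of i n] by simp
  qed (use k in simp)
  ultimately show ?thesis by (simp add: mult.commute)
qed

text \<open>The threshold may be much larger than the rest of the input; only its minimum with the
  number of vertices or elements matters, and that is found without reading all of it.\<close>

definition truncate_prog :: prog where
  "truncate_prog = Seq (Assign (NodeE (Left Var) (NodeE LeafE (NodeE (Right Var) LeafE))))
     (Seq (fold_prog (Cond (Left (Left (Right Var)))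
        (Assign (NodeE (Right (Left (Left (Right Var)))) (NodeE LeafE (Right (Left (Right Var))))))
        (Assign (Left (Right Var)))))
      (Assign (Right Var)))"

lemma runs_truncate_prog:
  "runs truncate_prog (Node (enc n) (enc t)) (enc (min t n)) (n * 140 + 30)"
proof -
  \<comment> \<open>The unary \<open>n\<close> is traversed as a list of \<open>n\<close> leaves;
    the accumulator holds the rest of \<open>t\<close> and the part counted so far.\<close>
  let ?f = "\<lambda>(c :: nat \<times> nat) (_ :: tree). if fst c = 0 then c else (fst c - 1, snd c + 1)"
  let ?B = "Cond (Left (Left (Right Var)))
        (Assign (NodeE (Right (Left (Left (Right Var)))) (NodeE LeafE (Right (Left (Right Var))))))
        (Assign (Left (Right Var)))"
  have body: "runs ?B (Node Leaf (Node (enc c) (enc y))) (enc (?f c y)) 18" for c y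
  proof (cases c)
    case (Pair a b)
    show ?thesis
    proof (cases a)
      case 0
      show ?thesis
        by (rule runs_mono[OF runs_CondFalse[OF _ runs_Assign[OF _ order_refl]]]) (simp_all add: Pair 0)
    next
      case (Suc a')
      show ?thesis
        by (rule runs_mono[OF runs_CondTrue[OF _ runs_Assign[OF _ order_refl]]]) (simp_all add: Pair Suc)
    qed
  qed
  have fold: "foldl ?f (t, m) (replicate n Leaf) = (t - n, m + min t n)" for m
    by (induction n arbitrary: t m) (auto simp: min_def)
  have "runs (fold_prog ?B) (Node (enc_list (map enc (replicate n Leaf))) (Node Leaf (enc (t, 0 :: nat))))
      (enc (foldl ?f (t, 0) (replicate n Leaf))) (length (replicate n Leaf) * (4 * 18 + 40) + 10)"
    by (rule runs_fold_prog) (rule body)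
  then have "runs (fold_prog ?B) (Node (enc n) (Node Leaf (Node (enc t) Leaf)))
      (enc (t - n, min t n)) (n * 112 + 10)"
    unfolding fold enc_nat_replicate[of n] by (simp add: enc_list_eq)
  from runs_Seq[OF this runs_Assign[of "Right Var" _ "enc (min t n)" 3]]
  have "runs (Seq (fold_prog ?B) (Assign (Right Var))) (Node (enc n) (Node Leaf (Node (enc t) Leaf)))
      (enc (min t n)) (n * 112 + 10 + 3)" by simp
  then have "runs truncate_prog (Node (enc n) (enc t)) (enc (min t n)) (10 + (n * 112 + 10 + 3))"
    unfolding truncate_prog_def by (intro runs_Seq[OF runs_Assign]) simp_all
  then show ?thesis by (rule runs_mono) simp
qed

lemma triangle_cardE:
  assumes "triangle V E T"
  shows "T \<subseteq> V" "card T = 3" "finite T" "T \<noteq> {}"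
  using assms card.infinite[of T] unfolding triangle_def by auto

lemma card_disjoint_triangles:
  assumes "finite P" "disjoint P" "\<forall>T\<in>P. triangle V E T"
  shows "card (\<Union>P) = 3 * card P"
proof -
  have "card (\<Union>P) = (\<Sum>T\<in>P. card T)"
  proof (rule card_Union_disjoint)
    show "pairwise disjnt P" using assms(2) by (auto simp: disjoint_def pairwise_def disjnt_def)
  qed (use assms(3) triangle_cardE(3) in blast)
  also have "\<dots> = (\<Sum>T\<in>P. 3)" using assms(3) triangle_cardE(2) by (intro sum.cong) auto
  finally show ?thesis by simp
qed

text \<open>Disjoint triangles whose number is at least the ceiling of \<open>n / 3\<close> occupy
  at least \<open>n\<close> vertices, hence all of them. If 3 does not divide \<open>n\<close>, the
  rounding up makes such a packing impossible, as it should be.\<close>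

lemma triangle_partition_iff_packing:
  "has_triangle_partition {..<n} E \<longleftrightarrow> has_triangle_packing {..<n} E (ceil_div n 3)"
proof
  assume "has_triangle_partition {..<n} E"
  then obtain P where P: "partition_on {..<n} P" "\<forall>T\<in>P. triangle {..<n} E T"
    unfolding has_triangle_partition_def by blast
  have f: "finite P" using P(1) finite_elements finite_lessThan by blast
  have "card (\<Union>P) = 3 * card P"
    using P f by (intro card_disjoint_triangles) (auto simp: partition_on_def)
  then have "n = 3 * card P" using P(1) by (simp add: partition_on_def)
  then have "ceil_div n 3 \<le> card P" using mult_ceil_div[of 3 n] by linarith
  then show "has_triangle_packing {..<n} E (ceil_div n 3)"
    unfolding has_triangle_packing_def using P f by (auto simp: partition_on_def)
next
  assume "has_triangle_packing {..<n} E (ceil_div n 3)"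
  then obtain P where P: "finite P" "disjoint P" "\<forall>T\<in>P. triangle {..<n} E T" "ceil_div n 3 \<le> card P"
    unfolding has_triangle_packing_def by blast
  have U: "\<Union>P \<subseteq> {..<n}" using P(3) triangle_cardE(1) by blast
  have "n \<le> card (\<Union>P)"
    using card_disjoint_triangles[OF P(1-3)] P(4) mult_ceil_div[of 3 n] by linarith
  then have "\<Union>P = {..<n}" using U by (intro card_subset_eq) (auto dest: card_mono[rotated])
  then have "partition_on {..<n} P"
    using P(2,3) triangle_cardE(4)[of "{..<n}" E "{}"] by (auto simp: partition_on_def)
  then show "has_triangle_partition {..<n} E" unfolding has_triangle_partition_def using P(3) by blast
qed

lemma esize_graph:
  assumes "simple_graph {..<n} E" "distinct (map set xss)" "\<forall>xs\<in>set xss. distinct xs"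
    "set ` set xss = E" "distinct as" "set as \<subseteq> {..<n}"
  shows "esize (n, xss, as) \<le> n + (n + 1) ^ 2 * (2 * (n + 1) + 1) + n * (n + 1) + 2"
proof -
  have "esize xss \<le> (n + 1) ^ 2 * (2 * (n + 1) + 1)"
    using assms(1,4) by (intro esize_family assms(2,3)) (auto simp: simple_graph_def)
  moreover have "esize as \<le> n * (n + 1)" using assms(5,6) by (rule esize_distinct_nat_list)
  ultimately show ?thesis by simp
qed

lemma ptime_partition_to_packing:
  "ptime (\<lambda>x :: nat \<times> nat list list \<times> nat list. (fst x, fst (snd x), snd (snd x), ceil_div (fst x) 3))"
  by (intro ptime_intros)

lemma packing_solvable_imp_partition_solvable:
  assumes "triangle_packing_solvable \<sigma> \<delta> b" "1 \<le> b"
  shows "triangle_partition_solvable \<sigma> \<delta> b"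
proof -
  obtain P c where P: "\<And>n E Q t e q. simple_graph {..<n} E \<Longrightarrow> is_hub \<sigma> \<delta> {..<n} E Q \<Longrightarrow>
      encodes_family E e \<Longrightarrow> encodes_vertices Q q \<Longrightarrow>
      decides_within P (Node (enc_nat n) (Node e (Node q (enc_nat t))))
          (has_triangle_packing {..<n} E t) (time_bound b (card Q) n c)"
    using assms unfolding triangle_packing_solvable_def by blast
  obtain p R where p: "poly_bounded p" "mono p"
    "\<And>x :: nat \<times> nat list list \<times> nat list.
      runs R (enc x) (enc (fst x, fst (snd x), snd (snd x), ceil_div (fst x) 3)) (p (esize x))"
    using ptime_partition_to_packing by (rule ptimeE) blast
  define s where "s n = n + (n + 1) ^ 2 * (2 * (n + 1) + 1) + n * (n + 1) + 2" for n :: nat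
  have "poly_bounded (\<lambda>n. p (s n) + c * (n + 1) ^ c)"
    unfolding s_def by (intro poly_bounded_intros poly_bounded_comp[OF p(1)])
  then obtain c' where c': "\<And>m n. b ^ m * real (p (s n) + c * (n + 1) ^ c) \<le> time_bound b m n c'"
    using time_bound_poly_bounded[of _ b] assms(2) by fastforce
  show ?thesis unfolding triangle_partition_solvable_def
  proof (intro exI[of _ "Seq R P"] exI[of _ c'] allI impI, elim conjE)
    fix n E Q e q
    assume E: "simple_graph {..<n} E" and Q: "is_hub \<sigma> \<delta> {..<n} E Q"
      and e: "encodes_family E e" and q: "encodes_vertices Q q"
    obtain xss as where x: "distinct (map set xss)" "\<forall>xs\<in>set xss. distinct xs" "set ` set xss = E"
      "e = enc xss" "distinct as" "set as = Q" "q = enc as"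
      using e q by (auto simp: encodes_family_iff encodes_vertices_iff)
    have "Q \<subseteq> {..<n}" using Q by (simp add: is_hub_def)
    with x E have "esize (n, xss, as) \<le> s n" unfolding s_def by (intro esize_graph) auto
    then have R: "runs R (Node (enc_nat n) (Node e q))
        (Node (enc_nat n) (Node e (Node q (enc_nat (ceil_div n 3))))) (p (s n))"
      using runs_mono[OF p(3)[of "(n, xss, as)"] monoD[OF p(2)]] x(4,7) by (simp add: enc_nat_def)
    obtain y K where y: "runs P (Node (enc_nat n) (Node e (Node q (enc_nat (ceil_div n 3))))) y K"
      "real K \<le> time_bound b (card Q) n c" "y \<noteq> Leaf \<longleftrightarrow> has_triangle_packing {..<n} E (ceil_div n 3)"
      using P[OF E Q e q] by (rule decides_withinE)
    have "real (p (s n) + K) \<le> b ^ card Q * real (p (s n)) + time_bound b (card Q) n c"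
      using y(2) mult_right_mono[OF one_le_power[OF assms(2), of "card Q"], of "real (p (s n))"] by simp
    also have "\<dots> = b ^ card Q * real (p (s n) + c * (n + 1) ^ c)"
      by (simp add: time_bound_def algebra_simps)
    also have "\<dots> \<le> time_bound b (card Q) n c'" by (rule c')
    finally show "decides_within (Seq R P) (Node (enc_nat n) (Node e q))
        (has_triangle_partition {..<n} E) (time_bound b (card Q) n c')"
      unfolding decides_within_iff_runs triangle_partition_iff_packing
      using runs_Seq[OF R y(1)] y(3) by blast
  qed
qed

section \<open>From exact cover to triangle partition\<close>

text \<open>The gadget of a set \<open>S\<close> of size \<open>s\<close> (a multiple of 3) at offset \<open>a\<close> has a ring of \<open>2 s\<close>
  vertices and \<open>s\<close> further vertices.  The ring can be covered in two ways only: by all the triples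
  \<open>ringT\<close>, which swallow \<open>S\<close> and leave the further vertices to \<open>restT\<close>, or by all the triples
  \<open>skipT\<close>, which swallow the further vertices and leave \<open>S\<close> alone.\<close>

definition ringT :: "nat \<Rightarrow> nat list \<Rightarrow> nat \<Rightarrow> nat set" where
  "ringT a S i = {a + 2 * i, a + 2 * i + 1, S ! i}"

definition skipT :: "nat \<Rightarrow> nat list \<Rightarrow> nat \<Rightarrow> nat set" where
  "skipT a S i = {a + 2 * i + 1, if Suc i < length S then a + 2 * i + 2 else a, a + 2 * length S + i}"

definition restT :: "nat \<Rightarrow> nat list \<Rightarrow> nat \<Rightarrow> nat set" where
  "restT a S j = {a + 2 * length S + 3 * j, a + 2 * length S + 3 * j + 1, a + 2 * length S + 3 * j + 2}"

definition gadget :: "nat \<Rightarrow> nat list \<Rightarrow> nat set set" where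
  "gadget a S = ringT a S ` {..<length S} \<union> skipT a S ` {..<length S} \<union> restT a S ` {..<length S div 3}"

fun offsets :: "nat \<Rightarrow> nat list list \<Rightarrow> (nat \<times> nat list) list" where
  "offsets a [] = []"
| "offsets a (S # Ss) = (a, S) # offsets (a + 3 * length S) Ss"

fun end_offset :: "nat \<Rightarrow> nat list list \<Rightarrow> nat" where
  "end_offset a [] = a"
| "end_offset a (S # Ss) = end_offset (a + 3 * length S) Ss"

definition triples :: "nat \<Rightarrow> nat list list \<Rightarrow> nat set set" where
  "triples a Ss = (\<Union>(o', S)\<in>set (offsets a Ss). gadget o' S)"

text \<open>The recursion either skips or takes the head of the list. It follows the order in which
  the gadgets are laid out, so that both can be treated by one induction.\<close>

fun exact_cover :: "nat list list \<Rightarrow> nat set \<Rightarrow> bool" where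
  "exact_cover [] H \<longleftrightarrow> H = {}"
| "exact_cover (S # Ss) H \<longleftrightarrow> exact_cover Ss H \<or> set S \<subseteq> H \<and> exact_cover Ss (H - set S)"

text \<open>Divisibility by 3 allows \<open>restT\<close> to partition the further vertices of a
  gadget, and elements below \<open>N\<close> keep clear of gadgets placed from \<open>N\<close>
  on.\<close>

definition exact_cover_sets :: "nat \<Rightarrow> nat list list \<Rightarrow> bool" where
  "exact_cover_sets N Ss \<longleftrightarrow>
    (\<forall>S\<in>set Ss. distinct S \<and> set S \<subseteq> {..<N} \<and> S \<noteq> [] \<and> 3 dvd length S)"

lemma end_offset_ge: "a \<le> end_offset a Ss"
  by (induction Ss arbitrary: a) (simp_all, metis add_leD1)

lemma offsets_range:
  "(b, S) \<in> set (offsets a Ss) \<Longrightarrow> a \<le> b \<and> b + 3 * length S \<le> end_offset a Ss \<and> S \<in> set Ss"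
proof (induction Ss arbitrary: a)
  case (Cons S' Ss)
  then show ?case using end_offset_ge[of "a + 3 * length S'" Ss] by fastforce
qed simp

lemma offsets_disjoint:
  "(b, S) \<in> set (offsets a Ss) \<Longrightarrow> (b', S') \<in> set (offsets a Ss) \<Longrightarrow>
    (b, S) = (b', S') \<or> b + 3 * length S \<le> b' \<or> b' + 3 * length S' \<le> b"
proof (induction Ss arbitrary: a)
  case (Cons S0 Ss)
  then show ?case using offsets_range[of _ _ "a + 3 * length S0" Ss] by fastforce
qed simp

lemma gadget_subset: "T \<in> gadget a S \<Longrightarrow> 3 dvd length S \<Longrightarrow> T \<subseteq> {a..<a + 3 * length S} \<union> set S"
  by (auto simp: gadget_def ringT_def skipT_def restT_def elim!: dvdE)

lemma card_gadget:
  assumes "T \<in> gadget a S" "3 dvd length S" "S \<noteq> []" "set S \<subseteq> {..<a}"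
  shows "card T = 3"
proof -
  have s: "3 \<le> length S" using assms(2,3) dvd_imp_le[of 3 "length S"] by simp
  have h: "i < length S \<Longrightarrow> S ! i < a" for i using assms(4) nth_mem by fastforce
  from assms(1) show ?thesis unfolding gadget_def
  proof (elim UnE imageE)
    fix i assume "T = ringT a S i" "i \<in> {..<length S}"
    then show ?thesis using h[of i] by (simp add: ringT_def card_insert_if)
  next
    fix i assume "T = skipT a S i" "i \<in> {..<length S}"
    then show ?thesis using s by (simp add: skipT_def card_insert_if)
  qed (simp add: restT_def card_insert_if)
qed

text \<open>The vertex \<open>a + 2 * i + 1\<close> lies in both \<open>ringT\<close> and
  \<open>skipT\<close> with index \<open>i\<close>, so at most one of them is chosen. The vertex
  \<open>a + 2 * (i + 1)\<close> can be covered only by \<open>ringT\<close> with index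
  \<open>i + 1\<close> or by \<open>skipT\<close> with index \<open>i\<close>. So
  \<open>ringT\<close> propagates forwards from index 0; if it is missing there,
  \<open>skipT\<close> is chosen at the last index and propagates backwards.\<close>

lemma gadget_cover_cases:
  assumes P: "P \<subseteq> gadget a S" "disjoint P" "{a..<a + 3 * length S} \<subseteq> \<Union>P"
    and S: "3 dvd length S" "S \<noteq> []" "set S \<subseteq> {..<a}"
  shows "\<Union>P = {a..<a + 3 * length S} \<or> \<Union>P = {a..<a + 3 * length S} \<union> set S"
proof -
  define s where "s = length S"
  have s: "3 \<le> s" using S(1,2) dvd_imp_le[of 3 "length S"] by (simp add: s_def)
  have h: "i < s \<Longrightarrow> S ! i < a" for i using S(3) nth_mem by (fastforce simp: s_def)
  have dis: "T = T'" if "T \<in> P" "T' \<in> P" "x \<in> T" "x \<in> T'" for T T' x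
    using P(2) that unfolding disjoint_def by blast
  have form: "(\<exists>i<s. T = ringT a S i) \<or> (\<exists>i<s. T = skipT a S i) \<or> (\<exists>j. 3 * j < s \<and> T = restT a S j)"
    if "T \<in> P" for T
  proof -
    have "T \<in> gadget a S" using P(1) that by blast
    then show ?thesis using S(1) by (fastforce simp: gadget_def s_def elim!: dvdE)
  qed
  have cov: "\<exists>T\<in>P. x \<in> T" if "a \<le> x" "x < a + 3 * s" for x using P(3) that by (auto simp: s_def)
  have even: "ringT a S (Suc i) \<in> P \<or> skipT a S i \<in> P" if i: "Suc i < s" for i
  proof -
    obtain T where T: "T \<in> P" "a + 2 * Suc i \<in> T" using cov[of "a + 2 * Suc i"] i by auto
    from form[OF T(1)] show ?thesis
    proof (elim disjE exE conjE)
      fix i' assume i': "i' < s" "T = ringT a S i'"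
      have "i' = Suc i" using T(2) i' h[of i'] by (auto simp: ringT_def; presburger)
      then show ?thesis using T i' by simp
    next
      fix i' assume i': "i' < s" "T = skipT a S i'"
      have "i' = i" using T(2) i' i by (auto simp: skipT_def s_def split: if_splits; presburger)
      then show ?thesis using T i' by simp
    next
      fix j assume "3 * j < s" "T = restT a S j"
      then show ?thesis using T i by (auto simp: restT_def s_def)
    qed
  qed
  have first: "ringT a S 0 \<in> P \<or> skipT a S (s - 1) \<in> P"
  proof -
    obtain T where T: "T \<in> P" "a \<in> T" using cov[of a] s by auto
    from form[OF T(1)] show ?thesis
    proof (elim disjE exE conjE)
      fix i' assume i': "i' < s" "T = ringT a S i'"
      have "i' = 0" using T(2) i' h[of i'] by (auto simp: ringT_def)
      then show ?thesis using T i' by simp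
    next
      fix i' assume i': "i' < s" "T = skipT a S i'"
      then have "i' = s - 1" using T by (auto simp: skipT_def s_def split: if_splits)
      then show ?thesis using T i' by simp
    next
      fix j assume "3 * j < s" "T = restT a S j"
      then show ?thesis using T s by (auto simp: restT_def s_def)
    qed
  qed
  have neq: "ringT a S i \<noteq> skipT a S i" if "i < s" for i
  proof
    assume "ringT a S i = skipT a S i"
    then have "a + 2 * s + i \<in> ringT a S i" by (auto simp: skipT_def s_def)
    then show False using h[OF that] that by (auto simp: ringT_def)
  qed
  have excl: "\<not> (ringT a S i \<in> P \<and> skipT a S i \<in> P)" if "i < s" for i
    using dis[of "ringT a S i" "skipT a S i" "a + 2 * i + 1"] neq[OF that] by (auto simp: ringT_def skipT_def)
  have sub: "\<Union>P \<subseteq> {a..<a + 3 * length S} \<union> set S"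
    using P(1) gadget_subset[OF _ S(1)] by blast
  show ?thesis
  proof (cases "ringT a S 0 \<in> P")
    case True
    have ring: "i < s \<Longrightarrow> ringT a S i \<in> P" for i
    proof (induction i)
      case (Suc i)
      then show ?case using even[of i] excl[of i] by auto
    qed (use True in simp)
    have "set S \<subseteq> \<Union>P"
    proof
      fix x assume "x \<in> set S"
      then obtain i where "i < s" "x = S ! i" by (auto simp: in_set_conv_nth s_def)
      then show "x \<in> \<Union>P" using ring[of i] by (intro UnionI[of "ringT a S i"]) (auto simp: ringT_def)
    qed
    then show ?thesis using sub P(3) by auto
  next
    case False
    have skip': "i < s \<Longrightarrow> skipT a S (s - 1 - i) \<in> P" for i
    proof (induction i)
      case (Suc i)
      then have "skipT a S (s - 1 - i) \<in> P" by simp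
      moreover have "s - 1 - i = Suc (s - 1 - Suc i)" using Suc.prems by simp
      ultimately show ?case
        using even[of "s - 1 - Suc i"] excl[of "s - 1 - i"] Suc.prems by auto
    qed (use False first in simp)
    have skip: "skipT a S i \<in> P" if "i < s" for i
    proof -
      have "s - 1 - (s - 1 - i) = i" "s - 1 - i < s" using that by auto
      then show ?thesis using skip'[of "s - 1 - i"] by simp
    qed
    have "x \<notin> set S" if T: "T \<in> P" "x \<in> T" for x T
    proof
      assume x: "x \<in> set S"
      then have xa: "x < a" using S(3) by auto
      from form[OF T(1)] show False
      proof (elim disjE exE conjE)
        fix i assume "i < s" "T = ringT a S i"
        then show ?thesis using T(1) excl[of i] skip[of i] by simp
      next
        fix i assume "T = skipT a S i"
        then show ?thesis using T(2) xa by (simp add: skipT_def split: if_splits)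
      next
        fix j assume "T = restT a S j"
        then show ?thesis using T(2) xa by (simp add: restT_def)
      qed
    qed
    then have "\<Union>P \<inter> set S = {}" by blast
    then show ?thesis using sub P(3) by blast
  qed
qed

lemma disjoint_imageI:
  assumes "\<And>i j. i \<in> I \<Longrightarrow> j \<in> I \<Longrightarrow> i \<noteq> j \<Longrightarrow> f i \<inter> f j = {}"
  shows "disjoint (f ` I)"
  unfolding disjoint_def
proof (intro ballI impI)
  fix x y assume "x \<in> f ` I" "y \<in> f ` I" "x \<noteq> y"
  then obtain i j where "i \<in> I" "j \<in> I" "x = f i" "y = f j" "i \<noteq> j" by blast
  then show "x \<inter> y = {}" using assms by simp
qed

lemma skipT_cover:
  assumes "S \<noteq> []"
  shows "disjoint (skipT a S ` {..<length S})" "\<Union>(skipT a S ` {..<length S}) = {a..<a + 3 * length S}"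
proof -
  have "skipT a S i \<inter> skipT a S j = {}" if "i < length S" "j < length S" "i \<noteq> j" for i j
  proof (rule ccontr)
    assume "skipT a S i \<inter> skipT a S j \<noteq> {}"
    then obtain x where "x \<in> skipT a S i" "x \<in> skipT a S j" by blast
    with that show False unfolding skipT_def by (auto split: if_splits; presburger)
  qed
  then show "disjoint (skipT a S ` {..<length S})" by (intro disjoint_imageI) simp
  show "\<Union>(skipT a S ` {..<length S}) = {a..<a + 3 * length S}"
  proof
    show "{a..<a + 3 * length S} \<subseteq> \<Union>(skipT a S ` {..<length S})"
    proof
      fix x assume x: "x \<in> {a..<a + 3 * length S}"
      define k where "k = x - a"
      have k: "x = a + k" "k < 3 * length S" using x by (auto simp: k_def)
      have "\<exists>i<length S. x \<in> skipT a S i"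
      proof (cases "k < 2 * length S")
        case True
        show ?thesis
        proof (cases "odd k")
          case odd: True
          then show ?thesis using True k(1)
            by (intro exI[of _ "k div 2"]) (auto simp: skipT_def)
        next
          case even: False
          show ?thesis
          proof (cases "k = 0")
            case True
            then show ?thesis using k assms by (intro exI[of _ "length S - 1"]) (auto simp: skipT_def)
          next
            case False
            with even obtain i where "k = 2 * i + 2" by (metis evenE mult_Suc_right add.commute not0_implies_Suc mult_0_right)
            then show ?thesis using k True by (intro exI[of _ i]) (auto simp: skipT_def)
          qed
        qed
      next
        case False
        then show ?thesis using k by (intro exI[of _ "k - 2 * length S"]) (auto simp: skipT_def)
      qed
      then show "x \<in> \<Union>(skipT a S ` {..<length S})" by blast
    qed
  qed (use assms in \<open>auto simp: skipT_def\<close>)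
qed

lemma restT_index: "x \<in> restT a S i \<Longrightarrow> (x - (a + 2 * length S)) div 3 = i"
  by (auto simp: restT_def)

lemma ringT_cover:
  assumes "3 dvd length S" "distinct S" "set S \<subseteq> {..<a}"
  shows "disjoint (ringT a S ` {..<length S} \<union> restT a S ` {..<length S div 3})"
    "\<Union>(ringT a S ` {..<length S} \<union> restT a S ` {..<length S div 3}) = {a..<a + 3 * length S} \<union> set S"
proof -
  have h: "i < length S \<Longrightarrow> S ! i < a" for i using assms(3) nth_mem by fastforce
  have d: "i < length S \<Longrightarrow> j < length S \<Longrightarrow> S ! i = S ! j \<Longrightarrow> i = j" for i j
    using assms(2) nth_eq_iff_index_eq by blast
  have rr: "ringT a S i \<inter> ringT a S j = {}" if "i < length S" "j < length S" "i \<noteq> j" for i j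
    using that h[of i] h[of j] d[of i j] by (auto simp: ringT_def; presburger)
  have rz: "ringT a S i \<inter> restT a S j = {}" if "i < length S" for i j
    using that h[of i] by (auto simp: ringT_def restT_def)
  have zz: "restT a S i \<inter> restT a S j = {}" if "i \<noteq> j" for i j
  proof (rule ccontr)
    assume "restT a S i \<inter> restT a S j \<noteq> {}"
    then obtain x where "x \<in> restT a S i" "x \<in> restT a S j" by blast
    from restT_index[OF this(1)] restT_index[OF this(2)] have "i = j" by (rule trans[OF sym])
    with that show False ..
  qed
  show "disjoint (ringT a S ` {..<length S} \<union> restT a S ` {..<length S div 3})"
  proof (rule disjoint_union)
    show "disjoint (ringT a S ` {..<length S})" "disjoint (restT a S ` {..<length S div 3})"
      by (rule disjoint_imageI, use rr zz in simp)+
    show "\<Union>(ringT a S ` {..<length S}) \<inter> \<Union>(restT a S ` {..<length S div 3}) = {}"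
      using rz by blast
  qed
  show "\<Union>(ringT a S ` {..<length S} \<union> restT a S ` {..<length S div 3}) = {a..<a + 3 * length S} \<union> set S"
  proof
    show "\<Union>(ringT a S ` {..<length S} \<union> restT a S ` {..<length S div 3}) \<subseteq> {a..<a + 3 * length S} \<union> set S"
      using assms(1) by (auto simp: ringT_def restT_def elim!: dvdE)
    show "{a..<a + 3 * length S} \<union> set S \<subseteq> \<Union>(ringT a S ` {..<length S} \<union> restT a S ` {..<length S div 3})"
    proof
      fix x assume "x \<in> {a..<a + 3 * length S} \<union> set S"
      then consider "x \<in> set S" | "a \<le> x" "x < a + 2 * length S"
        | "a + 2 * length S \<le> x" "x < a + 3 * length S" by force
      then show "x \<in> \<Union>(ringT a S ` {..<length S} \<union> restT a S ` {..<length S div 3})"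
      proof cases
        case 1
        then obtain i where "i < length S" "x = S ! i" by (auto simp: in_set_conv_nth)
        then show ?thesis by (auto simp: ringT_def)
      next
        case 2
        have "x = a + 2 * ((x - a) div 2) \<or> x = a + 2 * ((x - a) div 2) + 1"
          using 2 by presburger
        moreover have "(x - a) div 2 < length S" using 2 by linarith
        ultimately have "(x - a) div 2 < length S" "x \<in> ringT a S ((x - a) div 2)" by (auto simp: ringT_def)
        then show ?thesis by blast
      next
        case 3
        let ?j = "(x - a - 2 * length S) div 3"
        have "x = a + 2 * length S + 3 * ?j \<or> x = a + 2 * length S + 3 * ?j + 1 \<or> x = a + 2 * length S + 3 * ?j + 2"
        proof -
          obtain y where "x = a + 2 * length S + y" using 3(1) le_Suc_ex by blast
          then show ?thesis by simp presburger
        qed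
        moreover have "?j < length S div 3"
        proof -
          obtain k where "length S = 3 * k" using assms(1) ..
          then show ?thesis using 3 by simp
        qed
        ultimately show ?thesis by (intro UnionI[of "restT a S ?j"]) (auto simp: restT_def)
      qed
    qed
  qed
qed

lemma triples_Cons: "triples a (S # Ss) = gadget a S \<union> triples (a + 3 * length S) Ss"
  by (auto simp: triples_def)

lemma triples_subset:
  assumes "exact_cover_sets N Ss" "T \<in> triples a Ss"
  shows "T \<subseteq> {..<N} \<union> {a..<end_offset a Ss}"
proof -
  obtain b S where "(b, S) \<in> set (offsets a Ss)" "T \<in> gadget b S"
    using assms(2) by (auto simp: triples_def)
  then show ?thesis
    using offsets_range[of b S a Ss] gadget_subset[of T b S] assms(1)
    by (fastforce simp: exact_cover_sets_def)
qed

text \<open>The own vertices of the first gadget meet no other gadget, so its chosen triples cover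
  all of them and \<open>gadget_cover_cases\<close> applies. The other triples then face the same
  problem for \<open>H\<close> or for \<open>H - set S\<close>, which is why \<open>H\<close> is
  arbitrary in the induction.\<close>

lemma triples_cover_iff:
  assumes "exact_cover_sets N Ss" "N \<le> a" "H \<subseteq> {..<N}"
  shows "(\<exists>P\<subseteq>triples a Ss. disjoint P \<and> \<Union>P = H \<union> {a..<end_offset a Ss}) \<longleftrightarrow> exact_cover Ss H"
  using assms
proof (induction Ss arbitrary: a H)
  case Nil
  then show ?case by (auto simp: triples_def)
next
  case (Cons S Ss)
  let ?a = "a + 3 * length S"
  have Ha: "x \<in> H \<Longrightarrow> x < a" for x using Cons.prems(2,3) by auto
  have S: "distinct S" "set S \<subseteq> {..<N}" "S \<noteq> []" "3 dvd length S" "exact_cover_sets N Ss"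
    using Cons.prems(1) by (auto simp: exact_cover_sets_def)
  have Sa: "set S \<subseteq> {..<a}" using S(2) Cons.prems(2) by auto
  have e: "?a \<le> end_offset ?a Ss" by (rule end_offset_ge)
  have N: "N \<le> ?a" using Cons.prems(2) by simp
  note IH = Cons.IH[OF S(5) N]
  have Sa': "x \<in> set S \<Longrightarrow> x < a" for x using Sa by auto
  have tail: "\<Union>P \<subseteq> {..<N} \<union> {?a..<end_offset ?a Ss}" if "P \<subseteq> triples ?a Ss" for P
    using triples_subset[OF S(5)] that by blast
  show ?case
  proof
    assume "\<exists>P\<subseteq>triples a (S # Ss). disjoint P \<and> \<Union>P = H \<union> {a..<end_offset a (S # Ss)}"
    then obtain P where P: "P \<subseteq> gadget a S \<union> triples ?a Ss" "disjoint P" "\<Union>P = H \<union> {a..<end_offset ?a Ss}"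
      by (auto simp: triples_Cons)
    define P1 where "P1 = P \<inter> gadget a S"
    define P2 where "P2 = P - gadget a S"
    have P12: "\<Union>P = \<Union>P1 \<union> \<Union>P2" "P2 \<subseteq> triples ?a Ss" "P1 \<subseteq> P" "P2 \<subseteq> P" "P1 \<inter> P2 = {}"
      using P(1) by (auto simp: P1_def P2_def)
    have dj: "disjoint P1" "disjoint P2" using P(2) P12(3,4) pairwise_subset by blast+
    have disj: "\<Union>P1 \<inter> \<Union>P2 = {}"
    proof (rule ccontr)
      assume "\<Union>P1 \<inter> \<Union>P2 \<noteq> {}"
      then obtain A B where AB: "A \<in> P1" "B \<in> P2" "A \<inter> B \<noteq> {}" by blast
      then have "A = B" using P(2) P12(3,4) unfolding disjoint_def by blast
      then show False using AB P12(5) by blast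
    qed
    have P2: "\<Union>P2 = \<Union>P - \<Union>P1" using P12(1) disj by blast
    have "y \<notin> {a..<?a}" if "y \<in> \<Union>P2" for y
      using subsetD[OF tail[OF P12(2)] that] Cons.prems(2) by auto
    then have "{a..<?a} \<inter> \<Union>P2 = {}" by blast
    moreover have "{a..<?a} \<subseteq> \<Union>P" unfolding P(3) using e by auto
    ultimately have c: "{a..<?a} \<subseteq> \<Union>P1" using P12(1) by blast
    from gadget_cover_cases[OF _ dj(1) c S(4,3) Sa]
    consider "\<Union>P1 = {a..<?a}" | "\<Union>P1 = {a..<?a} \<union> set S" by (auto simp: P1_def)
    then show "exact_cover (S # Ss) H"
    proof cases
      case 1
      then have "\<Union>P2 = H \<union> {?a..<end_offset ?a Ss}"
        unfolding P2 P(3) using e by (auto dest: Ha)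
      then have "exact_cover Ss H" using IH[OF Cons.prems(3)] dj(2) P12(2) by blast
      then show ?thesis by simp
    next
      case 2
      have "set S \<subseteq> \<Union>P" using 2 P12(1) by blast
      then have sub: "set S \<subseteq> H" unfolding P(3) using Sa' by (meson UnE atLeastLessThan_iff leD subset_iff)
      have "\<Union>P2 = (H - set S) \<union> {?a..<end_offset ?a Ss}"
        unfolding P2 P(3) 2 using e by (auto dest: Ha Sa')
      moreover have "H - set S \<subseteq> {..<N}" using Cons.prems(3) by auto
      ultimately have "exact_cover Ss (H - set S)" using IH dj(2) P12(2) by blast
      then show ?thesis using sub by simp
    qed
  next
    assume "exact_cover (S # Ss) H"
    then consider "exact_cover Ss H" | "set S \<subseteq> H" "exact_cover Ss (H - set S)" by auto
    then show "\<exists>P\<subseteq>triples a (S # Ss). disjoint P \<and> \<Union>P = H \<union> {a..<end_offset a (S # Ss)}"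
    proof cases
      case 1
      then obtain P2 where P2: "P2 \<subseteq> triples ?a Ss" "disjoint P2" "\<Union>P2 = H \<union> {?a..<end_offset ?a Ss}"
        using IH[OF Cons.prems(3)] by blast
      let ?P1 = "skipT a S ` {..<length S}"
      have "\<Union>?P1 \<inter> \<Union>P2 = {}"
        unfolding skipT_cover(2)[OF S(3)] P2(3) by (auto dest: Ha)
      then have "disjoint (?P1 \<union> P2)" by (rule disjoint_union[OF skipT_cover(1)[OF S(3)] P2(2)])
      moreover have "\<Union>(?P1 \<union> P2) = H \<union> {a..<end_offset ?a Ss}"
        unfolding Union_Un_distrib skipT_cover(2)[OF S(3)] P2(3) using e by auto
      moreover have "?P1 \<union> P2 \<subseteq> triples a (S # Ss)" using P2(1) by (auto simp: triples_Cons gadget_def)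
      ultimately show ?thesis by (intro exI[of _ "?P1 \<union> P2"]) simp
    next
      case 2
      have H: "H - set S \<subseteq> {..<N}" using Cons.prems(3) by auto
      obtain P2 where P2: "P2 \<subseteq> triples ?a Ss" "disjoint P2" "\<Union>P2 = (H - set S) \<union> {?a..<end_offset ?a Ss}"
        using IH[OF H] 2(2) by blast
      let ?P1 = "ringT a S ` {..<length S} \<union> restT a S ` {..<length S div 3}"
      note c = ringT_cover[OF S(4,1) Sa]
      have "\<Union>?P1 \<inter> \<Union>P2 = {}"
        unfolding c(2) P2(3) by (auto dest: Ha Sa')
      then have "disjoint (?P1 \<union> P2)" by (rule disjoint_union[OF c(1) P2(2)])
      moreover have "\<Union>(?P1 \<union> P2) = H \<union> {a..<end_offset ?a Ss}"
        unfolding Union_Un_distrib[of ?P1 P2] c(2) P2(3) using e 2(1) by auto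
      moreover have "?P1 \<union> P2 \<subseteq> triples a (S # Ss)" using P2(1) by (auto simp: triples_Cons gadget_def)
      ultimately show ?thesis by (intro exI[of _ "?P1 \<union> P2"]) simp
    qed
  qed
qed

section \<open>The graph has no triangles other than the triples\<close>

definition edges_of :: "'a set set \<Rightarrow> 'a set set" where
  "edges_of \<T> = {e. card e = 2 \<and> (\<exists>T\<in>\<T>. e \<subseteq> T)}"

lemma gadget_meet_same:
  assumes "T \<in> gadget b S" "T' \<in> gadget b' S'" "x \<in> T" "x \<in> T'" "N \<le> x"
    "(b, S) \<in> set (offsets a Ss)" "(b', S') \<in> set (offsets a Ss)" "exact_cover_sets N Ss"
  shows "b = b' \<and> S = S'"
proof -
  have S: "3 dvd length S" "set S \<subseteq> {..<N}" "3 dvd length S'" "set S' \<subseteq> {..<N}"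
    using assms(6-8) offsets_range unfolding exact_cover_sets_def by blast+
  have "x \<in> {b..<b + 3 * length S}" "x \<in> {b'..<b' + 3 * length S'}"
    using gadget_subset[OF assms(1) S(1)] gadget_subset[OF assms(2) S(3)] assms(3-5) S(2,4) by force+
  then show ?thesis using offsets_disjoint[OF assms(6,7)] by auto
qed

lemma gadget_cases:
  assumes "T \<in> gadget b S"
  obtains (ring) i where "i < length S" "T = ringT b S i"
  | (skip) i where "i < length S" "T = skipT b S i"
  | (rest) j where "j < length S div 3" "T = restT b S j"
  using assms unfolding gadget_def by blast

lemma skipT_disjoint:
  assumes "i < length S" "j < length S" "i \<noteq> j"
  shows "skipT a S i \<inter> skipT a S j = {}"
proof (rule ccontr)
  assume "skipT a S i \<inter> skipT a S j \<noteq> {}"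
  then obtain x where "x \<in> skipT a S i" "x \<in> skipT a S j" by blast
  with assms show False unfolding skipT_def by (auto split: if_splits; presburger)
qed

lemma ringT_index: "x \<in> ringT a S i \<Longrightarrow> S ! i < a \<Longrightarrow> a \<le> x \<Longrightarrow> (x - a) div 2 = i \<and> x < a + 2 * i + 2"
  by (auto simp: ringT_def)

text \<open>A triangle that is not a triple needs three triples that meet pairwise in different points.
  Of two triples that meet at or above \<open>N\<close> exactly one is a \<open>skipT\<close>, and they belong to the same
  gadget; two triples that meet below \<open>N\<close> are \<open>ringT\<close> triples of different gadgets.\<close>

lemma gadget_meet_high:
  assumes T: "T \<in> gadget b S" "T' \<in> gadget b S" "T \<noteq> T'" "x \<in> T" "x \<in> T'" "b \<le> x"
    and S: "3 dvd length S" "set S \<subseteq> {..<b}"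
  shows "T \<in> skipT b S ` {..<length S} \<longleftrightarrow> T' \<notin> skipT b S ` {..<length S}"
proof -
  have h: "i < length S \<Longrightarrow> S ! i < b" for i using S(2) nth_mem by fastforce
  have "\<not> (T \<in> skipT b S ` {..<length S} \<and> T' \<in> skipT b S ` {..<length S})"
  proof
    assume "T \<in> skipT b S ` {..<length S} \<and> T' \<in> skipT b S ` {..<length S}"
    then obtain i j where "i < length S" "j < length S" "T = skipT b S i" "T' = skipT b S j" by blast
    then show False using skipT_disjoint[of i S j b] T(3-5) by auto
  qed
  moreover have "False" if no: "T \<notin> skipT b S ` {..<length S}" "T' \<notin> skipT b S ` {..<length S}"
  proof -
    have ring: "x < b + 2 * length S" if "i < length S" "x \<in> ringT b S i" for i
      using ringT_index[OF that(2) h[OF that(1)] T(6)] that(1) by linarith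
    have rest: "b + 2 * length S \<le> x" if "x \<in> restT b S j" for j
      using that by (auto simp: restT_def)
    from T(1) show False
    proof (cases rule: gadget_cases)
      case (ring i)
      from T(2) show False
      proof (cases rule: gadget_cases)
        case (ring j)
        have "i = j" using ringT_index[OF _ h T(6)] T(4,5) \<open>i < length S\<close> \<open>T = ringT b S i\<close> ring by metis
        then show ?thesis using T(3) \<open>T = ringT b S i\<close> ring by simp
      next
        case (rest j)
        then show ?thesis using \<open>\<And>i. i < length S \<Longrightarrow> x \<in> ringT b S i \<Longrightarrow> x < b + 2 * length S\<close>[of i]
            \<open>\<And>j. x \<in> restT b S j \<Longrightarrow> b + 2 * length S \<le> x\<close>[of j] T(4,5) ring by simp
      qed (use no in auto)
    next
      case (rest i)
      from T(2) show False
      proof (cases rule: gadget_cases)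
        case (ring j)
        then show ?thesis using \<open>\<And>i. i < length S \<Longrightarrow> x \<in> ringT b S i \<Longrightarrow> x < b + 2 * length S\<close>[of j]
            \<open>\<And>j. x \<in> restT b S j \<Longrightarrow> b + 2 * length S \<le> x\<close>[of i] T(4,5) rest by simp
      next
        case (rest j)
        have "i = j" using restT_index T(4,5) \<open>T = restT b S i\<close> rest(2) by metis
        then show ?thesis using T(3) \<open>T = restT b S i\<close> rest by simp
      qed (use no in auto)
    qed (use no in auto)
  qed
  ultimately show ?thesis by blast
qed

lemma gadget_low:
  assumes "T \<in> gadget b S" "x \<in> T" "x < b"
  obtains i where "i < length S" "T = ringT b S i" "x = S ! i"
  using assms(1)
proof (cases rule: gadget_cases)
  case (ring i)
  then show ?thesis using assms(2,3) that[of i] by (auto simp: ringT_def)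
qed (use assms(2,3) in \<open>auto simp: skipT_def restT_def split: if_splits\<close>)

lemma triples_no_spurious:
  assumes X: "exact_cover_sets N Ss" "N \<le> a"
    and T: "A \<in> triples a Ss" "B \<in> triples a Ss" "C \<in> triples a Ss"
    and xyz: "x \<in> A" "y \<in> A" "y \<in> B" "z \<in> B" "x \<in> C" "z \<in> C" "x \<noteq> y" "y \<noteq> z" "x \<noteq> z"
  shows "A = B \<or> B = C \<or> A = C"
proof (rule ccontr)
  assume ne: "\<not> (A = B \<or> B = C \<or> A = C)"
  have off: "N \<le> b" "set S \<subseteq> {..<N}" "set S \<subseteq> {..<b}" "distinct S" "3 dvd length S"
    if "(b, S) \<in> set (offsets a Ss)" for b S
    using offsets_range[OF that] X unfolding exact_cover_sets_def by fastforce+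
  have obt: "\<exists>b S. (b, S) \<in> set (offsets a Ss) \<and> T \<in> gadget b S" if "T \<in> triples a Ss" for T
    using that unfolding triples_def by blast
  have low_low: "w = w'" if t: "T \<in> triples a Ss" "w \<in> T" "w' \<in> T" "w < N" "w' < N" for T w w'
  proof -
    obtain b S where b: "(b, S) \<in> set (offsets a Ss)" "T \<in> gadget b S" using obt[OF t(1)] by blast
    have "w < b" "w' < b" using t(4,5) off(1)[OF b(1)] by auto
    obtain i where i: "i < length S" "T = ringT b S i" "w = S ! i"
      by (rule gadget_low[OF b(2) t(2) \<open>w < b\<close>])
    then show ?thesis using t(3) \<open>w' < b\<close> by (auto simp: ringT_def)
  qed
  \<comment> \<open>A triple has at most one point below \<open>N\<close>, so the other two meeting
    points are at or above \<open>N\<close> and put \<open>A\<close> and \<open>B\<close> into the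
    gadget of \<open>C\<close>. There two different \<open>ringT\<close> triples cannot share an
    element, as the list is distinct.\<close>
  have no_low: False
    if T: "A \<in> triples a Ss" "B \<in> triples a Ss" "C \<in> triples a Ss" "A \<noteq> B"
      and m: "y \<in> A" "y \<in> B" "y < N" "z \<in> B" "z \<in> C" "x \<in> A" "x \<in> C" "z \<noteq> y" "x \<noteq> y" for A B C x y z
  proof -
    have xz: "N \<le> x" "N \<le> z" using low_low[OF T(1), of x y] low_low[OF T(2), of z y] m by force+
    obtain b S where b: "(b, S) \<in> set (offsets a Ss)" "C \<in> gadget b S" using obt[OF T(3)] by blast
    obtain b1 S1 where b1: "(b1, S1) \<in> set (offsets a Ss)" "A \<in> gadget b1 S1" using obt[OF T(1)] by blast
    obtain b2 S2 where b2: "(b2, S2) \<in> set (offsets a Ss)" "B \<in> gadget b2 S2" using obt[OF T(2)] by blast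
    have "b1 = b \<and> S1 = S" by (rule gadget_meet_same[OF b1(2) b(2) m(6,7) xz(1) b1(1) b(1) X(1)])
    moreover have "b2 = b \<and> S2 = S" by (rule gadget_meet_same[OF b2(2) b(2) m(4,5) xz(2) b2(1) b(1) X(1)])
    ultimately have AB: "A \<in> gadget b S" "B \<in> gadget b S" using b1 b2 by simp_all
    have "y < b" using m(3) off(1)[OF b(1)] by simp
    obtain i where i: "i < length S" "A = ringT b S i" "y = S ! i"
      by (rule gadget_low[OF AB(1) m(1) \<open>y < b\<close>])
    obtain j where j: "j < length S" "B = ringT b S j" "y = S ! j"
      by (rule gadget_low[OF AB(2) m(2) \<open>y < b\<close>])
    have "i = j" using i j off(4)[OF b(1)] nth_eq_iff_index_eq by metis
    then show False using i j T(4) by simp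
  qed
  \<comment> \<open>Among three different triples that meet pairwise at or above \<open>N\<close>,
    any two would differ in \<open>sk\<close>; two truth values do not suffice for three
    triples.\<close>
  define sk where "sk T \<longleftrightarrow> (\<exists>b S. (b, S) \<in> set (offsets a Ss) \<and> T \<in> skipT b S ` {..<length S})" for T
  have high: "sk T \<noteq> sk T'"
    if t: "T \<in> triples a Ss" "T' \<in> triples a Ss" "T \<noteq> T'" "w \<in> T" "w \<in> T'" "N \<le> w" for T T' w
  proof -
    obtain b S where b: "(b, S) \<in> set (offsets a Ss)" "T \<in> gadget b S" using obt[OF t(1)] by blast
    obtain b' S' where b': "(b', S') \<in> set (offsets a Ss)" "T' \<in> gadget b' S'" using obt[OF t(2)] by blast
    have "b' = b \<and> S' = S" by (rule gadget_meet_same[OF b'(2) b(2) t(5,4,6) b'(1) b(1) X(1)])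
    then have T': "T' \<in> gadget b S" using b' by simp
    have "b \<le> w" using gadget_subset[OF b(2) off(5)[OF b(1)]] off(2)[OF b(1)] t(4,6) by force
    have eq: "sk T0 \<longleftrightarrow> T0 \<in> skipT b S ` {..<length S}" if T0: "T0 \<in> gadget b S" "w \<in> T0" for T0
    proof
      assume "sk T0"
      then obtain c R where c: "(c, R) \<in> set (offsets a Ss)" "T0 \<in> skipT c R ` {..<length R}"
        unfolding sk_def by blast
      then have "T0 \<in> gadget c R" by (auto simp: gadget_def)
      then have "c = b \<and> R = S"
        by (rule gadget_meet_same[OF _ T0(1) T0(2) T0(2) \<open>N \<le> w\<close> c(1) b(1) X(1)])
      then show "T0 \<in> skipT b S ` {..<length S}" using c by simp
    qed (use b(1) in \<open>auto simp: sk_def\<close>)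
    show ?thesis
      using gadget_meet_high[OF b(2) T' t(3-5) \<open>b \<le> w\<close> off(5,3)[OF b(1)]] eq[OF b(2) t(4)] eq[OF T' t(5)]
      by blast
  qed
  have "\<not> y < N" using no_low[OF T(1-3) _ xyz(2,3) _ xyz(4,6,1,5)] ne xyz(7-9) by blast
  moreover have "\<not> z < N" using no_low[OF T(2,3,1) _ xyz(4,6) _ xyz(5,1,3,2)] ne xyz(7-9) by blast
  moreover have "\<not> x < N" using no_low[OF T(3,1,2) _ xyz(5,1) _ xyz(2,3,6,4)] ne xyz(7-9) by blast
  ultimately have "N \<le> x" "N \<le> y" "N \<le> z" by simp_all
  then show False using high[OF T(1,2), of y] high[OF T(2,3), of z] high[OF T(1,3), of x] ne xyz by blast
qed

text \<open>Each edge of the triangle lies in a triple. By \<open>triples_no_spurious\<close> two of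
  the three edges share a triple; it contains all three vertices and has no others.\<close>

lemma triangles_of_triples:
  assumes X: "exact_cover_sets N Ss" "N \<le> a" and T: "card T = 3" "\<forall>u\<in>T. \<forall>v\<in>T. u \<noteq> v \<longrightarrow> {u, v} \<in> edges_of (triples a Ss)"
  shows "T \<in> triples a Ss"
proof -
  obtain x y z where xyz: "T = {x, y, z}" "x \<noteq> y" "x \<noteq> z" "y \<noteq> z"
    using T(1) by (auto simp: card_3_iff)
  have "\<exists>A\<in>triples a Ss. {u, v} \<subseteq> A" if "u \<in> T" "v \<in> T" "u \<noteq> v" for u v
    using T(2) that unfolding edges_of_def by blast
  then obtain A B C where ABC: "A \<in> triples a Ss" "B \<in> triples a Ss" "C \<in> triples a Ss"
    "{x, y} \<subseteq> A" "{y, z} \<subseteq> B" "{x, z} \<subseteq> C" using xyz by (metis insertCI)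
  have c3: "card D = 3" if "D \<in> triples a Ss" for D
  proof -
    obtain b S where b: "(b, S) \<in> set (offsets a Ss)" "D \<in> gadget b S" using \<open>D \<in> triples a Ss\<close> unfolding triples_def by blast
    then show ?thesis using offsets_range[OF b(1)] X
      by (intro card_gadget[OF b(2)]) (auto simp: exact_cover_sets_def dest!: bspec)
  qed
  have "T = D" if "D \<in> triples a Ss" "T \<subseteq> D" for D
    using card_subset_eq[OF _ that(2)] c3[OF that(1)] T(1) by (metis card.infinite zero_neq_numeral)
  moreover have "A = B \<or> B = C \<or> A = C"
    by (rule triples_no_spurious[OF X ABC(1-3), of x y z]) (use ABC xyz in auto)
  ultimately show ?thesis using ABC xyz(1) by blast
qed

lemma card_triples:
  assumes "exact_cover_sets N Ss" "N \<le> a" "T \<in> triples a Ss"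
  shows "card T = 3"
proof -
  obtain b S where b: "(b, S) \<in> set (offsets a Ss)" "T \<in> gadget b S"
    using assms(3) unfolding triples_def by blast
  then show ?thesis using offsets_range[OF b(1)] assms(1,2)
    by (intro card_gadget[OF b(2)]) (auto simp: exact_cover_sets_def dest!: bspec)
qed

lemma triple_graph_partition_iff:
  assumes X: "exact_cover_sets N Ss"
  shows "has_triangle_partition {..<end_offset N Ss} (edges_of (triples N Ss)) \<longleftrightarrow> exact_cover Ss {..<N}"
proof -
  let ?V = "{..<end_offset N Ss}"
  have V: "{..<N} \<union> {N..<end_offset N Ss} = ?V" using end_offset_ge[of N Ss] by auto
  have tri: "triangle ?V (edges_of (triples N Ss)) T \<longleftrightarrow> T \<in> triples N Ss" for T
  proof
    assume "triangle ?V (edges_of (triples N Ss)) T"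
    then show "T \<in> triples N Ss"
      using triangles_of_triples[OF X order_refl] by (auto simp: triangle_def)
  next
    assume T: "T \<in> triples N Ss"
    then have "T \<subseteq> ?V" using triples_subset[OF X T] V by simp
    then show "triangle ?V (edges_of (triples N Ss)) T"
      using T card_triples[OF X order_refl T] by (auto simp: triangle_def edges_of_def)
  qed
  have "has_triangle_partition ?V (edges_of (triples N Ss)) \<longleftrightarrow>
      (\<exists>P\<subseteq>triples N Ss. disjoint P \<and> \<Union>P = ?V)"
  proof
    assume "has_triangle_partition ?V (edges_of (triples N Ss))"
    then show "\<exists>P\<subseteq>triples N Ss. disjoint P \<and> \<Union>P = ?V"
      unfolding has_triangle_partition_def tri partition_on_def by blast
  next
    assume "\<exists>P\<subseteq>triples N Ss. disjoint P \<and> \<Union>P = ?V"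
    then obtain P where P: "P \<subseteq> triples N Ss" "disjoint P" "\<Union>P = ?V" by blast
    have "{} \<notin> P"
    proof
      assume "{} \<in> P"
      then show False using card_triples[OF X order_refl, of "{}"] P(1) by auto
    qed
    then show "has_triangle_partition ?V (edges_of (triples N Ss))"
      unfolding has_triangle_partition_def tri partition_on_def using P by blast
  qed
  also have "\<dots> \<longleftrightarrow> exact_cover Ss {..<N}"
    using triples_cover_iff[OF X order_refl order_refl] unfolding V .
  finally show ?thesis .
qed

lemma triple_graph_simple:
  assumes "exact_cover_sets N Ss"
  shows "simple_graph {..<end_offset N Ss} (edges_of (triples N Ss))"
proof -
  have "T \<subseteq> {..<end_offset N Ss}" if "T \<in> triples N Ss" for T
    using triples_subset[OF assms that] end_offset_ge[of N Ss] by auto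
  then show ?thesis unfolding simple_graph_def edges_of_def by blast
qed

text \<open>An edge at an own vertex of a gadget leads to another own vertex of that gadget or to an
  element of its set. So a component outside the hub stays within the \<open>3 * length S\<close>
  own vertices of one gadget and sees only \<open>set S\<close>.\<close>

lemma triple_graph_hub:
  assumes X: "exact_cover_sets N Ss" and r: "\<forall>S\<in>set Ss. length S \<le> r"
  shows "is_hub (3 * r) r {..<end_offset N Ss} (edges_of (triples N Ss)) {..<N}"
  unfolding is_hub_def
proof (intro conjI ballI)
  show "{..<N} \<subseteq> {..<end_offset N Ss}" using end_offset_ge[of N Ss] by auto
  let ?E = "edges_of (triples N Ss)"
  let ?E' = "{e \<in> ?E. e \<inter> {..<N} = {}}"
  have off: "3 dvd length S" "set S \<subseteq> {..<N}" "length S \<le> r" if "(b, S) \<in> set (offsets N Ss)" for b S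
    using offsets_range[OF that] X r unfolding exact_cover_sets_def by blast+
  have edge: "w \<in> {b..<b + 3 * length S} \<union> set S"
    if g: "(b, S) \<in> set (offsets N Ss)" and v: "v \<in> {b..<b + 3 * length S}" and e: "{v, w} \<in> ?E" for b S v w
  proof -
    obtain T where T: "T \<in> triples N Ss" "v \<in> T" "w \<in> T" using e unfolding edges_of_def by blast
    then obtain b' S' where b': "(b', S') \<in> set (offsets N Ss)" "T \<in> gadget b' S'"
      unfolding triples_def by blast
    have "N \<le> b" using offsets_range[OF g] by simp
    then have "v \<in> {b'..<b' + 3 * length S'}"
      using gadget_subset[OF b'(2) off(1)[OF b'(1)]] T(2) v off(2)[OF b'(1)] by force
    then have "(b', S') = (b, S)" using offsets_disjoint[OF g b'(1)] v by auto
    then show ?thesis using gadget_subset[OF b'(2) off(1)[OF b'(1)]] T(3) by auto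
  qed
  fix C assume "C \<in> components ({..<end_offset N Ss} - {..<N}) ?E'"
  then obtain v where v: "v \<in> {..<end_offset N Ss} - {..<N}"
    "C \<subseteq> {w. (v, w) \<in> {(x, y). {x, y} \<in> ?E'}\<^sup>*}"
    unfolding components_def by (elim quotientE) (simp, blast)
  have "\<exists>b S. (b, S) \<in> set (offsets a Ts) \<and> x \<in> {b..<b + 3 * length S}" if "a \<le> x" "x < end_offset a Ts" for a x Ts
    using that
  proof (induction Ts arbitrary: a)
    case (Cons S Ts)
    show ?case
    proof (cases "x < a + 3 * length S")
      case True
      then show ?thesis using Cons.prems by (intro exI[of _ a] exI[of _ S]) auto
    next
      case False
      then obtain b S' where "(b, S') \<in> set (offsets (a + 3 * length S) Ts)" "x \<in> {b..<b + 3 * length S'}"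
        using Cons.IH[of "a + 3 * length S"] Cons.prems by auto
      then show ?thesis by (intro exI[of _ b] exI[of _ S']) auto
    qed
  qed simp
  from this[of N v Ss] obtain b S where g: "(b, S) \<in> set (offsets N Ss)" and vb: "v \<in> {b..<b + 3 * length S}"
    using v(1) by auto
  have "w \<in> {b..<b + 3 * length S}" if "(v, w) \<in> {(x, y). {x, y} \<in> ?E'}\<^sup>*" for w
    using that
  proof (induction rule: rtrancl_induct)
    case (step y z)
    then have "{y, z} \<in> ?E" "z \<notin> {..<N}" by auto
    then show ?case using edge[OF g step.IH] off(2)[OF g] by auto
  qed (rule vb)
  then have C: "C \<subseteq> {b..<b + 3 * length S}" using v(2) by auto
  have "card C \<le> 3 * length S" using card_mono[OF _ C] by simp
  then show "card C \<le> 3 * r" using off(3)[OF g] by simp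
  have "{q \<in> {..<N}. \<exists>v\<in>C. {q, v} \<in> ?E} \<subseteq> set S"
  proof
    fix q assume "q \<in> {q \<in> {..<N}. \<exists>v\<in>C. {q, v} \<in> ?E}"
    then obtain u where u: "q < N" "u \<in> C" "{u, q} \<in> ?E" by (auto simp: insert_commute)
    then show "q \<in> set S" using edge[OF g _ u(3)] C offsets_range[OF g] by auto
  qed
  then have "card {q \<in> {..<N}. \<exists>v\<in>C. {q, v} \<in> ?E} \<le> card (set S)" by (rule card_mono[rotated]) simp
  also have "\<dots> \<le> r" using card_length[of S] off(3)[OF g] by simp
  finally show "card {q \<in> {..<N}. \<exists>v\<in>C. {q, v} \<in> ?E} \<le> r" .
qed

section \<open>Computing the graph in polynomial time\<close>

lemma funpow_tl: "(tl ^^ n) xs = drop n xs"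
  by (induction n arbitrary: xs) (auto simp: drop_Suc tl_drop)

lemma esize_drop: "esize (drop n xs) \<le> esize xs"
  by (metis append_take_drop_id esize_append le_add2)

lemma ptime_drop [ptime_intros]:
  assumes "ptime f" "ptime g"
  shows "ptime (\<lambda>x. drop (f x) (g x))"
proof (rule ptime_comp2[OF _ assms, where h = drop])
  have "ptime (\<lambda>z :: nat \<times> 'b list. (tl ^^ fst z) (snd z))"
    by (rule ptime_funpow[OF _ _ _ poly_bounded_id])
      (auto simp: funpow_tl intro!: ptime_intros order_trans[OF esize_drop])
  then show "ptime (\<lambda>z :: nat \<times> 'b list. drop (fst z) (snd z))" by (simp add: funpow_tl)
qed

text \<open>The \<open>case\<close> on \<open>drop\<close> is element access with the harmless
  default 0, and \<open>ceil_div\<close> agrees with \<open>div\<close> since the lengths in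
  question are divisible by 3.\<close>

definition gadget_list :: "nat \<times> nat list \<Rightarrow> (nat \<times> nat \<times> nat) list" where
  "gadget_list p =
     map (\<lambda>i. (fst p + 2 * i, fst p + 2 * i + 1, case drop i (snd p) of [] \<Rightarrow> 0 | y # _ \<Rightarrow> y))
       [0..<length (snd p)] @
     map (\<lambda>i. (fst p + 2 * i + 1, if Suc i < length (snd p) then fst p + 2 * i + 2 else fst p,
            fst p + 2 * length (snd p) + i)) [0..<length (snd p)] @
     map (\<lambda>j. (fst p + 2 * length (snd p) + 3 * j, fst p + 2 * length (snd p) + 3 * j + 1,
            fst p + 2 * length (snd p) + 3 * j + 2)) [0..<ceil_div (length (snd p)) 3]"

definition offset_step :: "nat \<times> (nat \<times> nat list) list \<Rightarrow> nat list \<Rightarrow> nat \<times> (nat \<times> nat list) list" where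
  "offset_step c S = (fst c + 3 * length S, snd c @ [(fst c, S)])"

definition in_triple :: "nat \<Rightarrow> nat \<times> nat \<times> nat \<Rightarrow> bool" where
  "in_triple u t \<longleftrightarrow> u = fst t \<or> u = fst (snd t) \<or> u = snd (snd t)"

text \<open>Only pairs with \<open>u < v\<close> are listed, so that each edge occurs once even if
  several triples contain it; the encoding of a family forbids repetitions.\<close>

definition edge_list :: "nat \<Rightarrow> (nat \<times> nat \<times> nat) list \<Rightarrow> nat list list" where
  "edge_list n ts = concat (map (\<lambda>v. map (\<lambda>u. [u, v])
     (filter (\<lambda>u. \<exists>t\<in>set ts. in_triple u t \<and> in_triple v t) [0..<v])) [0..<n])"

definition partition_instance :: "nat \<times> nat list list \<Rightarrow> nat \<times> nat list list \<times> nat list" where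
  "partition_instance x = (fst (foldl offset_step (fst x, []) (snd x)),
     edge_list (fst (foldl offset_step (fst x, []) (snd x)))
       (concat (map gadget_list (snd (foldl offset_step (fst x, []) (snd x))))), [0..<fst x])"

lemma foldl_offset_step: "foldl offset_step (a, acc) Ss = (end_offset a Ss, acc @ offsets a Ss)"
  by (induction Ss arbitrary: a acc) (auto simp: offset_step_def)

lemma set_gadget_list:
  assumes "3 dvd length S"
  shows "(\<lambda>(x, y, z). {x, y, z}) ` set (gadget_list (b, S)) = gadget b S"
proof -
  have "ceil_div (length S) 3 = length S div 3"
    using assms mult_ceil_div[of 3 "length S"] by (auto elim!: dvdE)
  moreover have "(case drop i S of [] \<Rightarrow> 0 | y # _ \<Rightarrow> y) = S ! i" if "i < length S" for i
    using that by (simp add: Cons_nth_drop_Suc[symmetric])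
  ultimately show ?thesis
    unfolding gadget_def gadget_list_def ringT_def skipT_def restT_def fst_conv snd_conv
    by (simp add: image_Un image_image Un_assoc atLeast0LessThan cong: image_cong_simp)
qed

lemma set_edge_list:
  "set (edge_list n ts) = (\<lambda>(u, v). [u, v]) `
    {(u, v). u < v \<and> v < n \<and> (\<exists>t\<in>set ts. in_triple u t \<and> in_triple v t)}"
proof -
  have "set (concat (map (\<lambda>v. map (\<lambda>u. [u, v]) (filter (\<lambda>u. P u v) [0..<v])) [0..<n])) =
      (\<lambda>(u, v). [u, v]) ` {(u, v). u < v \<and> v < n \<and> P u v}" for P
    by force
  then show ?thesis unfolding edge_list_def .
qed

lemma edge_list_props:
  "distinct (map set (edge_list n ts))" "xs \<in> set (edge_list n ts) \<Longrightarrow> distinct xs"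
  "set ` set (edge_list n ts) = {{u, v} | u v. u < v \<and> v < n \<and> (\<exists>t\<in>set ts. in_triple u t \<and> in_triple v t)}"
proof -
  define R where "R = {(u, v). u < v \<and> v < n \<and> (\<exists>t\<in>set ts. in_triple u t \<and> in_triple v t)}"
  note E = set_edge_list[of n ts, folded R_def]
  have lt: "u < v" if "(u, v) \<in> R" for u v using that by (simp add: R_def)
  have inj: "inj_on set (set (edge_list n ts))"
  proof (rule inj_onI)
    fix xs ys assume "xs \<in> set (edge_list n ts)" "ys \<in> set (edge_list n ts)" "set xs = set ys"
    then obtain u v u' v' where "xs = [u, v]" "ys = [u', v']" "u < v" "u' < v'" "{u, v} = {u', v'}"
      unfolding E using lt by auto
    then show "xs = ys" by (auto simp: doubleton_eq_iff)
  qed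
  have "distinct (edge_list n ts)"
    unfolding edge_list_def by (induction n) (auto simp: distinct_map inj_on_def)
  then show "distinct (map set (edge_list n ts))" using inj by (simp add: distinct_map)
  show "distinct xs" if "xs \<in> set (edge_list n ts)"
  proof -
    obtain u v where "(u, v) \<in> R" "xs = [u, v]" using \<open>xs \<in> set (edge_list n ts)\<close> unfolding E by auto
    then show ?thesis using lt[of u v] by simp
  qed
  have "set ` set (edge_list n ts) = (\<lambda>(u, v). {u, v}) ` R"
    unfolding E image_image by (rule image_cong) auto
  also have "\<dots> = {{u, v} | u v. (u, v) \<in> R}" by auto
  finally show "set ` set (edge_list n ts) =
      {{u, v} | u v. u < v \<and> v < n \<and> (\<exists>t\<in>set ts. in_triple u t \<and> in_triple v t)}"
    unfolding R_def mem_Collect_eq prod.case .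
qed

lemma in_triple_iff: "in_triple u t \<longleftrightarrow> u \<in> (\<lambda>(x, y, z). {x, y, z}) t"
  by (cases t) (auto simp: in_triple_def)

lemma partition_instance_correct:
  assumes X: "exact_cover_sets N Ss" and r: "\<forall>S\<in>set Ss. length S \<le> r"
  obtains n es where "partition_instance (N, Ss) = (n, es, [0..<N])"
    "simple_graph {..<n} (set ` set es)" "is_hub (3 * r) r {..<n} (set ` set es) {..<N}"
    "encodes_family (set ` set es) (enc es)" "encodes_vertices {..<N} (enc [0..<N])"
    "has_triangle_partition {..<n} (set ` set es) \<longleftrightarrow> exact_cover Ss {..<N}"
proof -
  let ?n = "end_offset N Ss"
  let ?ts = "concat (map gadget_list (offsets N Ss))"
  have T: "(\<lambda>(x, y, z). {x, y, z}) ` set ?ts = triples N Ss"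
  proof -
    have "(\<lambda>(x, y, z). {x, y, z}) ` set ?ts =
        (\<Union>(b, S)\<in>set (offsets N Ss). (\<lambda>(x, y, z). {x, y, z}) ` set (gadget_list (b, S)))" by auto
    also have "\<dots> = triples N Ss" unfolding triples_def
    proof (rule SUP_cong[OF refl])
      fix p assume p: "p \<in> set (offsets N Ss)"
      obtain b S where b: "p = (b, S)" by fastforce
      have "3 dvd length S" using offsets_range[of b S N Ss] p b X unfolding exact_cover_sets_def by blast
      then show "(case p of (b, S) \<Rightarrow> (\<lambda>(x, y, z). {x, y, z}) ` set (gadget_list (b, S))) = (case p of (b, S) \<Rightarrow> gadget b S)"
        unfolding b by (simp add: set_gadget_list)
    qed
    finally show ?thesis .
  qed
  have E: "set ` set (edge_list ?n ?ts) = edges_of (triples N Ss)"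
  proof -
    have 1: "(\<exists>t\<in>set ?ts. in_triple u t \<and> in_triple v t) \<longleftrightarrow> (\<exists>T\<in>triples N Ss. {u, v} \<subseteq> T)" for u v
      unfolding T[symmetric] in_triple_iff
      by (simp only: bex_simps insert_subset empty_subsetI simp_thms)
    have 2: "v < ?n" if "T \<in> triples N Ss" "v \<in> T" for T v
      using triples_subset[OF X that(1)] that(2) end_offset_ge[of N Ss] by force
    show ?thesis
    proof (intro equalityI subsetI)
      fix e assume "e \<in> set ` set (edge_list ?n ?ts)"
      then show "e \<in> edges_of (triples N Ss)" unfolding edge_list_props(3) 1 edges_of_def by auto
    next
      fix e assume "e \<in> edges_of (triples N Ss)"
      then obtain T where T: "card e = 2" "T \<in> triples N Ss" "e \<subseteq> T" unfolding edges_of_def by blast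
      then obtain u v where uv: "e = {u, v}" "u < v" by (metis card_2_iff doubleton_eq_iff linorder_neqE_nat)
      then have "v < ?n" using 2[OF T(2)] T(3) by blast
      then show "e \<in> set ` set (edge_list ?n ?ts)"
        unfolding edge_list_props(3) 1 using uv T by blast
    qed
  qed
  show ?thesis
  proof (rule that)
    show "partition_instance (N, Ss) = (?n, edge_list ?n ?ts, [0..<N])"
      by (simp add: partition_instance_def foldl_offset_step)
    show "simple_graph {..<?n} (set ` set (edge_list ?n ?ts))" unfolding E by (rule triple_graph_simple[OF X])
    show "is_hub (3 * r) r {..<?n} (set ` set (edge_list ?n ?ts)) {..<N}"
      unfolding E by (rule triple_graph_hub[OF X r])
    show "encodes_family (set ` set (edge_list ?n ?ts)) (enc (edge_list ?n ?ts))"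
      unfolding encodes_family_iff using edge_list_props(1,2) by blast
    show "encodes_vertices {..<N} (enc [0..<N])"
      unfolding encodes_vertices_iff by (intro exI[of _ "[0..<N]"]) auto
    show "has_triangle_partition {..<?n} (set ` set (edge_list ?n ?ts)) \<longleftrightarrow> exact_cover Ss {..<N}"
      unfolding E by (rule triple_graph_partition_iff[OF X])
  qed
qed

lemma ptime_in_triple [ptime_intros]: "ptime f \<Longrightarrow> ptime g \<Longrightarrow> ptime (\<lambda>x. in_triple (f x) (g x))"
  unfolding in_triple_def by (intro ptime_intros)

lemma ptime_edge_list [ptime_intros]:
  assumes "ptime f" "ptime g"
  shows "ptime (\<lambda>x. edge_list (f x) (g x))"
  by (rule ptime_comp2[OF _ assms, where h = edge_list], unfold edge_list_def) (intro ptime_intros)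

lemma ptime_gadget_list [ptime_intros]: "ptime f \<Longrightarrow> ptime (\<lambda>x. gadget_list (f x))"
  by (rule ptime_comp[of gadget_list], unfold gadget_list_def) (intro ptime_intros, assumption?)

lemma end_offset_le: "end_offset a Ss \<le> a + 3 * esize Ss"
proof (induction Ss arbitrary: a)
  case (Cons S Ss)
  have "end_offset a (S # Ss) \<le> (a + 3 * length S) + 3 * esize Ss" using Cons.IH by simp
  then show ?case using length_le_esize[of S] by simp
qed simp

lemma length_offsets: "length (offsets a Ss) = length Ss"
  by (induction Ss arbitrary: a) auto

lemma ptime_foldl_offset_step: "ptime (\<lambda>x. foldl offset_step (fst x, []) (snd x))"
proof (rule ptime_foldl)
  show "poly_bounded (\<lambda>s. 4 * s + s * (5 * s + 2) + 1)" by (intro poly_bounded_intros)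
  show "ptime (\<lambda>z :: (nat \<times> nat list list) \<times> (nat \<times> (nat \<times> nat list) list) \<times> nat list.
      offset_step (fst (snd z)) (snd (snd z)))"
    unfolding offset_step_def by (intro ptime_intros)
  fix x :: "nat \<times> nat list list" and ys zs assume x: "snd x = ys @ zs"
  let ?s = "esize x"
  have ys: "esize ys \<le> ?s" "fst x + 3 * esize ys \<le> 4 * ?s" using x by simp_all
  have e: "end_offset (fst x) ys \<le> 4 * ?s" using end_offset_le[of "fst x" ys] ys(2) by simp
  have "esize (offsets (fst x) ys) \<le> length (offsets (fst x) ys) * (5 * ?s + 1 + 1)"
  proof (rule esize_list_bound)
    fix p assume p: "p \<in> set (offsets (fst x) ys)"
    obtain b S where b: "p = (b, S)" by fastforce
    then show "esize p \<le> 5 * ?s + 1"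
      using offsets_range[of b S "fst x" ys] p e esize_member[of S ys] ys(1) by simp
  qed
  also have "\<dots> \<le> ?s * (5 * ?s + 2)"
    using order_trans[OF length_le_esize[of ys] ys(1)] unfolding length_offsets
    by (intro mult_le_mono) simp_all
  finally show "esize (foldl offset_step (fst x, []) ys) \<le> 4 * ?s + ?s * (5 * ?s + 2) + 1"
    using e by (simp add: foldl_offset_step del: esize_nat) simp
qed (intro ptime_intros)+

lemma ptime_partition_instance: "ptime partition_instance"
  unfolding partition_instance_def by (intro ptime_intros ptime_foldl_offset_step)

section \<open>From set cover to exact cover\<close>

text \<open>Two bounds on the number of sets: \<open>k\<close> is a constant and gives the depth of
  the recursion, hence polynomial time; \<open>m\<close> is part of the input and carries the rest
  of the budget.\<close>

fun coverable :: "nat \<Rightarrow> nat \<Rightarrow> nat list list \<Rightarrow> nat list \<Rightarrow> bool" where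
  "coverable 0 m F A \<longleftrightarrow> A = []"
| "coverable (Suc k) m F A \<longleftrightarrow>
    A = [] \<or> 0 < m \<and> (\<exists>S\<in>set F. coverable k (m - 1) F (filter (\<lambda>x. x \<notin> set S) A))"

lemma coverable_iff:
  "coverable k m F A \<longleftrightarrow>
    (\<exists>Cs. set Cs \<subseteq> set F \<and> length Cs \<le> k \<and> length Cs \<le> m \<and> set A \<subseteq> \<Union>(set ` set Cs))"
proof (induction k arbitrary: m A)
  case 0
  show ?case by auto
next
  case (Suc k)
  show ?case
  proof
    assume "coverable (Suc k) m F A"
    then consider "A = []" | S where "0 < m" "S \<in> set F" "coverable k (m - 1) F (filter (\<lambda>x. x \<notin> set S) A)"
      by auto
    then show "\<exists>Cs. set Cs \<subseteq> set F \<and> length Cs \<le> Suc k \<and> length Cs \<le> m \<and> set A \<subseteq> \<Union>(set ` set Cs)"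
    proof cases
      case 1
      then show ?thesis by (intro exI[of _ "[]"]) auto
    next
      case 2
      then obtain Cs where "set Cs \<subseteq> set F" "length Cs \<le> k" "length Cs \<le> m - 1"
        "set (filter (\<lambda>x. x \<notin> set S) A) \<subseteq> \<Union>(set ` set Cs)" unfolding Suc.IH by blast
      then show ?thesis using 2 by (intro exI[of _ "S # Cs"]) auto
    qed
  next
    assume "\<exists>Cs. set Cs \<subseteq> set F \<and> length Cs \<le> Suc k \<and> length Cs \<le> m \<and> set A \<subseteq> \<Union>(set ` set Cs)"
    then obtain Cs where Cs: "set Cs \<subseteq> set F" "length Cs \<le> Suc k" "length Cs \<le> m" "set A \<subseteq> \<Union>(set ` set Cs)"
      by blast
    show "coverable (Suc k) m F A"
    proof (cases Cs)
      case Nil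
      then show ?thesis using Cs(4) by simp
    next
      case (Cons S Cs')
      then have "coverable k (m - 1) F (filter (\<lambda>x. x \<notin> set S) A)"
        unfolding Suc.IH using Cs by (intro exI[of _ Cs']) auto
      then show ?thesis using Cs Cons by auto
    qed
  qed
qed

lemma ptime_coverable:
  "ptime m \<Longrightarrow> ptime F \<Longrightarrow> ptime A \<Longrightarrow> ptime (\<lambda>x. coverable k (m x) (F x) (A x))"
proof -
  have "ptime (\<lambda>z. coverable k (fst z) (fst (snd z)) (snd (snd z)))"
  proof (induction k)
    case 0
    show ?case unfolding coverable.simps by (intro ptime_intros)
  next
    case (Suc k)
    show ?case unfolding coverable.simps
      by (intro ptime_intros ptime_comp3[OF Suc.IH, of "\<lambda>z. fst (fst z) - 1" "\<lambda>z. fst (snd (fst z))"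
            "\<lambda>z. filter (\<lambda>x. x \<notin> set (snd z)) (snd (snd (fst z)))"])
  qed
  then show "ptime m \<Longrightarrow> ptime F \<Longrightarrow> ptime A \<Longrightarrow> ptime (\<lambda>x. coverable k (m x) (F x) (A x))"
    by (rule ptime_comp3)
qed

text \<open>Strictly increasing lists represent each set of at most \<open>k\<close> elements
  exactly once; for constant \<open>k\<close> there are polynomially many.\<close>

fun inc_lists :: "nat \<Rightarrow> nat list \<Rightarrow> nat list list" where
  "inc_lists 0 xs = [[]]"
| "inc_lists (Suc k) xs =
    [] # concat (map (\<lambda>x. map (\<lambda>A. x # A) (filter (\<lambda>A. \<forall>y\<in>set A. x < y) (inc_lists k xs))) xs)"

lemma in_inc_lists_iff: "A \<in> set (inc_lists k xs) \<longleftrightarrow> sorted_wrt (<) A \<and> set A \<subseteq> set xs \<and> length A \<le> k"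
proof (induction k arbitrary: A)
  case (Suc k)
  show ?case
  proof (cases A)
    case (Cons x A')
    have "A \<in> set (inc_lists (Suc k) xs) \<longleftrightarrow> x \<in> set xs \<and> A' \<in> set (inc_lists k xs) \<and> (\<forall>y\<in>set A'. x < y)"
      unfolding Cons by auto
    then show ?thesis unfolding Suc.IH Cons by auto
  qed simp
qed auto

lemma distinct_inc_lists: "distinct xs \<Longrightarrow> distinct (inc_lists k xs)"
proof (induction k)
  case (Suc k)
  have "distinct (concat (map (\<lambda>x. map (\<lambda>A. x # A) (filter (P x) (inc_lists k xs))) ys))" if "distinct ys" for P ys
    using that by (induction ys) (auto simp: distinct_map inj_on_def Suc)
  then show ?case using Suc.prems by auto
qed simp

lemma ptime_inc_lists [ptime_intros]: "ptime f \<Longrightarrow> ptime (\<lambda>x. inc_lists k (f x))"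
proof -
  have "ptime (\<lambda>xs. inc_lists k xs)"
  proof (induction k)
    case 0
    show ?case unfolding inc_lists.simps by (intro ptime_intros)
  next
    case (Suc k)
    show ?case unfolding inc_lists.simps by (intro ptime_intros ptime_comp[OF Suc.IH])
  qed
  then show "ptime f \<Longrightarrow> ptime (\<lambda>x. inc_lists k (f x))" by (rule ptime_comp)
qed

text \<open>Conversion between the recursion and a set of sets. From right to left, a member of
  \<open>P\<close> is taken at its first occurrence in the list.\<close>

lemma exact_cover_iff:
  assumes "\<forall>S\<in>set Ss. S \<noteq> []"
  shows "exact_cover Ss H \<longleftrightarrow> (\<exists>P\<subseteq>set ` set Ss. disjoint P \<and> \<Union>P = H)"
  using assms
proof (induction Ss arbitrary: H)
  case Nil
  show ?case by auto
next
  case (Cons S Ss)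
  have IH: "exact_cover Ss H' \<longleftrightarrow> (\<exists>P\<subseteq>set ` set Ss. disjoint P \<and> \<Union>P = H')" for H'
    using Cons by simp
  show ?case
  proof
    assume "exact_cover (S # Ss) H"
    then consider "exact_cover Ss H" | "set S \<subseteq> H" "exact_cover Ss (H - set S)" by auto
    then show "\<exists>P\<subseteq>set ` set (S # Ss). disjoint P \<and> \<Union>P = H"
    proof cases
      case 1
      then obtain P where "P \<subseteq> set ` set Ss" "disjoint P" "\<Union>P = H" unfolding IH by blast
      then show ?thesis by (intro exI[of _ P]) auto
    next
      case 2
      then obtain P where P: "P \<subseteq> set ` set Ss" "disjoint P" "\<Union>P = H - set S" unfolding IH by blast
      have "disjoint (insert (set S) P)" using P(2,3) by (auto simp: disjoint_def)
      then show ?thesis using P 2(1) by (intro exI[of _ "insert (set S) P"]) auto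
    qed
  next
    assume "\<exists>P\<subseteq>set ` set (S # Ss). disjoint P \<and> \<Union>P = H"
    then obtain P where P: "P \<subseteq> insert (set S) (set ` set Ss)" "disjoint P" "\<Union>P = H" by auto
    show "exact_cover (S # Ss) H"
    proof (cases "set S \<in> P")
      case False
      then have "P \<subseteq> set ` set Ss" using P(1) by blast
      then have "exact_cover Ss H" unfolding IH using P(2,3) by (intro exI[of _ P]) simp
      then show ?thesis by simp
    next
      case True
      let ?P = "P - {set S}"
      have "disjoint ?P" using P(2) by (simp add: pairwise_subset[OF _ Diff_subset])
      moreover have "\<Union>?P = H - set S"
      proof -
        have "T \<inter> set S = {}" if "T \<in> ?P" for T
          using P(2) True that unfolding disjoint_def by blast
        then show ?thesis using P(3) by blast
      qed
      moreover have "?P \<subseteq> set ` set Ss" using P(1) by blast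
      ultimately have "exact_cover Ss (H - set S)" unfolding IH by (intro exI[of _ ?P]) simp
      then show ?thesis using True P(3) by auto
    qed
  qed
qed

lemma partition_into_triples:
  "finite R \<Longrightarrow> 3 dvd card R \<Longrightarrow> \<exists>P. disjoint P \<and> \<Union>P = R \<and> (\<forall>T\<in>P. card T = 3)"
proof (induction "card R" arbitrary: R rule: less_induct)
  case less
  show ?case
  proof (cases "R = {}")
    case True
    then show ?thesis by (intro exI[of _ "{}"]) (auto simp: disjoint_def)
  next
    case False
    then have "3 \<le> card R" using less.prems by (auto intro: dvd_imp_le simp: card_gt_0_iff)
    then obtain T where T: "T \<subseteq> R" "card T = 3" "finite T" using obtain_subset_with_card_n by metis
    have c: "card (R - T) = card R - 3" using T by (simp add: card_Diff_subset)
    then obtain P where P: "disjoint P" "\<Union>P = R - T" "\<forall>T\<in>P. card T = 3"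
      using less.hyps[of "R - T"] less.prems \<open>3 \<le> card R\<close> by (auto simp: dvd_diff_nat)
    have "disjoint (insert T P)" using P(1,2) by (auto simp: disjoint_def)
    then show ?thesis using P T by (intro exI[of _ "insert T P"]) auto
  qed
qed

text \<open>Group \<open>j\<close> may use at most \<open>min k (t - j * k)\<close> sets: all groups
  but the last one get \<open>k\<close>, and the last gets the remainder, so that grouping never
  exceeds the total budget.\<close>

lemma sum_min_blocks: "(\<Sum>j<b. min k (t - j * k)) \<le> (t :: nat)"
proof -
  have "(\<Sum>j<b. min k (t - j * k)) = min t (b * k)"
    by (induction b) (auto simp: min_def)
  then show ?thesis by simp
qed

text \<open>Groups of \<open>k\<close> sets of the cover are merged, and each group has a token element, so that only
  \<open>t / k\<close> tokens are needed to bound the number of sets.  Two dummy elements for each token make the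
  sizes of the merged sets divisible by 3; the dummies left over are covered in triples.\<close>

definition token_set :: "nat \<Rightarrow> nat \<Rightarrow> nat \<Rightarrow> nat list \<Rightarrow> nat list" where
  "token_set n b j A = (n + j) # A @
     drop (2 - (3 * ceil_div (length A + 1) 3 - (length A + 1))) [n + b + 2 * j, n + b + 2 * j + 1]"

text \<open>Elements are the numbers below \<open>n\<close>, followed by \<open>b\<close> tokens and
  \<open>2 * b\<close> dummies; up to two more dummies round the total up to a multiple of 3. Thus a
  token costs three elements altogether.\<close>

definition universe_size :: "nat \<Rightarrow> nat \<Rightarrow> nat" where
  "universe_size n b = 3 * (ceil_div n 3 + b)"

text \<open>A merged set may be any small set contained in a union of permitted sets, not just the
  union itself. So overlaps of the original cover can be removed, and the empty list serves for
  tokens that have nothing to cover.\<close>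

definition cover_sets :: "nat \<Rightarrow> nat \<Rightarrow> nat \<times> nat list list \<times> nat \<Rightarrow> nat list list" where
  "cover_sets d k x =
     concat (map (\<lambda>j. map (\<lambda>A. token_set (fst x) (ceil_div (snd (snd x)) k) j A)
       (filter (\<lambda>A. coverable k (snd (snd x) - j * k) (fst (snd x)) A) (inc_lists (d * k) [0..<fst x])))
       [0..<ceil_div (snd (snd x)) k]) @
     filter (\<lambda>A. length A = 3 \<and> (\<forall>y\<in>set A. fst x + ceil_div (snd (snd x)) k \<le> y))
       (inc_lists 3 [0..<universe_size (fst x) (ceil_div (snd (snd x)) k)])"

definition cover_instance :: "nat \<Rightarrow> nat \<Rightarrow> nat \<times> nat list list \<times> nat \<Rightarrow> nat \<times> nat list list" where
  "cover_instance d k x = (universe_size (fst x) (ceil_div (snd (snd x)) k), cover_sets d k x)"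

lemma ptime_cover_instance: "ptime (cover_instance d k)"
  unfolding cover_instance_def cover_sets_def universe_size_def token_set_def
  by (intro ptime_intros ptime_coverable)

lemma universe_size_bounds: "n + 3 * b \<le> universe_size n b" "universe_size n b \<le> n + 3 * b + 2" "3 dvd universe_size n b"
  using mult_ceil_div[of 3 n] by (auto simp: universe_size_def)

lemma token_set_props:
  assumes "sorted_wrt (<) A" "set A \<subseteq> {..<n}" "j < b"
  shows "distinct (token_set n b j A)" "3 dvd length (token_set n b j A)" "length (token_set n b j A) \<le> length A + 3"
    "\<exists>D. D \<subseteq> {n + b + 2 * j, n + b + 2 * j + 1} \<and> set (token_set n b j A) = insert (n + j) (set A \<union> D)"
    "set (token_set n b j A) \<subseteq> {..<universe_size n b}"
proof -
  let ?c = "3 * ceil_div (length A + 1) 3 - (length A + 1)"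
  let ?D = "drop (2 - ?c) [n + b + 2 * j, n + b + 2 * j + 1]"
  have c: "?c \<le> 2" "3 dvd length A + 1 + ?c"
    using mult_ceil_div[of 3 "length A + 1"] by auto
  have D: "set ?D \<subseteq> {n + b + 2 * j, n + b + 2 * j + 1}" using set_drop_subset by fastforce
  have dD: "distinct ?D" by (intro distinct_drop) simp
  have A: "distinct A" using assms(1) strict_sorted_iff[of A] by simp
  have lD: "length ?D = ?c" using c(1) by simp
  have "set A \<inter> set ?D = {}" "n + j \<notin> set A" "n + j \<notin> set ?D" using D assms(2,3) by force+
  then show "distinct (token_set n b j A)" unfolding token_set_def using A dD by simp
  have l: "length (token_set n b j A) = length A + 1 + ?c" unfolding token_set_def using lD by simp
  show "3 dvd length (token_set n b j A)" unfolding l by (rule c(2))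
  show "length (token_set n b j A) \<le> length A + 3" unfolding l using c(1) by simp
  have "set (token_set n b j A) = insert (n + j) (set A \<union> set ?D)" unfolding token_set_def by simp
  then show "\<exists>D. D \<subseteq> {n + b + 2 * j, n + b + 2 * j + 1} \<and> set (token_set n b j A) = insert (n + j) (set A \<union> D)"
    using D by blast
  have "set A \<subseteq> {..<universe_size n b}" "set ?D \<subseteq> {..<universe_size n b}" "n + j < universe_size n b"
    using D assms(2,3) universe_size_bounds(1)[of n b] by force+
  then show "set (token_set n b j A) \<subseteq> {..<universe_size n b}" unfolding token_set_def by simp
qed

lemma cover_sets_cases:
  assumes "S \<in> set (cover_sets d k (n, F, t))"
  obtains (token) j A where "j < ceil_div t k" "sorted_wrt (<) A" "set A \<subseteq> {..<n}" "length A \<le> d * k"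
      "coverable k (t - j * k) F A" "S = token_set n (ceil_div t k) j A"
  | (dummy) "sorted_wrt (<) S" "set S \<subseteq> {n + ceil_div t k..<universe_size n (ceil_div t k)}" "length S = 3"
  using assms unfolding cover_sets_def fst_conv snd_conv set_append
proof (elim UnE)
  assume "S \<in> set (concat (map (\<lambda>j. map (\<lambda>A. token_set n (ceil_div t k) j A)
       (filter (\<lambda>A. coverable k (t - j * k) F A) (inc_lists (d * k) [0..<n]))) [0..<ceil_div t k]))"
  then obtain j A where "j < ceil_div t k" "A \<in> set (inc_lists (d * k) [0..<n])" "coverable k (t - j * k) F A"
    "S = token_set n (ceil_div t k) j A" by auto
  then show thesis by (intro token[of j A]) (auto simp: in_inc_lists_iff)
next
  assume "S \<in> set (filter (\<lambda>A. length A = 3 \<and> (\<forall>y\<in>set A. n + ceil_div t k \<le> y))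
       (inc_lists 3 [0..<universe_size n (ceil_div t k)]))"
  then show thesis by (intro dummy) (auto simp: in_inc_lists_iff)
qed

lemma token_set_in_cover_sets:
  assumes "j < ceil_div t k" "sorted_wrt (<) A" "set A \<subseteq> {..<n}" "length A \<le> d * k"
    "coverable k (t - j * k) F A"
  shows "token_set n (ceil_div t k) j A \<in> set (cover_sets d k (n, F, t))"
proof -
  have "A \<in> set (inc_lists (d * k) [0..<n])" using assms by (auto simp: in_inc_lists_iff)
  then show ?thesis unfolding cover_sets_def using assms(1,5) by auto
qed

lemma cover_sets_props:
  shows "exact_cover_sets (universe_size n (ceil_div t k)) (cover_sets d k (n, F, t))"
    "\<forall>S\<in>set (cover_sets d k (n, F, t)). length S \<le> d * k + 3"
proof -
  have "(distinct S \<and> set S \<subseteq> {..<universe_size n (ceil_div t k)} \<and> S \<noteq> [] \<and> 3 dvd length S) \<and> length S \<le> d * k + 3"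
    if "S \<in> set (cover_sets d k (n, F, t))" for S
    using that
  proof (cases rule: cover_sets_cases)
    case (token j A)
    then show ?thesis using token_set_props[OF token(2,3,1)] by (auto simp: token_set_def)
  next
    case dummy
    then show ?thesis using strict_sorted_iff[of S] by auto
  qed
  then show "exact_cover_sets (universe_size n (ceil_div t k)) (cover_sets d k (n, F, t))"
    "\<forall>S\<in>set (cover_sets d k (n, F, t)). length S \<le> d * k + 3"
    unfolding exact_cover_sets_def by blast+
qed

text \<open>Each token lies in exactly one set of the partition, so each group contributes one
  merged set. The original sets that witness \<open>coverable\<close> are collected over all groups;
  their number is bounded by \<open>sum_min_blocks\<close>.\<close>

lemma exact_cover_imp_set_cover:
  assumes k: "0 < k"
    and P: "P \<subseteq> set ` set (cover_sets d k (n, F, t))" "disjoint P" "\<Union>P = {..<universe_size n (ceil_div t k)}"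
  shows "\<exists>Cs. set Cs \<subseteq> set F \<and> length Cs \<le> t \<and> {..<n} \<subseteq> \<Union>(set ` set Cs)"
proof -
  let ?b = "ceil_div t k"
  have form: "(\<exists>j A. j < ?b \<and> set A \<subseteq> {..<n} \<and> coverable k (t - j * k) F A \<and> n + j \<in> T \<and>
      T \<inter> {..<n + ?b} = insert (n + j) (set A)) \<or> T \<inter> {..<n + ?b} = {}" if T: "T \<in> P" for T
  proof -
    obtain S where S: "S \<in> set (cover_sets d k (n, F, t))" "T = set S" using P(1) T by blast
    from S(1) show ?thesis
    proof (cases rule: cover_sets_cases)
      case (token j A)
      obtain D where D: "D \<subseteq> {n + ?b + 2 * j, n + ?b + 2 * j + 1}" "T = insert (n + j) (set A \<union> D)"
        using token_set_props(4)[OF token(2,3,1)] S(2) token(6) by auto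
      have "T \<inter> {..<n + ?b} = insert (n + j) (set A)" using D token(1,3) by auto
      then show ?thesis using token D(2) by auto
    next
      case dummy
      then show ?thesis unfolding S(2) by auto
    qed
  qed
  have ex: "\<exists>A Cs. (\<forall>T\<in>P. n + j \<in> T \<longrightarrow> T \<inter> {..<n} \<subseteq> set A) \<and> set Cs \<subseteq> set F \<and> length Cs \<le> min k (t - j * k) \<and>
      set A \<subseteq> \<Union>(set ` set Cs)" if j: "j < ?b" for j
  proof -
    have "n + j < universe_size n ?b" using universe_size_bounds(1)[of n ?b] j by simp
    then obtain T where T: "T \<in> P" "n + j \<in> T" using P(3) by blast
    have low: "n + j \<in> T \<inter> {..<n + ?b}" using T j by simp
    then obtain i A where A: "set A \<subseteq> {..<n}" "coverable k (t - i * k) F A" "T \<inter> {..<n + ?b} = insert (n + i) (set A)"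
      using form[OF T(1)] by blast
    have "i = j" using low A(1,3) by auto
    have "T' = T" if "T' \<in> P" "n + j \<in> T'" for T'
      using P(2) T that unfolding disjoint_def by blast
    moreover have "T \<inter> {..<n} \<subseteq> set A"
    proof
      fix x assume x: "x \<in> T \<inter> {..<n}"
      then have "x \<in> insert (n + i) (set A)" unfolding A(3)[symmetric] by simp
      then show "x \<in> set A" using x by auto
    qed
    ultimately have "\<forall>T'\<in>P. n + j \<in> T' \<longrightarrow> T' \<inter> {..<n} \<subseteq> set A" by blast
    moreover obtain Cs where "set Cs \<subseteq> set F" "length Cs \<le> k" "length Cs \<le> t - j * k" "set A \<subseteq> \<Union>(set ` set Cs)"
      using A(2) unfolding coverable_iff \<open>i = j\<close> by blast
    ultimately show ?thesis by (intro exI[of _ A] exI[of _ Cs]) simp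
  qed
  then obtain A Cs where AC: "\<And>j. j < ?b \<Longrightarrow> (\<forall>T\<in>P. n + j \<in> T \<longrightarrow> T \<inter> {..<n} \<subseteq> set (A j)) \<and> set (Cs j) \<subseteq> set F \<and>
      length (Cs j) \<le> min k (t - j * k) \<and> set (A j) \<subseteq> \<Union>(set ` set (Cs j))"
    by metis
  let ?C = "concat (map Cs [0..<?b])"
  have "length ?C = (\<Sum>j<?b. length (Cs j))"
    by (simp add: length_concat comp_def interv_sum_list_conv_sum_set_nat atLeast0LessThan)
  also have "\<dots> \<le> (\<Sum>j<?b. min k (t - j * k))" using AC by (intro sum_mono) simp
  also have "\<dots> \<le> t" by (rule sum_min_blocks)
  finally have "length ?C \<le> t" .
  moreover have "set ?C \<subseteq> set F"
  proof -
    have "set (Cs j) \<subseteq> set F" if "j < ?b" for j using AC[OF that] by simp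
    then show ?thesis by fastforce
  qed
  moreover have "{..<n} \<subseteq> \<Union>(set ` set ?C)"
  proof
    fix x assume x: "x \<in> {..<n}"
    then have "x < universe_size n ?b" using universe_size_bounds(1)[of n ?b] by simp
    then obtain T where T: "T \<in> P" "x \<in> T" using P(3) by blast
    have "x \<in> T \<inter> {..<n + ?b}" using T x by simp
    then obtain j where "j < ?b" "n + j \<in> T" using form[OF T(1)] by blast
    then have "x \<in> \<Union>(set ` set (Cs j))" using AC[of j] T x by blast
    then show "x \<in> \<Union>(set ` set ?C)" using \<open>j < ?b\<close> by auto
  qed
  ultimately show ?thesis by blast
qed

text \<open>Each element is assigned to one set of the cover, and consecutive sets are grouped in
  blocks of \<open>k\<close>. Every merged set has size divisible by 3, as has the universe, so the
  number of leftover dummies is divisible by 3 as well.\<close>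

lemma set_cover_imp_exact_cover:
  assumes k: "0 < k" and F: "\<forall>S\<in>set F. card (set S) \<le> d \<and> set S \<subseteq> {..<n}"
    and Cs: "set Cs \<subseteq> set F" "length Cs \<le> t" "{..<n} \<subseteq> \<Union>(set ` set Cs)"
  shows "\<exists>P\<subseteq>set ` set (cover_sets d k (n, F, t)). disjoint P \<and> \<Union>P = {..<universe_size n (ceil_div t k)}"
proof -
  let ?b = "ceil_div t k"
  \<comment> \<open>The first set of the cover that contains \<open>x\<close> becomes responsible
    for it, which makes the cover disjoint.\<close>
  define ix where "ix x = (LEAST i. i < length Cs \<and> x \<in> set (Cs ! i))" for x
  have ix: "ix x < length Cs \<and> x \<in> set (Cs ! ix x)" if "x < n" for x
  proof -
    have "\<exists>i. i < length Cs \<and> x \<in> set (Cs ! i)" using Cs(3) that by (force simp: in_set_conv_nth)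
    then show ?thesis unfolding ix_def by (rule LeastI_ex)
  qed
  define A where "A j = filter (\<lambda>x. ix x div k = j) [0..<n]" for j
  have A: "sorted_wrt (<) (A j)" "set (A j) \<subseteq> {..<n}" for j
    unfolding A_def by (auto intro: sorted_wrt_filter)
  have cov: "set (A j) \<subseteq> \<Union>(set ` set (take k (drop (j * k) Cs)))" for j
  proof
    fix x assume "x \<in> set (A j)"
    then have x: "x < n" "ix x div k = j" by (auto simp: A_def)
    have i: "ix x = j * k + ix x mod k" using x(2) by (metis div_mult_mod_eq)
    have m: "ix x mod k < k" using k by simp
    have "take k (drop (j * k) Cs) ! (ix x mod k) = Cs ! ix x" using i m ix[OF x(1)] by simp
    moreover have "ix x mod k < length (take k (drop (j * k) Cs))"
    proof -
      have "ix x mod k < length Cs - j * k" using i ix[OF x(1)] by linarith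
      then show ?thesis using m by simp
    qed
    ultimately have "Cs ! ix x \<in> set (take k (drop (j * k) Cs))" by (metis nth_mem)
    then show "x \<in> \<Union>(set ` set (take k (drop (j * k) Cs)))" using ix[OF x(1)] by blast
  qed
  have sub: "set (take k (drop (j * k) Cs)) \<subseteq> set F" for j
    using Cs(1) set_take_subset set_drop_subset by fast
  have len: "length (A j) \<le> d * k" for j
  proof -
    let ?L = "take k (drop (j * k) Cs)"
    have "length (A j) = card (set (A j))" using A(1)[of j] strict_sorted_iff[of "A j"] distinct_card by metis
    also have "\<dots> \<le> card (\<Union>(set ` set ?L))" using cov by (intro card_mono) auto
    also have "\<dots> \<le> (\<Sum>S\<in>set ?L. card (set S))" by (rule card_UN_le) simp
    also have "\<dots> \<le> (\<Sum>S\<in>set ?L. d)" using sub[of j] F by (intro sum_mono) auto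
    also have "\<dots> = card (set ?L) * d" by simp
    also have "\<dots> \<le> k * d" using card_length[of ?L] by (intro mult_le_mono1) simp
    finally show ?thesis by (simp add: mult.commute)
  qed
  have cb: "coverable k (t - j * k) F (A j)" for j
    unfolding coverable_iff using cov[of j] sub[of j] Cs(2)
    by (intro exI[of _ "take k (drop (j * k) Cs)"]) auto
  define T where "T j = set (token_set n ?b j (A j))" for j
  have T: "\<exists>D. D \<subseteq> {n + ?b + 2 * j, n + ?b + 2 * j + 1} \<and> T j = insert (n + j) (set (A j) \<union> D)" if "j < ?b" for j
    unfolding T_def using token_set_props(4)[OF A that] .
  then obtain D where D: "\<And>j. j < ?b \<Longrightarrow> D j \<subseteq> {n + ?b + 2 * j, n + ?b + 2 * j + 1}"
    "\<And>j. j < ?b \<Longrightarrow> T j = insert (n + j) (set (A j) \<union> D j)" by metis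
  have Tdis: "T i \<inter> T j = {}" if "i < ?b" "j < ?b" "i \<noteq> j" for i j
  proof -
    have "set (A i) \<inter> set (A j) = {}" using that(3) by (auto simp: A_def)
    moreover have "D i \<inter> D j = {}" 
    proof (rule ccontr)
      assume "D i \<inter> D j \<noteq> {}"
      then obtain x where x: "x \<in> D i" "x \<in> D j" by blast
      have "x = n + ?b + 2 * i \<or> x = n + ?b + 2 * i + 1" using subsetD[OF D(1)[OF that(1)] x(1)] by simp
      moreover have "x = n + ?b + 2 * j \<or> x = n + ?b + 2 * j + 1" using subsetD[OF D(1)[OF that(2)] x(2)] by simp
      ultimately show False using that(3) by presburger
    qed
    moreover have "set (A i) \<inter> D j = {}" "set (A j) \<inter> D i = {}" "n + i \<notin> D j" "n + j \<notin> D i"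
      "n + i \<notin> set (A j)" "n + j \<notin> set (A i)"
      using D(1)[OF that(1)] D(1)[OF that(2)] that A(2)[of i] A(2)[of j] by force+
    ultimately show ?thesis unfolding D(2)[OF that(1)] D(2)[OF that(2)] using that(3) by auto
  qed
  \<comment> \<open>Proper elements and tokens are all covered, so the remainder consists of dummies
    only.\<close>
  define R where "R = {..<universe_size n ?b} - \<Union>(T ` {..<?b})"
  have Tsub: "T j \<subseteq> {..<universe_size n ?b}" if "j < ?b" for j
    unfolding T_def using token_set_props(5)[OF A that] .
  have Rsub: "R \<subseteq> {n + ?b..<universe_size n ?b}"
  proof
    fix x assume x: "x \<in> R"
    have "\<not> x < n"
    proof
      assume xn: "x < n"
      have "ix x div k < ?b"
        unfolding ceil_div_less_iff[OF k] using ix[OF xn] Cs(2)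
        by (meson div_times_less_eq_dividend le_less_trans less_le_trans)
      moreover have "x \<in> set (A (ix x div k))" using xn by (simp add: A_def)
      ultimately show False using x D(2)[of "ix x div k"] by (auto simp: R_def)
    qed
    moreover have "\<not> (n \<le> x \<and> x < n + ?b)"
    proof
      assume "n \<le> x \<and> x < n + ?b"
      then have "x - n < ?b" "x = n + (x - n)" by auto
      then have "x \<in> T (x - n)" using D(2)[of "x - n"] by simp
      then show False using x \<open>x - n < ?b\<close> by (auto simp: R_def)
    qed
    ultimately show "x \<in> {n + ?b..<universe_size n ?b}" using x by (auto simp: R_def)
  qed
  have "3 dvd card R"
  proof -
    have c3: "3 dvd card (T j)" if "j < ?b" for j
      unfolding T_def using token_set_props(1,2)[OF A that] by (simp add: distinct_card)
    have "card (\<Union>(T ` {..<?b})) = (\<Sum>j<?b. card (T j))"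
      using Tdis by (intro card_UN_disjoint) (auto simp: T_def)
    moreover have "3 dvd (\<Sum>j<?b. card (T j))" by (rule dvd_sum) (use c3 in simp)
    ultimately have "3 dvd card (\<Union>(T ` {..<?b}))" by simp
    moreover have "card R = universe_size n ?b - card (\<Union>(T ` {..<?b}))"
      unfolding R_def using Tsub by (subst card_Diff_subset) (auto simp: T_def)
    ultimately show ?thesis using universe_size_bounds(3) by (simp add: dvd_diff_nat)
  qed
  then obtain P where P: "disjoint P" "\<Union>P = R" "\<forall>T\<in>P. card T = 3"
    using partition_into_triples[of R] by (auto simp: R_def)
  show ?thesis
  proof (intro exI[of _ "T ` {..<?b} \<union> P"] conjI)
    show "T ` {..<?b} \<union> P \<subseteq> set ` set (cover_sets d k (n, F, t))"
    proof (intro Un_least subsetI)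
      fix X assume "X \<in> T ` {..<?b}"
      then obtain j where "j < ?b" "X = T j" by auto
      then show "X \<in> set ` set (cover_sets d k (n, F, t))"
        unfolding T_def using token_set_in_cover_sets[OF _ A len cb] by blast
    next
      fix X assume X: "X \<in> P"
      then have "X \<subseteq> R" using P(2) by blast
      then have XR: "X \<subseteq> {n + ?b..<universe_size n ?b}" using Rsub by blast
      let ?S = "sorted_list_of_set X"
      have fin: "finite X" using XR finite_subset by blast
      have "?S \<in> set (inc_lists 3 [0..<universe_size n ?b])"
        unfolding in_inc_lists_iff using fin XR X P(3) by (auto simp: strict_sorted_iff)
      then have "?S \<in> set (cover_sets d k (n, F, t))"
        unfolding cover_sets_def using fin XR X P(3) by auto
      then show "X \<in> set ` set (cover_sets d k (n, F, t))"
        using fin by (intro image_eqI[of _ _ ?S]) simp_all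
    qed
    show "disjoint (T ` {..<?b} \<union> P)"
    proof (rule disjoint_union[OF _ P(1)])
      show "disjoint (T ` {..<?b})" by (rule disjoint_imageI) (use Tdis in simp)
      show "\<Union>(T ` {..<?b}) \<inter> \<Union>P = {}" unfolding P(2) R_def by blast
    qed
    show "\<Union>(T ` {..<?b} \<union> P) = {..<universe_size n ?b}"
      unfolding Union_Un_distrib P(2) R_def using Tsub by blast
  qed
qed

lemma has_set_cover_list_iff:
  assumes "set_cover_instance d {..<n} (set ` set F)"
  shows "has_set_cover {..<n} (set ` set F) t \<longleftrightarrow>
    (\<exists>Cs. set Cs \<subseteq> set F \<and> length Cs \<le> t \<and> {..<n} \<subseteq> \<Union>(set ` set Cs))"
proof
  assume "has_set_cover {..<n} (set ` set F) t"
  then obtain C where C: "C \<subseteq> set ` set F" "finite C" "card C \<le> t" "\<Union>C = {..<n}"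
    unfolding has_set_cover_def by blast
  obtain Xs where Xs: "set Xs = C" "distinct Xs" using finite_distinct_list[OF C(2)] by blast
  let ?Cs = "map (inv_into (set F) set) Xs"
  have "set (inv_into (set F) set X) = X" if "X \<in> C" for X using C(1) that by (intro f_inv_into_f) blast
  then have "set ` set ?Cs = C" using Xs(1) by (force simp: image_image)
  moreover have "set ?Cs \<subseteq> set F" using C(1) Xs(1) by (auto intro!: inv_into_into)
  moreover have "length ?Cs \<le> t" using C(3) Xs distinct_card[OF Xs(2)] by simp
  ultimately show "\<exists>Cs. set Cs \<subseteq> set F \<and> length Cs \<le> t \<and> {..<n} \<subseteq> \<Union>(set ` set Cs)"
    using C(4) by (intro exI[of _ ?Cs]) simp
next
  assume "\<exists>Cs. set Cs \<subseteq> set F \<and> length Cs \<le> t \<and> {..<n} \<subseteq> \<Union>(set ` set Cs)"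
  then obtain Cs where Cs: "set Cs \<subseteq> set F" "length Cs \<le> t" "{..<n} \<subseteq> \<Union>(set ` set Cs)" by blast
  have "set S \<subseteq> {..<n}" if "S \<in> set F" for S using assms that unfolding set_cover_instance_def by auto
  then have "\<Union>(set ` set Cs) \<subseteq> {..<n}" using Cs(1) by (intro UN_least) auto
  moreover have "card (set ` set Cs) \<le> t"
    using Cs(2) card_image_le[of "set Cs" set] card_length[of Cs] by simp
  ultimately show "has_set_cover {..<n} (set ` set F) t"
    unfolding has_set_cover_def using Cs(1,3) by (intro exI[of _ "set ` set Cs"]) auto
qed

lemma exact_cover_cover_sets_iff:
  assumes "set_cover_instance d {..<n} (set ` set F)" "0 < k"
  shows "exact_cover (cover_sets d k (n, F, t)) {..<universe_size n (ceil_div t k)} \<longleftrightarrow>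
    has_set_cover {..<n} (set ` set F) t"
proof -
  have ne: "\<forall>S\<in>set (cover_sets d k (n, F, t)). S \<noteq> []"
    using cover_sets_props(1)[of n t k d F] unfolding exact_cover_sets_def by blast
  have F: "\<forall>S\<in>set F. card (set S) \<le> d \<and> set S \<subseteq> {..<n}"
    using assms(1) unfolding set_cover_instance_def by auto
  show ?thesis unfolding exact_cover_iff[OF ne] has_set_cover_list_iff[OF assms(1)]
  proof (intro iffI; elim exE conjE)
    fix P assume "P \<subseteq> set ` set (cover_sets d k (n, F, t))" "disjoint P" "\<Union>P = {..<universe_size n (ceil_div t k)}"
    then show "\<exists>Cs. set Cs \<subseteq> set F \<and> length Cs \<le> t \<and> {..<n} \<subseteq> \<Union>(set ` set Cs)"
      by (rule exact_cover_imp_set_cover[OF assms(2)])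
  next
    fix Cs assume "set Cs \<subseteq> set F" "length Cs \<le> t" "{..<n} \<subseteq> \<Union>(set ` set Cs)"
    then show "\<exists>P\<subseteq>set ` set (cover_sets d k (n, F, t)). disjoint P \<and> \<Union>P = {..<universe_size n (ceil_div t k)}"
      by (rule set_cover_imp_exact_cover[OF assms(2) F])
  qed
qed

text \<open>One set for each element is always enough. Capping \<open>t\<close> at \<open>n\<close>
  is essential: the number of tokens grows with \<open>t\<close> and must stay close to
  \<open>n / k\<close>.\<close>

lemma has_set_cover_min:
  assumes "set_cover_instance d {..<n} F"
  shows "has_set_cover {..<n} F (min t n) \<longleftrightarrow> has_set_cover {..<n} F t"
proof
  assume "has_set_cover {..<n} F (min t n)"
  then show "has_set_cover {..<n} F t" unfolding has_set_cover_def by auto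
next
  assume t: "has_set_cover {..<n} F t"
  show "has_set_cover {..<n} F (min t n)"
  proof (cases "t \<le> n")
    case False
    have "\<exists>S\<in>F. x \<in> S" if "x < n" for x using assms that unfolding set_cover_instance_def by auto
    then obtain f where f: "\<And>x. x < n \<Longrightarrow> f x \<in> F \<and> x \<in> f x" by metis
    have "f ` {..<n} \<subseteq> F" "{..<n} \<subseteq> \<Union>(f ` {..<n})" using f by auto
    moreover have "\<Union>(f ` {..<n}) \<subseteq> {..<n}" using f assms unfolding set_cover_instance_def by (intro UN_least) auto
    moreover have "card (f ` {..<n}) \<le> n" using card_image_le[of "{..<n}" f] by simp
    ultimately show ?thesis unfolding has_set_cover_def using False
      by (intro exI[of _ "f ` {..<n}"]) auto
  qed (use t in \<open>simp add: min_def\<close>)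
qed

definition truncate_second :: prog where
  "truncate_second = pair_prog (Assign (Left Var)) (pair_prog (Assign (Left (Right Var)))
     (Seq (Assign (NodeE (Left Var) (Right (Right Var)))) truncate_prog))"

lemma runs_truncate_second:
  "runs truncate_second (Node (enc n) (Node f (enc t))) (Node (enc n) (Node f (enc (min t n)))) (2240 * n + 800)"
proof -
  let ?s = "Node (enc n) (Node f (enc t))"
  have "runs (Seq (Assign (NodeE (Left Var) (Right (Right Var)))) truncate_prog) ?s (enc (min t n)) (7 + (n * 140 + 30))"
    by (rule runs_Seq[OF runs_Assign runs_truncate_prog]) simp_all
  moreover have "runs (Assign (Left (Right Var))) ?s f 4" by (rule runs_Assign) simp_all
  moreover have "runs (Assign (Left Var)) ?s (enc n) 3" by (rule runs_Assign) simp_all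
  ultimately have "runs truncate_second ?s (Node (enc n) (Node f (enc (min t n))))
      (4 * 3 + 4 * (4 * 4 + 4 * (7 + (n * 140 + 30)) + 16) + 16)"
    unfolding truncate_second_def by (intro runs_pair_prog)
  then show ?thesis by (rule runs_mono) simp
qed

text \<open>The gap between \<open>b\<close> and \<open>b'\<close> is spent on the tokens:
  \<open>\<rho> ^ n\<close> has to dominate the cost of about \<open>n / k\<close> of them.\<close>

lemma partition_solvable_imp_set_cover_solvable:
  assumes TP: "\<And>\<sigma> \<delta>. 0 < \<sigma> \<Longrightarrow> 0 < \<delta> \<Longrightarrow> triangle_partition_solvable \<sigma> \<delta> b"
    and b: "1 \<le> b" "b \<le> 2" "b < b'"
  shows "set_cover_solvable d b'"
proof -
  define \<rho> where "\<rho> = b' / b"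
  have \<rho>: "1 < \<rho>" "b' = b * \<rho>" using b by (simp_all add: \<rho>_def)
  \<comment> \<open>A token costs three elements of the universe, hence a factor
    \<open>b ^ 3\<close>, which is at most 8. One token per \<open>k\<close> elements is then paid
    by \<open>\<rho> ^ k\<close>.\<close>
  obtain k0 where "8 < \<rho> ^ k0" using real_arch_pow[OF \<rho>(1)] by blast
  moreover have "k0 \<noteq> 0" using calculation by (cases k0) auto
  ultimately obtain k where k: "0 < k" "8 \<le> \<rho> ^ k" by (intro that[of k0]) auto
  define r where "r = d * k + 3"
  obtain P c where P: "\<And>n E Q e q. simple_graph {..<n} E \<Longrightarrow> is_hub (3 * r) r {..<n} E Q \<Longrightarrow>
      encodes_family E e \<Longrightarrow> encodes_vertices Q q \<Longrightarrow> decides_within P (Node (enc_nat n) (Node e q))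
          (has_triangle_partition {..<n} E) (time_bound b (card Q) n c)"
  proof -
    have "triangle_partition_solvable (3 * r) r b" by (rule TP) (simp_all add: r_def)
    then show ?thesis using that unfolding triangle_partition_solvable_def by blast
  qed
  obtain p R where p: "poly_bounded p" "mono p"
    "\<And>x. runs R (enc x) (enc (partition_instance (cover_instance d k x))) (p (esize x))"
    "\<And>x. esize (partition_instance (cover_instance d k x)) \<le> p (esize x)"
    using ptime_comp[OF ptime_partition_instance ptime_cover_instance] by (rule ptimeE) blast
  define s where "s n = n + ((n + 1) ^ d * (d * (n + 1) + 1) + n + 2)" for n :: nat
  \<comment> \<open>The losses by rounding: 4 bounds \<open>b ^ 2\<close> for the two rounding
    dummies, and \<open>\<rho> ^ k\<close> comes from rounding up the number of groups.\<close>
  define a where "a = nat \<lceil>4 * \<rho> ^ k\<rceil>"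
  define q where "q n = 2240 * n + 800 + p (s n) + a * (c * (p (s n) + 1) ^ c)" for n
  have "poly_bounded q" unfolding q_def s_def
    by (intro poly_bounded_intros poly_bounded_comp[OF p(1)])
  then obtain c' where c': "\<And>m n. b' ^ m * real (q n) \<le> time_bound b' m n c'"
    using time_bound_poly_bounded[of q b'] b by fastforce
  show ?thesis unfolding set_cover_solvable_def
  proof (intro exI[of _ "Seq truncate_second (Seq R P)"] exI[of _ c'] allI impI, elim conjE)
    fix n F t f
    assume F: "set_cover_instance d {..<n} F" and f: "encodes_family F f"
    obtain xss where x: "distinct (map set xss)" "\<forall>xs\<in>set xss. distinct xs" "set ` set xss = F" "f = enc xss"
      using f by (auto simp: encodes_family_iff)
    define t' where "t' = min t n"
    define B where "B = ceil_div t' k"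
    define N where "N = universe_size n B"
    have F': "set_cover_instance d {..<n} (set ` set xss)" using F x(3) by simp
    obtain nv es where G: "partition_instance (N, cover_sets d k (n, xss, t')) = (nv, es, [0..<N])"
      "simple_graph {..<nv} (set ` set es)" "is_hub (3 * r) r {..<nv} (set ` set es) {..<N}"
      "encodes_family (set ` set es) (enc es)" "encodes_vertices {..<N} (enc [0..<N])"
      "has_triangle_partition {..<nv} (set ` set es) \<longleftrightarrow> exact_cover (cover_sets d k (n, xss, t')) {..<N}"
      using partition_instance_correct[OF cover_sets_props(1)[of n t' k d xss] cover_sets_props(2)]
      unfolding N_def B_def r_def by blast
    have inst: "partition_instance (cover_instance d k (n, xss, t')) = (nv, es, [0..<N])"
      using G(1) by (simp add: cover_instance_def N_def B_def)
    have "esize xss \<le> (n + 1) ^ d * (d * (n + 1) + 1)"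
      using F' by (intro esize_family x(1,2)) (auto simp: set_cover_instance_def)
    then have es: "esize (n, xss, t') \<le> s n" by (simp add: s_def t'_def)
    have R: "runs R (enc (n, xss, t')) (enc (nv, es, [0..<N])) (p (s n))"
      using runs_mono[OF p(3)[of "(n, xss, t')"] monoD[OF p(2) es]] unfolding inst .
    have nv: "nv \<le> p (s n)"
      using order_trans[OF p(4)[of "(n, xss, t')"] monoD[OF p(2) es]] unfolding inst by simp
    obtain y K where y: "runs P (Node (enc_nat nv) (Node (enc es) (enc [0..<N]))) y K"
      "real K \<le> time_bound b (card {..<N}) nv c" "y \<noteq> Leaf \<longleftrightarrow> has_triangle_partition {..<nv} (set ` set es)"
      using P[OF G(2-5)] by (rule decides_withinE)
    have run: "runs (Seq truncate_second (Seq R P)) (Node (enc_nat n) (Node f (enc_nat t))) y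
        (2240 * n + 800 + (p (s n) + K))"
      unfolding enc_nat_def[symmetric]
    proof (rule runs_Seq[OF runs_truncate_second runs_Seq])
      show "runs R (Node (enc n) (Node f (enc (min t n)))) (enc (nv, es, [0..<N])) (p (s n))"
        using R x(4) by (simp add: t'_def)
      show "runs P (enc (nv, es, [0..<N])) y K" using y(1) by (simp add: enc_nat_def)
    qed
    have ans: "y \<noteq> Leaf \<longleftrightarrow> has_set_cover {..<n} F t"
      unfolding y(3) G(6) N_def B_def exact_cover_cover_sets_iff[OF F' k(1)] x(3)
      unfolding t'_def by (rule has_set_cover_min[OF F])
    have "t' \<le> n" by (simp add: t'_def)
    then have kB: "k * B \<le> n + k" using mult_ceil_div[OF k(1), of t'] unfolding B_def by linarith
    have "b ^ N \<le> b ^ (n + 3 * B + 2)"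
      using universe_size_bounds(2)[of n B] b(1) unfolding N_def by (intro power_increasing) auto
    also have "\<dots> = b ^ n * (b ^ 3) ^ B * b ^ 2" unfolding power_add power_mult ..
    also have "\<dots> \<le> b ^ n * 8 ^ B * 4"
    proof (intro mult_mono power_mono)
      show "b ^ 3 \<le> 8" using power_mono[OF b(2), of 3] b(1) by simp
      show "b ^ 2 \<le> 4" using power_mono[OF b(2), of 2] b(1) by simp
    qed (use b in auto)
    also have "\<dots> \<le> b ^ n * (\<rho> ^ k) ^ B * 4"
      using b(1) k(2) by (intro mult_right_mono mult_left_mono power_mono) auto
    also have "(\<rho> ^ k) ^ B = \<rho> ^ (k * B)" by (simp add: power_mult)
    also have "b ^ n * \<rho> ^ (k * B) * 4 \<le> b ^ n * \<rho> ^ (n + k) * 4"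
      using b(1) \<rho>(1) kB by (intro mult_right_mono mult_left_mono power_increasing) auto
    also have "\<dots> = b' ^ n * (4 * \<rho> ^ k)" unfolding \<rho>(2) by (simp add: power_add power_mult_distrib)
    also have "\<dots> \<le> b' ^ n * real a"
      unfolding a_def using b \<rho>(1) by (intro mult_left_mono real_nat_ceiling_ge) auto
    finally have bN: "b ^ N \<le> b' ^ n * real a" .
    have "real K \<le> b ^ N * (real c * (real nv + 1) ^ c)" using y(2) by (simp add: time_bound_def)
    also have "\<dots> \<le> (b' ^ n * real a) * (real c * (real (p (s n)) + 1) ^ c)"
      using nv b(1,3) by (intro mult_mono bN power_mono mult_left_mono) auto
    finally have K: "real K \<le> b' ^ n * real (a * (c * (p (s n) + 1) ^ c))" by (simp add: add.commute mult.assoc)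
    have one: "1 \<le> b' ^ n" using b by (intro one_le_power) simp
    have "real (2240 * n + 800 + p (s n)) \<le> b' ^ n * real (2240 * n + 800 + p (s n))"
      using mult_right_mono[OF one, of "real (2240 * n + 800 + p (s n))"] by simp
    with K have "real (2240 * n + 800 + (p (s n) + K)) \<le> b' ^ n * real (q n)"
      unfolding q_def by (simp add: algebra_simps)
    also have "\<dots> \<le> time_bound b' n n c'" by (rule c')
    finally show "decides_within (Seq truncate_second (Seq R P)) (Node (enc_nat n) (Node f (enc_nat t)))
        (has_set_cover {..<n} F t) (time_bound b' n n c')"
      unfolding decides_within_iff_runs using run ans by blast
  qed
qed

section \<open>Counters and hashing\<close>

text \<open>An odometer in base \<open>s\<close> with the least significant digit first. The loop
  over all guesses is driven by such a counter.\<close>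

fun inc :: "nat \<Rightarrow> nat list \<Rightarrow> nat list" where
  "inc s [] = []"
| "inc s (d # ds) = (if d + 1 < s then (d + 1) # ds else 0 # inc s ds)"

fun digits :: "nat \<Rightarrow> nat \<Rightarrow> nat \<Rightarrow> nat list" where
  "digits s 0 i = []"
| "digits s (Suc l) i = (i mod s) # digits s l (i div s)"

lemma length_digits [simp]: "length (digits s l i) = l"
  by (induction l arbitrary: i) auto

lemma inc_digits: "0 < s \<Longrightarrow> inc s (digits s l i) = digits s l (Suc i)"
proof (induction l arbitrary: i)
  case (Suc l)
  show ?case
  proof (cases "i mod s + 1 < s")
    case True
    then have "Suc i mod s = i mod s + 1" "Suc i div s = i div s" by (auto simp: mod_Suc div_Suc)
    then show ?thesis using True by simp
  next
    case False
    then have "Suc (i mod s) = s" using mod_less_divisor[OF Suc.prems, of i] by simp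
    then have "Suc i mod s = 0" "Suc i div s = Suc (i div s)" by (auto simp: mod_Suc div_Suc)
    then show ?thesis using False Suc by simp
  qed
qed simp

lemma digits_surj:
  "\<forall>d\<in>set u. d < s \<Longrightarrow> \<exists>i<s ^ length u. digits s (length u) i = u"
proof (induction u)
  case (Cons d u)
  then obtain i where i: "i < s ^ length u" "digits s (length u) i = u" by auto
  have d: "d < s" using Cons.prems by simp
  have "d + s * i < s * s ^ length u"
  proof -
    have "d + s * i < s + s * i" using d by simp
    also have "\<dots> = s * Suc i" by simp
    also have "\<dots> \<le> s * s ^ length u" using i(1) by (intro mult_le_mono2) simp
    finally show ?thesis .
  qed
  then show ?case using i d by (intro exI[of _ "d + s * i"]) simp
qed simp

lemma digits_inj: "i < s ^ l \<Longrightarrow> j < s ^ l \<Longrightarrow> digits s l i = digits s l j \<Longrightarrow> i = j"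
proof (induction l arbitrary: i j)
  case (Suc l)
  have "i div s < s ^ l" "j div s < s ^ l" using Suc.prems(1,2) by (auto simp: less_mult_imp_div_less mult.commute)
  then have "i div s = j div s" using Suc by simp
  then show ?case using Suc.prems(3) by (metis digits.simps(2) list.inject div_mult_mod_eq)
qed simp

lemma digits_0: "digits s l 0 = replicate l 0"
  by (induction l) auto

text \<open>Overflow to all zeros is the termination test of the search. The counter also starts at
  zero, whence \<open>0 < i\<close>: the test is applied after incrementing.\<close>

lemma digits_zero_iff:
  assumes "0 < i" "i \<le> s ^ l" "0 < s"
  shows "(\<forall>d\<in>set (digits s l i). d = 0) \<longleftrightarrow> i = s ^ l"
proof -
  have *: "(\<forall>d\<in>set (digits s l i). d = 0) \<longleftrightarrow> s ^ l dvd i" for i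
  proof (induction l arbitrary: i)
    case (Suc l)
    have "(\<forall>d\<in>set (digits s (Suc l) i). d = 0) \<longleftrightarrow> i mod s = 0 \<and> s ^ l dvd i div s"
      using Suc[of "i div s"] by simp
    also have "\<dots> \<longleftrightarrow> s ^ Suc l dvd i"
    proof
      assume "i mod s = 0 \<and> s ^ l dvd i div s"
      then obtain m where "i div s = s ^ l * m" "s dvd i" by (auto elim: dvdE)
      then have "i = s ^ Suc l * m" by (metis dvd_mult_div_cancel mult.assoc power_Suc)
      then show "s ^ Suc l dvd i" by simp
    next
      assume "s ^ Suc l dvd i"
      then obtain m where "i = s ^ Suc l * m" ..
      then have "i = s * (s ^ l * m)" by (simp add: mult.assoc)
      then show "i mod s = 0 \<and> s ^ l dvd i div s" using assms(3) by simp
    qed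
    finally show ?case .
  qed simp
  show ?thesis unfolding * using assms dvd_imp_le by (metis dvd_refl le_antisym)
qed

section \<open>Toeplitz hashing over the field with two elements\<close>

fun dot :: "bool list \<Rightarrow> bool list \<Rightarrow> bool" where
  "dot (x # xs) (y # ys) \<longleftrightarrow> (x \<and> y) \<noteq> dot xs ys"
| "dot _ _ \<longleftrightarrow> False"

lemma dot_Nil [simp]: "\<not> dot xs []" by (cases xs) auto

lemma dot_xor:
  "length a = length b \<Longrightarrow> dot (map2 (\<noteq>) a b) r \<longleftrightarrow> dot a r \<noteq> dot b r"
proof (induction a b arbitrary: r rule: list_induct2)
  case (Cons x xs y ys)
  then show ?case by (cases r) auto
qed simp

lemma finite_bool_lists: "finite {r :: bool list. length r = m}"
  using finite_lists_length_eq[of "UNIV :: bool set" m] by simp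

lemma card_bool_lists: "card {r :: bool list. length r = m} = 2 ^ m"
  using card_lists_length_eq[of "UNIV :: bool set" m] by simp

lemma dot_drop_False: "dot (False # d) (drop i (x # r)) \<longleftrightarrow> dot d (drop i r)"
proof (cases "drop i (x # r)")
  case Nil
  then have "length r \<le> i" by simp
  then show ?thesis using Nil by simp
next
  case (Cons y ys)
  then have "drop i r = ys" by (metis drop_Suc_Cons drop_Suc tl_drop list.sel(3))
  then show ?thesis using Cons by simp
qed

text \<open>The rows \<open>drop i r\<close> of a Toeplitz matrix with random entries \<open>r\<close> map a fixed nonzero vector to
  a uniformly distributed one: the leading bit of each row appears in no later row.\<close>

lemma card_toeplitz_kernel:
  assumes "True \<in> set d" "length d + j \<le> m + 1"
  shows "card {r. length r = m \<and> (\<forall>i<j. \<not> dot d (drop i r))} = 2 ^ (m - j)"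
  using assms
proof (induction m arbitrary: d j)
  case 0
  then have "j = 0" by (cases d) auto
  then show ?case using card_bool_lists[of 0] by simp
next
  case (Suc m)
  show ?case
  proof (cases d)
    case (Cons b d')
    let ?Z = "\<lambda>j d m. {r. length r = m \<and> (\<forall>i<j. \<not> dot d (drop i r))}"
    have fin: "finite (?Z j d m)" for j d m
      by (rule finite_subset[OF _ finite_bool_lists[of m]]) auto
    show ?thesis
    proof (cases b)
      case False
      have d': "True \<in> set d'" using Suc.prems(1) Cons False by simp
      then have jm: "j \<le> m" using Suc.prems(2) Cons by (cases d') auto
      \<comment> \<open>A leading zero of \<open>d\<close> makes all rows ignore the first entry of
        the seed, in effect shifting \<open>d\<close> against the rows; that entry is free and
        doubles the count.\<close>
      have "?Z j d (Suc m) = (\<lambda>(x, r). x # r) ` (UNIV \<times> ?Z j d' m)"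
      proof (intro equalityI subsetI)
        fix r assume r: "r \<in> ?Z j d (Suc m)"
        then obtain x r' where "r = x # r'" by (cases r) auto
        then show "r \<in> (\<lambda>(x, r). x # r) ` (UNIV \<times> ?Z j d' m)"
          using r Cons False dot_drop_False by (intro image_eqI[of _ _ "(x, r')"]) auto
      next
        fix r assume "r \<in> (\<lambda>(x, r). x # r) ` (UNIV \<times> ?Z j d' m)"
        then obtain x r' where "r = x # r'" "r' \<in> ?Z j d' m" by auto
        then show "r \<in> ?Z j d (Suc m)" using Cons False dot_drop_False by auto
      qed
      then have "card (?Z j d (Suc m)) = card ((UNIV :: bool set) \<times> ?Z j d' m)"
        by (simp add: card_image inj_on_def split_beta)
      also have "\<dots> = 2 * 2 ^ (m - j)"
        using Suc.IH[OF d'] Suc.prems(2) Cons by (simp add: card_cartesian_product)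
      also have "\<dots> = 2 ^ (Suc m - j)" using jm by (simp add: Suc_diff_le)
      finally show ?thesis .
    next
      case True
      show ?thesis
      proof (cases j)
        case 0
        then show ?thesis using card_bool_lists[of "Suc m"] by simp
      next
        case (Suc j')
        \<comment> \<open>With a leading one, the first row determines the first entry of the seed,
          and the later rows are the rows of the rest.\<close>
        have *: "(\<forall>i<j. \<not> dot d (drop i (x # r))) \<longleftrightarrow> x = dot d' r \<and> (\<forall>i<j'. \<not> dot d (drop i r))" for x r
          unfolding Suc All_less_Suc2 using Cons True by auto
        have "?Z j d (Suc m) = (\<lambda>r. dot d' r # r) ` ?Z j' d m"
        proof (intro equalityI subsetI)
          fix r assume r: "r \<in> ?Z j d (Suc m)"
          then obtain x r' where "r = x # r'" by (cases r) auto
          then show "r \<in> (\<lambda>r. dot d' r # r) ` ?Z j' d m" using r * by auto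
        next
          fix r assume "r \<in> (\<lambda>r. dot d' r # r) ` ?Z j' d m"
          then show "r \<in> ?Z j d (Suc m)" using * by auto
        qed
        then have "card (?Z j d (Suc m)) = card (?Z j' d m)" by (simp add: card_image inj_on_def)
        also have "\<dots> = 2 ^ (m - j')" using Suc.IH[of d j'] \<open>j = Suc j'\<close> Suc.prems by simp
        finally show ?thesis using Suc by simp
      qed
    qed
  qed (use Suc.prems in simp)
qed

text \<open>Ordered pairs are counted, so a class of more than \<open>k\<close> elements contributes
  at least \<open>k * (k + 1)\<close>.\<close>

definition collisions :: "(nat \<Rightarrow> bool list) \<Rightarrow> nat \<Rightarrow> bool list \<Rightarrow> nat set \<Rightarrow> nat" where
  "collisions nm j r X =
     card {(u, v). u \<in> X \<and> v \<in> X \<and> u \<noteq> v \<and> (\<forall>i<j. dot (nm u) (drop i r) = dot (nm v) (drop i r))}"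

lemma card_filter_eq_sum: "finite A \<Longrightarrow> card {x \<in> A. P x} = (\<Sum>x\<in>A. if P x then 1 else 0 :: nat)"
  by (simp add: sum.inter_filter[symmetric])

text \<open>This is the expectation: two different names collide under \<open>j\<close> hash bits
  with probability \<open>2 ^ -j\<close>. The double sum over seeds and pairs is swapped, and
  \<open>card_toeplitz_kernel\<close> is applied to the nonzero sum of the two names.\<close>

lemma sum_collisions:
  assumes X: "finite X" "inj_on nm X" "\<And>v. v \<in> X \<Longrightarrow> length (nm v) = w" and m: "w + j \<le> m"
  shows "(\<Sum>r | length r = m. collisions nm j r X) = card X * (card X - 1) * 2 ^ (m - j)"
proof -
  let ?Q = "{(u, v). u \<in> X \<and> v \<in> X \<and> u \<noteq> v}"
  let ?R = "{r :: bool list. length r = m}"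
  let ?ok = "\<lambda>(u, v) r. \<forall>i<j. dot (nm u) (drop i r) = dot (nm v) (drop i r)"
  have Q: "?Q = X \<times> X - (\<lambda>x. (x, x)) ` X" by auto
  have finQ: "finite ?Q" unfolding Q using X(1) by simp
  have cardQ: "card ?Q = card X * (card X - 1)"
    unfolding Q using X(1) by (subst card_Diff_subset) (auto simp: card_image inj_on_def card_cartesian_product algebra_simps)
  have "(\<Sum>r\<in>?R. collisions nm j r X) = (\<Sum>r\<in>?R. \<Sum>q\<in>?Q. if ?ok q r then 1 else 0 :: nat)"
  proof (rule sum.cong[OF refl])
    fix r
    have "collisions nm j r X = card {q \<in> ?Q. ?ok q r}" unfolding collisions_def by (rule arg_cong[of _ _ card]) auto
    also have "\<dots> = (\<Sum>q\<in>?Q. if ?ok q r then 1 else 0)"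
      by (rule card_filter_eq_sum[OF finQ])
    finally show "collisions nm j r X = (\<Sum>q\<in>?Q. if ?ok q r then 1 else 0)" .
  qed
  also have "\<dots> = (\<Sum>q\<in>?Q. \<Sum>r\<in>?R. if ?ok q r then 1 else 0)" by (rule sum.swap)
  also have "\<dots> = (\<Sum>q\<in>?Q. (2 :: nat) ^ (m - j))"
  proof (rule sum.cong[OF refl])
    fix q assume "q \<in> ?Q"
    then obtain u v where uv: "q = (u, v)" "u \<in> X" "v \<in> X" "u \<noteq> v" by auto
    let ?d = "map2 (\<noteq>) (nm u) (nm v)"
    have len: "length (nm u) = length (nm v)" "length ?d = w" using X(3) uv by auto
    have "nm u \<noteq> nm v" using X(2) uv by (auto dest: inj_onD)
    then obtain i where i: "i < length (nm u)" "nm u ! i \<noteq> nm v ! i" using len(1) nth_equalityI by blast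
    then have "?d ! i = True" "i < length ?d" using len by simp_all
    then have "True \<in> set ?d" by (metis nth_mem)
    then have "card {r. length r = m \<and> (\<forall>i<j. \<not> dot ?d (drop i r))} = 2 ^ (m - j)"
      using len m by (intro card_toeplitz_kernel) auto
    moreover have "{r. length r = m \<and> (\<forall>i<j. \<not> dot ?d (drop i r))} = {r \<in> ?R. ?ok q r}"
      unfolding uv dot_xor[OF len(1)] by auto
    ultimately show "(\<Sum>r\<in>?R. if ?ok q r then 1 else 0) = (2 :: nat) ^ (m - j)"
      using card_filter_eq_sum[OF finite_bool_lists[of m], of "?ok q"] by simp
  qed
  also have "\<dots> = card X * (card X - 1) * 2 ^ (m - j)" using cardQ by simp
  finally show ?thesis .
qed

lemma collisions_0: "finite X \<Longrightarrow> collisions nm 0 r X = card X * (card X - 1)"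
proof -
  assume X: "finite X"
  have "{(u, v). u \<in> X \<and> v \<in> X \<and> u \<noteq> v} = X \<times> X - (\<lambda>x. (x, x)) ` X" by auto
  then show ?thesis unfolding collisions_def using X
    by (simp add: card_Diff_subset card_image inj_on_def card_cartesian_product image_subset_iff algebra_simps)
qed

text \<open>The Toeplitz structure makes hashing recursive: the first bit splits \<open>X\<close>,
  and the later bits on either side are those of the seed without its first entry.\<close>

lemma collisions_Suc:
  assumes "finite X"
  shows "collisions nm (Suc j) (y # r) X =
    collisions nm j r {v \<in> X. \<not> dot (nm v) (y # r)} + collisions nm j r {v \<in> X. dot (nm v) (y # r)}"
proof -
  let ?C = "\<lambda>X. {(u, v). u \<in> X \<and> v \<in> X \<and> u \<noteq> v \<and> (\<forall>i<j. dot (nm u) (drop i r) = dot (nm v) (drop i r))}"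
  let ?A = "{v \<in> X. \<not> dot (nm v) (y # r)}" and ?B = "{v \<in> X. dot (nm v) (y # r)}"
  have "{(u, v). u \<in> X \<and> v \<in> X \<and> u \<noteq> v \<and> (\<forall>i<Suc j. dot (nm u) (drop i (y # r)) = dot (nm v) (drop i (y # r)))}
      = ?C ?A \<union> ?C ?B"
    unfolding All_less_Suc2 by auto
  moreover have "finite (?C ?A)" "finite (?C ?B)"
    by (rule finite_subset[of _ "X \<times> X"], use assms in auto)+
  moreover have "?C ?A \<inter> ?C ?B = {}" by auto
  ultimately show ?thesis unfolding collisions_def by (simp add: card_Un_disjoint)
qed

text \<open>The number of inner nodes of the binary tree in which a class is split by the next hash
  bit as long as it has more than \<open>k\<close> elements and the seed is not exhausted.\<close>

fun heavy :: "nat \<Rightarrow> (nat \<Rightarrow> bool list) \<Rightarrow> bool list \<Rightarrow> nat set \<Rightarrow> nat" where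
  "heavy k nm [] X = 0"
| "heavy k nm (y # r) X = (if card X \<le> k then 0 else
     1 + heavy k nm r {v \<in> X. \<not> dot (nm v) (y # r)} + heavy k nm r {v \<in> X. dot (nm v) (y # r)})"

fun splits :: "nat \<Rightarrow> (nat \<Rightarrow> bool list) \<Rightarrow> bool list \<Rightarrow> nat set \<Rightarrow> bool" where
  "splits k nm [] X \<longleftrightarrow> card X \<le> k"
| "splits k nm (y # r) X \<longleftrightarrow> card X \<le> k \<or>
     splits k nm r {v \<in> X. \<not> dot (nm v) (y # r)} \<and> splits k nm r {v \<in> X. dot (nm v) (y # r)}"

text \<open>At most \<open>2 ^ j0 - 1\<close> inner nodes are above depth \<open>j0\<close>. Any
  other inner node is charged to its own \<open>k * (k + 1)\<close> or more pairs that still collide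
  at its depth.\<close>

lemma heavy_le_collisions:
  "finite X \<Longrightarrow> k * (k + 1) * heavy k nm r X \<le>
    k * (k + 1) * (2 ^ j0 - 1) + (\<Sum>j=j0..length r. collisions nm j r X)"
proof (induction r arbitrary: X j0)
  case (Cons y r)
  let ?A = "{v \<in> X. \<not> dot (nm v) (y # r)}" and ?B = "{v \<in> X. dot (nm v) (y # r)}"
  let ?k = "k * (k + 1)"
  have shift: "(\<Sum>j=Suc i..Suc (length r). collisions nm j (y # r) X) =
      (\<Sum>j=i..length r. collisions nm j r ?A) + (\<Sum>j=i..length r. collisions nm j r ?B)" for i
    unfolding sum.shift_bounds_cl_Suc_ivl collisions_Suc[OF Cons.prems] sum.distrib ..
  have fin: "finite ?A" "finite ?B" using Cons.prems by auto
  show ?case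
  proof (cases "card X \<le> k")
    case False
    have h: "?k * heavy k nm (y # r) X = ?k + ?k * heavy k nm r ?A + ?k * heavy k nm r ?B"
      using False by (simp add: algebra_simps)
    show ?thesis
    proof (cases j0)
      case 0
      have "?k \<le> card X * (card X - 1)"
        using False by (subst mult.commute, intro mult_le_mono) auto
      also have "\<dots> = collisions nm 0 (y # r) X" using collisions_0[OF Cons.prems] by simp
      finally have "?k * heavy k nm (y # r) X \<le> collisions nm 0 (y # r) X +
          (\<Sum>j=0..length r. collisions nm j r ?A) + (\<Sum>j=0..length r. collisions nm j r ?B)"
        unfolding h using Cons.IH[OF fin(1), of 0] Cons.IH[OF fin(2), of 0] by simp
      also have "\<dots> = (\<Sum>j=0..Suc (length r). collisions nm j (y # r) X)"
        using shift[of 0] sum.atLeast_Suc_atMost[of 0 "Suc (length r)" "\<lambda>j. collisions nm j (y # r) X"] by simp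
      finally show ?thesis unfolding 0 by simp
    next
      case (Suc i)
      have "?k * heavy k nm (y # r) X \<le> ?k + 2 * (?k * (2 ^ i - 1)) +
          ((\<Sum>j=i..length r. collisions nm j r ?A) + (\<Sum>j=i..length r. collisions nm j r ?B))"
        unfolding h using Cons.IH[OF fin(1), of i] Cons.IH[OF fin(2), of i] by linarith
      moreover have "?k + 2 * (?k * (2 ^ i - 1)) = ?k * (2 ^ Suc i - 1)"
      proof -
        have "1 + 2 * (2 ^ i - 1) = 2 ^ Suc i - (1 :: nat)" by (cases "2 ^ i :: nat") auto
        then show ?thesis by (metis add_mult_distrib2 mult.left_commute mult.right_neutral)
      qed
      ultimately show ?thesis using shift[of i] Suc by simp
    qed
  qed simp
qed simp

text \<open>If no two names agree on the first \<open>l\<close> bits, then every class at depth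
  \<open>l\<close> has at most one element.\<close>

lemma splitsI:
  "finite X \<Longrightarrow> collisions nm l r X = 0 \<Longrightarrow> l \<le> length r \<Longrightarrow> 1 \<le> k \<Longrightarrow> splits k nm r X"
proof (induction l arbitrary: r X)
  case 0
  have "card X * (card X - 1) = 0" using 0 collisions_0[OF 0(1)] by simp
  then have "card X \<le> 1" by auto
  then show ?case using 0(4) by (cases r) auto
next
  case (Suc l)
  then obtain y r' where r: "r = y # r'" by (cases r) auto
  then show ?case using Suc collisions_Suc[OF Suc.prems(1)] by auto
qed

text \<open>Averaging over the seeds. Depth \<open>j0\<close>, where a balanced tree would have
  about \<open>p / k\<close> nodes, is the threshold: above it there are few nodes anyway, and from
  there on the expected numbers of collisions form a geometric series.\<close>

lemma exists_splitting_seed: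
  assumes X: "finite X" "inj_on nm X" "\<And>v. v \<in> X \<Longrightarrow> length (nm v) = w"
    and p: "card X \<le> p" "p \<le> 2 ^ w" and k: "1 \<le> k"
  obtains r where "length r = 3 * w + 2" "splits k nm r X"
    "heavy k nm r X \<le> 5 * ceil_div p k + 1"
proof -
  \<comment> \<open>Beyond \<open>2 * w\<close> bits collisions are unlikely because there are fewer
    than \<open>4 ^ w\<close> pairs to separate; the two extra bits give the strict inequality
    below. A seed needs \<open>w + l\<close> entries, so that all rows are long enough for names of
    length \<open>w\<close>.\<close>
  define l where "l = 2 * w + 2"
  define m where "m = 3 * w + 2"
  define q where "q = card X * (card X - 1)"
  define j0 where "j0 = (LEAST j. p \<le> k * 2 ^ j)"
  have pw: "p \<le> k * 2 ^ w" using p(2) k by (metis le_trans mult_1 mult_le_mono1)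
  have j0: "p \<le> k * 2 ^ j0" unfolding j0_def using pw by (rule LeastI)
  have j0w: "j0 \<le> w" unfolding j0_def using pw by (rule Least_le)
  have j0l: "j0 \<le> l" "l \<le> m" "w + l = m" using j0w by (auto simp: l_def m_def)
  \<comment> \<open>One quantity controls both aims. The weight makes the last term comparable to
    the sum before it, so that the average of \<open>f\<close> is at most
    \<open>3 * q / 2 ^ j0\<close>; yet a single collision at depth \<open>l\<close> would push
    \<open>f\<close> above that value.\<close>
  define f where "f r = (\<Sum>j=j0..<l. collisions nm j r X) + 2 ^ (l - j0) * collisions nm l r X" for r
  let ?R = "{r :: bool list. length r = m}"
  have geo: "b \<le> m \<Longrightarrow> a \<le> b \<Longrightarrow> (\<Sum>j=a..<b. 2 ^ (m - j)) + 2 * 2 ^ (m - b) = 2 * (2 :: nat) ^ (m - a)" for a b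
  proof (induction b)
    case (Suc b)
    show ?case
    proof (cases "a = Suc b")
      case False
      have "m - b = Suc (m - Suc b)" using Suc.prems by simp
      then have "(\<Sum>j=a..<Suc b. 2 ^ (m - j)) + 2 * 2 ^ (m - Suc b) = (\<Sum>j=a..<b. 2 ^ (m - j)) + 2 * (2 :: nat) ^ (m - b)"
        using False Suc.prems by simp
      then show ?thesis using Suc False by simp
    qed simp
  qed simp
  have "(\<Sum>r\<in>?R. f r) = (\<Sum>j=j0..<l. \<Sum>r\<in>?R. collisions nm j r X) + 2 ^ (l - j0) * (\<Sum>r\<in>?R. collisions nm l r X)"
    unfolding f_def by (simp add: sum.distrib sum_distrib_left sum.swap[of _ _ ?R])
  also have "\<dots> = (\<Sum>j=j0..<l. q * 2 ^ (m - j)) + 2 ^ (l - j0) * (q * 2 ^ (m - l))"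
    unfolding q_def using sum_collisions[OF X] j0l by (intro arg_cong2[of _ _ _ _ "(+)"] sum.cong refl) auto
  also have "(\<Sum>j=j0..<l. q * 2 ^ (m - j)) \<le> q * (2 * 2 ^ (m - j0))"
    using geo[of l j0] j0l unfolding sum_distrib_left[symmetric] by (intro mult_le_mono2) linarith
  also have "2 ^ (l - j0) * (q * 2 ^ (m - l)) = q * 2 ^ (m - j0)"
    using j0l by (simp add: power_add[symmetric])
  finally have tot: "(\<Sum>r\<in>?R. f r) \<le> 3 * q * 2 ^ (m - j0)" by simp
  \<comment> \<open>Some seed is not worse than the average; multiplying by the number of seeds
    avoids a division.\<close>
  have "\<exists>r\<in>?R. f r * 2 ^ m \<le> 3 * q * 2 ^ (m - j0)"
  proof (rule ccontr)
    assume "\<not> (\<exists>r\<in>?R. f r * 2 ^ m \<le> 3 * q * 2 ^ (m - j0))"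
    then have "(\<Sum>r\<in>?R. 3 * q * 2 ^ (m - j0)) < (\<Sum>r\<in>?R. f r * 2 ^ m)"
      using finite_bool_lists[of m] card_bool_lists[of m]
      by (intro sum_strict_mono) (auto simp: not_le ex_in_conv[symmetric] intro: exI[of _ "replicate m True"])
    also have "\<dots> = (\<Sum>r\<in>?R. f r) * 2 ^ m" by (simp add: sum_distrib_right)
    also have "\<dots> \<le> 3 * q * 2 ^ (m - j0) * 2 ^ m" by (rule mult_le_mono1[OF tot])
    finally show False using card_bool_lists[of m] by simp
  qed
  then obtain r where r: "length r = m" "f r * 2 ^ m \<le> 3 * q * 2 ^ (m - j0)" by blast
  have "2 ^ m = 2 ^ j0 * (2 :: nat) ^ (m - j0)" using j0l by (simp add: power_add[symmetric])
  then have "(f r * 2 ^ j0) * 2 ^ (m - j0) \<le> (3 * q) * 2 ^ (m - j0)" using r(2) by (simp add: mult.assoc)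
  then have "f r * 2 ^ j0 \<le> 3 * q" by simp
  also have "q \<le> p * p" unfolding q_def using p(1) by (intro mult_le_mono) auto
  finally have fr: "f r * 2 ^ j0 \<le> 3 * (p * p)" by simp
  have col: "collisions nm l r X = 0"
  proof (rule ccontr)
    assume "collisions nm l r X \<noteq> 0"
    then have "2 ^ (l - j0) \<le> f r" unfolding f_def by (simp add: trans_le_add2)
    then have "2 ^ (l - j0) * 2 ^ j0 \<le> 3 * (p * p)" using fr by (meson le_trans mult_le_mono1)
    moreover have "2 ^ (l - j0) * 2 ^ j0 = (4 :: nat) * (2 ^ w * 2 ^ w)"
      using j0l by (simp add: power_add[symmetric]) (simp add: l_def mult_2 power_add)
    moreover have "p * p \<le> 2 ^ w * 2 ^ w" using p(2) by (intro mult_le_mono)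
    moreover have "0 < (2 :: nat) ^ w * 2 ^ w" by simp
    ultimately show False by linarith
  qed
  have mono: "collisions nm j r X \<le> collisions nm l r X" if "l \<le> j" for j
    unfolding collisions_def
    by (rule card_mono) (use that X(1) in \<open>auto intro: finite_subset[of _ "X \<times> X"]\<close>)
  have "(\<Sum>j=j0..length r. collisions nm j r X) = (\<Sum>j=j0..<l. collisions nm j r X)"
  proof (rule sum.mono_neutral_right)
    show "\<forall>j\<in>{j0..length r} - {j0..<l}. collisions nm j r X = 0" using mono col by auto
  qed (use r(1) j0l in auto)
  also have "\<dots> \<le> f r" unfolding f_def by simp
  finally have hv: "k * (k + 1) * heavy k nm r X \<le> k * (k + 1) * (2 ^ j0 - 1) + f r"
    using heavy_le_collisions[OF X(1), of k nm r j0] by linarith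
  let ?c = "ceil_div p k"
  have c: "p \<le> k * ?c" using mult_ceil_div[of k p] k by simp
  have "2 ^ j0 - 1 \<le> 2 * ?c"
  proof (cases j0)
    case (Suc i)
    then have "\<not> p \<le> k * 2 ^ i" using not_less_Least[of i "\<lambda>j. p \<le> k * 2 ^ j"] unfolding j0_def by simp
    then have "k * 2 ^ i < k * ?c" using c by linarith
    then have "2 ^ i < ?c" by simp
    then have "2 * 2 ^ i - 1 \<le> 2 * ?c" by linarith
    then show ?thesis using Suc by simp
  qed simp
  then have 1: "k * (k + 1) * (2 ^ j0 - 1) \<le> k * (k + 1) * (2 * ?c)" by (rule mult_le_mono2)
  have "f r * 2 ^ j0 \<le> (3 * p * k) * 2 ^ j0"
  proof -
    have "3 * (p * p) \<le> 3 * (p * (k * 2 ^ j0))" using j0 by (intro mult_le_mono2)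
    then have "f r * 2 ^ j0 \<le> 3 * (p * (k * 2 ^ j0))" using fr by (rule order_trans[rotated])
    then show ?thesis by (simp only: mult.assoc)
  qed
  then have "f r \<le> 3 * p * k" by simp
  also have "\<dots> \<le> 3 * (k * ?c) * (k + 1)" using c by (intro mult_le_mono) auto
  finally have "k * (k + 1) * heavy k nm r X \<le> k * (k + 1) * (2 * ?c) + 3 * (k * ?c) * (k + 1)"
    using hv 1 by linarith
  also have "\<dots> = k * (k + 1) * (5 * ?c)" by (simp add: algebra_simps)
  finally have "heavy k nm r X \<le> 5 * ?c" using k by (simp del: mult_Suc_right)
  then show ?thesis
    using splitsI[OF X(1) col] r(1) j0l k by (intro that[of r]) (auto simp: m_def)
qed

section \<open>From coloured exact cover to set cover\<close>

text \<open>A choice \<open>(v, S, x)\<close> covers \<open>S\<close>, gains \<open>x\<close> and uses the colour \<open>v\<close>; each colour may be used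
  once.\<close>

type_synonym choice = "nat \<times> nat list \<times> nat"

definition cells :: "choice \<Rightarrow> nat set" where
  "cells q = set (fst (snd q))"

definition gain :: "choice \<Rightarrow> nat" where
  "gain q = snd (snd q)"

definition compatible :: "choice set \<Rightarrow> bool" where
  "compatible Q \<longleftrightarrow> inj_on fst Q \<and> (\<forall>q\<in>Q. \<forall>q'\<in>Q. q \<noteq> q' \<longrightarrow> cells q \<inter> cells q' = {})"

definition coloured_cover :: "nat \<Rightarrow> choice list \<Rightarrow> nat \<Rightarrow> bool" where
  "coloured_cover p qs t \<longleftrightarrow>
     (\<exists>Q\<subseteq>set qs. compatible Q \<and> \<Union>(cells ` Q) = {..<p} \<and> t \<le> (\<Sum>q\<in>Q. gain q))"

text \<open>The binary expansion of a colour, which is the vector that is hashed.\<close>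

definition name :: "nat \<Rightarrow> nat \<Rightarrow> bool list" where
  "name w v = map (\<lambda>d. d \<noteq> 0) (digits 2 w v)"

lemma name_inj: "inj_on (name w) {..<2 ^ w}"
proof (rule inj_onI)
  fix u v assume uv: "u \<in> {..<2 ^ w}" "v \<in> {..<2 ^ w}" "name w u = name w v"
  have d: "d < 2" if "d \<in> set (digits 2 l i)" for d l i using that by (induction l arbitrary: i) auto
  have "inj_on (\<lambda>d. d \<noteq> 0) ({..<2} :: nat set)" by (auto simp: inj_on_def)
  then have "digits 2 w u = digits 2 w v"
    using uv(3) d unfolding name_def by (intro map_inj_on[of "\<lambda>d. d \<noteq> 0"]) (auto elim!: inj_on_subset)
  then show "u = v" using digits_inj uv by auto
qed

text \<open>The entries are the index, the colours, the number of elements to be covered and the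
  gain required.\<close>

type_synonym bucket = "nat \<times> nat list \<times> nat \<times> nat"

text \<open>The colours are distributed to buckets by descending a binary tree, which is given by its
  symbols in preorder: a symbol with first entry 0 splits the colours on top of the stack by the next
  hash bit, any other symbol makes a bucket, labelled with the number of elements that it shall cover
  and the gain that it shall have.\<close>

definition split_step :: "nat \<Rightarrow> (bool list \<times> nat list) list \<times> bucket list \<Rightarrow> nat \<times> nat \<times> nat \<Rightarrow>
    (bool list \<times> nat list) list \<times> bucket list" where
  "split_step w st y = (case fst st of [] \<Rightarrow> st | c # cs \<Rightarrow>
     if fst y = 0 then
       ((tl (fst c), filter (\<lambda>v. \<not> dot (name w v) (fst c)) (snd c)) #
        (tl (fst c), filter (\<lambda>v. dot (name w v) (fst c)) (snd c)) # cs, snd st)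
     else (cs, snd st @ [(length (snd st), snd c, snd y)]))"

definition buckets :: "nat \<Rightarrow> nat \<Rightarrow> bool list \<Rightarrow> (nat \<times> nat \<times> nat) list \<Rightarrow> bucket list" where
  "buckets w n r us = snd (foldl (split_step w) ([(r, [0..<n])], []) us)"

definition split_inv :: "(bool list \<times> nat list) list \<times> bucket list \<Rightarrow> bool" where
  "split_inv st \<longleftrightarrow> distinct (concat (map snd (fst st)) @ concat (map (\<lambda>b. fst (snd b)) (snd st))) \<and>
     map fst (snd st) = [0..<length (snd st)]"

lemma split_inv_step: "split_inv st \<Longrightarrow> split_inv (split_step w st y)"
  by (cases "fst st") (auto simp: split_inv_def split_step_def)

lemma split_inv_foldl: "split_inv st \<Longrightarrow> split_inv (foldl (split_step w) st us)"
  by (induction us arbitrary: st) (auto simp: split_inv_step)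

lemma buckets_inv:
  "distinct (concat (map (\<lambda>b. fst (snd b)) (buckets w n r us)))"
  "map fst (buckets w n r us) = [0..<length (buckets w n r us)]"
  using split_inv_foldl[of "([(r, [0..<n])], [])" w us] unfolding split_inv_def buckets_def by auto

lemma length_foldl_split_step: "length (snd (foldl (split_step w) st us)) \<le> length (snd st) + length us"
proof (induction us arbitrary: st)
  case (Cons y us)
  have "length (snd (split_step w st y)) \<le> length (snd st) + 1"
    by (cases "fst st") (auto simp: split_step_def)
  then show ?case using Cons[of "split_step w st y"] by simp
qed simp

lemma length_buckets: "length (buckets w n r us) \<le> length us"
  using length_foldl_split_step[of w "([(r, [0..<n])], [])" us] by (simp add: buckets_def)

text \<open>\<open>W\<close> is the set of used colours: only these count for the load, while all
  colours \<open>vs\<close> are distributed. A full binary tree with \<open>h\<close> inner nodes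
  has \<open>1 + 2 * h\<close> nodes, one symbol each. The word works above any stack
  \<open>rest\<close> and output \<open>out\<close>, so that the words of two subtrees can be
  concatenated. The label may depend on the colours that reach the bucket.\<close>

lemma split_complete:
  fixes lab :: "nat list \<Rightarrow> nat \<times> nat"
  assumes "splits k (name w) r (W \<inter> set vs)"
  shows "\<exists>us. length us = 1 + 2 * heavy k (name w) r (W \<inter> set vs) \<and>
    (\<forall>u\<in>set us. u = (0, 0, 0) \<or> (\<exists>vs'. u = (1, lab vs') \<and> card (W \<inter> set vs') \<le> k)) \<and>
    (\<forall>rest out. \<exists>bs. foldl (split_step w) ((r, vs) # rest, out) us = (rest, out @ bs) \<and>
      set vs = (\<Union>b\<in>set bs. set (fst (snd b))) \<and>
      (\<forall>b\<in>set bs. snd (snd b) = lab (fst (snd b)) \<and> card (W \<inter> set (fst (snd b))) \<le> k))"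
  using assms
proof (induction r arbitrary: vs)
  case Nil
  show ?case
    by (rule exI[of _ "[(1, lab vs)]"]) (use Nil in \<open>auto simp: split_step_def\<close>)
next
  case (Cons y r)
  show ?case
  proof (cases "card (W \<inter> set vs) \<le> k")
    case True
    show ?thesis
      by (rule exI[of _ "[(1, lab vs)]"]) (use True in \<open>auto simp: split_step_def\<close>)
  next
    case False
    let ?vs0 = "filter (\<lambda>v. \<not> dot (name w v) (y # r)) vs" and ?vs1 = "filter (\<lambda>v. dot (name w v) (y # r)) vs"
    have eq: "{v \<in> W \<inter> set vs. \<not> dot (name w v) (y # r)} = W \<inter> set ?vs0"
      "{v \<in> W \<inter> set vs. dot (name w v) (y # r)} = W \<inter> set ?vs1" by auto
    have sp: "splits k (name w) r (W \<inter> set ?vs0)" "splits k (name w) r (W \<inter> set ?vs1)"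
      using Cons.prems False eq by simp_all
    from Cons.IH[OF sp(1)] obtain us0 where us0: "length us0 = 1 + 2 * heavy k (name w) r (W \<inter> set ?vs0)"
      "\<forall>u\<in>set us0. u = (0, 0, 0) \<or> (\<exists>vs'. u = (1, lab vs') \<and> card (W \<inter> set vs') \<le> k)"
      "\<forall>rest out. \<exists>bs. foldl (split_step w) ((r, ?vs0) # rest, out) us0 = (rest, out @ bs) \<and>
      set ?vs0 = (\<Union>b\<in>set bs. set (fst (snd b))) \<and>
      (\<forall>b\<in>set bs. snd (snd b) = lab (fst (snd b)) \<and> card (W \<inter> set (fst (snd b))) \<le> k)" by (elim exE conjE)
    from Cons.IH[OF sp(2)] obtain us1 where us1: "length us1 = 1 + 2 * heavy k (name w) r (W \<inter> set ?vs1)"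
      "\<forall>u\<in>set us1. u = (0, 0, 0) \<or> (\<exists>vs'. u = (1, lab vs') \<and> card (W \<inter> set vs') \<le> k)"
      "\<forall>rest out. \<exists>bs. foldl (split_step w) ((r, ?vs1) # rest, out) us1 = (rest, out @ bs) \<and>
      set ?vs1 = (\<Union>b\<in>set bs. set (fst (snd b))) \<and>
      (\<forall>b\<in>set bs. snd (snd b) = lab (fst (snd b)) \<and> card (W \<inter> set (fst (snd b))) \<le> k)" by (elim exE conjE)
    show ?thesis
    proof (intro exI[of _ "(0, 0, 0) # us0 @ us1"] conjI allI)
      show "length ((0, 0, 0) # us0 @ us1) = 1 + 2 * heavy k (name w) (y # r) (W \<inter> set vs)"
      proof -
        have "heavy k (name w) (y # r) (W \<inter> set vs) =
            1 + heavy k (name w) r (W \<inter> set ?vs0) + heavy k (name w) r (W \<inter> set ?vs1)"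
          using False unfolding heavy.simps eq by simp
        then show ?thesis using us0(1) us1(1) by simp
      qed
      show "\<forall>u\<in>set ((0, 0, 0) # us0 @ us1). u = (0, 0, 0) \<or> (\<exists>vs'. u = (1, lab vs') \<and> card (W \<inter> set vs') \<le> k)"
        using us0(2) us1(2) by auto
      fix rest out
      obtain bs0 where bs0: "foldl (split_step w) ((r, ?vs0) # (r, ?vs1) # rest, out) us0 = ((r, ?vs1) # rest, out @ bs0)"
        "set ?vs0 = (\<Union>b\<in>set bs0. set (fst (snd b)))"
        "\<forall>b\<in>set bs0. snd (snd b) = lab (fst (snd b)) \<and> card (W \<inter> set (fst (snd b))) \<le> k"
        using us0(3) by blast
      obtain bs1 where bs1: "foldl (split_step w) ((r, ?vs1) # rest, out @ bs0) us1 = (rest, (out @ bs0) @ bs1)"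
        "set ?vs1 = (\<Union>b\<in>set bs1. set (fst (snd b)))"
        "\<forall>b\<in>set bs1. snd (snd b) = lab (fst (snd b)) \<and> card (W \<inter> set (fst (snd b))) \<le> k"
        using us1(3) by blast
      have "split_step w ((y # r, vs) # rest, out) (0, 0, 0) = ((r, ?vs0) # (r, ?vs1) # rest, out)"
        by (simp add: split_step_def)
      then have "foldl (split_step w) ((y # r, vs) # rest, out) ((0, 0, 0) # us0 @ us1) = (rest, out @ (bs0 @ bs1))"
        using bs0(1) bs1(1) by simp
      moreover have "set vs = set ?vs0 \<union> set ?vs1" by auto
      then have "set vs = (\<Union>b\<in>set (bs0 @ bs1). set (fst (snd b)))" using bs0(2) bs1(2) by simp
      ultimately show "\<exists>bs. foldl (split_step w) ((y # r, vs) # rest, out) ((0, 0, 0) # us0 @ us1) = (rest, out @ bs) \<and>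
        set vs = (\<Union>b\<in>set bs. set (fst (snd b))) \<and>
        (\<forall>b\<in>set bs. snd (snd b) = lab (fst (snd b)) \<and> card (W \<inter> set (fst (snd b))) \<le> k)"
        using bs0(3) bs1(3) by (intro exI[of _ "bs0 @ bs1"]) auto
    qed
  qed
qed

text \<open>Exhaustive search of constant depth \<open>k\<close>. The colours tried so far are
  collected in \<open>used\<close>; truncated subtraction turns the gain into a lower bound.\<close>

fun colourable :: "nat \<Rightarrow> choice list \<Rightarrow> nat list \<Rightarrow> nat list \<Rightarrow> nat \<Rightarrow> bool" where
  "colourable 0 qs used A g \<longleftrightarrow> A = [] \<and> g = 0"
| "colourable (Suc k) qs used A g \<longleftrightarrow> A = [] \<and> g = 0 \<or>
     (\<exists>q\<in>set qs. fst q \<notin> set used \<and> (\<forall>y\<in>set (fst (snd q)). y \<in> set A) \<and>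
        colourable k qs (fst q # used) (filter (\<lambda>y. y \<notin> set (fst (snd q))) A) (g - snd (snd q)))"

lemma colourable_iff:
  "colourable k qs used A g \<longleftrightarrow> (\<exists>Q\<subseteq>set qs. compatible Q \<and> card Q \<le> k \<and> fst ` Q \<inter> set used = {} \<and>
     \<Union>(cells ` Q) = set A \<and> g \<le> (\<Sum>q\<in>Q. gain q))"
proof (induction k arbitrary: used A g)
  case 0
  show ?case
  proof
    assume "colourable 0 qs used A g"
    then show "\<exists>Q\<subseteq>set qs. compatible Q \<and> card Q \<le> 0 \<and> fst ` Q \<inter> set used = {} \<and> \<Union>(cells ` Q) = set A \<and> g \<le> (\<Sum>q\<in>Q. gain q)"
      by (intro exI[of _ "{}"]) (auto simp: compatible_def)
  next
    assume "\<exists>Q\<subseteq>set qs. compatible Q \<and> card Q \<le> 0 \<and> fst ` Q \<inter> set used = {} \<and> \<Union>(cells ` Q) = set A \<and> g \<le> (\<Sum>q\<in>Q. gain q)"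
    then obtain Q where Q: "Q \<subseteq> set qs" "card Q \<le> 0" "\<Union>(cells ` Q) = set A" "g \<le> (\<Sum>q\<in>Q. gain q)" by blast
    then have "Q = {}" using finite_subset[of Q "set qs"] by auto
    then show "colourable 0 qs used A g" using Q by simp
  qed
next
  case (Suc k)
  show ?case
  proof
    assume "colourable (Suc k) qs used A g"
    then consider "A = []" "g = 0" | q where "q \<in> set qs" "fst q \<notin> set used" "cells q \<subseteq> set A"
      "colourable k qs (fst q # used) (filter (\<lambda>y. y \<notin> set (fst (snd q))) A) (g - snd (snd q))"
      by (auto simp: cells_def)
    then show "\<exists>Q\<subseteq>set qs. compatible Q \<and> card Q \<le> Suc k \<and> fst ` Q \<inter> set used = {} \<and> \<Union>(cells ` Q) = set A \<and> g \<le> (\<Sum>q\<in>Q. gain q)"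
    proof cases
      case 1
      then show ?thesis by (intro exI[of _ "{}"]) (auto simp: compatible_def)
    next
      case 2
      obtain Q where Q: "Q \<subseteq> set qs" "compatible Q" "card Q \<le> k" "fst ` Q \<inter> set (fst q # used) = {}"
        "\<Union>(cells ` Q) = set (filter (\<lambda>y. y \<notin> set (fst (snd q))) A)" "g - snd (snd q) \<le> (\<Sum>q\<in>Q. gain q)"
        using 2(4) unfolding Suc.IH by blast
      have fin: "finite Q" using Q(1) finite_subset by blast
      have nq: "q \<notin> Q" and nf: "fst q \<notin> fst ` Q" using Q(4) by auto
      have U: "\<Union>(cells ` Q) = set A - cells q" using Q(5) by (auto simp: cells_def)
      have "inj_on fst (insert q Q)" using Q(2) nf nq by (simp add: compatible_def)
      moreover have "\<forall>q'\<in>Q. cells q \<inter> cells q' = {} \<and> cells q' \<inter> cells q = {}" using U by blast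
      ultimately have "compatible (insert q Q)" using Q(2) unfolding compatible_def by blast
      moreover have "\<Union>(cells ` insert q Q) = set A" using U 2(3) by auto
      moreover have "g \<le> (\<Sum>q\<in>insert q Q. gain q)" using Q(6) fin nq by (simp add: gain_def)
      ultimately show ?thesis using Q(1,3,4) 2(1,2) fin nq by (intro exI[of _ "insert q Q"]) auto
    qed
  next
    assume "\<exists>Q\<subseteq>set qs. compatible Q \<and> card Q \<le> Suc k \<and> fst ` Q \<inter> set used = {} \<and> \<Union>(cells ` Q) = set A \<and> g \<le> (\<Sum>q\<in>Q. gain q)"
    then obtain Q where Q: "Q \<subseteq> set qs" "compatible Q" "card Q \<le> Suc k" "fst ` Q \<inter> set used = {}"
      "\<Union>(cells ` Q) = set A" "g \<le> (\<Sum>q\<in>Q. gain q)" by blast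
    have fin: "finite Q" using Q(1) finite_subset by blast
    show "colourable (Suc k) qs used A g"
    proof (cases "Q = {}")
      case True
      then show ?thesis using Q by simp
    next
      case False
      then obtain q where q: "q \<in> Q" by blast
      let ?Q = "Q - {q}"
      have dj: "cells q \<inter> cells q' = {}" if "q' \<in> ?Q" for q' using Q(2) q that unfolding compatible_def by blast
      have "colourable k qs (fst q # used) (filter (\<lambda>y. y \<notin> set (fst (snd q))) A) (g - snd (snd q))"
        unfolding Suc.IH
      proof (intro exI[of _ ?Q] conjI)
        show "compatible ?Q" using Q(2) unfolding compatible_def by (auto elim: inj_on_subset)
        show "card ?Q \<le> k" using Q(3) q fin by simp
        show "fst ` ?Q \<inter> set (fst q # used) = {}"
          using Q(2,4) q unfolding compatible_def by (auto dest: inj_onD)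
        have "\<Union>(cells ` ?Q) = set A - cells q" using Q(5) dj q by blast
        then show "\<Union>(cells ` ?Q) = set (filter (\<lambda>y. y \<notin> set (fst (snd q))) A)" by (auto simp: cells_def)
        have "(\<Sum>q\<in>Q. gain q) = gain q + (\<Sum>q\<in>?Q. gain q)" using fin q by (rule sum.remove)
        then show "g - snd (snd q) \<le> (\<Sum>q\<in>?Q. gain q)" using Q(6) by (simp add: gain_def)
      qed (use Q(1) in blast)
      moreover have "cells q \<subseteq> set A" using Q(5) q by blast
      moreover have "q \<in> set qs" "fst q \<notin> set used" using q Q(1,4) by blast+
      ultimately show ?thesis unfolding colourable.simps cells_def by blast
    qed
  qed
qed

text \<open>The appended element \<open>p + fst b\<close> identifies the bucket. All sets of a
  bucket have the guessed size, which is what later excludes overlaps.\<close>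

definition bucket_sets :: "nat \<Rightarrow> nat \<Rightarrow> nat \<Rightarrow> choice list \<Rightarrow> bucket \<Rightarrow> nat list list" where
  "bucket_sets k K p qs b = map (\<lambda>A. A @ [p + fst b])
     (filter (\<lambda>A. length A = fst (snd (snd b)) \<and>
        colourable k (filter (\<lambda>q. fst q \<in> set (fst (snd b))) qs) [] A (snd (snd (snd b))))
       (inc_lists K [0..<p]))"

definition sc_family :: "nat \<Rightarrow> nat \<Rightarrow> nat \<Rightarrow> choice list \<Rightarrow> bucket list \<Rightarrow> nat list list" where
  "sc_family k K p qs bs = concat (map (bucket_sets k K p qs) bs)"

text \<open>Guesses whose labels do not add up are answered by \<open>(1, [[0]], 0)\<close>, a legal
  instance without solution. The last test guarantees that the family covers its universe, as the
  problem demands.\<close>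

definition sc_instance :: "nat \<Rightarrow> nat \<Rightarrow> nat \<Rightarrow> choice list \<Rightarrow> nat \<Rightarrow> bucket list \<Rightarrow> nat \<times> nat list list \<times> nat" where
  "sc_instance k K p qs t bs =
     (if sum_list (map (\<lambda>b. fst (snd (snd b))) bs) = p \<and> t \<le> sum_list (map (\<lambda>b. snd (snd (snd b))) bs) \<and>
        (\<forall>x\<in>set [0..<p + length bs]. \<exists>S\<in>set (sc_family k K p qs bs). x \<in> set S)
      then (p + length bs, sc_family k K p qs bs, length bs)
      else (1, [[0]], 0))"

lemma in_bucket_sets_iff:
  "S \<in> set (bucket_sets k K p qs b) \<longleftrightarrow> (\<exists>A. S = A @ [p + fst b] \<and> sorted_wrt (<) A \<and> set A \<subseteq> {..<p} \<and>
     length A \<le> K \<and> length A = fst (snd (snd b)) \<and>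
     colourable k (filter (\<lambda>q. fst q \<in> set (fst (snd b))) qs) [] A (snd (snd (snd b))))"
  unfolding bucket_sets_def by (auto simp: in_inc_lists_iff atLeast0LessThan)

lemma sc_family_distinct:
  assumes "distinct (map fst bs)"
  shows "distinct (map set (sc_family k K p qs bs))"
  using assms
proof (induction bs)
  case (Cons b bs)
  have inj: "inj_on set (set (bucket_sets k K p qs b))"
  proof (rule inj_onI)
    fix S S' assume "S \<in> set (bucket_sets k K p qs b)" "S' \<in> set (bucket_sets k K p qs b)" and eq: "set S = set S'"
    then obtain A A' where A: "S = A @ [p + fst b]" "sorted_wrt (<) A" "set A \<subseteq> {..<p}"
      "S' = A' @ [p + fst b]" "sorted_wrt (<) A'" "set A' \<subseteq> {..<p}" unfolding in_bucket_sets_iff by blast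
    have "set A = set S - {p + fst b}" "set A' = set S' - {p + fst b}" using A by auto
    then have "set A = set A'" using eq by simp
    then have "A = A'" using A(2,5) by (simp add: strict_sorted_equal)
    then show "S = S'" using A by simp
  qed
  have "distinct (bucket_sets k K p qs b)"
    unfolding bucket_sets_def by (simp add: distinct_map inj_on_def distinct_inc_lists)
  then have "distinct (map set (bucket_sets k K p qs b))" using inj by (simp add: distinct_map)
  moreover have "distinct (map set (sc_family k K p qs bs))" using Cons by simp
  moreover have "set S \<noteq> set S'" if S: "S \<in> set (bucket_sets k K p qs b)" "S' \<in> set (sc_family k K p qs bs)" for S S'
  proof -
    have "p + fst b \<in> set S" using S(1) unfolding in_bucket_sets_iff by auto
    moreover obtain b' where b': "b' \<in> set bs" "S' \<in> set (bucket_sets k K p qs b')"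
      using S(2) unfolding sc_family_def by auto
    moreover have "fst b' \<noteq> fst b" using Cons.prems b'(1) by (metis distinct.simps(2) image_eqI list.set_map list.simps(9))
    ultimately show ?thesis unfolding in_bucket_sets_iff by fastforce
  qed
  then have "set (map set (bucket_sets k K p qs b)) \<inter> set (map set (sc_family k K p qs bs)) = {}" by auto
  moreover have "sc_family k K p qs (b # bs) = bucket_sets k K p qs b @ sc_family k K p qs bs"
    by (simp add: sc_family_def)
  ultimately show ?case by simp
qed (simp add: sc_family_def)

lemma sc_family_member:
  assumes "S \<in> set (sc_family k K p qs bs)"
  obtains b A where "b \<in> set bs" "S = A @ [p + fst b]" "sorted_wrt (<) A" "set A \<subseteq> {..<p}"
    "length A \<le> K" "length A = fst (snd (snd b))"
    "colourable k (filter (\<lambda>q. fst q \<in> set (fst (snd b))) qs) [] A (snd (snd (snd b)))"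
proof -
  obtain b where "b \<in> set bs" "S \<in> set (bucket_sets k K p qs b)" using assms unfolding sc_family_def by auto
  then show thesis using that unfolding in_bucket_sets_iff by blast
qed

lemma fst_bucket_less:
  assumes "map fst bs = [0..<length bs]" "b \<in> set bs"
  shows "fst b < length bs"
proof -
  have "fst b \<in> set (map fst bs)" using assms(2) by simp
  then show ?thesis unfolding assms(1) by simp
qed

lemma sc_instance_valid:
  assumes "map fst bs = [0..<length bs]" "sc_instance k K p qs t bs = (n, F, m)"
  shows "set_cover_instance (K + 1) {..<n} (set ` set F)" "encodes_family (set ` set F) (enc F)"
    "n \<le> p + length bs + 1"
proof -
  have "set_cover_instance (K + 1) {..<n} (set ` set F) \<and> distinct (map set F) \<and> (\<forall>S\<in>set F. distinct S) \<and> n \<le> p + length bs + 1"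
  proof (cases "(n, F, m) = (1, [[0]], 0)")
    case True
    then show ?thesis by (auto simp: set_cover_instance_def)
  next
    case False
    then have F: "n = p + length bs" "F = sc_family k K p qs bs"
      "\<forall>x\<in>set [0..<p + length bs]. \<exists>S\<in>set (sc_family k K p qs bs). x \<in> set S"
      using assms(2) unfolding sc_instance_def by (auto split: if_splits)
    have S: "set S \<subseteq> {..<n} \<and> distinct S \<and> card (set S) \<le> K + 1" if "S \<in> set F" for S
      using that unfolding F(2)
    proof (cases rule: sc_family_member)
      case (1 b A)
      have "set S \<subseteq> {..<n}" using 1 fst_bucket_less[OF assms(1) 1(1)] by (auto simp: F(1))
      moreover have "distinct S" using 1 strict_sorted_iff[of A] by auto
      moreover have "card (set S) \<le> K + 1" using 1(2,5) card_length[of S] by simp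
      ultimately show ?thesis by blast
    qed
    have "{..<n} \<subseteq> \<Union>(set ` set F)" using F by fastforce
    moreover have "\<Union>(set ` set F) \<subseteq> {..<n}" using S by (intro UN_least) simp
    ultimately have "set_cover_instance (K + 1) {..<n} (set ` set F)"
      unfolding set_cover_instance_def using S by auto
    moreover have "distinct (map set F)" unfolding F(2) by (rule sc_family_distinct) (simp add: assms(1))
    ultimately show ?thesis using S F(1) by simp
  qed
  then show "set_cover_instance (K + 1) {..<n} (set ` set F)" "encodes_family (set ` set F) (enc F)"
    "n \<le> p + length bs + 1" unfolding encodes_family_iff by blast+
qed

text \<open>An overlap between two sets would make the union smaller than the sum of the
  sizes.\<close>

lemma disjoint_of_card_UN:
  assumes "finite I" "\<And>i. i \<in> I \<Longrightarrow> finite (A i)" "(\<Sum>i\<in>I. card (A i)) \<le> card (\<Union>(A ` I))" "i \<in> I" "j \<in> I" "i \<noteq> j"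
  shows "A i \<inter> A j = {}"
proof -
  have "card (\<Union>(A ` I)) \<le> card (A i \<union> A j) + card (\<Union>(A ` (I - {i, j})))"
  proof -
    have "\<Union>(A ` I) = (A i \<union> A j) \<union> \<Union>(A ` (I - {i, j}))" using assms(4,5) by blast
    then show ?thesis using card_Un_le by metis
  qed
  also have "card (\<Union>(A ` (I - {i, j}))) \<le> (\<Sum>i\<in>I - {i, j}. card (A i))"
    by (rule card_UN_le) (use assms(1) in simp)
  finally have "(\<Sum>i\<in>I. card (A i)) \<le> card (A i \<union> A j) + (\<Sum>i\<in>I - {i, j}. card (A i))"
    using assms(3) by simp
  moreover have "(\<Sum>i\<in>I. card (A i)) = card (A i) + card (A j) + (\<Sum>i\<in>I - {i, j}. card (A i))"
  proof -
    have "I - {i, j} = I - {i} - {j}" by auto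
    then show ?thesis using assms(1,4-6) sum.remove[of I i "\<lambda>i. card (A i)"] sum.remove[of "I - {i}" j "\<lambda>i. card (A i)"] by simp
  qed
  moreover have "card (A i) + card (A j) = card (A i \<union> A j) + card (A i \<inter> A j)"
    using assms(2,4,5) by (intro card_Un_Int)
  ultimately have "card (A i \<inter> A j) = 0" by linarith
  then show ?thesis using assms(2,4) by simp
qed

lemma distinct_concat_nth:
  assumes "distinct (concat xss)" "i < length xss" "j < length xss" "i \<noteq> j"
  shows "set (xss ! i) \<inter> set (xss ! j) = {}"
proof -
  have *: "set (xss ! i) \<inter> set (xss ! j) = {}" if "i < j" "j < length xss" for i j
  proof -
    have "distinct (concat (take j xss) @ xss ! j @ concat (drop (Suc j) xss))"
      using assms(1) id_take_nth_drop[OF that(2)] by (metis concat.simps(2) concat_append)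
    moreover have "set (xss ! i) \<subseteq> set (concat (take j xss))"
      using that by (force simp: in_set_conv_nth)
    ultimately show ?thesis by auto
  qed
  show ?thesis using *[of i j] *[of j i] assms by (cases "i < j") auto
qed

lemma sum_list_nth: "sum_list (map f bs) = (\<Sum>i<length bs. f (bs ! i))" for f :: "'a \<Rightarrow> nat"
  by (simp add: sum_list_sum_nth atLeast0LessThan)

text \<open>Each bucket element needs a set of its own bucket, and the budget allows one set per
  bucket. The guessed sizes add up to \<open>p\<close>, so these sets cannot overlap. Different
  buckets have disjoint colours, so the choices behind the sets are compatible altogether.\<close>

lemma sc_instance_sound:
  assumes idx: "map fst bs = [0..<length bs]" and dist: "distinct (concat (map (\<lambda>b. fst (snd b)) bs))"
    and inst: "sc_instance k K p qs t bs = (n, F, m)" and cov: "has_set_cover {..<n} (set ` set F) m"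
  shows "coloured_cover p qs t"
proof (cases "sum_list (map (\<lambda>b. fst (snd (snd b))) bs) = p \<and> t \<le> sum_list (map (\<lambda>b. snd (snd (snd b))) bs) \<and>
        (\<forall>x\<in>set [0..<p + length bs]. \<exists>S\<in>set (sc_family k K p qs bs). x \<in> set S)")
  case False
  then have "sc_instance k K p qs t bs = (1, [[0]], 0)" unfolding sc_instance_def by (rule if_not_P)
  then have "(n, F, m) = (1, [[0]], 0)" using inst by simp
  then show ?thesis using cov by (auto simp: has_set_cover_def)
next
  case True
  let ?B = "length bs"
  have F: "n = p + ?B" "F = sc_family k K p qs bs" "m = ?B"
  proof -
    have "sc_instance k K p qs t bs = (p + ?B, sc_family k K p qs bs, ?B)"
      unfolding sc_instance_def by (rule if_P[OF True])
    then show "n = p + ?B" "F = sc_family k K p qs bs" "m = ?B" using inst by simp_all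
  qed
  have sums: "(\<Sum>i<?B. fst (snd (snd (bs ! i)))) = p" "t \<le> (\<Sum>i<?B. snd (snd (snd (bs ! i))))"
    using True unfolding sum_list_nth by blast+
  have fst_nth: "fst (bs ! i) = i" if "i < ?B" for i
    using that arg_cong[OF idx, of "\<lambda>xs. xs ! i"] by simp
  let ?qs = "\<lambda>i. filter (\<lambda>q. fst q \<in> set (fst (snd (bs ! i)))) qs"
  obtain C where C: "C \<subseteq> set ` set F" "finite C" "card C \<le> ?B" "\<Union>C = {..<p + ?B}"
    using cov unfolding has_set_cover_def F(1,3) by blast
  have "\<exists>A. insert (p + i) (set A) \<in> C \<and> sorted_wrt (<) A \<and> set A \<subseteq> {..<p} \<and>
      length A = fst (snd (snd (bs ! i))) \<and> colourable k (?qs i) [] A (snd (snd (snd (bs ! i))))" if i: "i < ?B" for i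
  proof -
    have "p + i \<in> \<Union>C" using C(4) i by simp
    then obtain S where S: "S \<in> set F" "set S \<in> C" "p + i \<in> set S" using C(1) by blast
    from S(1) show ?thesis unfolding F(2)
    proof (cases rule: sc_family_member)
      case (1 b A)
      have "p + i = p + fst b" using S(3) 1(2,4) by auto
      then have "fst b = i" by simp
      obtain j where j: "j < ?B" "b = bs ! j" using 1(1) by (auto simp: in_set_conv_nth)
      have "b = bs ! i" using fst_nth[OF j(1)] \<open>fst b = i\<close> j(2) by simp
      moreover have "insert (p + i) (set A) \<in> C" using S(2) 1(2) \<open>fst b = i\<close> by simp
      ultimately show ?thesis using 1 by (intro exI[of _ A]) simp
    qed
  qed
  then obtain A where A: "\<And>i. i < ?B \<Longrightarrow> insert (p + i) (set (A i)) \<in> C \<and> sorted_wrt (<) (A i) \<and> set (A i) \<subseteq> {..<p} \<and>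
      length (A i) = fst (snd (snd (bs ! i))) \<and> colourable k (?qs i) [] (A i) (snd (snd (snd (bs ! i))))"
    by metis
  define f where "f i = insert (p + i) (set (A i))" for i
  have "inj_on f {..<?B}"
  proof (rule inj_onI)
    fix i j assume ij: "i \<in> {..<?B}" "j \<in> {..<?B}" "f i = f j"
    then have "p + i \<in> f j" by (auto simp: f_def)
    then show "i = j" using A[of j] ij(2) by (auto simp: f_def)
  qed
  then have "card (f ` {..<?B}) = ?B" by (simp add: card_image)
  moreover have "f ` {..<?B} \<subseteq> C" using A by (auto simp: f_def)
  ultimately have fC: "f ` {..<?B} = C" using C(2,3) by (intro card_seteq) simp_all
  have UA: "\<Union>((\<lambda>i. set (A i)) ` {..<?B}) = {..<p}"
  proof
    show "\<Union>((\<lambda>i. set (A i)) ` {..<?B}) \<subseteq> {..<p}" using A by (intro UN_least) simp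
    show "{..<p} \<subseteq> \<Union>((\<lambda>i. set (A i)) ` {..<?B})"
    proof
      fix x assume x: "x \<in> {..<p}"
      then have "x \<in> \<Union>(f ` {..<?B})" unfolding fC C(4) by simp
      then obtain i where "i < ?B" "x \<in> f i" by blast
      then show "x \<in> \<Union>((\<lambda>i. set (A i)) ` {..<?B})" using x by (auto simp: f_def)
    qed
  qed
  have cA: "card (set (A i)) = fst (snd (snd (bs ! i)))" if "i < ?B" for i
    using A[OF that] strict_sorted_iff[of "A i"] by (metis distinct_card)
  have dA: "set (A i) \<inter> set (A j) = {}" if "i < ?B" "j < ?B" "i \<noteq> j" for i j
  proof (rule disjoint_of_card_UN[where I = "{..<?B}"])
    show "(\<Sum>i<?B. card (set (A i))) \<le> card (\<Union>((\<lambda>i. set (A i)) ` {..<?B}))"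
      unfolding UA using sums(1) cA by simp
  qed (use that in auto)
  have "\<exists>Q. Q \<subseteq> set (?qs i) \<and> compatible Q \<and> \<Union>(cells ` Q) = set (A i) \<and> snd (snd (snd (bs ! i))) \<le> (\<Sum>q\<in>Q. gain q)"
    if "i < ?B" for i
    using A[OF that] unfolding colourable_iff by blast
  then obtain Q where Q: "\<And>i. i < ?B \<Longrightarrow> Q i \<subseteq> set (?qs i) \<and> compatible (Q i) \<and> \<Union>(cells ` Q i) = set (A i) \<and>
      snd (snd (snd (bs ! i))) \<le> (\<Sum>q\<in>Q i. gain q)" by metis
  have dv: "fst q \<noteq> fst q'" if "i < ?B" "j < ?B" "i \<noteq> j" "q \<in> Q i" "q' \<in> Q j" for i j q q'
  proof -
    have "fst q \<in> set (fst (snd (bs ! i)))" "fst q' \<in> set (fst (snd (bs ! j)))"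
      using Q[OF that(1)] Q[OF that(2)] that(4,5) by auto
    then show ?thesis using distinct_concat_nth[OF dist, of i j] that(1-3) by auto
  qed
  let ?Q = "\<Union>(Q ` {..<?B})"
  have "compatible ?Q" unfolding compatible_def
  proof (intro conjI ballI impI)
    show "inj_on fst ?Q"
    proof (rule inj_onI)
      fix q q' assume "q \<in> ?Q" "q' \<in> ?Q" and eq: "fst q = fst q'"
      then obtain i j where ij: "i < ?B" "j < ?B" "q \<in> Q i" "q' \<in> Q j" by blast
      then have "i = j" using dv eq by blast
      then show "q = q'" using Q[OF ij(1)] ij(3,4) eq unfolding compatible_def by (metis inj_onD)
    qed
    fix q q' assume "q \<in> ?Q" "q' \<in> ?Q" and ne: "q \<noteq> q'"
    then obtain i j where ij: "i < ?B" "j < ?B" "q \<in> Q i" "q' \<in> Q j" by blast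
    show "cells q \<inter> cells q' = {}"
    proof (cases "i = j")
      case True
      then show ?thesis using Q[OF ij(1)] ij(3,4) ne unfolding compatible_def by blast
    next
      case False
      have "cells q \<subseteq> set (A i)" "cells q' \<subseteq> set (A j)" using Q[OF ij(1)] Q[OF ij(2)] ij(3,4) by blast+
      then show ?thesis using dA[OF ij(1,2) False] by blast
    qed
  qed
  moreover have "?Q \<subseteq> set qs"
  proof (rule UN_least)
    fix i assume "i \<in> {..<?B}"
    then show "Q i \<subseteq> set qs" using Q[of i] by auto
  qed
  moreover have "\<Union>(cells ` ?Q) = {..<p}"
  proof -
    have "\<Union>(cells ` ?Q) = (\<Union>i<?B. \<Union>(cells ` Q i))" by blast
    also have "\<dots> = (\<Union>i<?B. set (A i))" using Q by (intro SUP_cong) auto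
    finally show ?thesis using UA by simp
  qed
  moreover have "t \<le> (\<Sum>q\<in>?Q. gain q)"
  proof -
    have "(\<Sum>q\<in>?Q. gain q) = (\<Sum>i<?B. \<Sum>q\<in>Q i. gain q)"
    proof (rule sum.UNION_disjoint)
      show "\<forall>i\<in>{..<?B}. finite (Q i)" using Q finite_subset by fast
      show "\<forall>i\<in>{..<?B}. \<forall>j\<in>{..<?B}. i \<noteq> j \<longrightarrow> Q i \<inter> Q j = {}" using dv by blast
    qed simp
    moreover have "(\<Sum>i<?B. snd (snd (snd (bs ! i)))) \<le> (\<Sum>i<?B. \<Sum>q\<in>Q i. gain q)"
      using Q by (intro sum_mono) simp
    ultimately show ?thesis using sums(2) by linarith
  qed
  ultimately show ?thesis unfolding coloured_cover_def by blast
qed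

text \<open>The solution is cut up along the buckets. If every label equals the size and the gain of
  its part, and no part has more than \<open>k\<close> choices, then the unions of the parts are
  members of the family.\<close>

lemma sc_instance_complete:
  assumes idx: "map fst bs = [0..<length bs]" and dist: "distinct (concat (map (\<lambda>b. fst (snd b)) bs))"
    and inst: "sc_instance k K p qs t bs = (n, F, m)"
    and Q: "Q \<subseteq> set qs" "compatible Q" "\<Union>(cells ` Q) = {..<p}" "t \<le> (\<Sum>q\<in>Q. gain q)"
    and lab: "\<And>b. b \<in> set bs \<Longrightarrow> snd (snd b) = (\<Sum>q | q \<in> Q \<and> fst q \<in> set (fst (snd b)). card (cells q),
      \<Sum>q | q \<in> Q \<and> fst q \<in> set (fst (snd b)). gain q)"
    and load: "\<And>b. b \<in> set bs \<Longrightarrow> card {q \<in> Q. fst q \<in> set (fst (snd b))} \<le> k"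
    and all: "\<And>q. q \<in> Q \<Longrightarrow> \<exists>b\<in>set bs. fst q \<in> set (fst (snd b))"
    and D: "\<And>q. q \<in> Q \<Longrightarrow> card (cells q) \<le> D" "k * D \<le> K"
  shows "has_set_cover {..<n} (set ` set F) m"
proof -
  let ?B = "length bs"
  define R where "R i = {q \<in> Q. fst q \<in> set (fst (snd (bs ! i)))}" for i
  define A where "A i = sorted_list_of_set (\<Union>(cells ` R i))" for i
  have finQ: "finite Q" using Q(1) finite_subset by blast
  have finR: "finite (R i)" for i unfolding R_def using finQ by simp
  have fc: "finite (cells q)" for q by (simp add: cells_def)
  have fst_nth: "fst (bs ! i) = i" if "i < ?B" for i
    using that arg_cong[OF idx, of "\<lambda>xs. xs ! i"] by simp
  have RQ: "(\<Union>i<?B. R i) = Q"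
  proof
    show "Q \<subseteq> (\<Union>i<?B. R i)"
    proof
      fix q assume q: "q \<in> Q"
      then obtain b where "b \<in> set bs" "fst q \<in> set (fst (snd b))" using all by blast
      then obtain i where "i < ?B" "fst q \<in> set (fst (snd (bs ! i)))" by (metis in_set_conv_nth)
      then show "q \<in> (\<Union>i<?B. R i)" using q by (auto simp: R_def)
    qed
  qed (auto simp: R_def)
  have Rdis: "R i \<inter> R j = {}" if "i < ?B" "j < ?B" "i \<noteq> j" for i j
    using distinct_concat_nth[OF dist, of i j] that unfolding R_def by auto
  have labR: "fst (snd (snd (bs ! i))) = (\<Sum>q\<in>R i. card (cells q))" "snd (snd (snd (bs ! i))) = (\<Sum>q\<in>R i. gain q)"
    if "i < ?B" for i
    using lab[of "bs ! i"] that unfolding R_def by simp_all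
  have part: "(\<Sum>i<?B. \<Sum>q\<in>R i. f q) = (\<Sum>q\<in>Q. f q)" for f :: "choice \<Rightarrow> nat"
    unfolding RQ[symmetric] by (rule sum.UNION_disjoint[symmetric]) (use finR Rdis in auto)
  have cardU: "card (\<Union>(cells ` P)) = (\<Sum>q\<in>P. card (cells q))" if "P \<subseteq> Q" for P
  proof (rule card_UN_disjoint)
    show "finite P" using that finQ by (rule finite_subset)
    show "\<forall>q\<in>P. \<forall>q'\<in>P. q \<noteq> q' \<longrightarrow> cells q \<inter> cells q' = {}" using Q(2) that unfolding compatible_def by blast
  qed (use fc in blast)
  have setA: "set (A i) = \<Union>(cells ` R i)" for i unfolding A_def using finR fc by simp
  have sortA: "sorted_wrt (<) (A i)" for i unfolding A_def by simp
  have RsubQ: "R i \<subseteq> Q" for i unfolding R_def by blast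
  have lenA: "length (A i) = (\<Sum>q\<in>R i. card (cells q))" for i
    unfolding A_def using cardU[OF RsubQ] by simp
  have Asub: "set (A i) \<subseteq> {..<p}" for i unfolding setA Q(3)[symmetric] using RsubQ by blast
  have lenK: "length (A i) \<le> K" if "i < ?B" for i
  proof -
    have "length (A i) \<le> (\<Sum>q\<in>R i. D)" unfolding lenA using D(1) RsubQ by (intro sum_mono) blast
    also have "\<dots> = card (R i) * D" by simp
    also have "\<dots> \<le> k * D" using load[of "bs ! i"] that unfolding R_def by (intro mult_le_mono1) simp
    finally show ?thesis using D(2) by simp
  qed
  have colA: "colourable k (filter (\<lambda>q. fst q \<in> set (fst (snd (bs ! i)))) qs) [] (A i) (snd (snd (snd (bs ! i))))"
    if i: "i < ?B" for i
    unfolding colourable_iff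
  proof (intro exI[of _ "R i"] conjI)
    show "compatible (R i)" using Q(2) RsubQ[of i] unfolding compatible_def by (meson inj_on_subset subsetD)
    show "card (R i) \<le> k" using load[of "bs ! i"] i unfolding R_def by simp
    show "R i \<subseteq> set (filter (\<lambda>q. fst q \<in> set (fst (snd (bs ! i)))) qs)" using Q(1) unfolding R_def by auto
  qed (use setA labR[OF i] in simp_all)
  have mem: "A i @ [p + i] \<in> set (sc_family k K p qs bs)" if i: "i < ?B" for i
  proof -
    have "A i @ [p + i] \<in> set (bucket_sets k K p qs (bs ! i))"
      unfolding in_bucket_sets_iff fst_nth[OF i] using sortA Asub lenK[OF i] lenA labR(1)[OF i] colA[OF i] by simp
    then show ?thesis unfolding sc_family_def using i by auto
  qed
  have "(\<Sum>q\<in>Q. card (cells q)) = p" using cardU[OF order_refl] Q(3) by simp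
  then have s1: "sum_list (map (\<lambda>b. fst (snd (snd b))) bs) = p"
    unfolding sum_list_nth using part[of "\<lambda>q. card (cells q)"] labR(1) by simp
  have s2: "t \<le> sum_list (map (\<lambda>b. snd (snd (snd b))) bs)"
    unfolding sum_list_nth using part[of gain] labR(2) Q(4) by simp
  have covA: "\<exists>i<?B. x \<in> set (A i @ [p + i])" if "x < p + ?B" for x
  proof (cases "x < p")
    case True
    then obtain q where "q \<in> Q" "x \<in> cells q" using Q(3) by blast
    then obtain i where "i < ?B" "q \<in> R i" using RQ by blast
    then show ?thesis using \<open>x \<in> cells q\<close> by (intro exI[of _ i]) (auto simp: setA)
  next
    case False
    then show ?thesis using that by (intro exI[of _ "x - p"]) auto
  qed
  have s3: "\<forall>x\<in>set [0..<p + length bs]. \<exists>S\<in>set (sc_family k K p qs bs). x \<in> set S"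
    using covA mem by (metis atLeastLessThan_iff set_upt)
  have F: "n = p + ?B" "F = sc_family k K p qs bs" "m = ?B"
  proof -
    have "sc_instance k K p qs t bs = (p + ?B, sc_family k K p qs bs, ?B)"
      unfolding sc_instance_def by (rule if_P) (use s1 s2 s3 in blast)
    then show "n = p + ?B" "F = sc_family k K p qs bs" "m = ?B" using inst by simp_all
  qed
  let ?C = "(\<lambda>i. set (A i @ [p + i])) ` {..<?B}"
  have "?C \<subseteq> set ` set F" using mem unfolding F(2) by blast
  moreover have "card ?C \<le> m" using card_image_le[of "{..<?B}" "\<lambda>i. set (A i @ [p + i])"] F(3) by simp
  moreover have "\<Union>?C = {..<n}"
  proof
    show "{..<n} \<subseteq> \<Union>?C" unfolding F(1) using covA by auto
    show "\<Union>?C \<subseteq> {..<n}"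
    proof (rule UN_least)
      fix i assume "i \<in> {..<?B}"
      then show "set (A i @ [p + i]) \<subseteq> {..<n}" using Asub[of i] by (auto simp: F(1))
    qed
  qed
  ultimately show ?thesis unfolding has_set_cover_def by (intro exI[of _ ?C]) simp
qed

section \<open>Running times of the counter, the hash function and the instance\<close>

lemma esize_filter: "esize (filter P xs) \<le> esize xs"
  by (induction xs) auto

lemma esize_tl: "esize (tl xs) \<le> esize xs"
  by (cases xs) auto

text \<open>Incrementing as a single fold; the flag is the carry.\<close>

definition inc_step :: "nat \<Rightarrow> bool \<times> nat list \<Rightarrow> nat \<Rightarrow> bool \<times> nat list" where
  "inc_step s c d = (if fst c then (if d + 1 < s then (False, snd c @ [d + 1]) else (True, snd c @ [0]))
     else (False, snd c @ [d]))"

lemma foldl_inc_step_False: "foldl (inc_step s) (False, acc) ds = (False, acc @ ds)"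
  by (induction ds arbitrary: acc) (auto simp: inc_step_def)

lemma foldl_inc_step: "snd (foldl (inc_step s) (True, acc) ds) = acc @ inc s ds"
  by (induction ds arbitrary: acc) (auto simp: inc_step_def foldl_inc_step_False)

lemma esize_inc: "esize (inc s ds) \<le> 2 * esize ds"
  by (induction ds) auto

lemma ptime_inc [ptime_intros]: "ptime f \<Longrightarrow> ptime (\<lambda>x. inc s (f x))"
proof -
  have "ptime (\<lambda>ds. foldl (inc_step s) (True, []) ds)"
  proof (rule ptime_foldl)
    show "poly_bounded (\<lambda>s. 2 * s + 2)" by (intro poly_bounded_intros)
    show "ptime (\<lambda>z :: nat list \<times> (bool \<times> nat list) \<times> nat. inc_step s (fst (snd z)) (snd (snd z)))"
      unfolding inc_step_def by (intro ptime_intros)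
    fix ds ys zs :: "nat list" assume "ds = ys @ zs"
    then have "esize (snd (foldl (inc_step s) (True, []) ys)) \<le> 2 * esize ds"
      using esize_inc[of s ys] by (simp add: foldl_inc_step)
    then show "esize (foldl (inc_step s) (True, []) ys) \<le> 2 * esize ds + 2"
      using esize_bool[of "fst (foldl (inc_step s) (True, []) ys)"] by simp
  qed (intro ptime_intros)+
  then have "ptime (\<lambda>ds. snd (foldl (inc_step s) (True, []) ds))" by (rule ptime_snd)
  then have "ptime (\<lambda>ds. inc s ds)" by (simp add: foldl_inc_step)
  then show "ptime f \<Longrightarrow> ptime (\<lambda>x. inc s (f x))" by (rule ptime_comp)
qed

lemma funpow_inc: "0 < s \<Longrightarrow> (inc s ^^ i) (replicate l 0) = digits s l i"
  by (induction i) (auto simp: digits_0 inc_digits)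

lemma digits_less: "0 < s \<Longrightarrow> d \<in> set (digits s l i) \<Longrightarrow> d < s"
  by (induction l arbitrary: i) auto

lemma ptime_replicate_0 [ptime_intros]: "ptime f \<Longrightarrow> ptime (\<lambda>x. replicate (f x) (0 :: nat))"
proof -
  have "ptime (\<lambda>n. map (\<lambda>_. 0 :: nat) [0..<n])" by (intro ptime_intros)
  then have "ptime (\<lambda>n. replicate n (0 :: nat))" by (simp add: map_replicate_const)
  then show "ptime f \<Longrightarrow> ptime (\<lambda>x. replicate (f x) (0 :: nat))" by (rule ptime_comp)
qed

lemma ptime_name [ptime_intros]:
  assumes "ptime f" "ptime g"
  shows "ptime (\<lambda>x. name (f x) (g x))"
proof (rule ptime_comp2[OF _ assms, where h = name])
  have "ptime (\<lambda>z :: nat \<times> nat. (inc 2 ^^ snd z) (replicate (fst z) 0))"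
  proof (rule ptime_funpow)
    show "poly_bounded (\<lambda>s. 3 * s)" by (intro poly_bounded_intros)
    fix z :: "nat \<times> nat" and i
    have "esize (digits 2 (fst z) i) \<le> length (digits 2 (fst z) i) * (2 + 1)"
      by (rule esize_list_bound) (use digits_less[of 2 _ "fst z" i] in fastforce)
    then show "esize ((inc 2 ^^ i) (replicate (fst z) 0)) \<le> 3 * esize z" by (simp add: funpow_inc)
  qed (intro ptime_intros)+
  then have "ptime (\<lambda>z :: nat \<times> nat. map (\<lambda>d. d \<noteq> 0) ((inc 2 ^^ snd z) (replicate (fst z) 0)))"
    by (intro ptime_intros)
  then show "ptime (\<lambda>z. name (fst z) (snd z))" by (simp add: funpow_inc name_def)
qed

definition dot_step :: "bool list \<times> bool \<Rightarrow> bool \<Rightarrow> bool list \<times> bool" where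
  "dot_step c x = (case fst c of [] \<Rightarrow> c | y # ys \<Rightarrow>
     (ys, (x \<and> y) \<and> \<not> snd c \<or> \<not> (x \<and> y) \<and> snd c))"

lemma foldl_dot_step: "snd (foldl dot_step (ys, b) xs) \<longleftrightarrow> b \<noteq> dot xs ys"
proof (induction xs arbitrary: ys b)
  case (Cons x xs)
  then show ?case by (cases ys) (auto simp: dot_step_def)
qed simp

lemma esize_foldl_dot_step: "esize (fst (foldl dot_step c xs)) \<le> esize (fst c)"
proof (induction xs arbitrary: c)
  case (Cons x xs)
  have "esize (fst (dot_step c x)) \<le> esize (fst c)" by (cases "fst c") (auto simp: dot_step_def)
  then show ?case using Cons[of "dot_step c x"] by simp
qed simp

lemma ptime_dot [ptime_intros]:
  assumes "ptime f" "ptime g"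
  shows "ptime (\<lambda>x. dot (f x) (g x))"
proof (rule ptime_comp2[OF _ assms, where h = dot])
  have "ptime (\<lambda>z :: bool list \<times> bool list. foldl dot_step (snd z, False) (fst z))"
  proof (rule ptime_foldl)
    show "poly_bounded (\<lambda>s. s + 2)" by (intro poly_bounded_intros)
    show "ptime (\<lambda>z :: (bool list \<times> bool list) \<times> (bool list \<times> bool) \<times> bool. dot_step (fst (snd z)) (snd (snd z)))"
      unfolding dot_step_def by (intro ptime_intros)
    fix z :: "bool list \<times> bool list" and ys
    show "esize (foldl dot_step (snd z, False) ys) \<le> esize z + 2"
      using esize_foldl_dot_step[of "(snd z, False)" ys] esize_bool[of "snd (foldl dot_step (snd z, False) ys)"] by simp
  qed (intro ptime_intros)+
  then have "ptime (\<lambda>z :: bool list \<times> bool list. snd (foldl dot_step (snd z, False) (fst z)))" by (rule ptime_snd)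
  then show "ptime (\<lambda>z. dot (fst z) (snd z))" by (simp add: foldl_dot_step)
qed

text \<open>A split copies the hash bits, so the total size need not grow by a constant only. The
  invariant separates a bound \<open>B\<close> on every entry, which no step violates, from the
  number of entries, which increases by at most one on each side.\<close>

definition split_bounded :: "nat \<Rightarrow> nat \<Rightarrow> (bool list \<times> nat list) list \<times> bucket list \<Rightarrow> bool" where
  "split_bounded B l st \<longleftrightarrow> length (fst st) \<le> 1 + l \<and> length (snd st) \<le> l \<and>
     (\<forall>c\<in>set (fst st). esize (fst c) \<le> B \<and> esize (snd c) \<le> B) \<and>
     (\<forall>b\<in>set (snd st). fst b \<le> l \<and> esize (fst (snd b)) \<le> B \<and> esize (snd (snd b)) \<le> B)"

lemma split_bounded_step:
  assumes "split_bounded B l st" "esize (snd y) \<le> B"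
  shows "split_bounded B (Suc l) (split_step w st y)"
proof -
  have W: "\<forall>b\<in>set (snd st). fst b \<le> Suc l \<and> esize (fst (snd b)) \<le> B \<and> esize (snd (snd b)) \<le> B"
    using assms(1) le_SucI unfolding split_bounded_def by blast
  have L: "length (fst st) \<le> 1 + l" "length (snd st) \<le> l"
    and C: "\<forall>c\<in>set (fst st). esize (fst c) \<le> B \<and> esize (snd c) \<le> B"
    using assms(1) unfolding split_bounded_def by blast+
  show ?thesis
  proof (cases "fst st")
    case Nil
    then have "split_step w st y = st" by (simp add: split_step_def)
    then show ?thesis unfolding split_bounded_def using L C W by simp
  next
    case (Cons c cs)
    have c: "esize (fst c) \<le> B" "esize (snd c) \<le> B" using C Cons by simp_all
    have cs: "\<forall>c\<in>set cs. esize (fst c) \<le> B \<and> esize (snd c) \<le> B" using C Cons by simp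
    have t: "esize (tl (fst c)) \<le> B" using esize_tl[of "fst c"] c(1) by simp
    have f: "esize (filter P (snd c)) \<le> B" for P using esize_filter[of P "snd c"] c(2) by simp
    show ?thesis
    proof (cases "fst y = 0")
      case True
      then have "split_step w st y = ((tl (fst c), filter (\<lambda>v. \<not> dot (name w v) (fst c)) (snd c)) #
        (tl (fst c), filter (\<lambda>v. dot (name w v) (fst c)) (snd c)) # cs, snd st)"
        using Cons by (simp add: split_step_def)
      then show ?thesis unfolding split_bounded_def using L W t f cs Cons by simp
    next
      case False
      then have "split_step w st y = (cs, snd st @ [(length (snd st), snd c, snd y)])"
        using Cons by (simp add: split_step_def)
      then show ?thesis unfolding split_bounded_def using L W c cs Cons assms(2)
        by (simp add: ball_Un del: esize_prod)
    qed
  qed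
qed

lemma split_bounded_foldl:
  assumes "split_bounded B l st" "\<forall>y\<in>set us. esize (snd y) \<le> B"
  shows "split_bounded B (l + length us) (foldl (split_step w) st us)"
  using assms
proof (induction us arbitrary: st l)
  case (Cons y us)
  then show ?case using Cons.IH[of "Suc l" "split_step w st y"] split_bounded_step by simp
qed simp

lemma split_bounded_esize:
  assumes "split_bounded B l st"
  shows "esize st \<le> (1 + l) * (2 * B + 2) + l * (l + 2 * B + 3) + 1"
proof -
  have "esize (fst st) \<le> length (fst st) * (2 * B + 1 + 1)"
    by (rule esize_list_bound) (use assms in \<open>auto simp: split_bounded_def\<close>)
  also have "\<dots> \<le> (1 + l) * (2 * B + 2)" using assms by (intro mult_le_mono) (auto simp: split_bounded_def)
  finally have 1: "esize (fst st) \<le> (1 + l) * (2 * B + 2)" .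
  have "esize (snd st) \<le> length (snd st) * (l + 2 * B + 2 + 1)"
  proof (rule esize_list_bound)
    fix b assume "b \<in> set (snd st)"
    then have "fst b \<le> l" "esize (fst (snd b)) \<le> B" "esize (snd (snd b)) \<le> B"
      using assms unfolding split_bounded_def by blast+
    then show "esize b \<le> l + 2 * B + 2" unfolding esize_prod[of b] esize_prod[of "snd b"] by simp
  qed
  also have "\<dots> \<le> l * (l + 2 * B + 3)" using assms by (intro mult_le_mono) (auto simp: split_bounded_def)
  finally show ?thesis using 1 unfolding esize_prod[of st] by simp
qed

lemma ptime_buckets:
  "ptime (\<lambda>z :: nat \<times> nat \<times> bool list \<times> (nat \<times> nat \<times> nat) list.
     buckets (fst z) (fst (snd z)) (fst (snd (snd z))) (snd (snd (snd z))))"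
  unfolding buckets_def
proof (rule ptime_snd, rule ptime_foldl)
  show "poly_bounded (\<lambda>s. (1 + s) * (2 * (s * (s + 1) + s) + 2) + s * (s + 2 * (s * (s + 1) + s) + 3) + 1)"
    by (intro poly_bounded_intros)
  show "ptime (\<lambda>z :: (nat \<times> nat \<times> bool list \<times> (nat \<times> nat \<times> nat) list) \<times>
      ((bool list \<times> nat list) list \<times> bucket list) \<times> (nat \<times> nat \<times> nat).
      split_step (fst (fst z)) (fst (snd z)) (snd (snd z)))"
    unfolding split_step_def by (intro ptime_intros)
  fix z :: "nat \<times> nat \<times> bool list \<times> (nat \<times> nat \<times> nat) list" and ys zs
  assume ys: "snd (snd (snd z)) = ys @ zs"
  let ?s = "esize z"
  let ?B = "?s * (?s + 1) + ?s"
  obtain w n r us where z: "z = (w, n, r, us)" by (metis surj_pair)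
  have sz: "n \<le> ?s" "esize r \<le> ?s" "esize us \<le> ?s" unfolding z by simp_all
  have "esize [0..<n] \<le> n * (n + 1)" by (rule esize_nat_list) auto
  also have "\<dots> \<le> ?s * (?s + 1)" using sz(1) by (intro mult_le_mono) auto
  finally have v: "esize [0..<n] \<le> ?B" by simp
  have "split_bounded ?B 0 ([(r, [0..<n])], [])" using v sz(2) unfolding split_bounded_def by simp
  moreover have "\<forall>y\<in>set ys. esize (snd y) \<le> ?B"
  proof
    fix y assume "y \<in> set ys"
    then have "y \<in> set us" using ys z by simp
    then have "esize y < esize us" by (rule esize_member)
    then show "esize (snd y) \<le> ?B" using sz(3) unfolding esize_prod[of y] by simp
  qed
  ultimately have "split_bounded ?B (0 + length ys) (foldl (split_step w) ([(r, [0..<n])], []) ys)"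
    by (rule split_bounded_foldl)
  then have "esize (foldl (split_step w) ([(r, [0..<n])], []) ys) \<le>
      (1 + length ys) * (2 * ?B + 2) + length ys * (length ys + 2 * ?B + 3) + 1"
    unfolding add_0 by (rule split_bounded_esize)
  also have "\<dots> \<le> (1 + ?s) * (2 * ?B + 2) + ?s * (?s + 2 * ?B + 3) + 1"
  proof -
    have "length ys \<le> ?s" using ys z sz(3) length_le_esize[of us] by simp
    then show ?thesis by (intro add_mono mult_le_mono) simp_all
  qed
  finally show "esize (foldl (split_step (fst z)) ([(fst (snd (snd z)), [0..<fst (snd z)])], []) ys) \<le>
      (1 + ?s) * (2 * ?B + 2) + ?s * (?s + 2 * ?B + 3) + 1"
    unfolding z by simp
qed (intro ptime_intros)+

lemma ptime_colourable [ptime_intros]: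
  assumes "ptime f" "ptime u" "ptime g" "ptime h"
  shows "ptime (\<lambda>x. colourable k (f x) (u x) (g x) (h x))"
proof -
  have *: "ptime (\<lambda>z. colourable k (fst z) (fst (snd z)) (fst (snd (snd z))) (snd (snd (snd z))))"
  proof (induction k)
    case 0
    show ?case unfolding colourable.simps by (intro ptime_intros)
  next
    case (Suc k)
    have IH: "ptime (\<lambda>x. colourable k (f x) (u x) (g x) (h x))"
      if "ptime f" "ptime u" "ptime g" "ptime h" for f u g h
      using ptime_comp[OF Suc.IH ptime_Pair[OF that(1) ptime_Pair[OF that(2) ptime_Pair[OF that(3,4)]]]] by simp
    show ?case unfolding colourable.simps by (intro ptime_intros IH)
  qed
  show ?thesis
    using ptime_comp[OF * ptime_Pair[OF assms(1) ptime_Pair[OF assms(2) ptime_Pair[OF assms(3,4)]]]] by simp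
qed

lemma ptime_sc_instance:
  "ptime (\<lambda>z. sc_instance k K (fst z) (fst (snd z)) (fst (snd (snd z))) (snd (snd (snd z))))"
  unfolding sc_instance_def sc_family_def bucket_sets_def by (intro ptime_intros)

section \<open>From triangle packing to coloured exact cover\<close>

text \<open>The colours are the components of the graph without the hub, represented by their least
  vertices, together with the hub vertices, which stand for triangles inside the hub and for unused
  hub vertices.  The gain of a set \<open>S\<close> of hub vertices for a component \<open>C\<close> is the number of additional
  triangles that fit into \<open>C \<union> S\<close>.\<close>

definition adj :: "nat list list \<Rightarrow> nat \<Rightarrow> nat \<Rightarrow> bool" where
  "adj es u v \<longleftrightarrow> (\<exists>e\<in>set es. u \<in> set e \<and> v \<in> set e \<and> u \<noteq> v)"

text \<open>Breadth-first search for a constant number of rounds, outside the hub.\<close>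

fun reach :: "nat \<Rightarrow> nat \<Rightarrow> nat list list \<Rightarrow> nat list \<Rightarrow> nat \<Rightarrow> nat list" where
  "reach 0 n es hub v = [v]"
| "reach (Suc i) n es hub v = filter (\<lambda>w. w \<notin> set hub \<and>
     (w \<in> set (reach i n es hub v) \<or> (\<exists>u\<in>set (reach i n es hub v). adj es u w))) [0..<n]"

text \<open>Empty for hub vertices and for vertices that are not least in their component, so each
  component is represented once although every vertex is a colour.\<close>

definition cluster :: "nat \<Rightarrow> nat \<Rightarrow> nat list list \<Rightarrow> nat list \<Rightarrow> nat \<Rightarrow> nat list" where
  "cluster \<sigma> n es hub v =
     (if v \<notin> set hub \<and> (\<forall>u\<in>set (reach \<sigma> n es hub v). v \<le> u) then reach \<sigma> n es hub v else [])"

fun can_pack :: "nat \<Rightarrow> nat list list \<Rightarrow> nat list \<Rightarrow> bool" where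
  "can_pack 0 es X \<longleftrightarrow> True"
| "can_pack (Suc m) es X \<longleftrightarrow> (\<exists>a\<in>set X. \<exists>b\<in>set X. \<exists>c\<in>set X. adj es a b \<and> adj es b c \<and> adj es a c \<and>
     can_pack m es (filter (\<lambda>y. y \<noteq> a \<and> y \<noteq> b \<and> y \<noteq> c) X))"

fun pack_number :: "nat \<Rightarrow> nat list list \<Rightarrow> nat list \<Rightarrow> nat" where
  "pack_number 0 es X = 0"
| "pack_number (Suc m) es X = (if can_pack (Suc m) es X then Suc m else pack_number m es X)"

text \<open>The universe of a set cover instance is an initial segment of the numbers, so hub
  vertices are renumbered by their rank; \<open>at_ranks\<close> goes back.\<close>

definition rank :: "nat list \<Rightarrow> nat \<Rightarrow> nat" where
  "rank hub q = length (filter (\<lambda>h. h < q) hub)"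

definition at_ranks :: "nat list \<Rightarrow> nat list \<Rightarrow> nat list" where
  "at_ranks hub I = filter (\<lambda>q. rank hub q \<in> set I) hub"

text \<open>Only nonempty sets of hub vertices are offered, hence a solution uses at most as many
  colours as there are hub vertices. For a colour with empty cluster the gain counts triangles
  inside the hub.\<close>

definition cluster_opts :: "nat \<Rightarrow> nat \<Rightarrow> nat \<Rightarrow> nat list list \<Rightarrow> nat list \<Rightarrow> choice list" where
  "cluster_opts \<sigma> D n es hub = concat (map (\<lambda>v. map (\<lambda>I. (v, I,
       pack_number (\<sigma> + D) es (cluster \<sigma> n es hub v @ at_ranks hub I) - pack_number (\<sigma> + D) es (cluster \<sigma> n es hub v)))
     (filter (\<lambda>I. I \<noteq> []) (inc_lists D [0..<length hub]))) [0..<n])"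

text \<open>What the clusters achieve without any hub vertex. Clusters that take part in no choice
  are accounted for by this number alone.\<close>

definition base_number :: "nat \<Rightarrow> nat \<Rightarrow> nat \<Rightarrow> nat list list \<Rightarrow> nat list \<Rightarrow> nat" where
  "base_number \<sigma> D n es hub = sum_list (map (\<lambda>v. pack_number (\<sigma> + D) es (cluster \<sigma> n es hub v)) [0..<n])"

lemma ptime_adj [ptime_intros]: "ptime f \<Longrightarrow> ptime g \<Longrightarrow> ptime h \<Longrightarrow> ptime (\<lambda>x. adj (f x) (g x) (h x))"
proof -
  have "ptime (\<lambda>z. adj (fst z) (fst (snd z)) (snd (snd z)))" unfolding adj_def by (intro ptime_intros)
  then show "ptime f \<Longrightarrow> ptime g \<Longrightarrow> ptime h \<Longrightarrow> ptime (\<lambda>x. adj (f x) (g x) (h x))" by (rule ptime_comp3)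
qed

lemma ptime_reach [ptime_intros]:
  "ptime n \<Longrightarrow> ptime f \<Longrightarrow> ptime g \<Longrightarrow> ptime h \<Longrightarrow> ptime (\<lambda>x. reach i (n x) (f x) (g x) (h x))"
proof -
  have *: "ptime (\<lambda>z. reach i (fst z) (fst (snd z)) (fst (snd (snd z))) (snd (snd (snd z))))"
  proof (induction i)
    case 0
    show ?case unfolding reach.simps by (intro ptime_intros)
  next
    case (Suc i)
    have IH: "ptime (\<lambda>x. reach i (n x) (f x) (g x) (h x))" if "ptime n" "ptime f" "ptime g" "ptime h" for n f g h
      using ptime_comp[OF Suc.IH ptime_Pair[OF that(1) ptime_Pair[OF that(2) ptime_Pair[OF that(3,4)]]]] by simp
    show ?case unfolding reach.simps by (intro ptime_intros IH)
  qed
  show "ptime n \<Longrightarrow> ptime f \<Longrightarrow> ptime g \<Longrightarrow> ptime h \<Longrightarrow> ptime (\<lambda>x. reach i (n x) (f x) (g x) (h x))"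
    using ptime_comp[OF * ptime_Pair[OF _ ptime_Pair[OF _ ptime_Pair]], of n f g h] by simp
qed

lemma ptime_can_pack [ptime_intros]: "ptime f \<Longrightarrow> ptime g \<Longrightarrow> ptime (\<lambda>x. can_pack m (f x) (g x))"
proof -
  have "ptime (\<lambda>z. can_pack m (fst z) (snd z))"
  proof (induction m)
    case 0
    show ?case unfolding can_pack.simps by (intro ptime_intros)
  next
    case (Suc m)
    note IH = ptime_comp2[OF Suc.IH]
    show ?case unfolding can_pack.simps by (intro ptime_intros IH)
  qed
  then show "ptime f \<Longrightarrow> ptime g \<Longrightarrow> ptime (\<lambda>x. can_pack m (f x) (g x))" by (rule ptime_comp2)
qed

lemma ptime_pack_number [ptime_intros]: "ptime f \<Longrightarrow> ptime g \<Longrightarrow> ptime (\<lambda>x. pack_number m (f x) (g x))"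
proof -
  have "ptime (\<lambda>z. pack_number m (fst z) (snd z))"
    by (induction m) (unfold pack_number.simps, intro ptime_intros, intro ptime_intros)
  then show "ptime f \<Longrightarrow> ptime g \<Longrightarrow> ptime (\<lambda>x. pack_number m (f x) (g x))" by (rule ptime_comp2)
qed

lemma ptime_cluster [ptime_intros]:
  "ptime n \<Longrightarrow> ptime f \<Longrightarrow> ptime g \<Longrightarrow> ptime h \<Longrightarrow> ptime (\<lambda>x. cluster \<sigma> (n x) (f x) (g x) (h x))"
proof -
  have *: "ptime (\<lambda>z. cluster \<sigma> (fst z) (fst (snd z)) (fst (snd (snd z))) (snd (snd (snd z))))"
    unfolding cluster_def by (intro ptime_intros)
  show "ptime n \<Longrightarrow> ptime f \<Longrightarrow> ptime g \<Longrightarrow> ptime h \<Longrightarrow> ptime (\<lambda>x. cluster \<sigma> (n x) (f x) (g x) (h x))"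
    using ptime_comp[OF * ptime_Pair[OF _ ptime_Pair[OF _ ptime_Pair]], of n f g h] by simp
qed

lemma ptime_at_ranks [ptime_intros]: "ptime f \<Longrightarrow> ptime g \<Longrightarrow> ptime (\<lambda>x. at_ranks (f x) (g x))"
proof -
  have "ptime (\<lambda>z. at_ranks (fst z) (snd z))" unfolding at_ranks_def rank_def by (intro ptime_intros)
  then show "ptime f \<Longrightarrow> ptime g \<Longrightarrow> ptime (\<lambda>x. at_ranks (f x) (g x))" by (rule ptime_comp2)
qed

lemma ptime_cluster_opts: "ptime (\<lambda>z. cluster_opts \<sigma> D (fst z) (fst (snd z)) (snd (snd z)))"
  unfolding cluster_opts_def by (intro ptime_intros)

lemma ptime_base_number: "ptime (\<lambda>z. base_number \<sigma> D (fst z) (fst (snd z)) (snd (snd z)))"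
  unfolding base_number_def by (intro ptime_intros)

lemma rank_bij:
  assumes "distinct hub"
  shows "bij_betw (rank hub) (set hub) {..<length hub}"
proof -
  have r: "rank hub q = card {h \<in> set hub. h < q}" for q
    unfolding rank_def using distinct_card[of "filter (\<lambda>h. h < q) hub"] assms by simp
  have less: "rank hub q < rank hub q'" if "q \<in> set hub" "q < q'" for q q'
    unfolding r by (rule psubset_card_mono) (use that in auto)
  have inj: "inj_on (rank hub) (set hub)"
    by (rule linorder_inj_onI) (use less in \<open>auto simp: less_imp_neq\<close>)
  have "rank hub q < length hub" if "q \<in> set hub" for q
  proof -
    have "card {h \<in> set hub. h < q} < card (set hub)" by (rule psubset_card_mono) (use that in auto)
    then show ?thesis unfolding r using distinct_card[OF assms] by simp
  qed
  then have "rank hub ` set hub \<subseteq> {..<length hub}" by auto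
  moreover have "card (rank hub ` set hub) = length hub" using inj assms by (simp add: card_image distinct_card)
  ultimately have "rank hub ` set hub = {..<length hub}" by (intro card_subset_eq) auto
  then show ?thesis using inj by (simp add: bij_betw_def)
qed

section \<open>Triangle packings, component by component\<close>

definition packs :: "'a set \<Rightarrow> 'a set set \<Rightarrow> 'a set \<Rightarrow> nat \<Rightarrow> bool" where
  "packs V E X m \<longleftrightarrow> (\<exists>P. finite P \<and> disjoint P \<and> (\<forall>T\<in>P. triangle V E T \<and> T \<subseteq> X) \<and> card P = m)"

lemma packs_subset:
  assumes "packs V E X m" "X \<subseteq> Y"
  shows "packs V E Y m"
proof -
  obtain P where P: "finite P" "disjoint P" "\<forall>T\<in>P. triangle V E T \<and> T \<subseteq> X" "card P = m"
    using assms(1) unfolding packs_def by blast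
  have "\<forall>T\<in>P. triangle V E T \<and> T \<subseteq> Y" using P(3) assms(2) by blast
  with P show ?thesis unfolding packs_def by blast
qed

lemma packs_card:
  assumes "packs V E X m" "finite X"
  shows "3 * m \<le> card X"
proof -
  obtain P where P: "finite P" "disjoint P" "\<forall>T\<in>P. triangle V E T \<and> T \<subseteq> X" "card P = m"
    using assms(1) unfolding packs_def by blast
  have "card (\<Union>P) = 3 * card P" using P by (intro card_disjoint_triangles) auto
  moreover have "card (\<Union>P) \<le> card X" using P(3) assms(2) by (intro card_mono) auto
  ultimately show ?thesis using P(4) by simp
qed

lemma packs_UN:
  assumes "finite I" "\<And>i. i \<in> I \<Longrightarrow> packs V E (X i) (m i)"
    "\<And>i j. i \<in> I \<Longrightarrow> j \<in> I \<Longrightarrow> i \<noteq> j \<Longrightarrow> X i \<inter> X j = {}"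
  shows "packs V E (\<Union>(X ` I)) (\<Sum>i\<in>I. m i)"
proof -
  have "\<forall>i\<in>I. \<exists>P. finite P \<and> disjoint P \<and> (\<forall>T\<in>P. triangle V E T \<and> T \<subseteq> X i) \<and> card P = m i"
    using assms(2) unfolding packs_def by blast
  then obtain P where P: "\<forall>i\<in>I. finite (P i) \<and> disjoint (P i) \<and> (\<forall>T\<in>P i. triangle V E T \<and> T \<subseteq> X i) \<and> card (P i) = m i"
    by metis
  have ne: "T \<noteq> {}" if "i \<in> I" "T \<in> P i" for i T using P that triangle_cardE(4) by blast
  have "card (\<Union>(P ` I)) = (\<Sum>i\<in>I. card (P i))"
  proof (rule card_UN_disjoint[OF assms(1)])
    show "\<forall>i\<in>I. finite (P i)" using P by blast
    show "\<forall>i\<in>I. \<forall>j\<in>I. i \<noteq> j \<longrightarrow> P i \<inter> P j = {}"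
    proof (intro ballI impI)
      fix i j assume ij: "i \<in> I" "j \<in> I" "i \<noteq> j"
      show "P i \<inter> P j = {}"
      proof (rule ccontr)
        assume "P i \<inter> P j \<noteq> {}"
        then obtain T where T: "T \<in> P i" "T \<in> P j" by blast
        then have "T \<subseteq> X i \<inter> X j" using P ij by blast
        then show False using assms(3)[OF ij] ne[OF ij(1) T(1)] by blast
      qed
    qed
  qed
  also have "\<dots> = (\<Sum>i\<in>I. m i)" using P by (intro sum.cong) auto
  finally have c: "card (\<Union>(P ` I)) = (\<Sum>i\<in>I. m i)" .
  have "disjoint (\<Union>(P ` I))" unfolding disjoint_def
  proof (intro ballI impI)
    fix S T assume "S \<in> \<Union>(P ` I)" "T \<in> \<Union>(P ` I)" and neq: "S \<noteq> T"
    then obtain i j where ij: "i \<in> I" "j \<in> I" "S \<in> P i" "T \<in> P j" by blast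
    show "S \<inter> T = {}"
    proof (cases "i = j")
      case True
      then have "S \<in> P i" "T \<in> P i" "disjoint (P i)" using ij P by auto
      then show ?thesis using neq unfolding disjoint_def by blast
    next
      case False
      have "S \<subseteq> X i" "T \<subseteq> X j" using P ij by blast+
      then show ?thesis using assms(3)[OF ij(1,2) False] by blast
    qed
  qed
  moreover have "finite (\<Union>(P ` I))" using P assms(1) by blast
  moreover have "\<forall>T\<in>\<Union>(P ` I). triangle V E T \<and> T \<subseteq> \<Union>(X ` I)" using P by blast
  ultimately show ?thesis unfolding packs_def using c by blast
qed

text \<open>\<open>D\<close> bounds the number of hub vertices taken by one colour: at most
  \<open>\<delta>\<close> neighbours for a component, at most 3 for a triangle inside the
  hub.\<close>

locale hub_graph =
  fixes n :: nat and es :: "nat list list" and hub :: "nat list" and \<sigma> \<delta> D :: nat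
  assumes graph: "simple_graph {..<n} (set ` set es)"
    and hub: "is_hub \<sigma> \<delta> {..<n} (set ` set es) (set hub)"
    and dist: "distinct hub" and D: "\<delta> \<le> D" "3 \<le> D"
begin

abbreviation "E \<equiv> set ` set es"
abbreviation "V \<equiv> {..<n}"

definition R :: "(nat \<times> nat) set" where
  "R = {(x, y). {x, y} \<in> {e \<in> E. e \<inter> set hub = {}}}"

definition comp :: "nat \<Rightarrow> nat set" where
  "comp v = {w. w \<in> V - set hub \<and> (v, w) \<in> R\<^sup>*}"

lemma edge_card: "e \<in> E \<Longrightarrow> e \<subseteq> V \<and> card e = 2"
  using graph unfolding simple_graph_def by blast

lemma edge_neq: "{u, v} \<in> E \<Longrightarrow> u \<noteq> v"
  using edge_card[of "{u, v}"] by (cases "u = v") auto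

lemma adj_iff: "adj es u v \<longleftrightarrow> {u, v} \<in> E"
proof
  assume "adj es u v"
  then obtain e where e: "e \<in> set es" "u \<in> set e" "v \<in> set e" "u \<noteq> v" unfolding adj_def by blast
  then have "card (set e) = 2" using edge_card by blast
  then have "set e = {u, v}" using e by (metis card_2_iff doubleton_eq_iff insertE singletonD)
  then show "{u, v} \<in> E" using e(1) by blast
next
  assume uv: "{u, v} \<in> E"
  then obtain e where e: "e \<in> set es" "{u, v} = set e" by (rule imageE) simp
  have "u \<in> set e" "v \<in> set e" unfolding e(2)[symmetric] by simp_all
  then show "adj es u v" unfolding adj_def using e(1) edge_neq[OF uv] by blast
qed

lemma hub_subset: "set hub \<subseteq> V"
  using hub unfolding is_hub_def by blast

lemma R_iff: "(x, y) \<in> R \<longleftrightarrow> {x, y} \<in> E \<and> x \<notin> set hub \<and> y \<notin> set hub"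
  unfolding R_def by auto

lemma R_sym: "sym R"
  unfolding sym_def R_iff by (auto simp: insert_commute)

lemma R_in_V: "(x, y) \<in> R \<Longrightarrow> y \<in> V - set hub"
  unfolding R_iff using edge_card by blast

lemma comp_component:
  assumes "v \<in> V - set hub"
  shows "card (comp v) \<le> \<sigma>" "card {q \<in> set hub. \<exists>u\<in>comp v. {q, u} \<in> E} \<le> \<delta>"
proof -
  let ?r = "{(u, v). u \<in> V - set hub \<and> v \<in> V - set hub \<and> (u, v) \<in> R\<^sup>*}"
  have "?r `` {v} \<in> (V - set hub) // ?r" using assms by (rule quotientI)
  moreover have "?r `` {v} = comp v" using assms unfolding comp_def by auto
  ultimately have "comp v \<in> components (V - set hub) {e \<in> E. e \<inter> set hub = {}}"
    unfolding components_def R_def by simp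
  then show "card (comp v) \<le> \<sigma>" "card {q \<in> set hub. \<exists>u\<in>comp v. {q, u} \<in> E} \<le> \<delta>"
    using hub unfolding is_hub_def by blast+
qed

lemma comp_finite: "finite (comp v)"
  unfolding comp_def by simp

lemma comp_eq:
  assumes "w \<in> comp v"
  shows "comp w = comp v"
proof -
  have vw: "(v, w) \<in> R\<^sup>*" using assms unfolding comp_def by blast
  then have "(w, v) \<in> R\<^sup>*" using sym_rtrancl[OF R_sym] by (meson symD)
  then show ?thesis unfolding comp_def using vw by (auto intro: rtrancl_trans)
qed

text \<open>A round that does not start with the whole component adds a vertex, and the component
  has at most \<open>\<sigma>\<close> vertices.\<close>

lemma reach_eq:
  assumes v: "v \<in> V - set hub"
  shows "set (reach \<sigma> n es hub v) = comp v"
proof -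
  let ?S = "\<lambda>i. set (reach i n es hub v)"
  have sub: "?S i \<subseteq> comp v" for i
  proof (induction i)
    case 0
    then show ?case using v unfolding comp_def by simp
  next
    case (Suc i)
    show ?case
    proof
      fix w assume "w \<in> ?S (Suc i)"
      then have w: "w \<in> V - set hub" "w \<in> ?S i \<or> (\<exists>u\<in>?S i. {u, w} \<in> E)" by (auto simp: adj_iff)
      show "w \<in> comp v"
      proof (cases "w \<in> ?S i")
        case False
        then obtain u where u: "u \<in> ?S i" "{u, w} \<in> E" using w(2) by blast
        then have "u \<in> comp v" using Suc by blast
        then have "(v, u) \<in> R\<^sup>*" "(u, w) \<in> R" using u(2) w(1) unfolding comp_def R_iff by auto
        then show ?thesis using w(1) unfolding comp_def by (auto intro: rtrancl_into_rtrancl)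
      qed (use Suc in blast)
    qed
  qed
  have mono: "?S i \<subseteq> ?S (Suc i)" for i
    using sub[of i] unfolding comp_def by auto
  have v0: "v \<in> ?S i" for i
  proof (induction i)
    case (Suc i)
    then show ?case using mono[of i] by blast
  qed simp
  have "?S i = comp v \<or> i < card (?S i)" for i
  proof (induction i)
    case (Suc i)
    show ?case
    proof (cases "?S i = comp v")
      case True
      then show ?thesis using mono[of i] sub[of "Suc i"] by blast
    next
      case False
      have "\<exists>u\<in>?S i. \<exists>w. w \<notin> ?S i \<and> (u, w) \<in> R"
      proof (rule ccontr)
        assume closed: "\<not> (\<exists>u\<in>?S i. \<exists>w. w \<notin> ?S i \<and> (u, w) \<in> R)"
        have "w \<in> ?S i" if "(v, w) \<in> R\<^sup>*" for w
          using that by (induction rule: rtrancl_induct) (use v0 closed in blast)+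
        then have "comp v \<subseteq> ?S i" unfolding comp_def by blast
        then show False using False sub[of i] by blast
      qed
      then obtain u w where uw: "u \<in> ?S i" "w \<notin> ?S i" "(u, w) \<in> R" by blast
      have "w \<in> ?S (Suc i)" using uw R_in_V[OF uw(3)] by (auto simp: adj_iff R_iff)
      then have "?S i \<subset> ?S (Suc i)" using mono[of i] uw(2) by blast
      then have "card (?S i) < card (?S (Suc i))" by (intro psubset_card_mono) simp_all
      then show ?thesis using Suc False by linarith
    qed
  qed simp
  moreover have "card (?S \<sigma>) \<le> \<sigma>"
    using card_mono[OF comp_finite sub[of \<sigma>]] comp_component(1)[OF v] by simp
  ultimately show ?thesis by (metis not_le)
qed

definition C :: "nat \<Rightarrow> nat set" where
  "C v = set (cluster \<sigma> n es hub v)"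

lemma C_eq: "v < n \<Longrightarrow> C v = (if v \<notin> set hub \<and> (\<forall>u\<in>comp v. v \<le> u) then comp v else {})"
  using reach_eq[of v] unfolding C_def cluster_def by auto

lemma C_subset: "v < n \<Longrightarrow> C v \<subseteq> V - set hub"
  unfolding C_eq comp_def by auto

lemma C_disjoint:
  assumes "u < n" "v < n" "u \<noteq> v"
  shows "C u \<inter> C v = {}"
proof (rule ccontr)
  assume "C u \<inter> C v \<noteq> {}"
  then obtain w where w: "w \<in> C u" "w \<in> C v" by blast
  then have *: "u \<notin> set hub" "v \<notin> set hub" "w \<in> comp u" "w \<in> comp v" "\<forall>x\<in>comp u. u \<le> x" "\<forall>x\<in>comp v. v \<le> x"
    using assms C_eq[of u] C_eq[of v] by (auto split: if_splits)
  then have "comp u = comp v" using comp_eq by metis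
  moreover have "u \<in> comp u" "v \<in> comp v" using assms *(1,2) unfolding comp_def by auto
  ultimately have "u \<le> v" "v \<le> u" using *(5,6) by auto
  then show False using assms(3) by simp
qed

lemma C_cover:
  assumes "w \<in> V - set hub"
  shows "\<exists>v<n. v \<notin> set hub \<and> w \<in> C v \<and> C v = comp w"
proof -
  let ?v = "Min (comp w)"
  have w: "w \<in> comp w" using assms unfolding comp_def by auto
  then have v: "?v \<in> comp w" using comp_finite Min_in by blast
  then have "?v < n" "?v \<notin> set hub" unfolding comp_def by auto
  moreover have "comp ?v = comp w" by (rule comp_eq[OF v])
  moreover have "\<forall>u\<in>comp w. ?v \<le> u" using comp_finite by (simp add: Min_le)
  ultimately show ?thesis using w C_eq[of ?v] by (intro exI[of _ ?v]) simp
qed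

lemma triangle_adj: "triangle V E T \<longleftrightarrow> (\<exists>a b c. T = {a, b, c} \<and> adj es a b \<and> adj es b c \<and> adj es a c)"
proof
  assume T: "triangle V E T"
  then obtain a b c where abc: "T = {a, b, c}" "a \<noteq> b" "b \<noteq> c" "a \<noteq> c"
    unfolding triangle_def by (metis card_3_iff)
  have "{u, v} \<in> E" if "u \<in> T" "v \<in> T" "u \<noteq> v" for u v using T that unfolding triangle_def by simp
  then have "adj es a b" "adj es b c" "adj es a c" unfolding adj_iff using abc by simp_all
  then show "\<exists>a b c. T = {a, b, c} \<and> adj es a b \<and> adj es b c \<and> adj es a c" using abc(1) by blast
next
  assume "\<exists>a b c. T = {a, b, c} \<and> adj es a b \<and> adj es b c \<and> adj es a c"
  then obtain a b c where T: "T = {a, b, c}" "{a, b} \<in> E" "{b, c} \<in> E" "{a, c} \<in> E" unfolding adj_iff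
    by (elim exE conjE)
  then have "a \<noteq> b" "b \<noteq> c" "a \<noteq> c" using edge_neq by simp_all
  moreover have "T \<subseteq> V" using T(1) edge_card[OF T(2)] edge_card[OF T(3)] by simp
  ultimately show "triangle V E T" unfolding triangle_def using T by (auto simp: insert_commute)
qed

lemma can_pack_iff: "can_pack m es X \<longleftrightarrow> packs V E (set X) m"
proof (induction m arbitrary: X)
  case 0
  show ?case unfolding packs_def by (auto intro!: exI[of _ "{}"] simp: disjoint_def)
next
  case (Suc m)
  show ?case
  proof
    assume "can_pack (Suc m) es X"
    then obtain a b c where abc: "a \<in> set X" "b \<in> set X" "c \<in> set X" "adj es a b" "adj es b c" "adj es a c"
      "can_pack m es (filter (\<lambda>y. y \<noteq> a \<and> y \<noteq> b \<and> y \<noteq> c) X)" by auto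
    let ?T = "{a, b, c}"
    have T: "triangle V E ?T" unfolding triangle_adj using abc by blast
    obtain P where P: "finite P" "disjoint P" "\<forall>T\<in>P. triangle V E T \<and> T \<subseteq> set X - ?T" "card P = m"
    proof -
      have "set (filter (\<lambda>y. y \<noteq> a \<and> y \<noteq> b \<and> y \<noteq> c) X) = set X - ?T" by auto
      then show ?thesis using abc(7) that unfolding Suc.IH packs_def by auto
    qed
    have nT: "?T \<notin> P"
    proof
      assume "?T \<in> P"
      then have "?T \<subseteq> set X - ?T" by (rule bspec[OF P(3), THEN conjunct2])
      then show False by simp
    qed
    have "T' \<inter> ?T = {}" if "T' \<in> P" for T' using bspec[OF P(3) that] by auto
    then have "disjoint (insert ?T P)" using P(2) by (simp add: pairwise_insert disjnt_def Int_commute)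
    then show "packs V E (set X) (Suc m)" unfolding packs_def
      using P T nT abc(1-3) by (intro exI[of _ "insert ?T P"]) auto
  next
    assume "packs V E (set X) (Suc m)"
    then obtain P where P: "finite P" "disjoint P" "\<forall>T\<in>P. triangle V E T \<and> T \<subseteq> set X" "card P = Suc m"
      unfolding packs_def by blast
    then obtain T where T: "T \<in> P" by (metis card.empty equals0I nat.distinct(1))
    then obtain a b c where abc: "T = {a, b, c}" "adj es a b" "adj es b c" "adj es a c"
      using P(3) triangle_adj[of T] by auto
    have "packs V E (set (filter (\<lambda>y. y \<noteq> a \<and> y \<noteq> b \<and> y \<noteq> c) X)) m" unfolding packs_def
    proof (intro exI[of _ "P - {T}"] conjI)
      show "disjoint (P - {T})" using P(2) by (simp add: pairwise_subset[OF _ Diff_subset])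
      have "T' \<inter> T = {}" if "T' \<in> P - {T}" for T' using P(2) T that unfolding disjoint_def by blast
      moreover have "set (filter (\<lambda>y. y \<noteq> a \<and> y \<noteq> b \<and> y \<noteq> c) X) = set X - T" unfolding abc(1) by auto
      ultimately show "\<forall>T'\<in>P - {T}. triangle V E T' \<and> T' \<subseteq> set (filter (\<lambda>y. y \<noteq> a \<and> y \<noteq> b \<and> y \<noteq> c) X)"
        using P(3) by (metis Diff_iff Diff_triv Diff_mono order_refl)
      show "card (P - {T}) = m" using P(1,4) T by simp
    qed (use P(1) in simp)
    then have "can_pack m es (filter (\<lambda>y. y \<noteq> a \<and> y \<noteq> b \<and> y \<noteq> c) X)" unfolding Suc.IH .
    moreover have "T \<subseteq> set X" using bspec[OF P(3) T] by simp
    then have "a \<in> set X" "b \<in> set X" "c \<in> set X" unfolding abc(1) by simp_all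
    ultimately show "can_pack (Suc m) es X" unfolding can_pack.simps using abc(2-4) by blast
  qed
qed

lemma pack_number_packs: "packs V E (set X) (pack_number m es X)"
proof (induction m)
  case 0
  show ?case unfolding packs_def by (auto intro!: exI[of _ "{}"] simp: disjoint_def)
next
  case (Suc m)
  then show ?case by (auto simp: can_pack_iff simp del: can_pack.simps)
qed

lemma pack_number_max: "packs V E (set X) i \<Longrightarrow> i \<le> m \<Longrightarrow> i \<le> pack_number m es X"
proof (induction m)
  case (Suc m)
  then show ?case by (auto simp: can_pack_iff le_Suc_eq simp del: can_pack.simps)
qed simp

end

lemma packs_imp_packing: "packs V E X m \<Longrightarrow> t \<le> m \<Longrightarrow> has_triangle_packing V E t"
  unfolding packs_def has_triangle_packing_def by auto

lemma packsI:
  "finite P \<Longrightarrow> disjoint P \<Longrightarrow> (\<And>T. T \<in> P \<Longrightarrow> triangle V E T) \<Longrightarrow> (\<And>T. T \<in> P \<Longrightarrow> T \<subseteq> X) \<Longrightarrow>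
    packs V E X (card P)"
  unfolding packs_def by blast

context hub_graph
begin

abbreviation "cl \<equiv> cluster \<sigma> n es hub"
abbreviation "pn \<equiv> pack_number (\<sigma> + D) es"
abbreviation "qs \<equiv> cluster_opts \<sigma> D n es hub"

definition S :: "nat set \<Rightarrow> nat set" where
  "S J = {h \<in> set hub. rank hub h \<in> J}"

lemma set_at_ranks: "set (at_ranks hub I) = S (set I)"
  unfolding at_ranks_def S_def by auto

lemma rank_inj: "inj_on (rank hub) (set hub)" and rank_image: "rank hub ` set hub = {..<length hub}"
  using rank_bij[OF dist] unfolding bij_betw_def by blast+

lemma S_rank: "Y \<subseteq> set hub \<Longrightarrow> S (rank hub ` Y) = Y"
  unfolding S_def using rank_inj by (auto dest: inj_onD)

lemma card_C: "v < n \<Longrightarrow> card (C v) \<le> \<sigma>"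
  using C_eq[of v] comp_component(1)[of v] by auto

lemma pn_max: "packs V E (set X) i \<Longrightarrow> card (set X) \<le> \<sigma> + D \<Longrightarrow> i \<le> pn X"
  using pack_number_max[of X i "\<sigma> + D"] packs_card[of V E "set X" i] by simp

lemma pn_le: "pack_number m es X \<le> m"
  by (induction m) auto

lemma pn_mono: "set X \<subseteq> set Y \<Longrightarrow> pn X \<le> pn Y"
  by (rule pack_number_max[OF packs_subset[OF pack_number_packs] pn_le])

lemma in_options_iff:
  "q \<in> set qs \<longleftrightarrow> fst q < n \<and> sorted_wrt (<) (fst (snd q)) \<and> set (fst (snd q)) \<subseteq> {..<length hub} \<and>
     length (fst (snd q)) \<le> D \<and> fst (snd q) \<noteq> [] \<and>
     snd (snd q) = pn (cl (fst q) @ at_ranks hub (fst (snd q))) - pn (cl (fst q))"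
proof -
  obtain v I x where q: "q = (v, I, x)" by (metis surj_pair)
  have "(v, I, x) \<in> set qs \<longleftrightarrow> v < n \<and> I \<in> set (inc_lists D [0..<length hub]) \<and> I \<noteq> [] \<and>
      x = pn (cl v @ at_ranks hub I) - pn (cl v)"
    unfolding cluster_opts_def by auto
  then show ?thesis unfolding q in_inc_lists_iff by (auto simp: atLeast0LessThan)
qed

lemma base_sum: "base_number \<sigma> D n es hub = (\<Sum>v<n. pn (cl v))"
  unfolding base_number_def by (simp add: interv_sum_list_conv_sum_set_nat atLeast0LessThan)

text \<open>Each colour \<open>v\<close> has at most one choice. Its cluster together with the
  chosen hub vertices packs \<open>pn (cl v)\<close> plus the gain, and these regions are disjoint
  for different colours.\<close>

lemma coloured_cover_imp_packing:
  assumes "coloured_cover (length hub) qs (t - base_number \<sigma> D n es hub)"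
  shows "has_triangle_packing V E t"
proof -
  obtain Q where Q: "Q \<subseteq> set qs" "compatible Q" "t - base_number \<sigma> D n es hub \<le> (\<Sum>q\<in>Q. gain q)"
    using assms unfolding coloured_cover_def by blast
  have finQ: "finite Q" using Q(1) finite_subset by blast
  define W where "W v = {q \<in> Q. fst q = v}" for v
  have W: "W v = {} \<or> (\<exists>q. W v = {q})" for v
  proof (rule ccontr)
    assume "\<not> (W v = {} \<or> (\<exists>q. W v = {q}))"
    then obtain q q' where "q \<in> W v" "q' \<in> W v" "q \<noteq> q'" by blast
    then show False using Q(2) unfolding W_def compatible_def inj_on_def by force
  qed
  define X where "X v = C v \<union> \<Union>((\<lambda>q. S (cells q)) ` W v)" for v
  have p: "packs V E (X v) (pn (cl v) + (\<Sum>q\<in>W v. gain q))" if v: "v < n" for v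
  proof -
    consider "W v = {}" | q where "W v = {q}" using W[of v] by blast
    then show ?thesis
    proof cases
      case 1
      then show ?thesis unfolding X_def C_def using pack_number_packs[of "cl v"] by simp
    next
      case (2 q)
      have q: "q \<in> set qs" "fst q = v" using 2 Q(1) unfolding W_def by blast+
      have X: "X v = set (cl v @ at_ranks hub (fst (snd q)))"
        unfolding X_def 2 C_def cells_def by (simp add: set_at_ranks)
      have "pn (cl v) \<le> pn (cl v @ at_ranks hub (fst (snd q)))" by (rule pn_mono) simp
      moreover have "gain q = pn (cl v @ at_ranks hub (fst (snd q))) - pn (cl v)"
        using q unfolding in_options_iff gain_def by simp
      ultimately have "pn (cl v) + (\<Sum>q\<in>W v. gain q) = pn (cl v @ at_ranks hub (fst (snd q)))" unfolding 2 by simp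
      then show ?thesis unfolding X using pack_number_packs[of "cl v @ at_ranks hub (fst (snd q))" "\<sigma> + D"] by simp
    qed
  qed
  have X: "X u \<inter> X v = {}" if uv: "u < n" "v < n" "u \<noteq> v" for u v
  proof -
    have h: "S J \<subseteq> set hub" for J unfolding S_def by auto
    have "S (cells q) \<inter> S (cells q') = {}" if "q \<in> W u" "q' \<in> W v" for q q'
    proof -
      have "q \<noteq> q'" "q \<in> Q" "q' \<in> Q" using that uv(3) unfolding W_def by auto
      then have "cells q \<inter> cells q' = {}" using Q(2) unfolding compatible_def by simp
      then show ?thesis unfolding S_def by blast
    qed
    then have "\<Union>((\<lambda>q. S (cells q)) ` W u) \<inter> \<Union>((\<lambda>q. S (cells q)) ` W v) = {}" by blast
    moreover have "C u \<inter> C v = {}" by (rule C_disjoint[OF uv])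
    moreover have "C u \<inter> \<Union>((\<lambda>q. S (cells q)) ` W v) = {}" using C_subset[OF uv(1)] h by blast
    moreover have "C v \<inter> \<Union>((\<lambda>q. S (cells q)) ` W u) = {}" using C_subset[OF uv(2)] h by blast
    ultimately show ?thesis unfolding X_def Int_Un_distrib Int_Un_distrib2
      by (simp only: Int_commute[of _ "C v"] Un_empty_left)
  qed
  have "packs V E (\<Union>(X ` {..<n})) (\<Sum>v<n. pn (cl v) + (\<Sum>q\<in>W v. gain q))"
    by (rule packs_UN) (use p X in auto)
  moreover have "(\<Sum>v<n. \<Sum>q\<in>W v. gain q) = (\<Sum>q\<in>Q. gain q)"
    unfolding W_def using Q(1) finQ by (intro sum.group) (auto simp: in_options_iff)
  then have "t \<le> (\<Sum>v<n. pn (cl v) + (\<Sum>q\<in>W v. gain q))" using Q(3) unfolding base_sum sum.distrib by simp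
  ultimately show ?thesis by (rule packs_imp_packing)
qed

text \<open>A triangle is a clique, so its vertices outside the hub lie in one component, and every
  triangle can be charged to one colour. The hub vertices of the triangles charged to a colour form
  its choice.\<close>

lemma packing_imp_coloured_cover:
  assumes "has_triangle_packing V E t"
  shows "coloured_cover (length hub) qs (t - base_number \<sigma> D n es hub)"
proof -
  obtain P where P: "finite P" "disjoint P" "\<forall>T\<in>P. triangle V E T" "t \<le> card P"
    using assms unfolding has_triangle_packing_def by (elim exE conjE)
  have T: "T \<subseteq> V" "card T = 3" "finite T" "T \<noteq> {}" if "T \<in> P" for T
    using triangle_cardE[OF bspec[OF P(3) that]] by blast+
  have Tadj: "{u, w} \<in> E" if "T \<in> P" "u \<in> T" "w \<in> T" "u \<noteq> w" for T u w
    using bspec[OF P(3) that(1)] that(2-4) unfolding triangle_def by simp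
  have same: "T = T'" if "T \<in> P" "T' \<in> P" "x \<in> T" "x \<in> T'" for T T' x
    using P(2) that unfolding disjoint_def by blast
  have Tcomp: "u \<in> comp w" if "T \<in> P" "u \<in> T" "w \<in> T" "u \<notin> set hub" "w \<notin> set hub" for T u w
  proof -
    have "u \<in> V" using T(1)[OF that(1)] that(2) by blast
    moreover have "(w, u) \<in> R\<^sup>*"
    proof (cases "u = w")
      case False
      then have "(w, u) \<in> R" unfolding R_iff using Tadj[OF that(1,3,2)] that(4,5) by simp
      then show ?thesis by simp
    qed simp
    ultimately show ?thesis unfolding comp_def using that(4) by simp
  qed
  \<comment> \<open>A triangle inside the hub is charged to its least vertex, which gives each hub
    vertex at most one such triangle.\<close>
  define A where "A v = (if v \<in> set hub then {T \<in> P. T \<subseteq> set hub \<and> Min T = v} else {T \<in> P. T \<inter> C v \<noteq> {}})" for v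
  \<comment> \<open>The cover must exhaust the hub, so a hub vertex in no triangle is taken by its
    own colour, with gain 0.\<close>
  define Y where "Y v = (\<Union>(A v) \<inter> set hub) \<union> (if v \<in> set hub \<and> v \<notin> \<Union>P then {v} else {})" for v
  have AP: "A v \<subseteq> P" for v unfolding A_def by auto
  have Ahub: "T \<subseteq> set hub" if "T \<in> A v" "v \<in> set hub" for T v using that unfolding A_def by auto
  have Anon: "\<not> T \<subseteq> set hub" if *: "T \<in> A v" "v \<notin> set hub" "v < n" for T v
  proof -
    obtain u where "u \<in> T" "u \<in> C v" using *(1,2) unfolding A_def by auto
    then show ?thesis using C_subset[OF *(3)] by blast
  qed
  have CvT: "T \<subseteq> C v \<union> set hub" "\<exists>u\<in>T. u \<in> C v \<and> C v = comp v" if A: "T \<in> A v" and v: "v < n" "v \<notin> set hub" for T v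
  proof -
    obtain u where u: "u \<in> T" "u \<in> C v" using A v(2) unfolding A_def by auto
    have "C v \<noteq> {}" using u(2) by blast
    then have Cv: "C v = comp v" using C_eq[OF v(1)] by (auto split: if_splits)
    then show "\<exists>u\<in>T. u \<in> C v \<and> C v = comp v" using u by blast
    have uh: "u \<notin> set hub" using C_subset[OF v(1)] u(2) by blast
    have "comp u = comp v" using comp_eq u(2) Cv by simp
    show "T \<subseteq> C v \<union> set hub"
    proof
      fix w assume w: "w \<in> T"
      have "w \<in> comp u" if "w \<notin> set hub" using Tcomp[OF _ w u(1) that uh] A AP by blast
      then show "w \<in> C v \<union> set hub" using \<open>comp u = comp v\<close> Cv by blast
    qed
  qed
  have Adis: "A u \<inter> A v = {}" if uv: "u < n" "v < n" "u \<noteq> v" for u v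
  proof (rule ccontr)
    assume "A u \<inter> A v \<noteq> {}"
    then obtain T where T2: "T \<in> A u" "T \<in> A v" by blast
    consider "u \<in> set hub" "v \<in> set hub" | "u \<in> set hub" "v \<notin> set hub" | "u \<notin> set hub" "v \<in> set hub"
      | "u \<notin> set hub" "v \<notin> set hub" by blast
    then show False
    proof cases
      case 1
      then show ?thesis using T2 uv(3) unfolding A_def by auto
    next
      case 2
      then show ?thesis using Ahub[OF T2(1)] Anon[OF T2(2)] uv by blast
    next
      case 3
      then show ?thesis using Ahub[OF T2(2)] Anon[OF T2(1)] uv by blast
    next
      case 4
      obtain x where x: "x \<in> T" "x \<in> C u" using CvT(2)[OF T2(1) uv(1) 4(1)] by blast
      have "x \<in> C v \<union> set hub" using CvT(1)[OF T2(2) uv(2) 4(2)] x(1) by blast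
      moreover have "x \<notin> set hub" using C_subset[OF uv(1)] x(2) by blast
      ultimately show ?thesis using C_disjoint[OF uv] x(2) by blast
    qed
  qed
  have Acov: "(\<Union>v<n. A v) = P"
  proof
    show "P \<subseteq> (\<Union>v<n. A v)"
    proof
      fix U assume U: "U \<in> P"
      show "U \<in> (\<Union>v<n. A v)"
      proof (cases "U \<subseteq> set hub")
        case True
        have "Min U \<in> U" using T(3,4)[OF U] by simp
        then have "Min U \<in> set hub" "Min U < n" using True T(1)[OF U] by auto
        then show ?thesis using U True unfolding A_def by (intro UN_I[of "Min U"]) auto
      next
        case False
        then obtain w where w: "w \<in> U" "w \<notin> set hub" by blast
        then have "w \<in> V - set hub" using T(1)[OF U] by blast
        then obtain v where "v < n" "v \<notin> set hub" "w \<in> C v" using C_cover by blast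
        then show ?thesis using U w(1) unfolding A_def by (intro UN_I[of v]) auto
      qed
    qed
  qed (use AP in blast)
  have Ysub: "v < n \<Longrightarrow> Y v \<subseteq> set hub" for v unfolding Y_def by auto
  have Ydis: "Y u \<inter> Y v = {}" if uv: "u < n" "v < n" "u \<noteq> v" for u v
  proof (rule ccontr)
    assume "Y u \<inter> Y v \<noteq> {}"
    then obtain x where x: "x \<in> Y u" "x \<in> Y v" by blast
    show False
    proof (cases "x \<in> \<Union>P")
      case True
      then obtain T1 T2 where T12: "T1 \<in> A u" "T2 \<in> A v" "x \<in> T1" "x \<in> T2"
        using x unfolding Y_def by (auto split: if_splits)
      then have "T1 = T2" using same AP by blast
      then show ?thesis using T12 Adis[OF uv] by blast
    next
      case False
      then have "x \<notin> \<Union>(A u)" "x \<notin> \<Union>(A v)" using AP by blast+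
      then show ?thesis using x uv(3) unfolding Y_def by (auto split: if_splits)
    qed
  qed
  have Ycov: "(\<Union>v<n. Y v) = set hub"
  proof
    show "set hub \<subseteq> (\<Union>v<n. Y v)"
    proof
      fix h assume h: "h \<in> set hub"
      show "h \<in> (\<Union>v<n. Y v)"
      proof (cases "h \<in> \<Union>P")
        case True
        then obtain U v where "v < n" "U \<in> A v" "h \<in> U" using Acov by blast
        then show ?thesis using h unfolding Y_def by (intro UN_I[of v]) auto
      next
        case False
        have "h < n" using hub_subset h by blast
        then show ?thesis using h False unfolding Y_def by (intro UN_I[of h]) auto
      qed
    qed
  qed (use Ysub in blast)
  have Ycard: "card (Y v) \<le> D" if v: "v < n" for v
  proof (cases "v \<in> set hub")
    case True
    have Av: "v \<in> U" if "U \<in> A v" for U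
      using that True T(3,4)[of U] Min_in[of U] unfolding A_def by auto
    show ?thesis
    proof (cases "A v = {}")
      case True
      then show ?thesis unfolding Y_def using D(2) by simp
    next
      case False
      then obtain U where U: "U \<in> A v" by blast
      have "A v = {U}" using same[OF _ _ Av Av] AP U by blast
      moreover have "v \<in> \<Union>P" using Av[OF U] U AP by blast
      ultimately have "Y v \<subseteq> U" unfolding Y_def by auto
      moreover have "U \<in> P" using U AP by blast
      ultimately have "card (Y v) \<le> 3" using card_mono[of U "Y v"] T(2,3)[of U] by simp
      then show ?thesis using D(2) by simp
    qed
  next
    case False
    show ?thesis
    proof (cases "A v = {}")
      case True
      then show ?thesis unfolding Y_def using False by simp
    next
      case nonempty: False
      then obtain U0 where U0: "U0 \<in> A v" by blast
      have Cv: "C v = comp v" using CvT(2)[OF U0 v False] by blast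
      have "Y v \<subseteq> {q \<in> set hub. \<exists>u\<in>comp v. {q, u} \<in> E}"
      proof
        fix q assume "q \<in> Y v"
        then obtain U where U: "U \<in> A v" "q \<in> U" "q \<in> set hub" using False unfolding Y_def by auto
        obtain u where u: "u \<in> U" "u \<in> C v" using CvT(2)[OF U(1) v False] by blast
        have "u \<notin> set hub" using C_subset[OF v] u(2) by blast
        then have "q \<noteq> u" using U(3) by blast
        moreover have "U \<in> P" using U(1) AP by blast
        ultimately have "{q, u} \<in> E" using Tadj[of U q u] U(2) u(1) by simp
        then show "q \<in> {q \<in> set hub. \<exists>u\<in>comp v. {q, u} \<in> E}" using U(3) u(2) Cv by auto
      qed
      then have "card (Y v) \<le> card {q \<in> set hub. \<exists>u\<in>comp v. {q, u} \<in> E}" by (rule card_mono[rotated]) simp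
      also have "\<dots> \<le> \<delta>" using comp_component(2)[of v] v False by simp
      finally show ?thesis using D(1) by simp
    qed
  qed
  define I where "I v = sorted_list_of_set (rank hub ` Y v)" for v
  have Yfin: "finite (Y v)" if "v < n" for v using Ysub[OF that] finite_subset by blast
  have setI: "set (I v) = rank hub ` Y v" if "v < n" for v unfolding I_def using Yfin[OF that] by simp
  have lenI: "length (I v) = card (Y v)" if "v < n" for v
    unfolding I_def using card_image[OF inj_on_subset[OF rank_inj Ysub[OF that]]] by simp
  have subI: "set (I v) \<subseteq> {..<length hub}" if "v < n" for v
    unfolding setI[OF that] using Ysub[OF that] rank_image by blast
  have atI: "set (cl v @ at_ranks hub (I v)) = C v \<union> Y v" if "v < n" for v
    unfolding set_append set_at_ranks setI[OF that] S_rank[OF Ysub[OF that]] C_def ..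
  define opt where "opt v = (v, I v, pn (cl v @ at_ranks hub (I v)) - pn (cl v))" for v
  \<comment> \<open>Colours without hub vertices make no choice; their triangles lie within the
    cluster and are already in \<open>base_number\<close>.\<close>
  define Z where "Z = {v. v < n \<and> Y v \<noteq> {}}"
  have finZ: "finite Z" unfolding Z_def by simp
  have cells: "cells (opt v) = rank hub ` Y v" if "v < n" for v unfolding cells_def opt_def using setI[OF that] by simp
  have "opt ` Z \<subseteq> set qs"
  proof
    fix q assume "q \<in> opt ` Z"
    then obtain v where v: "v < n" "Y v \<noteq> {}" "q = opt v" unfolding Z_def by blast
    have "I v \<noteq> []" using setI[OF v(1)] v(2) by auto
    then show "q \<in> set qs" unfolding in_options_iff v(3) opt_def
      using v(1) subI[OF v(1)] lenI[OF v(1)] Ycard[OF v(1)] by (simp add: I_def)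
  qed
  moreover have "compatible (opt ` Z)" unfolding compatible_def
  proof (intro conjI ballI impI)
    show "inj_on fst (opt ` Z)" unfolding inj_on_def opt_def by auto
    fix q q' assume "q \<in> opt ` Z" "q' \<in> opt ` Z" "q \<noteq> q'"
    then obtain u v where uv: "u < n" "v < n" "q = opt u" "q' = opt v" "u \<noteq> v" unfolding Z_def by blast
    have "rank hub ` Y u \<inter> rank hub ` Y v = rank hub ` (Y u \<inter> Y v)"
      by (rule inj_on_image_Int[OF rank_inj Ysub[OF uv(1)] Ysub[OF uv(2)], symmetric])
    then show "cells q \<inter> cells q' = {}" unfolding uv(3,4) cells[OF uv(1)] cells[OF uv(2)] Ydis[OF uv(1,2,5)] by simp
  qed
  moreover have "\<Union>(cells ` opt ` Z) = {..<length hub}"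
  proof -
    have "\<Union>(cells ` opt ` Z) = (\<Union>v\<in>Z. rank hub ` Y v)" using cells unfolding Z_def by auto
    also have "\<dots> = rank hub ` (\<Union>v<n. Y v)" unfolding Z_def by auto
    finally show ?thesis unfolding Ycov rank_image .
  qed
  moreover have "t - base_number \<sigma> D n es hub \<le> (\<Sum>q\<in>opt ` Z. gain q)"
  proof -
    have pk: "card (A v) \<le> pn (cl v @ at_ranks hub (I v))" if v: "v < n" for v
    proof (rule pn_max)
      have "U \<subseteq> C v \<union> Y v" if U: "U \<in> A v" for U
      proof (cases "v \<in> set hub")
        case True
        then show ?thesis using Ahub[OF U] U unfolding Y_def by blast
      next
        case False
        then show ?thesis using CvT(1)[OF U v] U unfolding Y_def by blast
      qed
      moreover have "finite (A v)" using AP P(1) finite_subset by blast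
      moreover have "disjoint (A v)" using P(2) AP pairwise_subset by blast
      moreover have "triangle V E U" if "U \<in> A v" for U using bspec[OF P(3)] subsetD[OF AP that] by simp
      ultimately show "packs V E (set (cl v @ at_ranks hub (I v))) (card (A v))"
        unfolding atI[OF v] by (intro packsI)
      show "card (set (cl v @ at_ranks hub (I v))) \<le> \<sigma> + D"
        unfolding atI[OF v] using card_Un_le[of "C v" "Y v"] card_C[OF v] Ycard[OF v] by simp
    qed
    let ?g = "\<lambda>v. if v \<in> Z then gain (opt v) else 0"
    have each: "card (A v) \<le> pn (cl v) + ?g v" if v: "v < n" for v
    proof (cases "v \<in> Z")
      case True
      then show ?thesis using pk[OF v] unfolding gain_def opt_def by simp
    next
      case False
      then have "Y v = {}" using v unfolding Z_def by simp
      then have "set (cl v @ at_ranks hub (I v)) \<subseteq> set (cl v)" using atI[OF v] unfolding C_def by simp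
      then have "pn (cl v @ at_ranks hub (I v)) \<le> pn (cl v)" by (rule pn_mono)
      then show ?thesis using pk[OF v] by simp
    qed
    have "finite (A v)" for v using AP P(1) by (rule finite_subset)
    then have "card (\<Union>v<n. A v) = (\<Sum>v<n. card (A v))"
      by (intro card_UN_disjoint) (use Adis in simp_all)
    then have "card P = (\<Sum>v<n. card (A v))" unfolding Acov .
    also have "\<dots> \<le> (\<Sum>v<n. pn (cl v) + ?g v)" using each by (intro sum_mono) simp
    also have "\<dots> = base_number \<sigma> D n es hub + (\<Sum>v\<in>Z. gain (opt v))"
    proof -
      have "(\<Sum>v<n. ?g v) = (\<Sum>v\<in>{..<n} \<inter> Z. gain (opt v))" by (rule sum.inter_restrict[symmetric]) simp
      also have "{..<n} \<inter> Z = Z" unfolding Z_def by auto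
      finally show ?thesis unfolding sum.distrib base_sum by simp
    qed
    also have "(\<Sum>v\<in>Z. gain (opt v)) = (\<Sum>q\<in>opt ` Z. gain q)"
    proof -
      have "inj_on opt Z" unfolding inj_on_def opt_def by simp
      from sum.reindex[OF this, of gain] show ?thesis unfolding o_def ..
    qed
    finally show ?thesis using P(4) by simp
  qed
  ultimately show ?thesis unfolding coloured_cover_def by blast
qed

end

section \<open>Exhaustive search with a decision procedure\<close>

text \<open>The state consists of a flag, the counter, the input and the answer so far. Flag and
  next counter are computed from the old counter, and the solver is no longer run after a positive
  answer.\<close>

definition search_body :: "prog \<Rightarrow> prog \<Rightarrow> prog \<Rightarrow> prog" where
  "search_body PI PZ PO =
     pair_prog (Seq (Assign (Left (Right Var))) PZ)
      (pair_prog (Seq (Assign (Left (Right Var))) PI)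
       (pair_prog (Assign (Left (Right (Right Var))))
        (cond_prog (Assign (Right (Right (Right Var)))) (Assign (NodeE LeafE LeafE))
          (Seq (Assign (NodeE (Left (Right (Right Var))) (Left (Right Var)))) PO))))"

definition search_prog :: "prog \<Rightarrow> prog \<Rightarrow> prog \<Rightarrow> prog" where
  "search_prog PI PZ PO = Seq (While (Left Var) (search_body PI PZ PO)) (Assign (Right (Right (Right Var))))"

lemma runs_search_body:
  assumes "runs PZ u g T" "runs PI u u' T" "runs PO (Node x u) y T"
  shows "runs (search_body PI PZ PO) (Node h (Node u (Node x c)))
    (Node g (Node u' (Node x (if c \<noteq> Leaf then Node Leaf Leaf else y)))) (100 * T + 5000)"
proof -
  let ?s = "Node h (Node u (Node x c))"
  have G: "runs (Seq (Assign (Left (Right Var))) PZ) ?s g (4 + T)"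
    by (rule runs_Seq[OF runs_Assign assms(1)]) simp_all
  have U: "runs (Seq (Assign (Left (Right Var))) PI) ?s u' (4 + T)"
    by (rule runs_Seq[OF runs_Assign assms(2)]) simp_all
  have X: "runs (Assign (Left (Right (Right Var)))) ?s x 5" by (rule runs_Assign) simp_all
  have O: "runs (Seq (Assign (NodeE (Left (Right (Right Var))) (Left (Right Var)))) PO) ?s y (9 + T)"
    by (rule runs_Seq[OF runs_Assign assms(3)]) simp_all
  have C: "runs (cond_prog (Assign (Right (Right (Right Var)))) (Assign (NodeE LeafE LeafE))
      (Seq (Assign (NodeE (Left (Right (Right Var))) (Left (Right Var)))) PO)) ?s
      (if c \<noteq> Leaf then Node Leaf Leaf else y) (4 * 5 + (9 + T) + 10)"
  proof (rule runs_cond_prog)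
    show "runs (Assign (Right (Right (Right Var)))) ?s c 5" by (rule runs_Assign) simp_all
    show "runs (Assign (NodeE LeafE LeafE)) ?s (if c \<noteq> Leaf then Node Leaf Leaf else y) (9 + T)" if "c \<noteq> Leaf"
      by (rule runs_Assign) (use that in simp_all)
    show "runs (Seq (Assign (NodeE (Left (Right (Right Var))) (Left (Right Var)))) PO) ?s
        (if c \<noteq> Leaf then Node Leaf Leaf else y) (9 + T)" if "c = Leaf"
      using O that by simp
  qed
  show ?thesis unfolding search_body_def
    by (rule runs_mono[OF runs_pair_prog[OF G runs_pair_prog[OF U runs_pair_prog[OF X C]]]]) simp
qed

text \<open>The solver's time enters as a uniform bound \<open>T\<close> over all counter values.
  The flag goes down when the next counter value would be all zeros.\<close>

lemma runs_search:
  fixes s l :: nat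
  assumes s: "0 < s"
    and Z: "\<And>i. i < s ^ l \<Longrightarrow> runs PZ (enc (digits s l i)) (enc (\<exists>d\<in>set (inc s (digits s l i)). d \<noteq> 0)) T"
    and I: "\<And>i. i < s ^ l \<Longrightarrow> runs PI (enc (digits s l i)) (enc (inc s (digits s l i))) T"
    and O: "\<And>i. i < s ^ l \<Longrightarrow> runs PO (Node x (enc (digits s l i))) (y i) T"
  shows "\<exists>z. runs (search_prog PI PZ PO) (Node (enc True) (Node (enc (replicate l (0 :: nat))) (Node x Leaf))) z
      (s ^ l * (100 * T + 5003) + 8) \<and> (z \<noteq> Leaf \<longleftrightarrow> (\<exists>i<s ^ l. y i \<noteq> Leaf))"
proof -
  let ?N = "s ^ l"
  define acc where "acc = rec_nat Leaf (\<lambda>i c. if c \<noteq> Leaf then Node Leaf Leaf else y i)"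
  have acc: "acc 0 = Leaf" "acc (Suc i) = (if acc i \<noteq> Leaf then Node Leaf Leaf else y i)" for i
    by (simp_all add: acc_def)
  have acc_iff: "acc i \<noteq> Leaf \<longleftrightarrow> (\<exists>j<i. y j \<noteq> Leaf)" for i
    by (induction i) (auto simp: acc less_Suc_eq)
  define st where "st i = Node (enc (i \<noteq> ?N)) (Node (enc (digits s l i)) (Node x (acc i)))" for i
  have "runs (While (Left Var) (search_body PI PZ PO)) (st 0) (st ?N)
      (?N * (expr_cost (Left Var) + 1 + (100 * T + 5000)) + expr_cost (Left Var) + 1)"
  proof (rule runs_While)
    show "eval_expr (Left Var) (st i) \<noteq> Leaf" if "i < ?N" for i using that by (simp add: st_def)
    show "eval_expr (Left Var) (st ?N) = Leaf" by (simp add: st_def)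
    fix i assume i: "i < ?N"
    have "(\<exists>d\<in>set (inc s (digits s l i)). d \<noteq> 0) \<longleftrightarrow> Suc i \<noteq> ?N"
      using digits_zero_iff[of "Suc i" s l] i s unfolding inc_digits[OF s] by auto
    then have Z': "runs PZ (enc (digits s l i)) (enc (Suc i \<noteq> ?N)) T" using Z[OF i] by simp
    have I': "runs PI (enc (digits s l i)) (enc (digits s l (Suc i))) T" using I[OF i] by (simp add: inc_digits[OF s])
    show "runs (search_body PI PZ PO) (st i) (st (Suc i)) (100 * T + 5000)"
      unfolding st_def acc(2) by (rule runs_search_body[OF Z' I' O[OF i]])
  qed
  moreover have "runs (Assign (Right (Right (Right Var)))) (st ?N) (acc ?N) 5"
    by (rule runs_Assign) (simp_all add: st_def)
  ultimately have "runs (search_prog PI PZ PO) (st 0) (acc ?N)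
      (?N * (expr_cost (Left Var) + 1 + (100 * T + 5000)) + expr_cost (Left Var) + 1 + 5)"
    unfolding search_prog_def by (rule runs_Seq)
  then have "runs (search_prog PI PZ PO) (st 0) (acc ?N) (?N * (100 * T + 5003) + 8)"
    by (rule runs_mono) simp
  moreover have "st 0 = Node (enc True) (Node (enc (replicate l (0 :: nat))) (Node x Leaf))"
    using s by (simp add: st_def acc digits_0)
  ultimately show ?thesis using acc_iff by (intro exI[of _ "acc ?N"]) simp
qed

section \<open>Encoding of the guesses and choice of the group size\<close>

definition log_step :: "nat \<Rightarrow> nat \<times> nat \<Rightarrow> nat \<times> nat" where
  "log_step n c = (if snd c < n then (fst c + 1, snd c + snd c) else c)"

definition log_ceil :: "nat \<Rightarrow> nat" where
  "log_ceil n = fst ((log_step n ^^ n) (0, 1))"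

lemma log_step_funpow:
  "snd ((log_step n ^^ i) (0, 1)) = 2 ^ fst ((log_step n ^^ i) (0, 1)) \<and> snd ((log_step n ^^ i) (0, 1)) \<le> 2 * n + 1 \<and>
   fst ((log_step n ^^ i) (0, 1)) \<le> i \<and> (n \<le> snd ((log_step n ^^ i) (0, 1)) \<or> fst ((log_step n ^^ i) (0, 1)) = i)"
  by (induction i) (auto simp: log_step_def)

text \<open>The upper bound is what makes a power of a constant with exponent
  \<open>log_ceil n\<close> polynomial in \<open>n\<close>.\<close>

lemma log_ceil_bounds: "n \<le> 2 ^ log_ceil n" "2 ^ log_ceil n \<le> 2 * n + 1"
proof -
  note L = log_step_funpow[of n n, folded log_ceil_def]
  show "n \<le> 2 ^ log_ceil n" using L less_exp[of n] by (metis less_imp_le)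
  show "2 ^ log_ceil n \<le> 2 * n + 1" using L by simp
qed

lemma ptime_log_ceil [ptime_intros]: "ptime f \<Longrightarrow> ptime (\<lambda>x. log_ceil (f x))"
proof -
  have "ptime (\<lambda>n. (log_step n ^^ n) (0, 1))"
  proof (rule ptime_funpow)
    show "poly_bounded (\<lambda>s. s + (2 * s + 1) + 1)" by (intro poly_bounded_intros)
    show "ptime (\<lambda>z. log_step (fst z) (snd z))" unfolding log_step_def by (intro ptime_intros)
    fix n i :: nat assume "i \<le> n"
    then show "esize ((log_step n ^^ i) (0, 1)) \<le> esize n + (2 * esize n + 1) + 1"
      using log_step_funpow[where n = n and i = i] by simp
  qed (intro ptime_intros)+
  then have "ptime (\<lambda>n. log_ceil n)" unfolding log_ceil_def by (rule ptime_fst)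
  then show "ptime f \<Longrightarrow> ptime (\<lambda>x. log_ceil (f x))" by (rule ptime_comp)
qed

definition digit_at :: "nat list \<Rightarrow> nat \<Rightarrow> nat" where
  "digit_at u i = (case drop i u of [] \<Rightarrow> 0 | y # _ \<Rightarrow> y)"

lemma digit_at_nth: "i < length u \<Longrightarrow> digit_at u i = u ! i"
  by (simp add: digit_at_def Cons_nth_drop_Suc[symmetric])

text \<open>The counter holds three blocks of \<open>l\<close> digits, one for each component of the
  symbols; the hash seed follows behind them.\<close>

definition decode_symbols :: "nat \<Rightarrow> nat list \<Rightarrow> (nat \<times> nat \<times> nat) list" where
  "decode_symbols l u = map (\<lambda>i. (digit_at u i, digit_at u (l + i), digit_at u (2 * l + i))) [0..<l]"

lemma decode_symbols_append:
  assumes "length us = l"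
  shows "decode_symbols l (map fst us @ map (\<lambda>y. fst (snd y)) us @ map (\<lambda>y. snd (snd y)) us @ r) = us"
  using assms unfolding decode_symbols_def
  by (intro nth_equalityI) (auto simp: digit_at_nth nth_append)

type_synonym prepared = "nat \<times> nat \<times> nat \<times> nat \<times> choice list \<times> nat"

definition prepare :: "nat \<Rightarrow> nat \<Rightarrow> nat \<Rightarrow> nat \<times> nat list list \<times> nat list \<times> nat \<Rightarrow> prepared" where
  "prepare \<sigma> D k x = (fst x, log_ceil (fst x), 10 * ceil_div (length (fst (snd (snd x)))) k + 3, length (fst (snd (snd x))),
     cluster_opts \<sigma> D (fst x) (fst (snd x)) (fst (snd (snd x))),
     snd (snd (snd x)) - base_number \<sigma> D (fst x) (fst (snd x)) (fst (snd (snd x))))"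

definition search_start :: "nat \<Rightarrow> nat \<Rightarrow> nat \<Rightarrow> nat \<times> nat list list \<times> nat list \<times> nat \<Rightarrow> bool \<times> nat list \<times> prepared \<times> tree" where
  "search_start \<sigma> D k x = (True, replicate (3 * (10 * ceil_div (length (fst (snd (snd x)))) k + 3) + (3 * log_ceil (fst x) + 2)) 0,
     prepare \<sigma> D k x, Leaf)"

definition search_instance :: "nat \<Rightarrow> nat \<Rightarrow> prepared \<times> nat list \<Rightarrow> nat \<times> nat list list \<times> nat" where
  "search_instance k K z = sc_instance k K (fst (snd (snd (snd (fst z))))) (fst (snd (snd (snd (snd (fst z))))))
     (snd (snd (snd (snd (snd (fst z))))))
     (buckets (fst (snd (fst z))) (fst (fst z)) (map (\<lambda>d. d \<noteq> 0) (drop (3 * fst (snd (snd (fst z)))) (snd z)))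
       (decode_symbols (fst (snd (snd (fst z)))) (snd z)))"

lemma ptime_prepare: "ptime (prepare \<sigma> D k)"
  unfolding prepare_def by (intro ptime_intros ptime_comp3[OF ptime_cluster_opts] ptime_comp3[OF ptime_base_number])

lemma ptime_search_start: "ptime (search_start \<sigma> D k)"
  unfolding search_start_def by (intro ptime_intros ptime_prepare)

lemma ptime_search_instance: "ptime (search_instance k K)"
proof -
  have b: "ptime (\<lambda>x. buckets (f x) (g x) (h x) (u x))" if "ptime f" "ptime g" "ptime h" "ptime u" for f g h u
    using ptime_comp[OF ptime_buckets ptime_Pair[OF that(1) ptime_Pair[OF that(2) ptime_Pair[OF that(3,4)]]]] by simp
  have c: "ptime (\<lambda>x. sc_instance k K (f x) (g x) (h x) (u x))" if "ptime f" "ptime g" "ptime h" "ptime u" for f g h u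
    using ptime_comp[OF ptime_sc_instance ptime_Pair[OF that(1) ptime_Pair[OF that(2) ptime_Pair[OF that(3,4)]]]] by simp
  show ?thesis unfolding search_instance_def decode_symbols_def digit_at_def by (intro ptime_intros b c)
qed

text \<open>A group of \<open>k\<close> hub vertices is given 10 symbols. Each symbol has three
  digits in base \<open>k * g + 2\<close>, and possibly creates a bucket, whose element costs the
  solver a factor of at most 2. The product is polynomial in \<open>k\<close>, whereas the gap pays
  \<open>\<rho> ^ k\<close>.\<close>

lemma exists_group_size:
  fixes \<rho> :: real and g :: nat
  assumes "1 < \<rho>"
  obtains k :: nat where "1 \<le> k" "(2 * real (k * g + 2) ^ 3) ^ 10 \<le> \<rho> ^ k"
proof -
  \<comment> \<open>Bernoulli's inequality only gives linear growth. The left side grows like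
    \<open>k ^ 30\<close>, so 31 factors are used; the additional \<open>k\<close> absorbs the
    constant \<open>a\<close>.\<close>
  define \<eta> where "\<eta> = root 31 \<rho>"
  have \<eta>: "1 < \<eta>" "\<eta> ^ 31 = \<rho>" using assms unfolding \<eta>_def by (simp_all add: real_root_gt_1_iff)
  define e where "e = \<eta> - 1"
  have e: "0 < e" using \<eta> by (simp add: e_def)
  define a where "a = (2 * real (g + 2) ^ 3) ^ 10 / e ^ 31"
  obtain k0 :: nat where k0: "a < real k0" using reals_Archimedean2 by blast
  define k where "k = Suc k0"
  have k: "1 \<le> k" "a \<le> real k" using k0 by (auto simp: k_def)
  have "k * g + 2 \<le> k * (g + 2)" using k(1) by (simp add: algebra_simps)
  then have "real (k * g + 2) \<le> real k * real (g + 2)" using of_nat_mono[where 'a = real] by (metis of_nat_mult)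
  then have "(2 * real (k * g + 2) ^ 3) ^ 10 \<le> (2 * (real k * real (g + 2)) ^ 3) ^ 10"
    by (intro power_mono mult_left_mono) auto
  also have "\<dots> = real k ^ 30 * (2 * real (g + 2) ^ 3) ^ 10" by (simp add: power_mult_distrib power_mult[symmetric])
  also have "\<dots> = real k ^ 30 * (a * e ^ 31)" using e by (simp add: a_def)
  also have "\<dots> \<le> real k ^ 30 * (real k * e ^ 31)" using k(2) e by (intro mult_left_mono mult_right_mono) auto
  also have "\<dots> = (real k * e) ^ 31" by (simp add: power_mult_distrib power_Suc[symmetric] del: power_Suc)
     (simp flip: power_Suc power_Suc2 add: mult.assoc[symmetric])
  also have "\<dots> \<le> (\<eta> ^ k) ^ 31"
  proof (rule power_mono)
    have "1 + real k * e \<le> (1 + e) ^ k" using e by (intro Bernoulli_inequality) simp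
    then show "real k * e \<le> \<eta> ^ k" by (simp add: e_def)
  qed (use e in simp)
  also have "\<dots> = \<rho> ^ k" unfolding \<eta>(2)[symmetric] by (simp add: power_mult[symmetric] mult.commute)
  finally show ?thesis using k(1) that by blast
qed

definition set_cover_yes :: "nat \<times> nat list list \<times> nat \<Rightarrow> bool" where
  "set_cover_yes z \<longleftrightarrow> has_set_cover {..<fst z} (set ` set (fst (snd z))) (snd (snd z))"

lemma split_step_Nil: "foldl (split_step w) ([], bs) us = ([], bs)"
  by (induction us) (auto simp: split_step_def)

context hub_graph
begin

text \<open>Soundness holds for every counter value: a wrong guess of tree, seed or labels can lose
  solutions but never produce false ones.\<close>

lemma search_sound:
  assumes "set_cover_yes (search_instance k K (prepare \<sigma> D k (n, es, hub, t), u))"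
  shows "has_triangle_packing V E t"
proof -
  let ?w = "log_ceil n" and ?l = "10 * ceil_div (length hub) k + 3"
  let ?bs = "buckets ?w n (map (\<lambda>d. d \<noteq> 0) (drop (3 * ?l) u)) (decode_symbols ?l u)"
  obtain n' F m where i: "sc_instance k K (length hub) qs (t - base_number \<sigma> D n es hub) ?bs = (n', F, m)"
    by (metis surj_pair)
  then have "search_instance k K (prepare \<sigma> D k (n, es, hub, t), u) = (n', F, m)"
    unfolding search_instance_def prepare_def by simp
  then have "has_set_cover {..<n'} (set ` set F) m" using assms unfolding set_cover_yes_def by simp
  then have "coloured_cover (length hub) qs (t - base_number \<sigma> D n es hub)"
    by (rule sc_instance_sound[OF buckets_inv(2,1) i])
  then show ?thesis by (rule coloured_cover_imp_packing)
qed

text \<open>The used colours number at most \<open>length hub\<close>, because the choices cover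
  disjoint nonempty sets of ranks. The guess consists of a splitting seed for them, the tree it
  induces and the true labels, which are at most \<open>k * (\<sigma> + D)\<close>.\<close>

lemma search_complete:
  assumes k: "1 \<le> k" and t: "has_triangle_packing V E t"
  defines "s \<equiv> k * (\<sigma> + D) + 2"
  shows "\<exists>u. length u = 3 * (10 * ceil_div (length hub) k + 3) + (3 * log_ceil n + 2) \<and> (\<forall>d\<in>set u. d < s) \<and>
    set_cover_yes (search_instance k (k * (\<sigma> + D)) (prepare \<sigma> D k (n, es, hub, t), u))"
proof -
  let ?w = "log_ceil n" and ?l = "10 * ceil_div (length hub) k + 3" and ?p = "length hub"
  let ?t = "t - base_number \<sigma> D n es hub"
  obtain Q where Q: "Q \<subseteq> set qs" "compatible Q" "\<Union>(cells ` Q) = {..<?p}" "?t \<le> (\<Sum>q\<in>Q. gain q)"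
    using packing_imp_coloured_cover[OF t] unfolding coloured_cover_def by (elim exE conjE)
  have finQ: "finite Q" using Q(1) by (rule finite_subset) simp
  have inj: "inj_on fst Q" using Q(2) unfolding compatible_def by blast
  have q: "fst q < n" "card (cells q) \<le> \<sigma> + D" "1 \<le> card (cells q)" "gain q \<le> \<sigma> + D" if "q \<in> Q" for q
  proof -
    have o: "fst q < n" "length (fst (snd q)) \<le> D" "fst (snd q) \<noteq> []"
      "snd (snd q) = pn (cl (fst q) @ at_ranks hub (fst (snd q))) - pn (cl (fst q))"
      using that Q(1) in_options_iff by blast+
    show "fst q < n" by (rule o(1))
    show "card (cells q) \<le> \<sigma> + D" unfolding cells_def using card_length[of "fst (snd q)"] o(2) by linarith
    show "1 \<le> card (cells q)" unfolding cells_def using o(3) by (simp add: Suc_le_eq card_gt_0_iff)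
    show "gain q \<le> \<sigma> + D" unfolding gain_def o(4) using pn_le[of "\<sigma> + D"] by (meson diff_le_self le_trans)
  qed
  define W where "W = fst ` Q"
  have "card Q \<le> (\<Sum>q\<in>Q. card (cells q))"
    using sum_mono[of Q "\<lambda>_. 1" "\<lambda>q. card (cells q)"] q(3) by simp
  also have "\<dots> = card (\<Union>(cells ` Q))"
  proof (rule card_UN_disjoint[symmetric, OF finQ])
    show "\<forall>q\<in>Q. finite (cells q)" by (simp add: cells_def)
    show "\<forall>q\<in>Q. \<forall>q'\<in>Q. q \<noteq> q' \<longrightarrow> cells q \<inter> cells q' = {}" using Q(2) unfolding compatible_def by blast
  qed
  finally have cardW: "card W \<le> ?p" unfolding W_def card_image[OF inj] Q(3) by simp
  have Wn: "W \<subseteq> {..<n}" unfolding W_def using q(1) by auto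
  have "?p = card (set hub)" using distinct_card[OF dist] by simp
  then have "?p \<le> n" using card_mono[OF _ hub_subset] by simp
  then have p2: "?p \<le> 2 ^ ?w" using log_ceil_bounds(1)[of n] by linarith
  have "W \<subseteq> {..<2 ^ ?w}" using Wn log_ceil_bounds(1)[of n] by auto
  then have ninj: "inj_on (name ?w) W" by (rule inj_on_subset[OF name_inj])
  obtain r where r: "length r = 3 * ?w + 2" "splits k (name ?w) r W" "heavy k (name ?w) r W \<le> 5 * ceil_div ?p k + 1"
  proof (rule exists_splitting_seed[OF _ ninj _ cardW p2 k])
    show "finite W" unfolding W_def using finQ by simp
    show "length (name ?w v) = ?w" for v by (simp add: name_def)
  qed
  define lab where "lab vs = (\<Sum>q | q \<in> Q \<and> fst q \<in> set vs. card (cells q), \<Sum>q | q \<in> Q \<and> fst q \<in> set vs. gain q)" for vs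
  have Wvs: "W \<inter> set [0..<n] = W" using Wn by auto
  obtain us where us: "length us = 1 + 2 * heavy k (name ?w) r W"
    "\<forall>u\<in>set us. u = (0, 0, 0) \<or> (\<exists>vs'. u = (1, lab vs') \<and> card (W \<inter> set vs') \<le> k)"
    "\<forall>rest out. \<exists>bs. foldl (split_step ?w) ((r, [0..<n]) # rest, out) us = (rest, out @ bs) \<and>
      set [0..<n] = (\<Union>b\<in>set bs. set (fst (snd b))) \<and>
      (\<forall>b\<in>set bs. snd (snd b) = lab (fst (snd b)) \<and> card (W \<inter> set (fst (snd b))) \<le> k)"
    using split_complete[of k ?w r W "[0..<n]" lab, unfolded Wvs, OF r(2)] by (elim exE conjE)
  obtain bs where bs: "foldl (split_step ?w) ([(r, [0..<n])], []) us = ([], bs)"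
    "set [0..<n] = (\<Union>b\<in>set bs. set (fst (snd b)))"
    "\<forall>b\<in>set bs. snd (snd b) = lab (fst (snd b)) \<and> card (W \<inter> set (fst (snd b))) \<le> k"
    using us(3)[rule_format, of "[]" "[]"] by auto
  \<comment> \<open>Padding to the prescribed length is harmless, as symbols are ignored once the
    stack is empty. That length is \<open>1 + 2 * h\<close> for the bound \<open>h\<close> on the
    number of inner nodes.\<close>
  define us' where "us' = us @ replicate (?l - length us) (0, 0, 0)"
  have lus: "length us' = ?l" unfolding us'_def using us(1) r(3) by simp
  have bk: "buckets ?w n r us' = bs" unfolding buckets_def us'_def using bs(1) by (simp add: split_step_Nil)
  define u where "u = map fst us' @ map (\<lambda>y. fst (snd y)) us' @ map (\<lambda>y. snd (snd y)) us' @ map (\<lambda>b. if b then 1 else 0) r"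
  have dec: "decode_symbols ?l u = us'" unfolding u_def by (rule decode_symbols_append[OF lus])
  have "drop (3 * ?l) u = map (\<lambda>b. if b then 1 else 0) r" unfolding u_def using lus by simp
  then have rd: "map (\<lambda>d. d \<noteq> 0) (drop (3 * ?l) u) = r"
    by (simp only: map_map) (simp add: list_eq_iff_nth_eq)
  have load: "card {q \<in> Q. fst q \<in> set vs} = card (W \<inter> set vs)" for vs
  proof -
    have "W \<inter> set vs = fst ` {q \<in> Q. fst q \<in> set vs}" unfolding W_def by auto
    moreover have "inj_on fst {q \<in> Q. fst q \<in> set vs}" by (rule inj_on_subset[OF inj]) auto
    ultimately show ?thesis by (simp add: card_image)
  qed
  have labs: "fst (lab vs) \<le> k * (\<sigma> + D) \<and> snd (lab vs) \<le> k * (\<sigma> + D)" if "card (W \<inter> set vs) \<le> k" for vs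
  proof -
    have "(\<Sum>q | q \<in> Q \<and> fst q \<in> set vs. f q) \<le> k * (\<sigma> + D)" if f: "\<And>q. q \<in> Q \<Longrightarrow> f q \<le> \<sigma> + D" for f :: "choice \<Rightarrow> nat"
    proof -
      have "(\<Sum>q | q \<in> Q \<and> fst q \<in> set vs. f q) \<le> (\<Sum>q | q \<in> Q \<and> fst q \<in> set vs. \<sigma> + D)"
        using f by (intro sum_mono) simp
      also have "\<dots> = card (W \<inter> set vs) * (\<sigma> + D)" using load[of vs] by simp
      also have "\<dots> \<le> k * (\<sigma> + D)" using \<open>card (W \<inter> set vs) \<le> k\<close> by (rule mult_le_mono1)
      finally show ?thesis .
    qed
    then show ?thesis unfolding lab_def using q(2,4) by simp
  qed
  have "\<forall>y\<in>set us'. fst y < s \<and> fst (snd y) < s \<and> snd (snd y) < s"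
  proof
    fix y assume "y \<in> set us'"
    then have "y = (0, 0, 0) \<or> (\<exists>vs'. y = (1, lab vs') \<and> card (W \<inter> set vs') \<le> k)"
      using us(2) unfolding us'_def by auto
    then show "fst y < s \<and> fst (snd y) < s \<and> snd (snd y) < s"
    proof (elim disjE exE conjE)
      fix vs' assume "y = (1, lab vs')" "card (W \<inter> set vs') \<le> k"
      then show ?thesis using labs[of vs'] by (simp add: s_def)
    qed (simp add: s_def)
  qed
  then have du: "\<forall>d\<in>set u. d < s" unfolding u_def by (auto simp: s_def)
  have lu: "length u = 3 * ?l + (3 * ?w + 2)" unfolding u_def using lus r(1) by simp
  obtain n' F m where i: "sc_instance k (k * (\<sigma> + D)) ?p qs ?t bs = (n', F, m)" by (metis surj_pair)
  have inst: "search_instance k (k * (\<sigma> + D)) (prepare \<sigma> D k (n, es, hub, t), u) = (n', F, m)"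
    unfolding search_instance_def prepare_def fst_conv snd_conv rd dec bk by (rule i)
  have "has_set_cover {..<n'} (set ` set F) m"
  proof (rule sc_instance_complete[OF _ _ i Q])
    show "map fst bs = [0..<length bs]" "distinct (concat (map (\<lambda>b. fst (snd b)) bs))"
      using buckets_inv[of ?w n r us'] unfolding bk by simp_all
    show "card (cells q) \<le> \<sigma> + D" if "q \<in> Q" for q by (rule q(2)[OF that])
    show "card {q \<in> Q. fst q \<in> set (fst (snd b))} \<le> k" if "b \<in> set bs" for b using bs(3) that load by simp
    show "\<exists>b\<in>set bs. fst q \<in> set (fst (snd b))" if "q \<in> Q" for q
    proof -
      have "fst q \<in> set [0..<n]" using q(1)[OF that] by simp
      then show ?thesis unfolding bs(2) by blast
    qed
    show "snd (snd b) = (\<Sum>q | q \<in> Q \<and> fst q \<in> set (fst (snd b)). card (cells q),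
      \<Sum>q | q \<in> Q \<and> fst q \<in> set (fst (snd b)). gain q)" if "b \<in> set bs" for b
      using bs(3) that unfolding lab_def by simp
  qed simp
  then have "set_cover_yes (search_instance k (k * (\<sigma> + D)) (prepare \<sigma> D k (n, es, hub, t), u))"
    unfolding inst set_cover_yes_def by simp
  then show ?thesis using lu du by blast
qed

lemma packing_iff_search:
  assumes "1 \<le> k"
  defines "s \<equiv> k * (\<sigma> + D) + 2" and "l \<equiv> 3 * (10 * ceil_div (length hub) k + 3) + (3 * log_ceil n + 2)"
  shows "has_triangle_packing V E t \<longleftrightarrow>
    (\<exists>i<s ^ l. set_cover_yes (search_instance k (k * (\<sigma> + D)) (prepare \<sigma> D k (n, es, hub, t), digits s l i)))"
proof
  assume "has_triangle_packing V E t"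
  from search_complete[OF assms(1) this] obtain u where u: "length u = l" "\<forall>d\<in>set u. d < s"
    "set_cover_yes (search_instance k (k * (\<sigma> + D)) (prepare \<sigma> D k (n, es, hub, t), u))"
    unfolding s_def l_def by (elim exE conjE)
  obtain i where "i < s ^ l" "digits s l i = u" using digits_surj[OF u(2)] u(1) by auto
  then show "\<exists>i<s ^ l. set_cover_yes (search_instance k (k * (\<sigma> + D)) (prepare \<sigma> D k (n, es, hub, t), digits s l i))"
    using u(3) by blast
next
  assume "\<exists>i<s ^ l. set_cover_yes (search_instance k (k * (\<sigma> + D)) (prepare \<sigma> D k (n, es, hub, t), digits s l i))"
  then show "has_triangle_packing V E t" using search_sound by (elim exE conjE)
qed

end

definition truncate_third :: prog where
  "truncate_third = pair_prog (Assign (Left Var)) (pair_prog (Assign (Left (Right Var)))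
     (pair_prog (Assign (Left (Right (Right Var))))
       (Seq (Assign (NodeE (NodeE LeafE (Left Var)) (Right (Right (Right Var))))) truncate_prog)))"

lemma runs_truncate_third:
  "runs truncate_third (Node (enc n) (Node e (Node q (enc t))))
    (Node (enc n) (Node e (Node q (enc (min t (Suc n)))))) (8960 * n + 20000)"
proof -
  let ?s = "Node (enc n) (Node e (Node q (enc t)))"
  have "runs (Seq (Assign (NodeE (NodeE LeafE (Left Var)) (Right (Right (Right Var))))) truncate_prog) ?s
      (enc (min t (Suc n))) (10 + (Suc n * 140 + 30))"
    by (rule runs_Seq[OF runs_Assign runs_truncate_prog]) simp_all
  moreover have "runs (Assign (Left (Right (Right Var)))) ?s q 5" by (rule runs_Assign) simp_all
  moreover have "runs (Assign (Left (Right Var))) ?s e 4" by (rule runs_Assign) simp_all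
  moreover have "runs (Assign (Left Var)) ?s (enc n) 3" by (rule runs_Assign) simp_all
  ultimately have "runs truncate_third ?s (Node (enc n) (Node e (Node q (enc (min t (Suc n))))))
      (4 * 3 + 4 * (4 * 4 + 4 * (4 * 5 + 4 * (10 + (Suc n * 140 + 30)) + 16) + 16) + 16)"
    unfolding truncate_third_def by (intro runs_pair_prog)
  then show ?thesis by (rule runs_mono) simp
qed

text \<open>The cap is \<open>Suc n\<close> and not \<open>n\<close>: for \<open>n = 0\<close> a cap
  at 0 would turn every threshold into a trivially satisfied one.\<close>

lemma has_triangle_packing_min:
  "has_triangle_packing {..<n} E (min t (Suc n)) \<longleftrightarrow> has_triangle_packing {..<n} E t"
proof
  assume "has_triangle_packing {..<n} E t"
  then show "has_triangle_packing {..<n} E (min t (Suc n))"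
    unfolding has_triangle_packing_def by (auto simp: min_le_iff_disj)
next
  assume "has_triangle_packing {..<n} E (min t (Suc n))"
  then obtain P where P: "finite P" "disjoint P" "\<forall>T\<in>P. triangle {..<n} E T" "min t (Suc n) \<le> card P"
    unfolding has_triangle_packing_def by (elim exE conjE)
  have "\<Union>P \<subseteq> {..<n}" using P(3) triangle_cardE(1) by blast
  then have "card (\<Union>P) \<le> n" using card_mono[of "{..<n}" "\<Union>P"] by simp
  then have "3 * card P \<le> n" using card_disjoint_triangles[OF P(1-3)] by simp
  then have "t \<le> card P" using P(4) by (simp add: min_le_iff_disj)
  then show "has_triangle_packing {..<n} E t" unfolding has_triangle_packing_def using P(1-3) by blast
qed

lemma search_instance_valid:
  assumes "search_instance k K (prepare \<sigma> D k (n, es, hub, t), u) = (n', F, m)"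
  shows "set_cover_instance (K + 1) {..<n'} (set ` set F)" "encodes_family (set ` set F) (enc F)"
    "n' \<le> length hub + (10 * ceil_div (length hub) k + 3) + 1"
proof -
  let ?l = "10 * ceil_div (length hub) k + 3"
  let ?bs = "buckets (log_ceil n) n (map (\<lambda>d. d \<noteq> 0) (drop (3 * ?l) u)) (decode_symbols ?l u)"
  have i: "sc_instance k K (length hub) (cluster_opts \<sigma> D n es hub) (t - base_number \<sigma> D n es hub) ?bs = (n', F, m)"
    using assms unfolding search_instance_def prepare_def fst_conv snd_conv .
  have "length ?bs \<le> ?l"
    using length_buckets[of "log_ceil n" n "map (\<lambda>d. d \<noteq> 0) (drop (3 * ?l) u)" "decode_symbols ?l u"]
    by (simp add: decode_symbols_def)
  then show "set_cover_instance (K + 1) {..<n'} (set ` set F)" "encodes_family (set ` set F) (enc F)"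
    "n' \<le> length hub + ?l + 1"
    using sc_instance_valid[OF buckets_inv(2) i] by simp_all
qed

lemma ceil_div_le: "ceil_div n k \<le> n"
  unfolding ceil_div_def using length_filter_le[of "\<lambda>i. i * k < n" "[0..<n]"] by simp

text \<open>With \<open>L\<close> the number of symbols, there are \<open>s ^ (3 * L)\<close> words
  times polynomially many seeds, and each call works on at most \<open>p + L + 1\<close> elements.
  The group size makes \<open>(2 * s ^ 3) ^ L\<close> at most \<open>\<rho> ^ p\<close> up to a
  constant.\<close>

lemma set_cover_solvable_imp_packing_solvable:
  assumes SC: "\<And>d. 1 \<le> d \<Longrightarrow> set_cover_solvable d b" and b: "1 \<le> b" "b \<le> 2" "b < b'"
  shows "triangle_packing_solvable \<sigma> \<delta> b'"
proof -
  define \<rho> where "\<rho> = b' / b"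
  have \<rho>: "1 < \<rho>" "b' = b * \<rho>" using b by (simp_all add: \<rho>_def)
  define D where "D = \<delta> + 3"
  obtain k where k: "1 \<le> k" "(2 * real (k * (\<sigma> + D) + 2) ^ 3) ^ 10 \<le> \<rho> ^ k"
    using exists_group_size[OF \<rho>(1)] by metis
  define K where "K = k * (\<sigma> + D)"
  define s where "s = K + 2"
  have s: "0 < s" "1 \<le> real s" by (simp_all add: s_def)
  obtain P c where P: "\<And>n F t f. set_cover_instance (K + 1) {..<n} F \<Longrightarrow> encodes_family F f \<Longrightarrow>
        decides_within P (Node (enc_nat n) (Node f (enc_nat t)))
          (has_set_cover {..<n} F t) (time_bound b n n c)"
  proof -
    have "set_cover_solvable (K + 1) b" by (rule SC) simp
    then show ?thesis using that unfolding set_cover_solvable_def by blast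
  qed
  obtain pS PS where pS: "poly_bounded pS" "mono pS"
    "\<And>x. runs PS (enc x) (enc (search_start \<sigma> D k x)) (pS (esize x))"
    "\<And>x. esize (search_start \<sigma> D k x) \<le> pS (esize x)"
    using ptime_search_start by (rule ptimeE) blast
  obtain pR PR where pR: "poly_bounded pR" "mono pR"
    "\<And>x. runs PR (enc x) (enc (search_instance k K x)) (pR (esize x))"
    using ptime_search_instance by (rule ptimeE) blast
  have "ptime (\<lambda>u. inc s u)" by (intro ptime_intros)
  then obtain pI PI where pI: "poly_bounded pI" "mono pI" "\<And>u. runs PI (enc u) (enc (inc s u)) (pI (esize u))"
    by (rule ptimeE) blast
  have "ptime (\<lambda>u. \<exists>d\<in>set (inc s u). d \<noteq> 0)" by (intro ptime_intros)
  then obtain pZ PZ where pZ: "poly_bounded pZ" "mono pZ"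
    "\<And>u. runs PZ (enc u) (enc (\<exists>d\<in>set (inc s u). d \<noteq> 0)) (pZ (esize u))"
    by (rule ptimeE) blast
  define sz where "sz n = n + (n + 1) ^ 2 * (2 * (n + 1) + 1) + n * (n + 1) + 2 + (n + 2)" for n :: nat
  define e where "e n = pS (sz n)" for n
  define q1 where "q1 n = pI (e n * (s + 1)) + pZ (e n * (s + 1)) + pR (e n + e n * (s + 1) + 1)" for n
  \<comment> \<open>The number of values of the seed digits and two spare powers:
    \<open>s ^ w\<close> is at most \<open>(2 ^ w) ^ s\<close>, and \<open>2 ^ w\<close> is at most
    \<open>2 * n + 1\<close>.\<close>
  define q2 where "q2 n = s ^ 2 * (2 * n + 1) ^ (3 * s)" for n
  \<comment> \<open>The factor 2 pays for the one element by which the bound on the universe exceeds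
    \<open>p + L\<close>.\<close>
  define q3 where "q3 n = 2 * (c * (n + (10 * n + 3) + 1 + 1) ^ c)" for n
  \<comment> \<open>The losses by rounding: \<open>\<rho> ^ k\<close> from rounding up the number of
    groups, the rest from the three symbols in \<open>L\<close> that belong to no group.\<close>
  define a where "a = nat \<lceil>\<rho> ^ k * (2 * real s ^ 3) ^ 3\<rceil>"
  define q where "q n = 8960 * n + 20000 + e n + 8 + a * (q2 n * (100 * q1 n + 100 * q3 n + 5003))" for n
  have "poly_bounded sz" unfolding sz_def by (intro poly_bounded_intros)
  then have "poly_bounded e" unfolding e_def by (rule poly_bounded_comp[OF pS(1)])
  then have "poly_bounded q" unfolding q_def q1_def q2_def q3_def
    by (intro poly_bounded_intros poly_bounded_comp[OF pI(1)] poly_bounded_comp[OF pZ(1)] poly_bounded_comp[OF pR(1)])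
  then obtain c' where c': "\<And>m n. b' ^ m * real (q n) \<le> time_bound b' m n c'"
    using time_bound_poly_bounded[of q b'] b by fastforce
  let ?PO = "Seq PR P"
  let ?prog = "Seq truncate_third (Seq PS (search_prog PI PZ ?PO))"
  show ?thesis unfolding triangle_packing_solvable_def
  proof (intro exI[of _ ?prog] exI[of _ c'] allI impI, elim conjE)
    fix n E Q t f g
    assume E: "simple_graph {..<n} E" and Q: "is_hub \<sigma> \<delta> {..<n} E Q"
      and f: "encodes_family E f" and g: "encodes_vertices Q g"
    obtain xss as where x: "distinct (map set xss)" "\<forall>xs\<in>set xss. distinct xs" "set ` set xss = E"
      "f = enc xss" "distinct as" "set as = Q" "g = enc as"
      using f g by (auto simp: encodes_family_iff encodes_vertices_iff)
    have QV: "set as \<subseteq> {..<n}" using Q x(6) by (simp add: is_hub_def)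
    interpret hub_graph n xss as \<sigma> \<delta> D
      by unfold_locales (use E Q x in \<open>simp_all add: D_def\<close>)
    define t' where "t' = min t (Suc n)"
    define p where "p = length as"
    define L where "L = 10 * ceil_div p k + 3"
    define w where "w = log_ceil n"
    define l where "l = 3 * L + (3 * w + 2)"
    let ?x0 = "(n, xss, as, t')"
    let ?y = "prepare \<sigma> D k ?x0"
    have pQ: "p = card Q" using distinct_card[OF x(5)] x(6) by (simp add: p_def)
    have pn: "p \<le> n" unfolding pQ using card_mono[of "{..<n}" Q] QV x(6) by simp
    have start: "search_start \<sigma> D k ?x0 = (True, replicate l 0, ?y, Leaf)"
      unfolding search_start_def l_def L_def w_def p_def by simp
    have "esize (n, xss, as) \<le> n + (n + 1) ^ 2 * (2 * (n + 1) + 1) + n * (n + 1) + 2"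
      by (rule esize_graph[OF E x(1,2,3,5) QV])
    moreover have "t' \<le> n + 1" by (simp add: t'_def)
    ultimately have "esize ?x0 \<le> sz n" unfolding sz_def by simp
    then have mS: "pS (esize ?x0) \<le> e n" unfolding e_def by (rule monoD[OF pS(2)])
    have runS: "runs PS (enc ?x0) (enc (True, replicate l (0 :: nat), ?y, Leaf)) (e n)"
      using runs_mono[OF pS(3)[of ?x0] mS] unfolding start .
    have "esize (True, replicate l (0 :: nat), ?y, Leaf) \<le> e n" using order_trans[OF pS(4)[of ?x0] mS] unfolding start .
    then have ey: "esize ?y \<le> e n" and "esize (replicate l (0 :: nat)) \<le> e n" by (simp_all del: esize_prod add: esize_prod[of "(True, _)"] esize_prod[of "(replicate _ _, _)"] esize_prod[of "(?y, _)"])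
    then have el: "l \<le> e n" using length_le_esize[of "replicate l (0 :: nat)"] by simp
    define B where "B = b ^ (p + L + 1) * (real c * (real (p + L + 1) + 1) ^ c)"
    have B0: "0 \<le> B" unfolding B_def using b by simp
    define T where "T = q1 n + nat \<lfloor>B\<rfloor>"
    have eu: "esize (digits s l i) \<le> e n * (s + 1)" for i
    proof -
      have "esize (digits s l i) \<le> length (digits s l i) * (s + 1)"
      proof (rule esize_list_bound)
        fix d assume "d \<in> set (digits s l i)"
        then show "esize d \<le> s" using digits_less[OF s(1)] by (simp add: less_imp_le)
      qed
      also have "\<dots> \<le> e n * (s + 1)" unfolding length_digits using el by (rule mult_le_mono1)
      finally show ?thesis .
    qed
    have ez: "esize (?y, digits s l i) \<le> e n + e n * (s + 1) + 1" for i
      using ey eu[of i] unfolding esize_prod[of "(?y, _)"] by simp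
    have "\<exists>y K'. runs P (enc (search_instance k K (?y, digits s l i))) y K' \<and> K' \<le> nat \<lfloor>B\<rfloor> \<and>
        (y \<noteq> Leaf \<longleftrightarrow> set_cover_yes (search_instance k K (?y, digits s l i)))" for i
    proof -
      obtain n' F m where i: "search_instance k K (?y, digits s l i) = (n', F, m)" by (metis surj_pair)
      note v = search_instance_valid[OF i]
      obtain y K' where y: "runs P (Node (enc_nat n') (Node (enc F) (enc_nat m))) y K'" "real K' \<le> time_bound b n' n' c"
        "y \<noteq> Leaf \<longleftrightarrow> has_set_cover {..<n'} (set ` set F) m"
        using P[OF v(1,2)] by (rule decides_withinE)
      have n': "n' \<le> p + L + 1" using v(3) unfolding p_def L_def .
      have "time_bound b n' n' c \<le> B" unfolding time_bound_def B_def
        using n' b(1) by (intro mult_mono power_increasing mult_left_mono power_mono) auto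
      then have "K' \<le> nat \<lfloor>B\<rfloor>" using y(2) by (intro le_nat_floor) simp
      then show ?thesis unfolding i set_cover_yes_def using y by (auto simp: enc_nat_def)
    qed
    then obtain y K' where y: "\<And>i. runs P (enc (search_instance k K (?y, digits s l i))) (y i) (K' i)"
      "\<And>i. K' i \<le> nat \<lfloor>B\<rfloor>" "\<And>i. y i \<noteq> Leaf \<longleftrightarrow> set_cover_yes (search_instance k K (?y, digits s l i))"
      by metis
    obtain z where z: "runs (search_prog PI PZ ?PO) (Node (enc True) (Node (enc (replicate l (0 :: nat))) (Node (enc ?y) Leaf))) z
      (s ^ l * (100 * T + 5003) + 8)" "z \<noteq> Leaf \<longleftrightarrow> (\<exists>i<s ^ l. y i \<noteq> Leaf)"
    proof -
      have "\<exists>z. runs (search_prog PI PZ ?PO) (Node (enc True) (Node (enc (replicate l (0 :: nat))) (Node (enc ?y) Leaf))) z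
        (s ^ l * (100 * T + 5003) + 8) \<and> (z \<noteq> Leaf \<longleftrightarrow> (\<exists>i<s ^ l. y i \<noteq> Leaf))"
      proof (rule runs_search[OF s(1)])
        fix i
        show "runs PZ (enc (digits s l i)) (enc (\<exists>d\<in>set (inc s (digits s l i)). d \<noteq> 0)) T"
          by (rule runs_mono[OF pZ(3)]) (use monoD[OF pZ(2) eu[of i]] in \<open>simp add: T_def q1_def\<close>)
        show "runs PI (enc (digits s l i)) (enc (inc s (digits s l i))) T"
          by (rule runs_mono[OF pI(3)]) (use monoD[OF pI(2) eu[of i]] in \<open>simp add: T_def q1_def\<close>)
        have "runs PR (Node (enc ?y) (enc (digits s l i))) (enc (search_instance k K (?y, digits s l i)))
            (pR (e n + e n * (s + 1) + 1))"
          using runs_mono[OF pR(3)[of "(?y, digits s l i)"] monoD[OF pR(2) ez[of i]]] by simp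
        from runs_Seq[OF this y(1)[of i]]
        show "runs ?PO (Node (enc ?y) (enc (digits s l i))) (y i) T"
          by (rule runs_mono) (use y(2)[of i] in \<open>simp add: T_def q1_def\<close>)
      qed
      then show thesis using that by blast
    qed
    have run: "runs ?prog (Node (enc_nat n) (Node f (Node g (enc_nat t)))) z
        (8960 * n + 20000 + (e n + (s ^ l * (100 * T + 5003) + 8)))"
      unfolding enc_nat_def[symmetric]
    proof (rule runs_Seq[OF runs_truncate_third runs_Seq])
      show "runs PS (Node (enc n) (Node f (Node g (enc (min t (Suc n))))))
          (Node (enc True) (Node (enc (replicate l (0 :: nat))) (Node (enc ?y) Leaf))) (e n)"
        using runS x(4,7) by (simp add: t'_def enc_tree_def)
    qed (rule z(1))
    have ans: "z \<noteq> Leaf \<longleftrightarrow> has_triangle_packing {..<n} E t"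
    proof -
      have "z \<noteq> Leaf \<longleftrightarrow> has_triangle_packing {..<n} (set ` set xss) t'"
        unfolding z(2) y(3) packing_iff_search[OF k(1), of t'] K_def s_def l_def L_def w_def p_def ..
      then show ?thesis unfolding x(3) t'_def has_triangle_packing_min .
    qed
    have "real (s ^ l * (100 * T + 5003)) \<le> b' ^ p * real (a * (q2 n * (100 * q1 n + 100 * q3 n + 5003)))"
    proof -
      have "s ^ w \<le> (2 ^ s) ^ w" by (intro power_mono less_imp_le[OF less_exp]) simp
      also have "\<dots> = (2 ^ w) ^ s" by (simp add: power_mult[symmetric] mult.commute)
      also have "\<dots> \<le> (2 * n + 1) ^ s" using log_ceil_bounds(2)[of n] by (intro power_mono) (simp_all add: w_def)
      finally have "(s ^ w) ^ 3 \<le> ((2 * n + 1) ^ s) ^ 3" by (rule power_mono) simp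
      then have "s ^ (3 * w) \<le> (2 * n + 1) ^ (3 * s)" by (simp add: power_mult[symmetric] mult.commute)
      then have "s ^ (3 * w + 2) \<le> q2 n" unfolding q2_def power_add by (simp add: mult.commute)
      then have "s ^ l \<le> (s ^ 3) ^ L * q2 n" unfolding l_def power_add[of s "3 * L"] power_mult by (rule mult_le_mono2)
      then have sl: "real (s ^ l) \<le> (real s ^ 3) ^ L * real (q2 n)"
        using of_nat_mono[where 'a = real] by (metis of_nat_mult of_nat_power)
      have cd: "ceil_div p k \<le> n" using ceil_div_le[of p k] pn by simp
      have "b ^ (L + 1) \<le> 2 ^ (L + 1)" using b by (intro power_mono) auto
      then have bb: "b ^ (p + L + 1) \<le> b ^ p * 2 ^ L * 2"
        using b(1) mult_left_mono[of "b ^ (L + 1)" "2 ^ (L + 1)" "b ^ p"] by (simp add: power_add)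
      have "real c * (real (p + L + 1) + 1) ^ c \<le> real (c * (n + (10 * n + 3) + 1 + 1) ^ c)"
      proof -
        have "real (p + L + 1) + 1 \<le> real (n + (10 * n + 3) + 1 + 1)" using cd pn by (simp add: L_def)
        then have "(real (p + L + 1) + 1) ^ c \<le> real (n + (10 * n + 3) + 1 + 1) ^ c" by (intro power_mono) auto
        then show ?thesis unfolding of_nat_mult of_nat_power by (rule mult_left_mono) simp
      qed
      then have "B \<le> (b ^ p * 2 ^ L * 2) * real (c * (n + (10 * n + 3) + 1 + 1) ^ c)"
        unfolding B_def using b(1) by (intro mult_mono bb) auto
      also have "\<dots> = (b ^ p * 2 ^ L) * real (q3 n)" unfolding q3_def by simp
      finally have B: "B \<le> (b ^ p * 2 ^ L) * real (q3 n)" .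
      let ?M = "b ^ p * 2 ^ L"
      have M: "1 \<le> ?M" using b(1) mult_mono[of 1 "b ^ p" 1 "2 ^ L"] by (simp add: one_le_power)
      have "real (nat \<lfloor>B\<rfloor>) \<le> B" using B0 by simp
      then have "real (100 * T + 5003) \<le> 100 * real (q1 n) + 100 * B + 5003" unfolding T_def by simp
      also have "\<dots> \<le> ?M * (100 * real (q1 n)) + 100 * (?M * real (q3 n)) + ?M * 5003"
        using B mult_right_mono[OF M, of "100 * real (q1 n)"] mult_right_mono[OF M, of 5003] by simp
      also have "\<dots> = ?M * real (100 * q1 n + 100 * q3 n + 5003)" by (simp add: algebra_simps)
      finally have TT: "real (100 * T + 5003) \<le> ?M * real (100 * q1 n + 100 * q3 n + 5003)" .
      have kc: "k * ceil_div p k \<le> p + k" using mult_ceil_div[of k p] k(1) by simp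
      have "(real s ^ 3) ^ L * 2 ^ L = (2 * real s ^ 3) ^ L" by (simp add: power_mult_distrib mult.commute)
      also have "\<dots> = ((2 * real s ^ 3) ^ 10) ^ ceil_div p k * (2 * real s ^ 3) ^ 3"
        unfolding L_def power_add power_mult ..
      also have "\<dots> \<le> (\<rho> ^ k) ^ ceil_div p k * (2 * real s ^ 3) ^ 3"
        using k(2) unfolding s_def K_def by (intro mult_right_mono power_mono) auto
      also have "(\<rho> ^ k) ^ ceil_div p k = \<rho> ^ (k * ceil_div p k)" by (simp add: power_mult)
      also have "\<dots> * (2 * real s ^ 3) ^ 3 \<le> \<rho> ^ (p + k) * (2 * real s ^ 3) ^ 3"
        using \<rho>(1) kc by (intro mult_right_mono power_increasing) auto
      also have "\<dots> = \<rho> ^ p * (\<rho> ^ k * (2 * real s ^ 3) ^ 3)" by (simp add: power_add)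
      also have "\<dots> \<le> \<rho> ^ p * real a"
        unfolding a_def using \<rho>(1) by (intro mult_left_mono real_nat_ceiling_ge) auto
      finally have sL: "(real s ^ 3) ^ L * 2 ^ L \<le> \<rho> ^ p * real a" .
      let ?r = "real (100 * q1 n + 100 * q3 n + 5003)"
      have "real (s ^ l * (100 * T + 5003)) \<le> ((real s ^ 3) ^ L * real (q2 n)) * (?M * ?r)"
        unfolding of_nat_mult[of "s ^ l"] using sl TT by (intro mult_mono) auto
      also have "\<dots> = ((real s ^ 3) ^ L * 2 ^ L) * (b ^ p * (real (q2 n) * ?r))" by (simp add: mult_ac)
      also have "\<dots> \<le> (\<rho> ^ p * real a) * (b ^ p * (real (q2 n) * ?r))"
        using sL b(1) by (intro mult_right_mono) auto
      also have "\<dots> = b' ^ p * real (a * (q2 n * (100 * q1 n + 100 * q3 n + 5003)))"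
        unfolding \<rho>(2) by (simp add: power_mult_distrib mult_ac)
      finally show ?thesis .
    qed
    moreover have "real (8960 * n + 20000 + e n + 8) \<le> b' ^ p * real (8960 * n + 20000 + e n + 8)"
    proof -
      have "1 \<le> b' ^ p" using b by (intro one_le_power) simp
      from mult_right_mono[OF this, of "real (8960 * n + 20000 + e n + 8)"] show ?thesis by simp
    qed
    ultimately have "real (8960 * n + 20000 + (e n + (s ^ l * (100 * T + 5003) + 8))) \<le> b' ^ p * real (q n)"
      unfolding q_def by (simp add: distrib_left)
    also have "\<dots> \<le> time_bound b' (card Q) n c'" unfolding pQ by (rule c')
    finally show "decides_within ?prog (Node (enc_nat n) (Node f (Node g (enc_nat t))))
        (has_triangle_packing {..<n} E t) (time_bound b' (card Q) n c')"
      unfolding decides_within_iff_runs using run ans by blast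
  qed
qed

text \<open>The base is first raised to at least 1, so that \<open>b ^ p\<close> absorbs polynomial
  terms. The new base is the midpoint between it and 2, which leaves a gap to pay for the
  search.\<close>

lemma set_cover_imp_packing:
  assumes "0 < \<epsilon>" "\<And>d. 1 \<le> d \<Longrightarrow> set_cover_solvable d (2 - \<epsilon>)"
  shows "\<exists>\<epsilon>'>0. \<forall>\<sigma> \<delta>. triangle_packing_solvable \<sigma> \<delta> (2 - \<epsilon>')"
proof -
  let ?b = "max 1 (2 - \<epsilon>)"
  have "set_cover_solvable d ?b" if "1 \<le> d" for d
    using set_cover_solvable_mono[OF assms(2)[OF that] set_cover_solvable_pos[OF assms(2)[OF that] that]] by simp
  then have "triangle_packing_solvable \<sigma> \<delta> (2 - (2 - ?b) / 2)" for \<sigma> \<delta>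
    by (rule set_cover_solvable_imp_packing_solvable) (use assms(1) in \<open>auto simp: max_def field_simps\<close>)
  then show ?thesis using assms(1) by (intro exI[of _ "(2 - ?b) / 2"]) (auto simp: max_def)
qed

text \<open>Graph and hub are unchanged by this reduction, so the base need not grow beyond the
  maximum with 1.\<close>

lemma packing_imp_partition:
  assumes "0 < \<epsilon>" "\<And>\<sigma> \<delta>. 0 < \<sigma> \<Longrightarrow> 0 < \<delta> \<Longrightarrow> triangle_packing_solvable \<sigma> \<delta> (2 - \<epsilon>)"
  shows "\<exists>\<epsilon>'>0. \<forall>\<sigma>>0. \<forall>\<delta>>0. triangle_partition_solvable \<sigma> \<delta> (2 - \<epsilon>')"
proof -
  let ?b = "max 1 (2 - \<epsilon>)"
  have "triangle_partition_solvable \<sigma> \<delta> ?b" if "0 < \<sigma>" "0 < \<delta>" for \<sigma> \<delta>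
  proof (rule packing_solvable_imp_partition_solvable)
    show "triangle_packing_solvable \<sigma> \<delta> ?b"
      using triangle_packing_solvable_mono[OF assms(2)[OF that] triangle_packing_solvable_pos[OF assms(2)[OF that]]] by simp
  qed simp
  then show ?thesis using assms(1) by (intro exI[of _ "2 - ?b"]) (auto simp: max_def)
qed

lemma partition_imp_set_cover:
  assumes "0 < \<epsilon>" "\<And>\<sigma> \<delta>. 0 < \<sigma> \<Longrightarrow> 0 < \<delta> \<Longrightarrow> triangle_partition_solvable \<sigma> \<delta> (2 - \<epsilon>)"
  shows "\<exists>\<epsilon>'>0. \<forall>d. set_cover_solvable d (2 - \<epsilon>')"
proof -
  let ?b = "max 1 (2 - \<epsilon>)"
  have "triangle_partition_solvable \<sigma> \<delta> ?b" if "0 < \<sigma>" "0 < \<delta>" for \<sigma> \<delta>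
    using triangle_partition_solvable_mono[OF assms(2)[OF that] triangle_partition_solvable_pos[OF assms(2)[OF that]]] by simp
  then have "set_cover_solvable d (2 - (2 - ?b) / 2)" for d
    by (rule partition_solvable_imp_set_cover_solvable) (use assms(1) in \<open>auto simp: max_def field_simps\<close>)
  then show ?thesis using assms(1) by (intro exI[of _ "(2 - ?b) / 2"]) (auto simp: max_def)
qed

theorem theorem1p5:
  "(set_cover_conjecture \<longleftrightarrow>
      (\<forall>\<epsilon>::real. \<epsilon> > 0 \<longrightarrow>
        (\<exists>\<sigma>>0. \<exists>\<delta>>0. \<not> triangle_partition_solvable \<sigma> \<delta> (2 - \<epsilon>)))) \<and>
   (set_cover_conjecture \<longleftrightarrow>
      (\<forall>\<epsilon>::real. \<epsilon> > 0 \<longrightarrow>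
        (\<exists>\<sigma>>0. \<exists>\<delta>>0. \<not> triangle_packing_solvable \<sigma> \<delta> (2 - \<epsilon>))))"
proof -
  let ?S = "set_cover_conjecture"
  let ?A = "\<forall>\<epsilon>::real. \<epsilon> > 0 \<longrightarrow> (\<exists>\<sigma>>0. \<exists>\<delta>>0. \<not> triangle_partition_solvable \<sigma> \<delta> (2 - \<epsilon>))"
  let ?B = "\<forall>\<epsilon>::real. \<epsilon> > 0 \<longrightarrow> (\<exists>\<sigma>>0. \<exists>\<delta>>0. \<not> triangle_packing_solvable \<sigma> \<delta> (2 - \<epsilon>))"
  have "?S" if ?B
  proof (rule ccontr)
    assume "\<not> ?S"
    then obtain \<epsilon> :: real where e: "\<epsilon> > 0" "\<And>d. 1 \<le> d \<Longrightarrow> set_cover_solvable d (2 - \<epsilon>)"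
      unfolding set_cover_conjecture_def by blast
    show False using set_cover_imp_packing[OF e] \<open>?B\<close> by blast
  qed
  moreover have ?B if ?A
  proof (rule ccontr)
    assume "\<not> ?B"
    then obtain \<epsilon> :: real where e: "\<epsilon> > 0" "\<And>\<sigma> \<delta>. 0 < \<sigma> \<Longrightarrow> 0 < \<delta> \<Longrightarrow> triangle_packing_solvable \<sigma> \<delta> (2 - \<epsilon>)"
      by blast
    show False using packing_imp_partition[OF e] \<open>?A\<close> by blast
  qed
  moreover have ?A if ?S
  proof (rule ccontr)
    assume "\<not> ?A"
    then obtain \<epsilon> :: real where e: "\<epsilon> > 0" "\<And>\<sigma> \<delta>. 0 < \<sigma> \<Longrightarrow> 0 < \<delta> \<Longrightarrow> triangle_partition_solvable \<sigma> \<delta> (2 - \<epsilon>)"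
      by blast
    show False using partition_imp_set_cover[OF e] \<open>?S\<close> unfolding set_cover_conjecture_def by blast
  qed
  ultimately show ?thesis by blast
qed

end
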